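(* Let $A$ be an associative, commutative ring with unit, let $R_n=A[x_1,\ldots,x_n]$, and let $n$ and $d$ be integers with $1\leq d\leq n$. Let $I_{d,n}\subset R_n$ be the ideal generated by all squarefree monomials of degree $d$ in $x_1,\ldots,x_n$. (a) For all integers $i\ge 0$ and $j$ there are isomorphisms of $A[\mathfrak{S}_n]$-modules $$\operatorname{Tor}^{R_n}_i(I_{d,n},A)_j\cong\begin{cases}U^{d,n}_i,&\text{if }j=d+i,\\0,&\text{otherwise.}\end{cases}$$ (b) The Betti numbers of $I_{d,n}$ are given by $$\beta_{i,j}(I_{d,n})=\begin{cases}|\operatorname{SYT}((d,1^i),[n])|,&\text{if }j=d+i,\\0,&\text{otherwise.}\end{cases}$$
   Context: $R_n$ has the standard grading, $\mathfrak{S}_n$ acts on $R_n$ $A$-linearly by permuting variables (so it acts on $I_{d,n}$ and on $\operatorname{Tor}^{R_n}_i(I_{d,n},A)$), and $A=R_n/(x_1,\ldots,x_n)$ as an $R_n$-module. The Betti number $\beta_{i,j}(I_{d,n})$ is the number of degree-$j$ generators of the $i$-th module in a minimal graded free resolution of $I_{d,n}$ over $R_n$, i.e. the rank of the free $A$-module $\operatorname{Tor}^{R_n}_i(I_{d,n},A)_j$. Let $[n]=\{1,\ldots,n\}$. A tableau of shape $\lambda$ (a partition) with entries in $[n]$ is a filling of the Young diagram of $\lambda$ (English notation) with distinct elements of $[n]$; it is standard if its rows are strictly increasing from left to right and its columns are strictly increasing from top to bottom. $\operatorname{SYT}(\lambda,[n])$ is the set of standard tableaux of shape $\lambda$ with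 entries in $[n]$ ($\lambda$ need not be a partition of $n$). For $\lambda$ a partition of $m$, the Specht module $S^\lambda$ is the $A[\mathfrak{S}_m]$-module generated by classes $[T]$ of tableaux $T$ of shape $\lambda$ with entries in $[m]$ (with $\sigma[T]=[\sigma T]$), modulo: (alternating columns) $[\sigma T]=\operatorname{sgn}(\sigma)[T]$ for every permutation $\sigma$ of the entries of $T$ preserving each column of $T$; (shuffling relations) $[T]=\sum[T']$, the sum being over all $T'$ obtained from $T$ by exchanging the top $k$ elements of the $(j+1)$-st column of $T$ with $k$ elements in the $j$-th column, preserving the vertical order of each set of $k$ elements. For $1\leq d\leq n$ and $0\leq i\leq n-d$, $U^{d,n}_i:=\operatorname{Ind}^{\mathfrak{S}_n}_{\mathfrak{S}_{d+i}\times\mathfrak{S}_{n-d-i}}(S^{(d,1^i)}\otimes_A S^{(n-d-i)})$, where $\mathfrak{S}_{d+i}\times\mathfrak{S}_{n-d-i}$ is the subgroup of $\mathfrak{S}_n$ preserving $\{1,\ldots,d+i\}$ and $\{d+i+1,\ldots,n\}$; for all other values $U^{d,n}_i:=0$. *)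

theory Defs
  imports "HOL-Library.Multiset" "HOL-Combinatorics.Permutations"
    "HOL-Algebra.Module" "HOL-Algebra.Ideal" "HOL-Algebra.Sym_Groups"
begin

section \<open>Modules over a commutative ring\<close>

text \<open>
  The record fields \<open>mult\<close> and \<open>one\<close> of a module play no role in \<^locale>\<open>module\<close> and
  \<^locale>\<open>submodule\<close>.
\<close>

definition semilinear_maps ::
  "('r, 'p) ring_scheme \<Rightarrow> ('r \<Rightarrow> 'r) \<Rightarrow> ('r, 'b, 'q) module_scheme \<Rightarrow> ('r, 'c, 's) module_scheme
    \<Rightarrow> ('b \<Rightarrow> 'c) set" where
  "semilinear_maps R \<theta> M N = {f \<in> carrier M \<rightarrow> carrier N.
     (\<forall>x\<in>carrier M. \<forall>y\<in>carrier M. f (x \<oplus>\<^bsub>M\<^esub> y) = f x \<oplus>\<^bsub>N\<^esub> f y) \<and>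
     (\<forall>r\<in>carrier R. \<forall>x\<in>carrier M. f (r \<odot>\<^bsub>M\<^esub> x) = \<theta> r \<odot>\<^bsub>N\<^esub> f x)}"

abbreviation linear_maps where
  "linear_maps R M N \<equiv> semilinear_maps R id M N"

definition free_module :: "('r, 'p) ring_scheme \<Rightarrow> 'x set \<Rightarrow> ('r, 'x \<Rightarrow> 'r) module" where
  "free_module R X = \<lparr>
     carrier = {f. (\<forall>x. f x \<in> carrier R) \<and> (\<forall>x. x \<notin> X \<longrightarrow> f x = \<zero>\<^bsub>R\<^esub>) \<and> finite {x. f x \<noteq> \<zero>\<^bsub>R\<^esub>}},
     monoid.mult = undefined, one = undefined,
     zero = (\<lambda>x. \<zero>\<^bsub>R\<^esub>), add = (\<lambda>f g x. f x \<oplus>\<^bsub>R\<^esub> g x),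
     smult = (\<lambda>r f x. r \<otimes>\<^bsub>R\<^esub> f x)\<rparr>"

definition free_gen :: "('r, 'p) ring_scheme \<Rightarrow> 'x \<Rightarrow> 'x \<Rightarrow> 'r" where
  "free_gen R x = (\<lambda>y. if y = x then \<one>\<^bsub>R\<^esub> else \<zero>\<^bsub>R\<^esub>)"

text \<open>The \<open>\<theta>\<close>-semilinear map of free modules with \<open>free_gen R x \<mapsto> free_gen R (h x)\<close> for \<open>x \<in> X\<close>.\<close>

definition free_map ::
  "('r, 'p) ring_scheme \<Rightarrow> 'x set \<Rightarrow> ('r \<Rightarrow> 'r) \<Rightarrow> ('x \<Rightarrow> 'y) \<Rightarrow> ('x \<Rightarrow> 'r) \<Rightarrow> 'y \<Rightarrow> 'r" where
  "free_map R X \<theta> h f = (\<lambda>y. \<Oplus>\<^bsub>R\<^esub>x\<in>{x \<in> X. f x \<noteq> \<zero>\<^bsub>R\<^esub> \<and> h x = y}. \<theta> (f x))"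

definition submodule_span ::
  "('r, 'p) ring_scheme \<Rightarrow> ('r, 'b, 'q) module_scheme \<Rightarrow> 'b set \<Rightarrow> 'b set" where
  "submodule_span R M S = \<Inter>{N. submodule N R M \<and> S \<subseteq> N}"

definition quot_module ::
  "('r, 'b, 'q) module_scheme \<Rightarrow> 'b set \<Rightarrow> ('r, 'b set) module" where
  "quot_module M N = \<lparr>
     carrier = a_rcosets\<^bsub>M\<^esub> N, monoid.mult = undefined, one = undefined,
     zero = N, add = (\<lambda>X Y. X <+>\<^bsub>M\<^esub> Y),
     smult = (\<lambda>r X. N <+>\<^bsub>M\<^esub> ((\<lambda>x. r \<odot>\<^bsub>M\<^esub> x) ` X))\<rparr>"

text \<open>
  The map \<open>M / N \<rightarrow> M' / N'\<close> induced by an additive \<open>f : M \<rightarrow> M'\<close> with \<open>f ` N \<subseteq> N'\<close>; it sends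
  the coset of \<open>x\<close> to the coset of \<open>f x\<close>. Adding \<open>N'\<close> turns the image \<open>f ` X\<close>, which
  may be only part of a coset, into a full coset.
\<close>

definition quot_map ::
  "('r, 'c, 'q) module_scheme \<Rightarrow> 'c set \<Rightarrow> ('b \<Rightarrow> 'c) \<Rightarrow> 'b set \<Rightarrow> 'c set" where
  "quot_map M' N' f X = N' <+>\<^bsub>M'\<^esub> (f ` X)"

definition module_basis ::
  "('r, 'p) ring_scheme \<Rightarrow> ('r, 'b, 'q) module_scheme \<Rightarrow> 'b set \<Rightarrow> bool" where
  "module_basis R M B \<longleftrightarrow> B \<subseteq> carrier M \<and>
     bij_betw (\<lambda>f. \<Oplus>\<^bsub>M\<^esub>b\<in>{b. f b \<noteq> \<zero>\<^bsub>R\<^esub>}. f b \<odot>\<^bsub>M\<^esub> b) (carrier (free_module R B)) (carrier M)"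

text \<open>Only meaningful for free modules of finite rank over a nonzero commutative ring.\<close>

definition module_rank :: "('r, 'p) ring_scheme \<Rightarrow> ('r, 'b, 'q) module_scheme \<Rightarrow> nat" where
  "module_rank R M = (THE k. \<exists>B. finite B \<and> module_basis R M B \<and> card B = k)"

definition tensor_rel ::
  "('r, 'p) ring_scheme \<Rightarrow> ('r, 'b, 'q) module_scheme \<Rightarrow> ('r, 'c, 's) module_scheme
    \<Rightarrow> ('b \<times> 'c \<Rightarrow> 'r) set" where
  "tensor_rel R M N = (let F = free_module R (carrier M \<times> carrier N); e = free_gen R in
     submodule_span R F
      ({e (x \<oplus>\<^bsub>M\<^esub> x', y) \<ominus>\<^bsub>F\<^esub> e (x, y) \<ominus>\<^bsub>F\<^esub> e (x', y) | x x' y.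
          x \<in> carrier M \<and> x' \<in> carrier M \<and> y \<in> carrier N} \<union>
       {e (x, y \<oplus>\<^bsub>N\<^esub> y') \<ominus>\<^bsub>F\<^esub> e (x, y) \<ominus>\<^bsub>F\<^esub> e (x, y') | x y y'.
          x \<in> carrier M \<and> y \<in> carrier N \<and> y' \<in> carrier N} \<union>
       {e (r \<odot>\<^bsub>M\<^esub> x, y) \<ominus>\<^bsub>F\<^esub> r \<odot>\<^bsub>F\<^esub> e (x, y) | r x y.
          r \<in> carrier R \<and> x \<in> carrier M \<and> y \<in> carrier N} \<union>
       {e (x, r \<odot>\<^bsub>N\<^esub> y) \<ominus>\<^bsub>F\<^esub> r \<odot>\<^bsub>F\<^esub> e (x, y) | r x y.
          r \<in> carrier R \<and> x \<in> carrier M \<and> y \<in> carrier N}))"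

definition tensor ::
  "('r, 'p) ring_scheme \<Rightarrow> ('r, 'b, 'q) module_scheme \<Rightarrow> ('r, 'c, 's) module_scheme
    \<Rightarrow> ('r, ('b \<times> 'c \<Rightarrow> 'r) set) module" where
  "tensor R M N = quot_module (free_module R (carrier M \<times> carrier N)) (tensor_rel R M N)"

definition pure_tensor ::
  "('r, 'p) ring_scheme \<Rightarrow> ('r, 'b, 'q) module_scheme \<Rightarrow> ('r, 'c, 's) module_scheme
    \<Rightarrow> 'b \<Rightarrow> 'c \<Rightarrow> ('b \<times> 'c \<Rightarrow> 'r) set" where
  "pure_tensor R M N x y =
     tensor_rel R M N +>\<^bsub>free_module R (carrier M \<times> carrier N)\<^esub> free_gen R (x, y)"

text \<open>\<open>f \<otimes> g : M \<otimes> N \<rightarrow> M' \<otimes> N'\<close> for \<open>\<theta>\<close>-semilinear maps \<open>f : M \<rightarrow> M'\<close> and \<open>g : N \<rightarrow> N'\<close>.\<close>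

definition tensor_map ::
  "('r, 'p) ring_scheme \<Rightarrow> ('r, 'b, 'q) module_scheme \<Rightarrow> ('r, 'c, 's) module_scheme
    \<Rightarrow> ('r, 'd, 't) module_scheme \<Rightarrow> ('r, 'e, 'u) module_scheme \<Rightarrow> ('r \<Rightarrow> 'r)
    \<Rightarrow> ('b \<Rightarrow> 'd) \<Rightarrow> ('c \<Rightarrow> 'e) \<Rightarrow> ('b \<times> 'c \<Rightarrow> 'r) set \<Rightarrow> ('d \<times> 'e \<Rightarrow> 'r) set" where
  "tensor_map R M N M' N' \<theta> f g =
     quot_map (free_module R (carrier M' \<times> carrier N')) (tensor_rel R M' N')
       (free_map R (carrier M \<times> carrier N) \<theta> (map_prod f g))"


section \<open>Modules with a group action\<close>

record ('r, 'b, 'g) gmodule = "('r, 'b) module" +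
  gact :: "'g \<Rightarrow> 'b \<Rightarrow> 'b"

definition with_action :: "('r, 'b, 'q) module_scheme \<Rightarrow> ('g \<Rightarrow> 'b \<Rightarrow> 'b) \<Rightarrow> ('r, 'b, 'g) gmodule" where
  "with_action M \<rho> = \<lparr>carrier = carrier M, monoid.mult = monoid.mult M, one = one M, zero = zero M,
     add = add M, smult = smult M, gact = \<rho>\<rparr>"

text \<open>A module over the group ring \<open>A[G]\<close>, presented as an \<open>A\<close>-module with an \<open>A\<close>-linear \<open>G\<close>-action.\<close>

definition group_ring_module ::
  "('a, 'p) ring_scheme \<Rightarrow> ('g, 'q) monoid_scheme \<Rightarrow> ('a, 'b, 'g, 's) gmodule_scheme \<Rightarrow> bool" where
  "group_ring_module A G V \<longleftrightarrow> module A V \<and>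
     (\<forall>g\<in>carrier G. gact V g \<in> linear_maps A V V) \<and>
     (\<forall>v\<in>carrier V. gact V \<one>\<^bsub>G\<^esub> v = v) \<and>
     (\<forall>g\<in>carrier G. \<forall>h\<in>carrier G. \<forall>v\<in>carrier V. gact V (g \<otimes>\<^bsub>G\<^esub> h) v = gact V g (gact V h v))"

definition group_ring_module_iso ::
  "('a, 'p) ring_scheme \<Rightarrow> ('g, 'q) monoid_scheme \<Rightarrow> ('a, 'b, 'g, 's) gmodule_scheme
    \<Rightarrow> ('a, 'c, 'g, 't) gmodule_scheme \<Rightarrow> bool" where
  "group_ring_module_iso A G V W \<longleftrightarrow> group_ring_module A G V \<and> group_ring_module A G W \<and>
     (\<exists>f\<in>linear_maps A V W. bij_betw f (carrier V) (carrier W) \<and>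
        (\<forall>g\<in>carrier G. \<forall>v\<in>carrier V. f (gact V g v) = gact W g (f v)))"

definition zero_gmodule :: "('a, 'b, 'g) gmodule" where
  "zero_gmodule = \<lparr>carrier = {undefined}, monoid.mult = undefined, one = undefined,
     zero = undefined, add = (\<lambda>x y. undefined), smult = (\<lambda>a x. undefined),
     gact = (\<lambda>g x. undefined)\<rparr>"

definition tensor_gmodule ::
  "('a, 'p) ring_scheme \<Rightarrow> ('a, 'b, 'g, 's) gmodule_scheme \<Rightarrow> ('a, 'c, 'g, 't) gmodule_scheme
    \<Rightarrow> ('a, ('b \<times> 'c \<Rightarrow> 'a) set, 'g) gmodule" where
  "tensor_gmodule A V W =
     with_action (tensor A V W) (\<lambda>g. tensor_map A V W V W id (gact V g) (gact W g))"

text \<open>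
  \<open>A[G] \<otimes>\<^bsub>A[H]\<^esub> V\<close> for a subgroup \<open>H\<close> of \<open>G\<close> and an \<open>A[H]\<close>-module \<open>V\<close>: it is generated by the symbols
  \<open>(g, v) = g \<otimes> v\<close>, which are linear in \<open>v\<close> and satisfy \<open>g h \<otimes> v = g \<otimes> h v\<close> for \<open>h \<in> H\<close>.
\<close>

definition induced_rel ::
  "('a, 'p) ring_scheme \<Rightarrow> ('g, 'q) monoid_scheme \<Rightarrow> 'g set \<Rightarrow> ('a, 'b, 'g, 's) gmodule_scheme
    \<Rightarrow> ('g \<times> 'b \<Rightarrow> 'a) set" where
  "induced_rel A G H V = (let F = free_module A (carrier G \<times> carrier V); e = free_gen A in
     submodule_span A F
      ({e (g, v \<oplus>\<^bsub>V\<^esub> w) \<ominus>\<^bsub>F\<^esub> e (g, v) \<ominus>\<^bsub>F\<^esub> e (g, w) | g v w.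
          g \<in> carrier G \<and> v \<in> carrier V \<and> w \<in> carrier V} \<union>
       {e (g, a \<odot>\<^bsub>V\<^esub> v) \<ominus>\<^bsub>F\<^esub> a \<odot>\<^bsub>F\<^esub> e (g, v) | g a v.
          g \<in> carrier G \<and> a \<in> carrier A \<and> v \<in> carrier V} \<union>
       {e (g \<otimes>\<^bsub>G\<^esub> h, v) \<ominus>\<^bsub>F\<^esub> e (g, gact V h v) | g h v.
          g \<in> carrier G \<and> h \<in> H \<and> v \<in> carrier V}))"

definition induced ::
  "('a, 'p) ring_scheme \<Rightarrow> ('g, 'q) monoid_scheme \<Rightarrow> 'g set \<Rightarrow> ('a, 'b, 'g, 's) gmodule_scheme
    \<Rightarrow> ('a, ('g \<times> 'b \<Rightarrow> 'a) set, 'g) gmodule" where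
  "induced A G H V = (let X = carrier G \<times> carrier V; F = free_module A X; N = induced_rel A G H V in
     with_action (quot_module F N)
       (\<lambda>k. quot_map F N (free_map A X id (\<lambda>(g, v). (k \<otimes>\<^bsub>G\<^esub> g, v)))))"


section \<open>Tableaux and Specht modules\<close>

text \<open>
  A partition is given by the list of its parts. Cells are pairs (row, column), both counted
  from 0. Tableaux are extensional functions on the diagram.
\<close>

definition diagram :: "nat list \<Rightarrow> (nat \<times> nat) set" where
  "diagram \<mu> = {(r, c). r < length \<mu> \<and> c < \<mu> ! r}"

definition column :: "nat list \<Rightarrow> nat \<Rightarrow> nat set" where
  "column \<mu> c = {r. (r, c) \<in> diagram \<mu>}"

definition tableaux :: "nat list \<Rightarrow> nat set \<Rightarrow> (nat \<times> nat \<Rightarrow> nat) set" where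
  "tableaux \<mu> E = {T \<in> diagram \<mu> \<rightarrow>\<^sub>E E. inj_on T (diagram \<mu>)}"

definition SYT :: "nat list \<Rightarrow> nat set \<Rightarrow> (nat \<times> nat \<Rightarrow> nat) set" where
  "SYT \<mu> E = {T \<in> tableaux \<mu> E.
     (\<forall>r c c'. c < c' \<and> (r, c) \<in> diagram \<mu> \<and> (r, c') \<in> diagram \<mu> \<longrightarrow> T (r, c) < T (r, c')) \<and>
     (\<forall>r r' c. r < r' \<and> (r, c) \<in> diagram \<mu> \<and> (r', c) \<in> diagram \<mu> \<longrightarrow> T (r, c) < T (r', c))}"

definition tableau_act :: "nat list \<Rightarrow> (nat \<Rightarrow> nat) \<Rightarrow> (nat \<times> nat \<Rightarrow> nat) \<Rightarrow> (nat \<times> nat \<Rightarrow> nat)" where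
  "tableau_act \<mu> \<sigma> T = restrict (\<sigma> \<circ> T) (diagram \<mu>)"

text \<open>
  Exchange the top \<open>card S\<close> entries of column \<open>j + 1\<close> with the entries of column \<open>j\<close> in the rows
  of \<open>S\<close>, keeping the vertical order: the \<open>p\<close>-th smallest row of \<open>S\<close> is matched with row \<open>p\<close>
  (counted from 0).
\<close>

definition exchange ::
  "nat list \<Rightarrow> nat \<Rightarrow> nat set \<Rightarrow> (nat \<times> nat \<Rightarrow> nat) \<Rightarrow> (nat \<times> nat \<Rightarrow> nat)" where
  "exchange \<mu> j S T = (\<lambda>(r, c)\<in>diagram \<mu>.
     if c = j \<and> r \<in> S then T (card {s \<in> S. s < r}, Suc j)
     else if c = Suc j \<and> r < card S then T (sorted_list_of_set S ! r, j)
     else T (r, c))"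

definition alternating_rels ::
  "('a, 'p) ring_scheme \<Rightarrow> nat list \<Rightarrow> nat set \<Rightarrow> ((nat \<times> nat \<Rightarrow> nat) \<Rightarrow> 'a) set" where
  "alternating_rels A \<mu> E = (let F = free_module A (tableaux \<mu> E) in
     {free_gen A (tableau_act \<mu> \<sigma> T) \<ominus>\<^bsub>F\<^esub>
        (if evenperm \<sigma> then \<one>\<^bsub>A\<^esub> else \<ominus>\<^bsub>A\<^esub> \<one>\<^bsub>A\<^esub>) \<odot>\<^bsub>F\<^esub> free_gen A T | \<sigma> T.
        T \<in> tableaux \<mu> E \<and> \<sigma> permutes (T ` diagram \<mu>) \<and>
        (\<forall>c. \<sigma> ` (\<lambda>r. T (r, c)) ` column \<mu> c = (\<lambda>r. T (r, c)) ` column \<mu> c)})"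

definition shuffling_rels ::
  "('a, 'p) ring_scheme \<Rightarrow> nat list \<Rightarrow> nat set \<Rightarrow> ((nat \<times> nat \<Rightarrow> nat) \<Rightarrow> 'a) set" where
  "shuffling_rels A \<mu> E = (let F = free_module A (tableaux \<mu> E) in
     {free_gen A T \<ominus>\<^bsub>F\<^esub>
        (\<Oplus>\<^bsub>F\<^esub>S\<in>{S. S \<subseteq> column \<mu> j \<and> card S = k}. free_gen A (exchange \<mu> j S T)) | T j k.
        T \<in> tableaux \<mu> E \<and> 1 \<le> k \<and> k \<le> card (column \<mu> (Suc j))})"

text \<open>
  The Specht module of \<open>\<mu>\<close> on tableaux with entries in \<open>E\<close>, where \<open>\<mu>\<close> is a partition of \<open>card E\<close>.
  It is acted upon by the permutations that preserve \<open>E\<close>.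
\<close>

definition specht ::
  "('a, 'p) ring_scheme \<Rightarrow> nat list \<Rightarrow> nat set
    \<Rightarrow> ('a, ((nat \<times> nat \<Rightarrow> nat) \<Rightarrow> 'a) set, nat \<Rightarrow> nat) gmodule" where
  "specht A \<mu> E = (let X = tableaux \<mu> E; F = free_module A X;
       N = submodule_span A F (alternating_rels A \<mu> E \<union> shuffling_rels A \<mu> E) in
     with_action (quot_module F N) (\<lambda>\<sigma>. quot_map F N (free_map A X id (tableau_act \<mu> \<sigma>))))"

definition hook :: "nat \<Rightarrow> nat \<Rightarrow> nat list" where
  "hook d i = d # replicate i 1"

definition one_row :: "nat \<Rightarrow> nat list" where
  "one_row k = (if k = 0 then [] else [k])"

definition young_subgroup :: "nat \<Rightarrow> nat \<Rightarrow> (nat \<Rightarrow> nat) set" where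
  "young_subgroup n k = {\<sigma> \<in> carrier (sym_group n).
     \<sigma> ` {1..k} = {1..k} \<and> \<sigma> ` {k + 1..n} = {k + 1..n}}"

text \<open>
  The second factor \<open>S\<^bsup>(n - d - i)\<^esup>\<close> uses tableaux with entries in \<open>{d + i + 1..n}\<close>, so that the Young
  subgroup acts on both factors through its elements as permutations of \<open>{1..n}\<close>.
\<close>

definition U_module ::
  "('a, 'p) ring_scheme \<Rightarrow> nat \<Rightarrow> nat \<Rightarrow> nat
    \<Rightarrow> ('a, ((nat \<Rightarrow> nat) \<times>
          (((nat \<times> nat \<Rightarrow> nat) \<Rightarrow> 'a) set \<times> ((nat \<times> nat \<Rightarrow> nat) \<Rightarrow> 'a) set \<Rightarrow> 'a) set \<Rightarrow> 'a) set,
        nat \<Rightarrow> nat) gmodule" where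
  "U_module A d n i =
     (if 1 \<le> d \<and> d \<le> n \<and> i \<le> n - d
      then induced A (sym_group n) (young_subgroup n (d + i))
             (tensor_gmodule A (specht A (hook d i) {1..d + i})
                               (specht A (one_row (n - d - i)) {d + i + 1..n}))
      else zero_gmodule)"


section \<open>The polynomial ring and its graded modules\<close>

text \<open>
  \<open>A[x\<^sub>1, \<dots>, x\<^sub>n]\<close> as an \<open>A\<close>-algebra: a monomial is a multiset of indices in \<open>{1..n}\<close>, and a polynomial
  is the finitely supported function of its coefficients.
\<close>

definition mpoly_ring :: "('a, 'p) ring_scheme \<Rightarrow> nat \<Rightarrow> ('a, nat multiset \<Rightarrow> 'a) module" where
  "mpoly_ring A n = (free_module A {m. set_mset m \<subseteq> {1..n}})\<lparr>
     monoid.mult := (\<lambda>f g m. \<Oplus>\<^bsub>A\<^esub>k\<in>{k. k \<subseteq># m}. f k \<otimes>\<^bsub>A\<^esub> g (m - k)),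
     one := free_gen A {#}\<rparr>"

definition homog :: "('a, 'p) ring_scheme \<Rightarrow> nat \<Rightarrow> int \<Rightarrow> (nat multiset \<Rightarrow> 'a) set" where
  "homog A n j = {f \<in> carrier (mpoly_ring A n). \<forall>m. f m \<noteq> \<zero>\<^bsub>A\<^esub> \<longrightarrow> int (size m) = j}"

text \<open>The \<open>A\<close>-algebra automorphism \<open>x\<^sub>k \<mapsto> x\<^bsub>\<sigma> k\<^esub>\<close>.\<close>

definition perm_vars :: "(nat \<Rightarrow> nat) \<Rightarrow> (nat multiset \<Rightarrow> 'a) \<Rightarrow> nat multiset \<Rightarrow> 'a" where
  "perm_vars \<sigma> f = (\<lambda>m. f (image_mset (inv' \<sigma>) m))"

definition regular_module :: "('r, 'p) ring_scheme \<Rightarrow> ('r, 'r) module" where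
  "regular_module R = \<lparr>carrier = carrier R, monoid.mult = monoid.mult R, one = one R, zero = zero R,
     add = add R, smult = monoid.mult R\<rparr>"

record ('r, 'b, 'g) graded_gmodule = "('r, 'b, 'g) gmodule" +
  grade :: "int \<Rightarrow> 'b set"

definition with_action_grade ::
  "('r, 'b, 'q) module_scheme \<Rightarrow> ('g \<Rightarrow> 'b \<Rightarrow> 'b) \<Rightarrow> (int \<Rightarrow> 'b set) \<Rightarrow> ('r, 'b, 'g) graded_gmodule" where
  "with_action_grade M \<rho> gr =
     \<lparr>carrier = carrier M, monoid.mult = monoid.mult M, one = one M, zero = zero M,
      add = add M, smult = smult M, gact = \<rho>, grade = gr\<rparr>"

definition sqfree_ideal :: "('a, 'p) ring_scheme \<Rightarrow> nat \<Rightarrow> nat \<Rightarrow> (nat multiset \<Rightarrow> 'a) set" where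
  "sqfree_ideal A d n =
     Idl\<^bsub>mpoly_ring A n\<^esub> {free_gen A (mset_set S) | S. S \<subseteq> {1..n} \<and> card S = d}"

definition sqfree_ideal_module ::
  "('a, 'p) ring_scheme \<Rightarrow> nat \<Rightarrow> nat
    \<Rightarrow> (nat multiset \<Rightarrow> 'a, nat multiset \<Rightarrow> 'a, nat \<Rightarrow> nat) graded_gmodule" where
  "sqfree_ideal_module A d n = (let I = sqfree_ideal A d n in
     with_action_grade ((regular_module (mpoly_ring A n))\<lparr>carrier := I\<rparr>)
       perm_vars (\<lambda>j. I \<inter> homog A n j))"

definition irrelevant_ideal :: "('a, 'p) ring_scheme \<Rightarrow> nat \<Rightarrow> (nat multiset \<Rightarrow> 'a) set" where
  "irrelevant_ideal A n = Idl\<^bsub>mpoly_ring A n\<^esub> {free_gen A {#k#} | k. k \<in> {1..n}}"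

definition residue_module ::
  "('a, 'p) ring_scheme \<Rightarrow> nat
    \<Rightarrow> (nat multiset \<Rightarrow> 'a, (nat multiset \<Rightarrow> 'a) set, nat \<Rightarrow> nat) graded_gmodule" where
  "residue_module A n = (let M = regular_module (mpoly_ring A n); N = irrelevant_ideal A n in
     with_action_grade (quot_module M N)
       (\<lambda>\<sigma>. quot_map M N (perm_vars \<sigma>)) (\<lambda>j. (\<lambda>f. N +>\<^bsub>M\<^esub> f) ` homog A n j))"

text \<open>
  A free module over \<open>mpoly_ring A n\<close> with a homogeneous basis \<open>B\<close> whose elements have degrees \<open>deg\<close>:
  \<open>gr j\<close> is the set of combinations whose coefficient at \<open>b\<close> is homogeneous of degree \<open>j - deg b\<close>.
\<close>

definition graded_free ::
  "('a, 'p) ring_scheme \<Rightarrow> nat \<Rightarrow> (nat multiset \<Rightarrow> 'a, 'f, 'q) module_scheme \<Rightarrow> (int \<Rightarrow> 'f set) \<Rightarrow> bool"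
  where
  "graded_free A n M gr \<longleftrightarrow> (let R = mpoly_ring A n in
     module R M \<and>
     (\<exists>B deg. module_basis R M B \<and>
        (\<forall>j. gr j = (\<lambda>f. \<Oplus>\<^bsub>M\<^esub>b\<in>{b. f b \<noteq> \<zero>\<^bsub>R\<^esub>}. f b \<odot>\<^bsub>M\<^esub> b) `
               {f \<in> carrier (free_module R B). \<forall>b\<in>B. f b \<in> homog A n (j - deg b)})))"


section \<open>Tor and Betti numbers\<close>

text \<open>
  \<open>res_diff P i\<close> maps \<open>res_term P (i + 1)\<close> to \<open>res_term P i\<close>, and \<open>res_aug P\<close> maps \<open>res_term P 0\<close> to
  the resolved module.
\<close>

record ('r, 'f, 'm) resolution =
  res_term :: "nat \<Rightarrow> ('r, 'f) module"
  res_grade :: "nat \<Rightarrow> int \<Rightarrow> 'f set"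
  res_diff :: "nat \<Rightarrow> 'f \<Rightarrow> 'f"
  res_aug :: "'f \<Rightarrow> 'm"

definition graded_free_resolution ::
  "('a, 'p) ring_scheme \<Rightarrow> nat \<Rightarrow> (nat multiset \<Rightarrow> 'a, 'm, 'g, 's) graded_gmodule_scheme
    \<Rightarrow> (nat multiset \<Rightarrow> 'a, 'f, 'm) resolution \<Rightarrow> bool" where
  "graded_free_resolution A n M P \<longleftrightarrow>
    (let R = mpoly_ring A n; F = res_term P; D = res_diff P; \<epsilon> = res_aug P in
     (\<forall>i. graded_free A n (F i) (res_grade P i)) \<and>
     (\<forall>i. D i \<in> linear_maps R (F (Suc i)) (F i)) \<and>
     (\<forall>i j. D i ` res_grade P (Suc i) j \<subseteq> res_grade P i j) \<and>
     \<epsilon> \<in> linear_maps R (F 0) M \<and>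
     (\<forall>j. \<epsilon> ` res_grade P 0 j \<subseteq> grade M j) \<and>
     \<epsilon> ` carrier (F 0) = carrier M \<and>
     {x \<in> carrier (F 0). \<epsilon> x = \<zero>\<^bsub>M\<^esub>} = D 0 ` carrier (F 1) \<and>
     (\<forall>i. {x \<in> carrier (F (Suc i)). D i x = \<zero>\<^bsub>F i\<^esub>} = D (Suc i) ` carrier (F (Suc (Suc i)))))"

text \<open>
  For each permutation \<open>\<sigma>\<close>, a chain map \<open>\<phi> \<sigma>\<close> that lifts the action of \<open>\<sigma>\<close> on \<open>M\<close>. It is semilinear
  over the action of \<open>\<sigma>\<close> on the polynomial ring. Such lifts exist and are unique up to homotopy;
  \<open>\<phi>\<close> itself need not be multiplicative in \<open>\<sigma>\<close>.
\<close>

definition action_lift ::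
  "('a, 'p) ring_scheme \<Rightarrow> nat \<Rightarrow> (nat multiset \<Rightarrow> 'a, 'm, nat \<Rightarrow> nat, 's) graded_gmodule_scheme
    \<Rightarrow> (nat multiset \<Rightarrow> 'a, 'f, 'm) resolution \<Rightarrow> ((nat \<Rightarrow> nat) \<Rightarrow> nat \<Rightarrow> 'f \<Rightarrow> 'f) \<Rightarrow> bool" where
  "action_lift A n M P \<phi> \<longleftrightarrow>
    (let R = mpoly_ring A n; F = res_term P; D = res_diff P; \<epsilon> = res_aug P in
     \<forall>\<sigma>\<in>carrier (sym_group n).
       (\<forall>i. \<phi> \<sigma> i \<in> semilinear_maps R (perm_vars \<sigma>) (F i) (F i)) \<and>
       (\<forall>i j. \<phi> \<sigma> i ` res_grade P i j \<subseteq> res_grade P i j) \<and>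
       (\<forall>i. \<forall>x\<in>carrier (F (Suc i)). D i (\<phi> \<sigma> (Suc i) x) = \<phi> \<sigma> i (D i x)) \<and>
       (\<forall>x\<in>carrier (F 0). \<epsilon> (\<phi> \<sigma> 0 x) = gact M \<sigma> (\<epsilon> x)))"

text \<open>The homology of \<open>P \<otimes> N\<close> over \<open>mpoly_ring A n\<close>, where \<open>P\<close> is a resolution.\<close>

definition tor_chains ::
  "('a, 'p) ring_scheme \<Rightarrow> nat \<Rightarrow> (nat multiset \<Rightarrow> 'a, 'f, 'm) resolution
    \<Rightarrow> (nat multiset \<Rightarrow> 'a, 'b, 'g, 's) graded_gmodule_scheme \<Rightarrow> nat
    \<Rightarrow> (nat multiset \<Rightarrow> 'a, ('f \<times> 'b \<Rightarrow> nat multiset \<Rightarrow> 'a) set) module" where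
  "tor_chains A n P N i = tensor (mpoly_ring A n) (res_term P i) N"

definition tor_diff ::
  "('a, 'p) ring_scheme \<Rightarrow> nat \<Rightarrow> (nat multiset \<Rightarrow> 'a, 'f, 'm) resolution
    \<Rightarrow> (nat multiset \<Rightarrow> 'a, 'b, 'g, 's) graded_gmodule_scheme \<Rightarrow> nat
    \<Rightarrow> ('f \<times> 'b \<Rightarrow> nat multiset \<Rightarrow> 'a) set \<Rightarrow> ('f \<times> 'b \<Rightarrow> nat multiset \<Rightarrow> 'a) set" where
  "tor_diff A n P N i =
     tensor_map (mpoly_ring A n) (res_term P (Suc i)) N (res_term P i) N id (res_diff P i) id"

definition tor_grade ::
  "('a, 'p) ring_scheme \<Rightarrow> nat \<Rightarrow> (nat multiset \<Rightarrow> 'a, 'f, 'm) resolution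
    \<Rightarrow> (nat multiset \<Rightarrow> 'a, 'b, 'g, 's) graded_gmodule_scheme \<Rightarrow> nat \<Rightarrow> int
    \<Rightarrow> ('f \<times> 'b \<Rightarrow> nat multiset \<Rightarrow> 'a) set set" where
  "tor_grade A n P N i j = generate (add_monoid (tor_chains A n P N i))
     {pure_tensor (mpoly_ring A n) (res_term P i) N x y | x y p q.
        x \<in> res_grade P i p \<and> y \<in> grade N q \<and> p + q = j}"

definition tor_cycles ::
  "('a, 'p) ring_scheme \<Rightarrow> nat \<Rightarrow> (nat multiset \<Rightarrow> 'a, 'f, 'm) resolution
    \<Rightarrow> (nat multiset \<Rightarrow> 'a, 'b, 'g, 's) graded_gmodule_scheme \<Rightarrow> nat
    \<Rightarrow> ('f \<times> 'b \<Rightarrow> nat multiset \<Rightarrow> 'a) set set" where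
  "tor_cycles A n P N i = (case i of
       0 \<Rightarrow> carrier (tor_chains A n P N 0)
     | Suc k \<Rightarrow> {z \<in> carrier (tor_chains A n P N (Suc k)).
                  tor_diff A n P N k z = \<zero>\<^bsub>tor_chains A n P N k\<^esub>})"

definition tor_boundaries ::
  "('a, 'p) ring_scheme \<Rightarrow> nat \<Rightarrow> (nat multiset \<Rightarrow> 'a, 'f, 'm) resolution
    \<Rightarrow> (nat multiset \<Rightarrow> 'a, 'b, 'g, 's) graded_gmodule_scheme \<Rightarrow> nat
    \<Rightarrow> ('f \<times> 'b \<Rightarrow> nat multiset \<Rightarrow> 'a) set set" where
  "tor_boundaries A n P N i = tor_diff A n P N i ` carrier (tor_chains A n P N (Suc i))"

definition tor ::
  "('a, 'p) ring_scheme \<Rightarrow> nat \<Rightarrow> (nat multiset \<Rightarrow> 'a, 'f, 'm) resolution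
    \<Rightarrow> (nat multiset \<Rightarrow> 'a, 'b, 'g, 's) graded_gmodule_scheme \<Rightarrow> nat
    \<Rightarrow> (nat multiset \<Rightarrow> 'a, ('f \<times> 'b \<Rightarrow> nat multiset \<Rightarrow> 'a) set set) module" where
  "tor A n P N i =
     quot_module ((tor_chains A n P N i)\<lparr>carrier := tor_cycles A n P N i\<rparr>) (tor_boundaries A n P N i)"

text \<open>
  The degree \<open>j\<close> part of \<open>tor A n P N i\<close>, consisting of the classes of the cycles of degree \<open>j\<close>, as a
  module over \<open>A\<close> (regarded as the constants of \<open>mpoly_ring A n\<close>).
\<close>

definition tor_degree ::
  "('a, 'p) ring_scheme \<Rightarrow> nat \<Rightarrow> (nat multiset \<Rightarrow> 'a, 'f, 'm) resolution
    \<Rightarrow> (nat multiset \<Rightarrow> 'a, 'b, 'g, 's) graded_gmodule_scheme \<Rightarrow> nat \<Rightarrow> int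
    \<Rightarrow> ('a, ('f \<times> 'b \<Rightarrow> nat multiset \<Rightarrow> 'a) set set) module" where
  "tor_degree A n P N i j = (let R = mpoly_ring A n; H = tor A n P N i in
     \<lparr>carrier = (\<lambda>z. tor_boundaries A n P N i +>\<^bsub>tor_chains A n P N i\<^esub> z) `
                  (tor_cycles A n P N i \<inter> tor_grade A n P N i j),
      monoid.mult = undefined, one = undefined, zero = zero H, add = add H,
      smult = (\<lambda>a X. (a \<odot>\<^bsub>R\<^esub> \<one>\<^bsub>R\<^esub>) \<odot>\<^bsub>H\<^esub> X)\<rparr>)"

text \<open>\<open>\<sigma>\<close> acts on the homology of \<open>P \<otimes> N\<close> through the chain map given by \<open>\<phi> \<sigma>\<close> and the action on \<open>N\<close>.\<close>

definition tor_gmodule ::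
  "('a, 'p) ring_scheme \<Rightarrow> nat \<Rightarrow> (nat multiset \<Rightarrow> 'a, 'f, 'm) resolution
    \<Rightarrow> ((nat \<Rightarrow> nat) \<Rightarrow> nat \<Rightarrow> 'f \<Rightarrow> 'f)
    \<Rightarrow> (nat multiset \<Rightarrow> 'a, 'b, nat \<Rightarrow> nat, 's) graded_gmodule_scheme \<Rightarrow> nat \<Rightarrow> int
    \<Rightarrow> ('a, ('f \<times> 'b \<Rightarrow> nat multiset \<Rightarrow> 'a) set set, nat \<Rightarrow> nat) gmodule" where
  "tor_gmodule A n P \<phi> N i j = with_action (tor_degree A n P N i j)
     (\<lambda>\<sigma>. quot_map (tor_chains A n P N i) (tor_boundaries A n P N i)
        (tensor_map (mpoly_ring A n) (res_term P i) N (res_term P i) N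
           (perm_vars \<sigma>) (\<phi> \<sigma> i) (gact N \<sigma>)))"

definition betti ::
  "('a, 'p) ring_scheme \<Rightarrow> nat \<Rightarrow> (nat multiset \<Rightarrow> 'a, 'f, 'm) resolution \<Rightarrow> nat \<Rightarrow> int \<Rightarrow> nat" where
  "betti A n P i j = module_rank A (tor_degree A n P (residue_module A n) i j)"

end

theory Submission
 imports "HOL-Algebra.Ring_Divisibility" Defs
begin

text \<open>
 Koszul chains with coefficients in a graded module are represented by alternating functions on lists
 of indices, which avoids all explicit signs. A zigzag through the double complex formed by a resolution
 and the Koszul complex relates cycles of the resolution modulo the variables to Koszul cycles of
 the ideal. Zigzags exist in both directions, are unique up to boundaries, and are carried to zigzags by
 every action of a permutation, so no equivariant comparison of chain maps is needed.

 In degrees other than \<open>d + i\<close> a contraction chosen by multidegree shows that the Koszul complex of the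
 squarefree ideal is exact. In degree \<open>d + i\<close> there are no boundaries, and Tor is the module of
 cycles. Such a cycle is determined by its coefficients at standard pairs \<open>(c, Q)\<close> of a column and an arm,
 and the boundaries of the monomials \<open>x\<^sup>Q e\<^sub>c\<close> form the dual basis. The tableau with first column \<open>c\<close>
 and arm \<open>Q\<close> is sent to this boundary. The shuffling relation holds because a double boundary is zero, and
 straightening shows that the standard tableaux span the induced module, so the map is bijective.
\<close>

section \<open>Modules, quotients and universal properties\<close>

text \<open>The ring \<open>A\<close> is arbitrary, so nothing may be divided by two or by a group
  order: alternation always includes vanishing on repeated indices, and the representation cannot be
  recognised by characters. The resolution is arbitrary as well, and its lifts
  \<open>\<phi> \<sigma>\<close> need not form an action. The axioms of a group action on Tor are
  therefore carried over from the Koszul cycles along an injection.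

  The degree \<open>d + i\<close> is singled out by a count. A monomial of the ideal has degree at
  least \<open>d\<close>, so in Koszul degree \<open>i\<close> the total degree is at least
  \<open>d + i\<close>, and in that degree every monomial that occurs is squarefree with exactly
  \<open>d\<close> variables. The element x^Q e_c has \<open>d - 1\<close> variables in Q and
  \<open>i + 1\<close> indices in c. It lies just outside the complex of the ideal while its
  boundary lies inside; this is why the boundary is a cycle of the ideal that need not bound
  there.\<close>

lemma module_cring: "module R M ==> cring R"
 by (simp add: module_def)

lemma module_abelian_group: "module R M ==> abelian_group M"
 by (simp add: module_def)

lemma slinearI:
 assumes "!!x. x : carrier M ==> f x : carrier N"
  and "!!x y. x : carrier M ==> y : carrier M ==> f (x \<oplus>\<^bsub>M\<^esub> y) = f x \<oplus>\<^bsub>N\<^esub> f y"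
  and "!!r x. r : carrier R ==> x : carrier M ==> f (r \<odot>\<^bsub>M\<^esub> x) = \<theta> r \<odot>\<^bsub>N\<^esub> f x"
 shows "f : semilinear_maps R \<theta> M N"
 using assms by (simp add: semilinear_maps_def)

lemma slinearD:
 assumes "f : semilinear_maps R \<theta> M N"
 shows "x : carrier M ==> f x : carrier N"
  and "x : carrier M ==> y : carrier M ==> f (x \<oplus>\<^bsub>M\<^esub> y) = f x \<oplus>\<^bsub>N\<^esub> f y"
  and "r : carrier R ==> x : carrier M ==> f (r \<odot>\<^bsub>M\<^esub> x) = \<theta> r \<odot>\<^bsub>N\<^esub> f x"
 using assms by (auto simp: semilinear_maps_def)

lemma additive_zero:
 assumes "abelian_group M" "abelian_group N"
  and "!!x. x : carrier M ==> f x : carrier N"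
  and "!!x y. x : carrier M ==> y : carrier M ==> f (x \<oplus>\<^bsub>M\<^esub> y) = f x \<oplus>\<^bsub>N\<^esub> f y"
 shows "f \<zero>\<^bsub>M\<^esub> = \<zero>\<^bsub>N\<^esub>"
proof -
 interpret M: abelian_group M by fact
 interpret N: abelian_group N by fact
 have "f \<zero>\<^bsub>M\<^esub> \<oplus>\<^bsub>N\<^esub> f \<zero>\<^bsub>M\<^esub> = f \<zero>\<^bsub>M\<^esub>"
  using assms(4)[of "\<zero>\<^bsub>M\<^esub>" "\<zero>\<^bsub>M\<^esub>"] by simp
 thus ?thesis using assms(3)[of "\<zero>\<^bsub>M\<^esub>"] by (metis M.zero_closed N.add.r_cancel_one')
qed

lemma additive_minus:
 assumes "abelian_group M" "abelian_group N"
  and "!!x. x : carrier M ==> f x : carrier N"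
  and "!!x y. x : carrier M ==> y : carrier M ==> f (x \<oplus>\<^bsub>M\<^esub> y) = f x \<oplus>\<^bsub>N\<^esub> f y"
  and x: "x : carrier M"
 shows "f (\<ominus>\<^bsub>M\<^esub> x) = \<ominus>\<^bsub>N\<^esub> f x"
proof -
 interpret M: abelian_group M by fact
 interpret N: abelian_group N by fact
 have "f (\<ominus>\<^bsub>M\<^esub> x) \<oplus>\<^bsub>N\<^esub> f x = f (\<ominus>\<^bsub>M\<^esub> x \<oplus>\<^bsub>M\<^esub> x)"
  by (rule assms(4)[symmetric]) (use x in auto)
 also have "... = \<zero>\<^bsub>N\<^esub>" using additive_zero[OF assms(1-4)] x by (simp add: M.l_neg)
 finally show ?thesis
  using assms(3) x by (metis M.a_inv_closed N.minus_equality)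
qed

lemma additive_diff:
 assumes "abelian_group M" "abelian_group N"
  and "!!x. x : carrier M ==> f x : carrier N"
  and "!!x y. x : carrier M ==> y : carrier M ==> f (x \<oplus>\<^bsub>M\<^esub> y) = f x \<oplus>\<^bsub>N\<^esub> f y"
  and "x : carrier M" "y : carrier M"
 shows "f (x \<ominus>\<^bsub>M\<^esub> y) = f x \<ominus>\<^bsub>N\<^esub> f y"
proof -
 interpret M: abelian_group M by fact
 show ?thesis
  using assms(4)[of x "\<ominus>\<^bsub>M\<^esub> y"] additive_minus[OF assms(1-4), of y] assms(5,6)
  by (simp add: a_minus_def)
qed

lemma additive_finsum:
 assumes "abelian_group M" "abelian_group N"
  and "!!x. x : carrier M ==> f x : carrier N"
  and "!!x y. x : carrier M ==> y : carrier M ==> f (x \<oplus>\<^bsub>M\<^esub> y) = f x \<oplus>\<^bsub>N\<^esub> f y"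
  and "finite I" and "!!i. i : I ==> g i : carrier M"
 shows "f (\<Oplus>\<^bsub>M\<^esub>i\<in>I. g i) = (\<Oplus>\<^bsub>N\<^esub>i\<in>I. f (g i))"
proof -
 interpret M: abelian_group M by fact
 interpret N: abelian_group N by fact
 show ?thesis using assms(5,6)
 proof (induction I)
  case empty
  then show ?case using additive_zero[OF assms(1-4)] by simp
 next
  case (insert i I)
  then show ?case using assms(3,4) by (simp add: Pi_iff M.finsum_closed)
 qed
qed

lemma semilinear_zero:
 assumes "module R M" "module R' N" "f : semilinear_maps R \<theta> M N"
 shows "f \<zero>\<^bsub>M\<^esub> = \<zero>\<^bsub>N\<^esub>"
 by (rule additive_zero[OF module_abelian_group[OF assms(1)] module_abelian_group[OF assms(2)]
   slinearD(1,2)[OF assms(3)]])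

lemma semilinear_minus:
 assumes "module R M" "module R' N" "f : semilinear_maps R \<theta> M N" "x : carrier M"
 shows "f (\<ominus>\<^bsub>M\<^esub> x) = \<ominus>\<^bsub>N\<^esub> f x"
 by (rule additive_minus[OF module_abelian_group[OF assms(1)] module_abelian_group[OF assms(2)]
   slinearD(1,2)[OF assms(3)] assms(4)])

lemma semilinear_diff:
 assumes "module R M" "module R' N" "f : semilinear_maps R \<theta> M N" "x : carrier M" "y : carrier M"
 shows "f (x \<ominus>\<^bsub>M\<^esub> y) = f x \<ominus>\<^bsub>N\<^esub> f y"
 by (rule additive_diff[OF module_abelian_group[OF assms(1)] module_abelian_group[OF assms(2)]
   slinearD(1,2)[OF assms(3)] assms(4,5)])

lemma semilinear_finsum:
 assumes "module R M" "module R' N" "f : semilinear_maps R \<theta> M N"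
  and "finite I" "!!i. i : I ==> g i : carrier M"
 shows "f (\<Oplus>\<^bsub>M\<^esub>i\<in>I. g i) = (\<Oplus>\<^bsub>N\<^esub>i\<in>I. f (g i))"
 by (rule additive_finsum[OF module_abelian_group[OF assms(1)] module_abelian_group[OF assms(2)]
   slinearD(1,2)[OF assms(3)] assms(4,5)])

lemma semilinear_comp:
 assumes "f : semilinear_maps R \<theta> L M" "g : semilinear_maps R \<eta> M N"
  and "!!r. r : carrier R ==> \<theta> r : carrier R"
 shows "(%x. g (f x)) : semilinear_maps R (%r. \<eta> (\<theta> r)) L N"
 by (rule slinearI)
  (use assms in "simp_all add: slinearD[OF assms(1)] slinearD[OF assms(2)]")

text \<open>The graded pieces of Tor come as bare records of operations; their axioms are obtained
  by embedding them in a module that is already known. The additive inverse of an element is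
  supplied by the scalar -1.\<close>

lemma module_transport:
 assumes W: "module R W" and inj: "inj_on f (carrier V)"
  and f: "!!x. x : carrier V ==> f x : carrier W"
  and add: "!!x y. x : carrier V ==> y : carrier V ==>
   x \<oplus>\<^bsub>V\<^esub> y : carrier V & f (x \<oplus>\<^bsub>V\<^esub> y) = f x \<oplus>\<^bsub>W\<^esub> f y"
  and smult: "!!r x. r : carrier R ==> x : carrier V ==>
   r \<odot>\<^bsub>V\<^esub> x : carrier V & f (r \<odot>\<^bsub>V\<^esub> x) = r \<odot>\<^bsub>W\<^esub> f x"
  and zero: "\<zero>\<^bsub>V\<^esub> : carrier V" "f \<zero>\<^bsub>V\<^esub> = \<zero>\<^bsub>W\<^esub>"
 shows "module R V"
proof -
 interpret W: module R W by fact
 show ?thesis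
 proof (rule moduleI)
  show "cring R" by unfold_locales
  show "abelian_group V"
  proof (rule abelian_groupI)
   fix x assume x: "x : carrier V"
   show "\<exists>y\<in>carrier V. y \<oplus>\<^bsub>V\<^esub> x = \<zero>\<^bsub>V\<^esub>"
   proof (intro bexI)
    let ?m = "(\<ominus>\<^bsub>R\<^esub> \<one>\<^bsub>R\<^esub>) \<odot>\<^bsub>V\<^esub> x"
    show m: "?m : carrier V" using x smult by simp
    have "f (?m \<oplus>\<^bsub>V\<^esub> x) = f \<zero>\<^bsub>V\<^esub>"
     using x m add smult f zero by (simp add: W.smult_l_minus W.M.l_neg)
    thus "?m \<oplus>\<^bsub>V\<^esub> x = \<zero>\<^bsub>V\<^esub>" using add[OF m x] zero(1) by (intro inj_onD[OF inj]) simp_all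
   qed
  qed (use add zero f in "auto intro!: inj_onD[OF inj] simp: W.M.a_ac")
 qed (use add smult zero f in "auto intro!: inj_onD[OF inj] simp: W.smult_l_distr W.smult_r_distr W.smult_assoc1")
qed

subsection \<open>Free modules\<close>

lemma free_simps [simp]:
 "f : carrier (free_module R X) \<longleftrightarrow>
  (\<forall>x. f x : carrier R) & (\<forall>x. x \<notin> X --> f x = \<zero>\<^bsub>R\<^esub>) & finite {x. f x ~= \<zero>\<^bsub>R\<^esub>}"
 "\<zero>\<^bsub>free_module R X\<^esub> = (%x. \<zero>\<^bsub>R\<^esub>)"
 "f \<oplus>\<^bsub>free_module R X\<^esub> g = (%x. f x \<oplus>\<^bsub>R\<^esub> g x)"
 "r \<odot>\<^bsub>free_module R X\<^esub> f = (%x. r \<otimes>\<^bsub>R\<^esub> f x)"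
 by (simp_all add: free_module_def)

context cring
begin

lemma free_module_is_module: "module R (free_module R X)"
proof (rule moduleI)
 show "cring R" by unfold_locales
 show "abelian_group (free_module R X)"
 proof (rule abelian_groupI)
  fix f g assume f: "f : carrier (free_module R X)" and g: "g : carrier (free_module R X)"
  have "finite ({x. f x ~= \<zero>} \<union> {x. g x ~= \<zero>})" using f g by simp
  hence "finite {x. f x \<oplus> g x ~= \<zero>}" by (rule rev_finite_subset) auto
  thus "f \<oplus>\<^bsub>free_module R X\<^esub> g : carrier (free_module R X)" using f g by auto
 next
  fix f assume f: "f : carrier (free_module R X)"
  have "{x. \<ominus> f x ~= \<zero>} <= {x. f x ~= \<zero>}" by auto
  hence "(%x. \<ominus> f x) : carrier (free_module R X)" using f by (auto intro: finite_subset)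
  moreover have "(%x. \<ominus> f x) \<oplus>\<^bsub>free_module R X\<^esub> f = \<zero>\<^bsub>free_module R X\<^esub>"
   using f by (auto simp: l_neg)
  ultimately show "\<exists>y\<in>carrier (free_module R X). y \<oplus>\<^bsub>free_module R X\<^esub> f = \<zero>\<^bsub>free_module R X\<^esub>"
   by blast
 next
  fix f g h assume "f : carrier (free_module R X)" "g : carrier (free_module R X)"
   "h : carrier (free_module R X)"
  thus "f \<oplus>\<^bsub>free_module R X\<^esub> g \<oplus>\<^bsub>free_module R X\<^esub> h
    = f \<oplus>\<^bsub>free_module R X\<^esub> (g \<oplus>\<^bsub>free_module R X\<^esub> h)"
   by (simp add: fun_eq_iff a_assoc)
 next
  fix f g assume "f : carrier (free_module R X)" "g : carrier (free_module R X)"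
  thus "f \<oplus>\<^bsub>free_module R X\<^esub> g = g \<oplus>\<^bsub>free_module R X\<^esub> f" by (simp add: fun_eq_iff a_comm)
 qed (auto simp: fun_eq_iff)
next
 fix a f assume a: "a : carrier R" and f: "f : carrier (free_module R X)"
 have "{x. a \<otimes> f x ~= \<zero>} <= {x. f x ~= \<zero>}" using a by auto
 thus "a \<odot>\<^bsub>free_module R X\<^esub> f : carrier (free_module R X)"
  using a f by (auto intro: finite_subset)
qed (auto simp: fun_eq_iff l_distr r_distr m_assoc)

lemma gen_cl: "x : X ==> free_gen R x : carrier (free_module R X)"
 by (auto simp: free_gen_def intro: finite_subset[of _ "{x}"])

lemma free_module_minus:
 "f : carrier (free_module R X) ==> \<ominus>\<^bsub>free_module R X\<^esub> f = (%x. \<ominus> f x)"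
proof -
 assume f: "f : carrier (free_module R X)"
 interpret F: module R "free_module R X" by (rule free_module_is_module)
 have "{x. \<ominus> f x ~= \<zero>} <= {x. f x ~= \<zero>}" by auto
 hence "(%x. \<ominus> f x) : carrier (free_module R X)" using f by (auto intro: finite_subset)
 moreover have "(%x. \<ominus> f x) \<oplus>\<^bsub>free_module R X\<^esub> f = \<zero>\<^bsub>free_module R X\<^esub>"
  using f by (auto simp: l_neg)
 ultimately show ?thesis using f F.minus_equality by metis
qed

text \<open>Induction on the size of the support: each step splits off one coefficient.\<close>

lemma free_module_induct [consumes 1, case_names zero step]:
 assumes f: "f : carrier (free_module R X)"
  and zero: "P (%x. \<zero>)"
  and step: "!!f a x. f : carrier (free_module R X) ==> P f ==> a : carrier R ==> x : X ==>
   P (f \<oplus>\<^bsub>free_module R X\<^esub> a \<odot>\<^bsub>free_module R X\<^esub> free_gen R x)"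
 shows "P f"
 using f
proof (induction "card {x. f x ~= \<zero>}" arbitrary: f)
 case 0
 hence "f = (%x. \<zero>)" by auto
 thus ?case using zero by simp
next
 case (Suc n)
 then obtain x where x: "f x ~= \<zero>" by (metis (mono_tags, lifting) card.empty empty_Collect_eq nat.distinct(1))
 hence xX: "x : X" using Suc.prems by auto
 let ?g = "f(x := \<zero>)"
 have supp: "{y. ?g y ~= \<zero>} = {y. f y ~= \<zero>} - {x}" by auto
 have g: "?g : carrier (free_module R X)" unfolding free_simps supp using Suc.prems by auto
 have "card {y. ?g y ~= \<zero>} = n"
  unfolding supp using Suc.hyps(2) x Suc.prems by (subst card_Diff_singleton) auto
 hence "P ?g" using Suc.hyps(1) g by blast
 hence "P (?g \<oplus>\<^bsub>free_module R X\<^esub> f x \<odot>\<^bsub>free_module R X\<^esub> free_gen R x)"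
  using g xX Suc.prems by (intro step) auto
 moreover have "?g \<oplus>\<^bsub>free_module R X\<^esub> f x \<odot>\<^bsub>free_module R X\<^esub> free_gen R x = f"
  using Suc.prems by (auto simp: free_gen_def fun_eq_iff)
 ultimately show ?case by simp
qed

end

text \<open>For \<open>h\<close> the identity on a basis this is the map whose bijectivity
  \<open>module_basis\<close> demands, so linearity proved for it applies to bases as well.\<close>

definition free_lift ::
 "('r, 'p) ring_scheme => ('r, 'b, 'q) module_scheme => ('x => 'b) => ('x => 'r) => 'b" where
 "free_lift R M h f = (\<Oplus>\<^bsub>M\<^esub>x\<in>{x. f x ~= \<zero>\<^bsub>R\<^esub>}. f x \<odot>\<^bsub>M\<^esub> h x)"

context module
begin

text \<open>Functions with different supports can be added termwise only over a common finite index
  set, so the sum is first moved to such a set.\<close>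

lemma free_lift_eq:
 assumes "f : carrier (free_module R X)" "h : X \<rightarrow> carrier M"
  and "finite Y" "{x. f x ~= \<zero>} <= Y" "Y <= X"
 shows "free_lift R M h f = (\<Oplus>\<^bsub>M\<^esub>x\<in>Y. f x \<odot>\<^bsub>M\<^esub> h x)"
 unfolding free_lift_def
 by (rule M.add.finprod_mono_neutral_cong_left) (use assms in "auto simp: Pi_iff subset_iff")

lemma free_lift_linear:
 assumes h: "h : X \<rightarrow> carrier M"
 shows "free_lift R M h : linear_maps R (free_module R X) M"
proof (rule slinearI)
 fix f assume f: "f : carrier (free_module R X)"
 show "free_lift R M h f : carrier M"
  unfolding free_lift_def using f h by (intro M.finsum_closed) (auto simp: Pi_iff)
next
 fix f g assume f: "f : carrier (free_module R X)" and g: "g : carrier (free_module R X)"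
 let ?Y = "{x. f x ~= \<zero>} \<union> {x. g x ~= \<zero>}"
 interpret F: module R "free_module R X" by (rule R.free_module_is_module)
 have Y: "finite ?Y" "?Y <= X" using f g by auto
 have 1: "free_lift R M h (f \<oplus>\<^bsub>free_module R X\<^esub> g)
   = (\<Oplus>\<^bsub>M\<^esub>x\<in>?Y. (f \<oplus>\<^bsub>free_module R X\<^esub> g) x \<odot>\<^bsub>M\<^esub> h x)"
  by (rule free_lift_eq[OF F.M.a_closed[OF f g] h Y(1) _ Y(2)]) auto
 also have "... = (\<Oplus>\<^bsub>M\<^esub>x\<in>?Y. f x \<odot>\<^bsub>M\<^esub> h x \<oplus>\<^bsub>M\<^esub> g x \<odot>\<^bsub>M\<^esub> h x)"
  by (rule M.finsum_cong') (use f g h Y in "auto simp: Pi_iff subset_iff smult_l_distr")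
 also have "... = (\<Oplus>\<^bsub>M\<^esub>x\<in>?Y. f x \<odot>\<^bsub>M\<^esub> h x) \<oplus>\<^bsub>M\<^esub> (\<Oplus>\<^bsub>M\<^esub>x\<in>?Y. g x \<odot>\<^bsub>M\<^esub> h x)"
  by (rule M.finsum_addf) (use f g h Y in "auto simp: Pi_iff subset_iff")
 also have "(\<Oplus>\<^bsub>M\<^esub>x\<in>?Y. f x \<odot>\<^bsub>M\<^esub> h x) = free_lift R M h f"
  by (rule free_lift_eq[OF f h Y(1) _ Y(2), symmetric]) auto
 also have "(\<Oplus>\<^bsub>M\<^esub>x\<in>?Y. g x \<odot>\<^bsub>M\<^esub> h x) = free_lift R M h g"
  by (rule free_lift_eq[OF g h Y(1) _ Y(2), symmetric]) auto
 finally show "free_lift R M h (f \<oplus>\<^bsub>free_module R X\<^esub> g) = free_lift R M h f \<oplus>\<^bsub>M\<^esub> free_lift R M h g" .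
next
 fix r f assume r: "r : carrier R" and f: "f : carrier (free_module R X)"
 interpret F: module R "free_module R X" by (rule R.free_module_is_module)
 let ?Y = "{x. f x ~= \<zero>}"
 have Y: "finite ?Y" "?Y <= X" using f by auto
 have "free_lift R M h (r \<odot>\<^bsub>free_module R X\<^esub> f) = (\<Oplus>\<^bsub>M\<^esub>x\<in>?Y. (r \<odot>\<^bsub>free_module R X\<^esub> f) x \<odot>\<^bsub>M\<^esub> h x)"
  by (rule free_lift_eq[OF F.smult_closed[OF r f] h Y(1) _ Y(2)]) (use r in auto)
 also have "... = (\<Oplus>\<^bsub>M\<^esub>x\<in>?Y. r \<odot>\<^bsub>M\<^esub> (f x \<odot>\<^bsub>M\<^esub> h x))"
  by (rule M.finsum_cong') (use r f h Y in "auto simp: Pi_iff subset_iff smult_assoc1")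
 also have "... = r \<odot>\<^bsub>M\<^esub> free_lift R M h f"
  unfolding free_lift_def
  by (rule finsum_smult_ldistr[symmetric]) (use r f h Y in "auto simp: Pi_iff subset_iff")
 finally show "free_lift R M h (r \<odot>\<^bsub>free_module R X\<^esub> f) = id r \<odot>\<^bsub>M\<^esub> free_lift R M h f" unfolding id_apply .
qed

lemma free_lift_gen:
 assumes h: "h : X \<rightarrow> carrier M" and x: "x : X"
 shows "free_lift R M h (free_gen R x) = h x"
proof -
 have hx: "h x : carrier M" using h x by blast
 have supp: "{y. free_gen R x y ~= \<zero>} <= {x}" by (simp add: free_gen_def subset_iff)
 have "free_lift R M h (free_gen R x) = (\<Oplus>\<^bsub>M\<^esub>y\<in>{x}. free_gen R x y \<odot>\<^bsub>M\<^esub> h y)"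
  by (rule free_lift_eq[OF R.gen_cl[OF x] h _ supp]) (simp_all add: x)
 also have "... = h x" using hx by (simp add: free_gen_def)
 finally show ?thesis .
qed

end

lemma (in cring) free_module_closure:
 assumes K: "submodule K R (free_module R X)" and gen: "!!x. x : X ==> free_gen R x : K"
  and f: "f : carrier (free_module R X)"
 shows "f : K"
 using f
proof (induction rule: free_module_induct)
 case zero
 interpret F: module R "free_module R X" by (rule free_module_is_module)
 show ?case using subgroup.one_closed[OF submodule.axioms(1)[OF K]] by simp
next
 case (step f a x)
 interpret F: module R "free_module R X" by (rule free_module_is_module)
 show ?case using F.submoduleE(4,5)[OF K] step gen by blast
qed

text \<open>The instances are the identity and, on the polynomial ring, the permutations of the
  variables. The latter make the lifted actions semilinear rather than linear.\<close>

locale ring_endo = cring R for R (structure) and \<theta> +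
 assumes endo_closed: "r : carrier R ==> \<theta> r : carrier R"
  and endo_add: "r : carrier R ==> s : carrier R ==> \<theta> (r \<oplus> s) = \<theta> r \<oplus> \<theta> s"
  and endo_mult: "r : carrier R ==> s : carrier R ==> \<theta> (r \<otimes> s) = \<theta> r \<otimes> \<theta> s"
  and endo_one: "\<theta> \<one> = \<one>"

lemma (in cring) ring_endo_id: "ring_endo R id"
 by unfold_locales auto

context ring_endo
begin

lemma endo_zero: "\<theta> \<zero> = \<zero>"
 by (rule additive_zero[where M = R and N = R]) (use endo_closed endo_add is_abelian_group in auto)

lemma free_map_eq:
 assumes "f : carrier (free_module R X)" and "finite Y" "{x. f x ~= \<zero>} <= Y" "Y <= X"
 shows "free_map R X \<theta> h f y = (\<Oplus>x\<in>{x\<in>Y. h x = y}. \<theta> (f x))"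
 unfolding free_map_def
 by (rule add.finprod_mono_neutral_cong_left)
  (use assms endo_zero endo_closed in "auto simp: Pi_iff subset_iff")

lemma free_map_semilinear:
 assumes h: "!!x. x : X ==> h x : Y"
 shows "free_map R X \<theta> h : semilinear_maps R \<theta> (free_module R X) (free_module R Y)"
proof (rule slinearI)
 fix f assume f: "f : carrier (free_module R X)"
 have fX: "x : X" if "f x ~= \<zero>" for x using f that by auto
 have "free_map R X \<theta> h f y : carrier R" for y
  unfolding free_map_def using f endo_closed by (auto intro!: finsum_closed)
 moreover have z: "free_map R X \<theta> h f y = \<zero>" if "y \<notin> h ` {x. f x ~= \<zero>}" for y
 proof -
  have "{x \<in> X. f x ~= \<zero> & h x = y} = {}" using that by auto
  thus ?thesis unfolding free_map_def by (simp only: finsum_empty)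
 qed
 moreover have "finite {y. free_map R X \<theta> h f y ~= \<zero>}"
 proof (rule finite_subset)
  show "{y. free_map R X \<theta> h f y ~= \<zero>} <= h ` {x. f x ~= \<zero>}" using z by blast
 qed (use f in simp)
 moreover have "free_map R X \<theta> h f y = \<zero>" if "y \<notin> Y" for y
  using that h fX by (intro z) auto
 ultimately show "free_map R X \<theta> h f : carrier (free_module R Y)" by auto
next
 fix f g assume f: "f : carrier (free_module R X)" and g: "g : carrier (free_module R X)"
 let ?Y = "{x. f x ~= \<zero>} \<union> {x. g x ~= \<zero>}"
 interpret F: module R "free_module R X" by (rule free_module_is_module)
 have Y: "finite ?Y" "?Y <= X" using f g by auto
 have "free_map R X \<theta> h (f \<oplus>\<^bsub>free_module R X\<^esub> g) y
   = free_map R X \<theta> h f y \<oplus> free_map R X \<theta> h g y" for y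
 proof -
  have "free_map R X \<theta> h (f \<oplus>\<^bsub>free_module R X\<^esub> g) y
   = (\<Oplus>x\<in>{x\<in>?Y. h x = y}. \<theta> ((f \<oplus>\<^bsub>free_module R X\<^esub> g) x))"
   by (rule free_map_eq[OF F.M.a_closed[OF f g] Y(1) _ Y(2)]) auto
  also have "... = (\<Oplus>x\<in>{x\<in>?Y. h x = y}. \<theta> (f x) \<oplus> \<theta> (g x))"
   by (rule finsum_cong') (use f g endo_add endo_closed in auto)
  also have "... = (\<Oplus>x\<in>{x\<in>?Y. h x = y}. \<theta> (f x)) \<oplus> (\<Oplus>x\<in>{x\<in>?Y. h x = y}. \<theta> (g x))"
   by (rule finsum_addf) (use f g endo_closed in auto)
  also have "... = free_map R X \<theta> h f y \<oplus> free_map R X \<theta> h g y"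
   using free_map_eq[OF f Y(1) _ Y(2), of h y] free_map_eq[OF g Y(1) _ Y(2), of h y] by simp
  finally show ?thesis .
 qed
 thus "free_map R X \<theta> h (f \<oplus>\<^bsub>free_module R X\<^esub> g)
   = free_map R X \<theta> h f \<oplus>\<^bsub>free_module R Y\<^esub> free_map R X \<theta> h g" by (simp add: fun_eq_iff)
next
 fix r f assume r: "r : carrier R" and f: "f : carrier (free_module R X)"
 let ?Y = "{x. f x ~= \<zero>}"
 interpret F: module R "free_module R X" by (rule free_module_is_module)
 have Y: "finite ?Y" "?Y <= X" using f by auto
 have "free_map R X \<theta> h (r \<odot>\<^bsub>free_module R X\<^esub> f) y = \<theta> r \<otimes> free_map R X \<theta> h f y" for y
 proof -
  have "free_map R X \<theta> h (r \<odot>\<^bsub>free_module R X\<^esub> f) y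
   = (\<Oplus>x\<in>{x\<in>?Y. h x = y}. \<theta> ((r \<odot>\<^bsub>free_module R X\<^esub> f) x))"
   by (rule free_map_eq[OF F.smult_closed[OF r f] Y(1) _ Y(2)]) (use r in auto)
  also have "... = (\<Oplus>x\<in>{x\<in>?Y. h x = y}. \<theta> r \<otimes> \<theta> (f x))"
   by (rule finsum_cong') (use f r endo_mult endo_closed in auto)
  also have "... = \<theta> r \<otimes> (\<Oplus>x\<in>{x\<in>?Y. h x = y}. \<theta> (f x))"
   by (rule finsum_rdistr[symmetric]) (use f r endo_closed in auto)
  also have "... = \<theta> r \<otimes> free_map R X \<theta> h f y"
   using free_map_eq[OF f Y(1) _ Y(2), of h y] by simp
  finally show ?thesis .
 qed
 thus "free_map R X \<theta> h (r \<odot>\<^bsub>free_module R X\<^esub> f) = \<theta> r \<odot>\<^bsub>free_module R Y\<^esub> free_map R X \<theta> h f"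
  by (simp add: fun_eq_iff)
qed

lemma free_map_gen:
 assumes "x : X"
 shows "free_map R X \<theta> h (free_gen R x) = free_gen R (h x)"
proof
 fix y
 have "free_map R X \<theta> h (free_gen R x) y = (\<Oplus>z\<in>{z\<in>{x}. h z = y}. \<theta> (free_gen R x z))"
  by (rule free_map_eq[OF gen_cl[OF assms]]) (use assms in "auto simp: free_gen_def")
 also have "{z\<in>{x}. h z = y} = (if h x = y then {x} else {})" by auto
 finally show "free_map R X \<theta> h (free_gen R x) y = free_gen R (h x) y"
  by (auto simp: free_gen_def endo_one)
qed

end

declare free_simps [simp del]

lemma (in abelian_group) diff_eq_zero_iff:
 assumes "a : carrier G" "b : carrier G"
 shows "a \<ominus> b = \<zero> \<longleftrightarrow> a = b"
 using assms by (metis a_inv_closed a_minus_def minus_equality minus_minus r_neg)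

subsection \<open>Quotients\<close>

lemma quot_map_coset:
 assumes M: "module R M" and M': "module R' M'"
  and N: "submodule N R M" and N': "submodule N' R' M'"
  and f: "!!x. x : carrier M ==> f x : carrier M'"
  and add: "!!x y. x : carrier M ==> y : carrier M ==> f (x \<oplus>\<^bsub>M\<^esub> y) = f x \<oplus>\<^bsub>M'\<^esub> f y"
  and fN: "!!x. x : N ==> f x : N'"
  and x: "x : carrier M"
 shows "quot_map M' N' f (N +>\<^bsub>M\<^esub> x) = N' +>\<^bsub>M'\<^esub> f x"
proof -
 interpret M: module R M by fact
 interpret M': module R' M' by fact
 have NM: "N <= carrier M" and zN: "\<zero>\<^bsub>M\<^esub> : N"
  using M.submoduleE(1)[OF N] subgroup.one_closed[OF submodule.axioms(1)[OF N]] by auto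
 have NM': "N' <= carrier M'" using M'.submoduleE(1)[OF N'] .
 have "n' \<oplus>\<^bsub>M'\<^esub> f (n \<oplus>\<^bsub>M\<^esub> x) = (n' \<oplus>\<^bsub>M'\<^esub> f n) \<oplus>\<^bsub>M'\<^esub> f x" if "n' : N'" "n : N" for n n'
  using that NM NM' x f add by (simp add: subset_iff M'.a_assoc)
 moreover have "n' \<oplus>\<^bsub>M'\<^esub> f n : N'" if "n' : N'" "n : N" for n n'
  using that fN M'.submoduleE(5)[OF N'] by blast
 \<comment> \<open>Choosing the zero of \<open>N\<close> shows that every element of the coset of
   \<open>f x\<close> is attained.\<close>
 moreover have "n' \<oplus>\<^bsub>M'\<^esub> f x = n' \<oplus>\<^bsub>M'\<^esub> f (\<zero>\<^bsub>M\<^esub> \<oplus>\<^bsub>M\<^esub> x)" for n' using x by simp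
 ultimately show ?thesis
  using zN unfolding quot_map_def a_r_coset_def' set_add_def'
  by (auto 0 3)
qed

locale quotient = module R M + submodule N R M for R (structure) and M (structure) and N
begin

abbreviation "Q == quot_module M N"

lemma N_submodule: "submodule N R M" by unfold_locales

lemma N_abelian_subgroup: "abelian_subgroup N M"
 by (rule abelian_subgroupI3) (unfold_locales, simp add: submodule.axioms)

sublocale N: abelian_subgroup N M by (rule N_abelian_subgroup)

lemma quot_carrier: "carrier Q = (%x. N +>\<^bsub>M\<^esub> x) ` carrier M"
 by (auto simp: quot_module_def A_RCOSETS_def')

lemma coset_closed: "x : carrier M ==> N +>\<^bsub>M\<^esub> x : carrier Q"
 by (simp add: quot_carrier)

lemma quot_cases:
 assumes "X : carrier Q" obtains x where "x : carrier M" "X = N +>\<^bsub>M\<^esub> x"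
 using assms by (auto simp: quot_carrier)

lemma coset_eq_iff:
 assumes "x : carrier M" "y : carrier M"
 shows "N +>\<^bsub>M\<^esub> x = N +>\<^bsub>M\<^esub> y \<longleftrightarrow> x \<ominus>\<^bsub>M\<^esub> y : N"
 by (metis N.a_rcos_module N.a_rcos_self a_minus_def assms M.a_repr_independence' N.a_subgroup
   N.a_rcos_const abelian_subgroup.a_rcos_module N_abelian_subgroup M.a_repr_independence N.a_Hcarr)

lemma quot_zero: "\<zero>\<^bsub>Q\<^esub> = N +>\<^bsub>M\<^esub> \<zero>\<^bsub>M\<^esub>" "\<zero>\<^bsub>Q\<^esub> = N"
 using M.a_coset_add_zero by (auto simp: quot_module_def N.a_subset)

lemma quot_add:
 "x : carrier M ==> y : carrier M ==> (N +>\<^bsub>M\<^esub> x) \<oplus>\<^bsub>Q\<^esub> (N +>\<^bsub>M\<^esub> y) = N +>\<^bsub>M\<^esub> (x \<oplus>\<^bsub>M\<^esub> y)"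
 by (simp add: quot_module_def N.a_rcos_sum)

lemma quot_smult:
 assumes "r : carrier R" "x : carrier M"
 shows "r \<odot>\<^bsub>Q\<^esub> (N +>\<^bsub>M\<^esub> x) = N +>\<^bsub>M\<^esub> (r \<odot>\<^bsub>M\<^esub> x)"
proof -
 have "r \<odot>\<^bsub>Q\<^esub> (N +>\<^bsub>M\<^esub> x) = quot_map M N (%x. r \<odot>\<^bsub>M\<^esub> x) (N +>\<^bsub>M\<^esub> x)"
  by (simp add: quot_module_def quot_map_def)
 also have "... = N +>\<^bsub>M\<^esub> (r \<odot>\<^bsub>M\<^esub> x)"
  by (rule quot_map_coset[OF module_axioms module_axioms N_submodule N_submodule])
   (use assms in "auto simp: smult_r_distr")
 finally show ?thesis .
qed

lemma quot_is_module: "module R Q"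
proof (rule moduleI)
 show "cring R" by unfold_locales
 show "abelian_group Q"
 proof (rule abelian_groupI)
  fix X assume "X : carrier Q"
  then obtain x where x: "x : carrier M" "X = N +>\<^bsub>M\<^esub> x" by (rule quot_cases)
  have "(N +>\<^bsub>M\<^esub> (\<ominus>\<^bsub>M\<^esub> x)) \<oplus>\<^bsub>Q\<^esub> X = \<zero>\<^bsub>Q\<^esub>" using x by (simp add: quot_add M.l_neg quot_zero(1))
  thus "\<exists>Y\<in>carrier Q. Y \<oplus>\<^bsub>Q\<^esub> X = \<zero>\<^bsub>Q\<^esub>" using x coset_closed by blast
 qed (auto elim!: quot_cases simp: quot_add coset_closed M.a_ac quot_zero(1))
qed (auto elim!: quot_cases simp: quot_add quot_smult coset_closed smult_l_distr smult_r_distr smult_assoc1)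

lemma coset_linear: "(%x. N +>\<^bsub>M\<^esub> x) : linear_maps R M Q"
 by (rule slinearI) (auto simp: quot_add quot_smult coset_closed)

lemma quot_lift:
 assumes L: "module R L" and f: "f : linear_maps R M L" and fN: "!!x. x : N ==> f x = \<zero>\<^bsub>L\<^esub>"
 obtains g where "g : linear_maps R Q L" "!!x. x : carrier M ==> g (N +>\<^bsub>M\<^esub> x) = f x"
proof -
 interpret L: module R L by fact
 define g where "g X = f (SOME x. x : carrier M & X = N +>\<^bsub>M\<^esub> x)" for X
 have g: "g (N +>\<^bsub>M\<^esub> x) = f x" if x: "x : carrier M" for x
 proof -
  define y where "y = (SOME y. y : carrier M & N +>\<^bsub>M\<^esub> x = N +>\<^bsub>M\<^esub> y)"
  have y: "y : carrier M" "N +>\<^bsub>M\<^esub> x = N +>\<^bsub>M\<^esub> y"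
   unfolding y_def using someI[of "%y. y : carrier M & N +>\<^bsub>M\<^esub> x = N +>\<^bsub>M\<^esub> y" x] x by auto
  hence "f (x \<ominus>\<^bsub>M\<^esub> y) = \<zero>\<^bsub>L\<^esub>" using coset_eq_iff x fN by blast
  hence "f x \<ominus>\<^bsub>L\<^esub> f y = \<zero>\<^bsub>L\<^esub>" using semilinear_diff[OF module_axioms L f x y(1)] by simp
  hence "f x = f y" using slinearD(1)[OF f] x y L.M.diff_eq_zero_iff by blast
  thus ?thesis unfolding g_def y_def by simp
 qed
 show ?thesis
 proof (rule that[OF _ g])
  show "g : linear_maps R Q L"
   by (rule slinearI)
    (auto elim!: quot_cases simp: g quot_add quot_smult slinearD[OF f])
 qed
qed

end

lemma quotientI: "module R M ==> submodule N R M ==> quotient R M N"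
 by (simp add: quotient_def)

lemma quot_map_semilinear:
 assumes M: "module R M" and M': "module R M'"
  and N: "submodule N R M" and N': "submodule N' R M'"
  and f: "f : semilinear_maps R \<theta> M M'" and fN: "!!x. x : N ==> f x : N'"
  and \<theta>: "!!r. r : carrier R ==> \<theta> r : carrier R"
 shows "quot_map M' N' f : semilinear_maps R \<theta> (quot_module M N) (quot_module M' N')"
proof -
 interpret A: quotient R M N by (rule quotientI[OF M N])
 interpret B: quotient R M' N' by (rule quotientI[OF M' N'])
 note q = quot_map_coset[OF M M' N N' slinearD(1)[OF f] slinearD(2)[OF f] fN]
 show ?thesis
  by (rule slinearI)
   (auto elim!: A.quot_cases simp: q A.quot_add A.quot_smult B.quot_add B.quot_smult
    slinearD[OF f] B.coset_closed \<theta>)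
qed

subsection \<open>Modules given by generators and relations\<close>

context module
begin

lemma span_submodule: 
 assumes "S <= carrier M" shows "submodule (submodule_span R M S) R M"
proof (rule submoduleI)
 show "submodule_span R M S <= carrier M"
  unfolding submodule_span_def using carrier_is_submodule assms by auto
 show "\<zero>\<^bsub>M\<^esub> : submodule_span R M S"
  unfolding submodule_span_def using subgroup.one_closed[OF submodule.axioms(1)] by fastforce
qed (unfold submodule_span_def, use submoduleE in auto)

lemma span_incl: "x : S ==> x : submodule_span R M S"
 by (auto simp: submodule_span_def)

lemma span_least: "submodule N R M ==> S <= N ==> submodule_span R M S <= N"
 by (auto simp: submodule_span_def)

lemma kernel_submodule:
 assumes L: "module R L" and f: "f : linear_maps R M L"
 shows "submodule {x \<in> carrier M. f x = \<zero>\<^bsub>L\<^esub>} R M"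
proof -
 interpret L: module R L by fact
 show ?thesis
  by (rule submoduleI)
  (auto simp: slinearD[OF f] semilinear_zero[OF module_axioms L f]
   semilinear_minus[OF module_axioms L f])
qed

lemma vimage_submodule:
 assumes L: "module R L" and f: "f : semilinear_maps R \<theta> M L" and N: "submodule N R L"
  and \<theta>: "!!r. r : carrier R ==> \<theta> r : carrier R"
 shows "submodule {x \<in> carrier M. f x : N} R M"
proof -
 interpret L: module R L by fact
 have "\<zero>\<^bsub>L\<^esub> : N" using subgroup.one_closed[OF submodule.axioms(1)[OF N]] by simp
 thus ?thesis
  by (intro submoduleI)
  (auto simp: slinearD[OF f] semilinear_zero[OF module_axioms L f]
   semilinear_minus[OF module_axioms L f] L.submoduleE[OF N] \<theta>)
qed

lemma eq_submodule:
 assumes L: "module R L" and f: "f : semilinear_maps R \<theta> M L" and g: "g : semilinear_maps R \<theta> M L"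
 shows "submodule {x \<in> carrier M. f x = g x} R M"
 by (rule submoduleI)
  (auto simp: slinearD[OF f] slinearD[OF g] semilinear_zero[OF module_axioms L f]
   semilinear_zero[OF module_axioms L g] semilinear_minus[OF module_axioms L f]
   semilinear_minus[OF module_axioms L g])

end

text \<open>Tensor products, Specht modules and induced modules are all quotients of a free module
  by the span of given relations. Closure, uniqueness and existence of maps are proved here once for
  the three of them.\<close>

locale presented = cring R for R (structure) +
 fixes X :: "'x set" and G :: "('x => 'a) set"
 assumes rels: "G <= carrier (free_module R X)"
begin

abbreviation "F == free_module R X"
abbreviation "N == submodule_span R F G"
abbreviation "P == quot_module F N"
abbreviation "cls f == N +>\<^bsub>F\<^esub> f"
abbreviation "gen x == cls (free_gen R x)"

sublocale F: module R F by (rule free_module_is_module)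
sublocale Q: quotient R F N by (rule quotientI[OF F.module_axioms F.span_submodule[OF rels]])

lemma pres_module: "module R P" by (rule Q.quot_is_module)

lemma gen_closed: "x : X ==> gen x : carrier P"
 by (rule Q.coset_closed[OF gen_cl])

text \<open>This takes the place of an induction over elements of the quotient: a property that cuts
  out a submodule need only be checked on the classes of generators.\<close>

lemma pres_closure:
 assumes K: "submodule K R P" and gen: "!!x. x : X ==> gen x : K" and v: "v : carrier P"
 shows "v : K"
proof -
 obtain f where f: "f : carrier F" "v = cls f" using v by (rule Q.quot_cases)
 have "f : {f \<in> carrier F. cls f : K}"
  by (rule free_module_closure[OF F.vimage_submodule[OF pres_module Q.coset_linear K] _ f(1)])
   (use gen gen_cl in auto)
 thus ?thesis using f by simp
qed

lemma pres_ext: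
 assumes L: "module R L" and f: "f : semilinear_maps R \<theta> P L" and g: "g : semilinear_maps R \<theta> P L"
  and gen: "!!x. x : X ==> f (gen x) = g (gen x)" and v: "v : carrier P"
 shows "f v = g v"
proof -
 interpret P: module R P by (rule pres_module)
 have "v : {v \<in> carrier P. f v = g v}"
  by (rule pres_closure[OF P.eq_submodule[OF L f g] _ v]) (use gen gen_closed in auto)
 thus ?thesis by simp
qed

lemma pres_lift:
 assumes L: "module R L" and h: "h : X \<rightarrow> carrier L"
  and rel: "!!g. g : G ==> free_lift R L h g = \<zero>\<^bsub>L\<^esub>"
 obtains f where "f : linear_maps R P L" "!!x. x : X ==> f (gen x) = h x"
proof -
 interpret L: module R L by fact
 have "G <= {x \<in> carrier F. free_lift R L h x = \<zero>\<^bsub>L\<^esub>}" using rel rels by blast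
 hence "N <= {x \<in> carrier F. free_lift R L h x = \<zero>\<^bsub>L\<^esub>}"
  by (rule F.span_least[OF F.kernel_submodule[OF L L.free_lift_linear[OF h]]])
 then obtain f where f: "f : linear_maps R P L" "!!x. x : carrier F ==> f (cls x) = free_lift R L h x"
  using Q.quot_lift[OF L L.free_lift_linear[OF h]] by blast
 show ?thesis
  by (rule that[OF f(1)]) (simp only: f(2) gen_cl L.free_lift_gen[OF h])
qed

end

text \<open>A map of generators descends as soon as each single relation goes into the span of the
  relations of the target. It is applied to tensor products of maps and to the actions on Specht
  modules and induced modules.\<close>

lemma presented_map:
 assumes "presented R X G" "presented R Y H" "ring_endo R \<theta>"
  and h: "!!x. x : X ==> h x : Y"
  and rel: "!!g. g : G ==> free_map R X \<theta> h g : submodule_span R (free_module R Y) H"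
 defines "N == submodule_span R (free_module R X) G"
  and "N' == submodule_span R (free_module R Y) H"
 defines "f == quot_map (free_module R Y) N' (free_map R X \<theta> h)"
 shows "f : semilinear_maps R \<theta> (quot_module (free_module R X) N) (quot_module (free_module R Y) N')"
  and "!!x. x : X ==> f (N +>\<^bsub>free_module R X\<^esub> free_gen R x) = N' +>\<^bsub>free_module R Y\<^esub> free_gen R (h x)"
proof -
 interpret A: presented R X G by fact
 interpret B: presented R Y H by fact
 interpret ring_endo R \<theta> by fact
 have lin: "free_map R X \<theta> h : semilinear_maps R \<theta> (free_module R X) (free_module R Y)"
  by (rule free_map_semilinear) (rule h)
 have "G <= {x \<in> carrier (free_module R X). free_map R X \<theta> h x : N'}"
  using rel A.rels by (auto simp: N'_def)
 hence "N <= {x \<in> carrier (free_module R X). free_map R X \<theta> h x : N'}"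
  unfolding N_def N'_def
  using A.F.span_least[OF A.F.vimage_submodule[OF B.F.module_axioms lin B.Q.N_submodule]] endo_closed
  by blast
 hence NN': "free_map R X \<theta> h x : N'" if "x : N" for x using that by auto
 show "f : semilinear_maps R \<theta> (quot_module (free_module R X) N) (quot_module (free_module R Y) N')"
  unfolding f_def
  by (rule quot_map_semilinear[OF A.F.module_axioms B.F.module_axioms _ _ lin NN' endo_closed])
   (simp_all add: N_def N'_def A.Q.N_submodule B.Q.N_submodule)
 fix x assume x: "x : X"
 have "f (N +>\<^bsub>free_module R X\<^esub> free_gen R x) = N' +>\<^bsub>free_module R Y\<^esub> free_map R X \<theta> h (free_gen R x)"
  unfolding f_def
  by (rule quot_map_coset[OF A.F.module_axioms B.F.module_axioms
     A.Q.N_submodule[folded N_def] B.Q.N_submodule[folded N'_def]])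
   (use slinearD[OF lin] NN' A.gen_cl[OF x] in auto)
 thus "f (N +>\<^bsub>free_module R X\<^esub> free_gen R x) = N' +>\<^bsub>free_module R Y\<^esub> free_gen R (h x)"
  by (simp only: free_map_gen[OF x])
qed

subsection \<open>Tensor products\<close>

text \<open>The relations inside \<open>tensor_rel\<close> before the span is taken, so that the
  tensor product becomes an instance of \<open>presented\<close>.\<close>

definition tensor_gens ::
 "('r, 'p) ring_scheme => ('r, 'b, 'q) module_scheme => ('r, 'c, 's) module_scheme
  => ('b \<times> 'c => 'r) set" where
 "tensor_gens R M N = (let F = free_module R (carrier M \<times> carrier N); e = free_gen R in
   ({e (x \<oplus>\<^bsub>M\<^esub> x', y) \<ominus>\<^bsub>F\<^esub> e (x, y) \<ominus>\<^bsub>F\<^esub> e (x', y) | x x' y.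
     x : carrier M & x' : carrier M & y : carrier N} \<union>
   {e (x, y \<oplus>\<^bsub>N\<^esub> y') \<ominus>\<^bsub>F\<^esub> e (x, y) \<ominus>\<^bsub>F\<^esub> e (x, y') | x y y'.
     x : carrier M & y : carrier N & y' : carrier N} \<union>
   {e (r \<odot>\<^bsub>M\<^esub> x, y) \<ominus>\<^bsub>F\<^esub> r \<odot>\<^bsub>F\<^esub> e (x, y) | r x y.
     r : carrier R & x : carrier M & y : carrier N} \<union>
   {e (x, r \<odot>\<^bsub>N\<^esub> y) \<ominus>\<^bsub>F\<^esub> r \<odot>\<^bsub>F\<^esub> e (x, y) | r x y.
     r : carrier R & x : carrier M & y : carrier N}))"

lemma tensor_rel_span:
 "tensor_rel R M N = submodule_span R (free_module R (carrier M \<times> carrier N)) (tensor_gens R M N)"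
 by (simp only: tensor_rel_def tensor_gens_def Let_def)

lemma (in module) coset_relation_eqs:
 assumes N: "submodule N R M" and "x : carrier M" "y : carrier M" "z : carrier M"
 shows "x \<ominus>\<^bsub>M\<^esub> y \<ominus>\<^bsub>M\<^esub> z : N ==> N +>\<^bsub>M\<^esub> x = (N +>\<^bsub>M\<^esub> y) \<oplus>\<^bsub>quot_module M N\<^esub> (N +>\<^bsub>M\<^esub> z)"
  and "x \<ominus>\<^bsub>M\<^esub> y : N ==> N +>\<^bsub>M\<^esub> x = N +>\<^bsub>M\<^esub> y"
  and "r : carrier R ==> x \<ominus>\<^bsub>M\<^esub> r \<odot>\<^bsub>M\<^esub> y : N ==> N +>\<^bsub>M\<^esub> x = r \<odot>\<^bsub>quot_module M N\<^esub> (N +>\<^bsub>M\<^esub> y)"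
proof -
 interpret Q: quotient R M N by (rule quotientI[OF module_axioms N])
 have *: "x \<ominus>\<^bsub>M\<^esub> y \<ominus>\<^bsub>M\<^esub> z = x \<ominus>\<^bsub>M\<^esub> (y \<oplus>\<^bsub>M\<^esub> z)" using assms by (simp add: a_minus_def M.minus_add M.a_assoc)
 show "x \<ominus>\<^bsub>M\<^esub> y \<ominus>\<^bsub>M\<^esub> z : N ==> N +>\<^bsub>M\<^esub> x = (N +>\<^bsub>M\<^esub> y) \<oplus>\<^bsub>quot_module M N\<^esub> (N +>\<^bsub>M\<^esub> z)"
  using assms * by (simp add: Q.quot_add Q.coset_eq_iff)
qed (use assms quotient.coset_eq_iff[OF quotientI[OF module_axioms N]]
  quotient.quot_smult[OF quotientI[OF module_axioms N]] in auto)

locale tensors = M: module R M + N: module R N for R (structure) and M (structure) and N (structure)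
begin

abbreviation "T == tensor R M N"
abbreviation "pt == pure_tensor R M N"
abbreviation "FT == free_module R (carrier M \<times> carrier N)"

sublocale FT: module R FT by (rule M.free_module_is_module)

lemma tensors_presented: "presented R (carrier M \<times> carrier N) (tensor_gens R M N)"
proof (unfold_locales)
 have g: "free_gen R (x, y) : carrier FT" if "x : carrier M" "y : carrier N" for x y
  by (rule M.gen_cl) (use that in auto)
 show "tensor_gens R M N <= carrier FT"
  unfolding tensor_gens_def Let_def
  by (intro subsetI) (elim UnE CollectE exE conjE; simp only:;
    (intro FT.M.minus_closed FT.smult_closed g M.M.a_closed N.M.a_closed M.smult_closed N.smult_closed; assumption?)+)
qed

sublocale T: presented R "carrier M \<times> carrier N" "tensor_gens R M N"
 by (rule tensors_presented)

lemma tensor_eq: "T = T.P"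
 by (simp only: tensor_def tensor_rel_span)

lemma pure_tensor_eq: "pt x y = T.gen (x, y)"
 by (simp only: pure_tensor_def tensor_rel_span)

lemma tensor_module: "module R T"
 unfolding tensor_eq by (rule T.pres_module)

lemma pure_closed: "x : carrier M ==> y : carrier N ==> pt x y : carrier T"
 unfolding tensor_eq pure_tensor_eq by (rule T.gen_closed) simp

lemma tensor_gens_I:
 "x : carrier M ==> x' : carrier M ==> y : carrier N ==>
  free_gen R (x \<oplus>\<^bsub>M\<^esub> x', y) \<ominus>\<^bsub>FT\<^esub> free_gen R (x, y) \<ominus>\<^bsub>FT\<^esub> free_gen R (x', y) : tensor_gens R M N"
 "x : carrier M ==> y' : carrier N ==> y : carrier N ==>
  free_gen R (x, y \<oplus>\<^bsub>N\<^esub> y') \<ominus>\<^bsub>FT\<^esub> free_gen R (x, y) \<ominus>\<^bsub>FT\<^esub> free_gen R (x, y') : tensor_gens R M N"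
 "r : carrier R ==> x : carrier M ==> y : carrier N ==>
  free_gen R (r \<odot>\<^bsub>M\<^esub> x, y) \<ominus>\<^bsub>FT\<^esub> r \<odot>\<^bsub>FT\<^esub> free_gen R (x, y) : tensor_gens R M N"
 "r : carrier R ==> x : carrier M ==> y : carrier N ==>
  free_gen R (x, r \<odot>\<^bsub>N\<^esub> y) \<ominus>\<^bsub>FT\<^esub> r \<odot>\<^bsub>FT\<^esub> free_gen R (x, y) : tensor_gens R M N"
 unfolding tensor_gens_def Let_def by blast+

lemma fg: "x : carrier M ==> y : carrier N ==> free_gen R (x, y) : carrier FT"
 by (rule M.gen_cl) auto

lemma pure_add_left:
 "x : carrier M ==> x' : carrier M ==> y : carrier N ==> pt (x \<oplus>\<^bsub>M\<^esub> x') y = pt x y \<oplus>\<^bsub>T\<^esub> pt x' y"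
 unfolding tensor_eq pure_tensor_eq
 by (rule FT.coset_relation_eqs(1)[OF T.Q.N_submodule])
  (use FT.span_incl[OF tensor_gens_I(1)] fg in auto)

lemma pure_add_right:
 "x : carrier M ==> y : carrier N ==> y' : carrier N ==> pt x (y \<oplus>\<^bsub>N\<^esub> y') = pt x y \<oplus>\<^bsub>T\<^esub> pt x y'"
 unfolding tensor_eq pure_tensor_eq
 by (rule FT.coset_relation_eqs(1)[OF T.Q.N_submodule])
  (use FT.span_incl[OF tensor_gens_I(2)] fg in auto)

lemma pure_smult_left:
 "r : carrier R ==> x : carrier M ==> y : carrier N ==> pt (r \<odot>\<^bsub>M\<^esub> x) y = r \<odot>\<^bsub>T\<^esub> pt x y"
 unfolding tensor_eq pure_tensor_eq
 by (rule FT.coset_relation_eqs(3)[OF T.Q.N_submodule])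
  (use FT.span_incl[OF tensor_gens_I(3)] fg in auto)

lemma pure_smult_right:
 "r : carrier R ==> x : carrier M ==> y : carrier N ==> pt x (r \<odot>\<^bsub>N\<^esub> y) = r \<odot>\<^bsub>T\<^esub> pt x y"
 unfolding tensor_eq pure_tensor_eq
 by (rule FT.coset_relation_eqs(3)[OF T.Q.N_submodule])
  (use FT.span_incl[OF tensor_gens_I(4)] fg in auto)

lemma tensor_closure:
 assumes "submodule K R T" "!!x y. x : carrier M ==> y : carrier N ==> pt x y : K" "v : carrier T"
 shows "v : K"
 using T.pres_closure[of K v] assms unfolding tensor_eq pure_tensor_eq by auto

lemma tensor_ext:
 assumes L: "module R L" and f: "f : semilinear_maps R \<theta> T L" and g: "g : semilinear_maps R \<theta> T L"
  and gen: "!!x y. x : carrier M ==> y : carrier N ==> f (pt x y) = g (pt x y)" and v: "v : carrier T"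
 shows "f v = g v"
 using T.pres_ext[of L f \<theta> g v] assms unfolding tensor_eq pure_tensor_eq by auto

lemma tensor_lift:
 assumes L: "module R L"
  and \<beta>: "!!x y. x : carrier M ==> y : carrier N ==> \<beta> x y : carrier L"
   "!!x x' y. x : carrier M ==> x' : carrier M ==> y : carrier N ==> \<beta> (x \<oplus>\<^bsub>M\<^esub> x') y = \<beta> x y \<oplus>\<^bsub>L\<^esub> \<beta> x' y"
   "!!x y y'. x : carrier M ==> y : carrier N ==> y' : carrier N ==> \<beta> x (y \<oplus>\<^bsub>N\<^esub> y') = \<beta> x y \<oplus>\<^bsub>L\<^esub> \<beta> x y'"
   "!!r x y. r : carrier R ==> x : carrier M ==> y : carrier N ==> \<beta> (r \<odot>\<^bsub>M\<^esub> x) y = r \<odot>\<^bsub>L\<^esub> \<beta> x y"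
   "!!r x y. r : carrier R ==> x : carrier M ==> y : carrier N ==> \<beta> x (r \<odot>\<^bsub>N\<^esub> y) = r \<odot>\<^bsub>L\<^esub> \<beta> x y"
 obtains f where "f : linear_maps R T L"
  "!!x y. x : carrier M ==> y : carrier N ==> f (pt x y) = \<beta> x y"
proof -
 interpret L: module R L by fact
 let ?h = "%(x, y). \<beta> x y"
 have h: "?h : carrier M \<times> carrier N \<rightarrow> carrier L" using \<beta>(1) by auto
 note lin = L.free_lift_linear[OF h]
 note d = semilinear_diff[OF FT.module_axioms L lin]
 have ge: "free_lift R L ?h (free_gen R (x, y)) = \<beta> x y" if "x : carrier M" "y : carrier N" for x y
  using L.free_lift_gen[OF h, of "(x, y)"] that by simp
 have cancel: "a \<oplus>\<^bsub>L\<^esub> b \<ominus>\<^bsub>L\<^esub> a \<ominus>\<^bsub>L\<^esub> b = \<zero>\<^bsub>L\<^esub>" if "a : carrier L" "b : carrier L" for a b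
 proof -
  have "a \<oplus>\<^bsub>L\<^esub> b \<ominus>\<^bsub>L\<^esub> a \<ominus>\<^bsub>L\<^esub> b = (a \<oplus>\<^bsub>L\<^esub> b) \<ominus>\<^bsub>L\<^esub> (a \<oplus>\<^bsub>L\<^esub> b)"
   using that by (simp add: a_minus_def L.M.minus_add L.M.a_assoc)
  thus ?thesis using that by (simp add: L.M.diff_eq_zero_iff)
 qed
 have "free_lift R L ?h g = \<zero>\<^bsub>L\<^esub>" if "g : tensor_gens R M N" for g
  using that unfolding tensor_gens_def Let_def
  by (elim UnE CollectE exE conjE)
   (simp_all add: d fg ge \<beta> cancel L.M.diff_eq_zero_iff slinearD(3)[OF lin] FT.M.minus_closed FT.smult_closed)
 from T.pres_lift[OF L h this] obtain f where
  "f : linear_maps R T.P L" "!!x. x : carrier M \<times> carrier N ==> f (T.gen x) = ?h x" by blast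
 thus ?thesis by (intro that[of f]) (simp_all add: tensor_eq pure_tensor_eq)
qed

end

lemma tensor_map_props:
 assumes T: "tensors R M N" and T': "tensors R M' N'" and \<theta>: "ring_endo R \<theta>"
  and f: "f : semilinear_maps R \<theta> M M'" and g: "g : semilinear_maps R \<theta> N N'"
 shows "tensor_map R M N M' N' \<theta> f g : semilinear_maps R \<theta> (tensor R M N) (tensor R M' N')"
  and "!!x y. x : carrier M ==> y : carrier N ==>
   tensor_map R M N M' N' \<theta> f g (pure_tensor R M N x y) = pure_tensor R M' N' (f x) (g y)"
proof -
 interpret A: tensors R M N by fact
 interpret B: tensors R M' N' by fact
 interpret ring_endo R \<theta> by fact
 note fD = slinearD[OF f] and gD = slinearD[OF g]
 let ?h = "map_prod f g" and ?X = "carrier M \<times> carrier N"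
 have h: "?h x : carrier M' \<times> carrier N'" if "x : ?X" for x using that fD gD by auto
 have lin: "free_map R ?X \<theta> ?h : semilinear_maps R \<theta> A.FT B.FT"
  by (rule free_map_semilinear) (rule h)
 note d = semilinear_diff[OF A.FT.module_axioms B.FT.module_axioms lin]
 have ge: "free_map R ?X \<theta> ?h (free_gen R (x, y)) = free_gen R (f x, g y)"
  if "x : carrier M" "y : carrier N" for x y
  using free_map_gen[of "(x, y)" ?X ?h] that by simp
 \<comment> \<open>Each of the four kinds of relation is carried to a relation of the same
   kind.\<close>
 have rel: "free_map R ?X \<theta> ?h u : submodule_span R B.FT (tensor_gens R M' N')"
  if "u : tensor_gens R M N" for u
 proof (rule B.FT.span_incl)
  show "free_map R ?X \<theta> ?h u : tensor_gens R M' N'"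
   using that unfolding tensor_gens_def[of R M N] Let_def
   by (elim UnE CollectE exE conjE)
   (simp_all add: d A.fg ge fD gD slinearD(3)[OF lin] A.FT.M.minus_closed
    A.FT.smult_closed B.tensor_gens_I endo_closed)
 qed
 note pm = presented_map[OF A.tensors_presented B.tensors_presented \<theta> h rel]
 show "tensor_map R M N M' N' \<theta> f g : semilinear_maps R \<theta> (tensor R M N) (tensor R M' N')"
  unfolding tensor_map_def A.tensor_eq B.tensor_eq unfolding tensor_rel_span by (rule pm(1))
 fix x y assume "x : carrier M" "y : carrier N"
 thus "tensor_map R M N M' N' \<theta> f g (pure_tensor R M N x y) = pure_tensor R M' N' (f x) (g y)"
  unfolding tensor_map_def pure_tensor_def unfolding tensor_rel_span using pm(2)[of "(x, y)"] by simp
qed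

section \<open>Alternating functions on lists\<close>

text \<open>Restricted to lists of length b with entries in {1..n}, these functions model the
  coefficients in M of the b-th exterior power of a free module of rank n. Vanishing on equal
  neighbours is a condition of its own: in characteristic two antisymmetry does not imply
  it.\<close>

definition alternating :: "('b, 'q) ring_scheme => ('k list => 'b) => bool" where
 "alternating M c \<longleftrightarrow> range c <= carrier M &
  (\<forall>u a v. c (u @ a # a # v) = \<zero>\<^bsub>M\<^esub>) & (\<forall>u a b v. c (u @ a # b # v) = \<ominus>\<^bsub>M\<^esub> c (u @ b # a # v))"

lemma altD:
 assumes "alternating M c"
 shows "c l : carrier M" "c (u @ a # a # v) = \<zero>\<^bsub>M\<^esub>" "c (u @ a # b # v) = \<ominus>\<^bsub>M\<^esub> c (u @ b # a # v)"
  "c (a # a # v) = \<zero>\<^bsub>M\<^esub>" "c (a # b # v) = \<ominus>\<^bsub>M\<^esub> c (b # a # v)"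
 using assms unfolding alternating_def by (blast, blast, blast, metis append_Nil, metis append_Nil)

lemma altI:
 assumes "!!l. c l : carrier M" "!!u a v. c (u @ a # a # v) = \<zero>\<^bsub>M\<^esub>"
  "!!u a b v. c (u @ a # b # v) = \<ominus>\<^bsub>M\<^esub> c (u @ b # a # v)"
 shows "alternating M c"
 using assms unfolding alternating_def by blast

lemma alternating_Cons:
 assumes "alternating M c" shows "alternating M (%l. c (x # l))"
proof (rule altI)
 show "c (x # u @ a # a # v) = \<zero>\<^bsub>M\<^esub>" for u a v
  using altD(2)[OF assms, of "x # u" a v] by simp
 show "c (x # u @ a # b # v) = \<ominus>\<^bsub>M\<^esub> c (x # u @ b # a # v)" for u a b v
  using altD(3)[OF assms, of "x # u" a b v] by simp
qed (rule altD(1)[OF assms])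

lemma alternating_additive:
 assumes "abelian_group M" "abelian_group N" "alternating M c"
  and "!!x. x : carrier M ==> f x : carrier N"
  and "!!x y. x : carrier M ==> y : carrier M ==> f (x \<oplus>\<^bsub>M\<^esub> y) = f x \<oplus>\<^bsub>N\<^esub> f y"
 shows "alternating N (%l. f (c l))"
proof (rule altI)
 show "f (c (u @ a # b # v)) = \<ominus>\<^bsub>N\<^esub> f (c (u @ b # a # v))" for u a b v
  using additive_minus[OF assms(1,2,4,5)] altD(1,3)[OF assms(3)] by metis
qed (simp_all add: altD(1,2)[OF assms(3)] assms(4) additive_zero[OF assms(1,2,4,5)])

lemma alternating_map:
 assumes "alternating M c" shows "alternating M (%l. c (map g l))"
proof (rule altI)
 show "c (map g (u @ a # b # v)) = \<ominus>\<^bsub>M\<^esub> c (map g (u @ b # a # v))" for u a b v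
  using altD(3)[OF assms, of "map g u" "g a" "g b" "map g v"] by simp
qed (simp_all add: altD(1,2)[OF assms])

context abelian_group
begin

lemma neg_zero [simp]: "\<ominus> \<zero> = \<zero>"
 by (metis a_inv_closed l_zero r_neg zero_closed)

text \<open>Induction on the gap between the two entries: moving the intermediate entry
  \<open>x\<close> out of the way and back again costs two signs, which cancel.\<close>

lemma alternating_swap:
 assumes c: "alternating G c"
 shows "c (u @ a # v @ b # w) = \<ominus> c (u @ b # v @ a # w)"
proof (induction v arbitrary: u)
 case Nil
 show ?case using altD(3)[OF c, of u a b w] by simp
next
 case (Cons x v)
 note D = altD[OF c]
 have "c (u @ a # (x # v) @ b # w) = \<ominus> c (u @ x # a # v @ b # w)"
  using D(3)[of u a x "v @ b # w"] by simp
 also have "c (u @ x # a # v @ b # w) = \<ominus> c (u @ x # b # v @ a # w)" using Cons[of "u @ [x]"] by simp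
 also have "c (u @ x # b # v @ a # w) = \<ominus> c (u @ b # x # v @ a # w)"
  using D(3)[of u x b "v @ a # w"] by simp
 finally show ?case using D(1) by simp
qed

lemma alternating_repeat:
 assumes c: "alternating G c" and "~ distinct l"
 shows "c l = \<zero>"
proof -
 obtain u a v w where l: "l = u @ a # v @ a # w" using not_distinct_decomp[OF assms(2)] by auto
 show ?thesis unfolding l
 proof (induction v arbitrary: u)
  case (Cons x v)
  have "c (u @ a # (x # v) @ a # w) = \<ominus> c ((u @ [x]) @ a # v @ a # w)"
   using altD(3)[OF c, of u a x "v @ a # w"] by simp
  thus ?case using Cons[of "u @ [x]"] by simp
 qed (simp add: altD(2)[OF c])
qed

text \<open>This links the sign \<open>evenperm\<close> of the column relations for tableaux with
  alternation under adjacent swaps. The permutation is built up from transpositions, each of which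
  contributes one sign.\<close>

lemma alternating_permute:
 assumes c: "alternating G c" and p: "p permutes S" and "finite S" "set l = S" "distinct l"
 shows "c (map p l) = (if evenperm p then c l else \<ominus> c l)"
 using p assms(3)
proof (induction rule: permutes_induct)
 case id
 show ?case by simp
next
 case (swap a b p)
 have ab: "a : S" "b : S" "a ~= b" and pS: "p permutes S"
  and IH: "c (map p l) = (if evenperm p then c l else \<ominus> c l)"
  using swap by blast+
 have perm: "permutation p" using pS assms(3) permutation_permutes by blast
 have set: "set (map p l) = S" "distinct (map p l)"
  using permutes_image[OF pS] assms(4,5) permutes_inj_on[OF pS] by (auto simp: distinct_map)
 have sw: "c (map (transpose a b) (u @ a # v @ b # w)) = \<ominus> c (u @ a # v @ b # w)"
  if "distinct (u @ a # v @ b # w)" for u v w a b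
 proof -
  have "map (transpose a b) (u @ a # v @ b # w) = u @ b # v @ a # w"
   using that by (auto intro!: map_idI simp: transpose_def)
  thus ?thesis using alternating_swap[OF c] by metis
 qed
 have "c (map (transpose a b) (map p l)) = \<ominus> c (map p l)"
 proof -
  obtain u v where uv: "map p l = u @ a # v" using set ab(1) by (metis split_list)
  show ?thesis
  proof (cases "b : set v")
   case True
   then obtain v1 v2 where "v = v1 @ b # v2" by (metis split_list)
   thus ?thesis using sw[of u a v1 b v2] uv set by simp
  next
   case False
   hence "b : set u" using set ab(2,3) uv by auto
   then obtain u1 u2 where "u = u1 @ b # u2" by (metis split_list)
   thus ?thesis using sw[of u1 b u2 a v] uv set by (simp add: transpose_commute)
  qed
 qed
 hence 1: "c (map (transpose a b \<circ> p) l) = \<ominus> c (map p l)" by (simp only: map_map)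
 have 2: "evenperm (transpose a b \<circ> p) \<longleftrightarrow> ~ evenperm p"
  using ab(3) perm evenperm_comp[OF permutation_swap_id perm] evenperm_swap[of a b] by simp
 show ?case unfolding 1 2 IH using minus_minus[OF altD(1)[OF c, of l]] by (cases "evenperm p") simp_all
qed

end

section \<open>Sorting, and extension of values from increasing lists\<close>

fun inversions :: "nat list => nat" where
 "inversions [] = 0"
| "inversions (a # l) = length (filter (%b. b < a) l) + inversions l"

text \<open>The number of inversions is the measure for bubble sort, and its parity is the sign in
  \<open>alt_ext\<close>; both uses rest on this step.\<close>

lemma inversions_swap:
 "b < a ==> inversions (u @ a # b # v) = Suc (inversions (u @ b # a # v))"
proof (induction u)
 case (Cons x u)
 have "length (filter (%b. b < x) (u @ a # b # v)) = length (filter (%b. b < x) (u @ b # a # v))"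
  by simp
 thus ?case using Cons by simp
qed auto

lemma not_sorted_descent:
 "~ sorted_wrt (<) (l :: nat list) ==> \<exists>u a b v. l = u @ a # b # v & b <= a"
proof (induction l)
 case (Cons x l)
 show ?case
 proof (cases "sorted_wrt (<) l")
  case True
  then obtain y l' where l: "l = y # l'" using Cons.prems by (cases l) auto
  have "y <= x"
  proof (rule ccontr)
   assume "~ y <= x"
   thus False using Cons.prems True l by (auto dest: less_trans)
  qed
  thus ?thesis using l by (intro exI[of _ "[]"]) auto
 next
  case False
  then obtain u a b v where "l = u @ a # b # v" "b <= a" using Cons by blast
  thus ?thesis by (intro exI[of _ "x # u"]) auto
 qed
qed simp

text \<open>Bubble sort: a descent is traded for a list with fewer inversions at the cost of the
  same sign on both sides, and equal neighbours give zero on both sides.\<close>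

lemma alternating_eq_sorted:
 assumes c: "alternating M c" and c': "alternating M c'"
  and eq: "!!l :: nat list. sorted_wrt (<) l ==> c l = c' l"
 shows "c l = c' l"
proof (induction "inversions l" arbitrary: l rule: less_induct)
 case less
 show ?case
 proof (cases "sorted_wrt (<) l")
  case False
  then obtain u a b v where l: "l = u @ a # b # v" "b <= a" using not_sorted_descent by blast
  show ?thesis
  proof (cases "a = b")
   case True
   thus ?thesis using l altD(2)[OF c] altD(2)[OF c'] by simp
  next
   case False
   hence "c (u @ b # a # v) = c' (u @ b # a # v)"
    using less[of "u @ b # a # v"] inversions_swap[of b a u v] l by simp
   thus ?thesis using l altD(3)[OF c] altD(3)[OF c'] by metis
  qed
 qed (rule eq)
qed

text \<open>Preimages of the values of a chain are chosen list by list and need not alternate. This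
  construction keeps the choices at increasing lists and derives all other values from them.\<close>

definition alt_ext :: "('b, 'q) ring_scheme => (nat list => 'b) => nat list => 'b" where
 "alt_ext M y l = (if distinct l then
  (if even (inversions l) then y (sort l) else \<ominus>\<^bsub>M\<^esub> y (sort l)) else \<zero>\<^bsub>M\<^esub>)"

lemma inversions_sorted: "sorted_wrt (<) l ==> inversions l = 0"
 by (induction l) (auto simp: filter_empty_conv)

lemma alt_ext_sorted: "sorted_wrt (<) l ==> alt_ext M y l = y l"
 using inversions_sorted[of l] strict_sorted_iff[of l] by (simp add: alt_ext_def sorted_sort_id)

lemma (in abelian_group) alt_ext_alternating:
 assumes y: "!!l. y l : carrier G"
 shows "alternating G (alt_ext G y)"
proof (rule altI)
 show "alt_ext G y l : carrier G" for l using y by (simp add: alt_ext_def)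
 show "alt_ext G y (u @ a # a # v) = \<zero>" for u a v by (simp add: alt_ext_def)
 have sw: "alt_ext G y (u @ a # b # v) = \<ominus> alt_ext G y (u @ b # a # v)" if "b < a" for u a b v
 proof -
  have "mset (u @ a # b # v) = mset (u @ b # a # v)" by simp
  hence s: "sort (u @ a # b # v) = sort (u @ b # a # v)" by (metis properties_for_sort sorted_sort mset_sort)
  have d: "distinct (u @ a # b # v) = distinct (u @ b # a # v)" by auto
  show ?thesis unfolding alt_ext_def s d inversions_swap[OF that] using y by simp
 qed
 show "alt_ext G y (u @ a # b # v) = \<ominus> alt_ext G y (u @ b # a # v)" for u a b v
 proof (cases a b rule: linorder_cases)
  case less
  have "alt_ext G y (u @ a # b # v) : carrier G" using y by (simp add: alt_ext_def)
  thus ?thesis using sw[OF less, of u v] by (simp only: minus_minus)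
 next
  case equal
  thus ?thesis by (simp add: alt_ext_def)
 next
  case greater
  thus ?thesis by (rule sw)
 qed
qed

subsection \<open>Exterior multiplication\<close>

text \<open>Left multiplication by the exterior generator e_k: a signed sum over the occurrences of
  \<open>k\<close> in the list of the values of \<open>c\<close> on the list with that occurrence
  deleted. The recursion produces the sign, one minus for each entry passed.\<close>

fun wedge :: "('b, 'q) ring_scheme => 'k => ('k list => 'b) => 'k list => 'b" where
 "wedge M k c [] = \<zero>\<^bsub>M\<^esub>"
| "wedge M k c (a # l) = (if a = k then c l else \<zero>\<^bsub>M\<^esub>) \<ominus>\<^bsub>M\<^esub> wedge M k (%l'. c (a # l')) l"

lemma wedge_cong:
 "(!!l'. mset l = add_mset k (mset l') ==> c l' = c' l') ==> wedge M k c l = wedge M k c' l"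
proof (induction l arbitrary: c c')
 case (Cons a l)
 have "wedge M k (%l'. c (a # l')) l = wedge M k (%l'. c' (a # l')) l"
  by (rule Cons.IH) (use Cons.prems in simp)
 thus ?case using Cons.prems[of l] by simp
qed simp

lemma wedge_map:
 assumes "inj g" shows "wedge M (g k) c (map g l) = wedge M k (%l. c (map g l)) l"
proof (induction l arbitrary: c)
 case (Cons a l)
 have "g a = g k \<longleftrightarrow> a = k" using assms by (simp add: inj_eq)
 thus ?case using Cons[of "%l'. c (g a # l')"] by simp
qed simp

context abelian_group
begin

lemma wedge_closed: "(!!l. c l : carrier G) ==> wedge G k c l : carrier G"
 by (induction l arbitrary: c) simp_all

lemma wedge_null: "wedge G k (%l. \<zero>) l = \<zero>"
 by (induction l) (simp_all add: a_minus_def)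

lemma wedge_zero:
 assumes "!!l'. mset l = add_mset k (mset l') ==> c l' = \<zero>" shows "wedge G k c l = \<zero>"
 using wedge_cong[of l k c "%l. \<zero>" G] assms wedge_null by simp

lemma wedge_nonzero:
 assumes "wedge G k c l ~= \<zero>" shows "\<exists>l'. mset l = add_mset k (mset l') & c l' ~= \<zero>"
 using wedge_zero[of l k c] assms by blast

lemma wedge_additive:
 assumes N: "abelian_group N" and c: "!!l. c l : carrier G"
  and f: "!!x. x : carrier G ==> f x : carrier N"
  and add: "!!x y. x : carrier G ==> y : carrier G ==> f (x \<oplus> y) = f x \<oplus>\<^bsub>N\<^esub> f y"
 shows "f (wedge G k c l) = wedge N k (%l. f (c l)) l"
 using c
proof (induction l arbitrary: c)
 case (Cons a l)
 have "wedge G k (%l'. c (a # l')) l : carrier G" using Cons.prems by (intro wedge_closed)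
 thus ?case using Cons.prems Cons.IH[of "%l'. c (a # l')"] f
  by (simp add: additive_diff[OF abelian_group_axioms N f add] additive_zero[OF abelian_group_axioms N f add])
qed (simp add: additive_zero[OF abelian_group_axioms N f add])

lemma wedge_minus:
 assumes "!!l. c l : carrier G" shows "wedge G k (%l. \<ominus> c l) l = \<ominus> wedge G k c l"
 by (rule wedge_additive[symmetric, OF abelian_group_axioms assms]) (auto simp: minus_add a_comm)

lemma diff_add_swap:
 assumes "x : carrier G" "y : carrier G" "z : carrier G" "w : carrier G"
 shows "(x \<oplus> y) \<ominus> (z \<oplus> w) = (x \<ominus> z) \<oplus> (y \<ominus> w)"
 using assms by (simp add: a_minus_def minus_add a_ac)

lemma wedge_add:
 assumes "!!l. c l : carrier G" "!!l. c' l : carrier G"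
 shows "wedge G k (%l. c l \<oplus> c' l) l = wedge G k c l \<oplus> wedge G k c' l"
 using assms
proof (induction l arbitrary: c c')
 case (Cons a l)
 show ?case
  using Cons.prems diff_add_swap[of "if a = k then c l else \<zero>" "if a = k then c' l else \<zero>"
   "wedge G k (%l'. c (a # l')) l" "wedge G k (%l'. c' (a # l')) l"]
   Cons.IH[of "%l'. c (a # l')" "%l'. c' (a # l')"]
  by (cases "a = k") (simp_all add: wedge_closed)
qed simp

lemma wedge_finsum:
 assumes "finite I" "!!i l. i : I ==> c i l : carrier G"
 shows "wedge G k (%l. \<Oplus>i\<in>I. c i l) l = (\<Oplus>i\<in>I. wedge G k (c i) l)"
 using assms
proof (induction I)
 case (insert i I)
 have "wedge G k (%l. \<Oplus>j\<in>insert i I. c j l) l = wedge G k (%l. c i l \<oplus> (\<Oplus>j\<in>I. c j l)) l"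
  using insert by (intro wedge_cong) (simp add: Pi_iff)
 also have "... = wedge G k (c i) l \<oplus> wedge G k (%l. \<Oplus>j\<in>I. c j l) l"
  using insert by (intro wedge_add) auto
 finally show ?case using insert by (simp add: Pi_iff wedge_closed)
qed (simp add: wedge_null)

lemma wedge_alternating:
 assumes c: "alternating G c" shows "alternating G (wedge G k c)"
proof (rule altI)
 show "wedge G k c l : carrier G" for l by (rule wedge_closed) (rule altD(1)[OF c])
next
 fix u a v
 show "wedge G k c (u @ a # a # v) = \<zero>" using c
 proof (induction u arbitrary: c)
  case Nil
  have "wedge G k (%l. c (a # a # l)) v = \<zero>"
   by (rule wedge_zero) (rule altD(4)[OF Nil])
  thus ?case using altD(1)[OF Nil] neg_zero by (cases "a = k") (simp_all add: a_minus_def r_neg)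
 next
  case (Cons x u)
  show ?case using Cons.IH[OF alternating_Cons[OF Cons.prems, of x]] altD(2)[OF Cons.prems]
   by (simp add: a_minus_def)
 qed
next
 fix u a b v
 show "wedge G k c (u @ a # b # v) = \<ominus> wedge G k c (u @ b # a # v)" using c
 proof (induction u arbitrary: c)
  case Nil
  note D = altD[OF Nil]
  have "wedge G k (%l. c (a # b # l)) v = wedge G k (%l. \<ominus> c (b # a # l)) v"
   by (rule wedge_cong) (rule D(5))
  also have "... = \<ominus> wedge G k (%l. c (b # a # l)) v" using D(1) by (intro wedge_minus)
  finally show ?case using D(1)
   by (simp add: a_minus_def minus_add wedge_closed a_ac)
 next
  case (Cons x u)
  note D = altD[OF Cons.prems]
  have w: "wedge G k (%l'. c (x # l')) l : carrier G" for l by (rule wedge_closed) (rule D(1))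
  have "c (u @ a # b # v) = \<ominus> c (u @ b # a # v)" by (rule D(3))
  thus ?case using Cons.IH[OF alternating_Cons[OF Cons.prems, of x]] D(1) w
   by (simp add: a_minus_def minus_add)
 qed
qed

text \<open>Contracting by e_k and multiplying by e_k again recovers the part of \<open>c\<close>
  that involves e_k. This is the exterior half of the homotopy identity \<open>kosz_contr\<close>.
  When \<open>k\<close> stands in front, the remaining term vanishes because \<open>k\<close> would
  occur twice.\<close>

lemma wedge_contract:
 assumes c: "alternating G c" and k: "k : set l"
 shows "wedge G k (%l'. c (k # l')) l = c l"
 using c k
proof (induction l arbitrary: c)
 case (Cons a l)
 note D = altD[OF Cons.prems(1)]
 show ?case
 proof (cases "a = k")
  case True
  have "wedge G k (%l'. c (k # k # l')) l = \<zero>" by (rule wedge_zero) (rule D(4))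
  thus ?thesis using True D(1) by (simp add: a_minus_def)
 next
  case False
  have "wedge G k (%l'. c (k # a # l')) l = wedge G k (%l'. \<ominus> c (a # k # l')) l"
   by (rule wedge_cong) (rule D(5))
  also have "... = \<ominus> wedge G k (%l'. c (a # k # l')) l" using D(1) by (intro wedge_minus)
  also have "wedge G k (%l'. c (a # k # l')) l = c (a # l)"
   using Cons.IH[OF alternating_Cons[OF Cons.prems(1), of a]] Cons.prems False by simp
  finally show ?thesis using False D(1) by (simp add: a_minus_def)
 qed
qed simp

text \<open>Exterior generators anticommute. The vanishing of the square gets its own induction,
  since anticommutation only yields that twice the square is zero.\<close>

lemma wedge_wedge:
 assumes "!!l. c l : carrier G"
 shows "wedge G a (wedge G b c) l = \<ominus> wedge G b (wedge G a c) l" and "wedge G a (wedge G a c) l = \<zero>"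
proof -
 \<comment> \<open>The first entry is removed by the outer factor, by the inner factor, or by
   neither; in the third case the two signs cancel.\<close>
 have step: "wedge G a (wedge G b c) (x # l)
   = (if x = a then wedge G b c l else \<zero>) \<ominus> (if x = b then wedge G a c l else \<zero>)
     \<oplus> wedge G a (wedge G b (%l. c (x # l))) l"
  if c: "!!l. c l : carrier G" for a b x l c
 proof -
  let ?c = "%l. c (x # l)"
  have cl: "wedge G k ?c l : carrier G" "wedge G k c l : carrier G" for k l using c by (simp_all add: wedge_closed)
  have cl': "wedge G k' (wedge G k ?c) l : carrier G" for k k' by (rule wedge_closed) (rule cl)
  have "wedge G a (%l'. wedge G b c (x # l')) l
    = wedge G a (%l'. (if x = b then c l' else \<zero>) \<oplus> \<ominus> wedge G b ?c l') l"
   by (simp add: a_minus_def)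
  also have "... = wedge G a (%l'. if x = b then c l' else \<zero>) l \<oplus> wedge G a (%l'. \<ominus> wedge G b ?c l') l"
   using c cl by (intro wedge_add) auto
  also have "wedge G a (%l'. if x = b then c l' else \<zero>) l = (if x = b then wedge G a c l else \<zero>)"
   by (simp add: wedge_null)
  also have "wedge G a (%l'. \<ominus> wedge G b ?c l') l = \<ominus> wedge G a (wedge G b ?c) l"
   using cl by (intro wedge_minus)
  finally show ?thesis using cl cl' by (simp add: a_minus_def minus_add a_assoc)
 qed
 have cl: "wedge G k' (wedge G k c) l : carrier G" if "!!l. c l : carrier G" for k k' c l
  using that by (intro wedge_closed)
 show "wedge G a (wedge G b c) l = \<ominus> wedge G b (wedge G a c) l" using assms
 proof (induction l arbitrary: c)
  case (Cons x l)
  have "wedge G k c l : carrier G" for k using Cons.prems by (intro wedge_closed)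
  moreover have "wedge G k' (wedge G k (%l. c (x # l))) l : carrier G" for k k'
   using Cons.prems by (intro cl)
  ultimately show ?case
   unfolding step[OF Cons.prems] using Cons.IH[of "%l. c (x # l)"] Cons.prems
   by (simp add: a_minus_def minus_add a_ac)
 qed simp
 show "wedge G a (wedge G a c) l = \<zero>" using assms
 proof (induction l arbitrary: c)
  case (Cons x l)
  have "wedge G k c l : carrier G" for k using Cons.prems by (intro wedge_closed)
  thus ?case unfolding step[OF Cons.prems] using Cons.IH[of "%l. c (x # l)"] Cons.prems
   by (simp add: a_minus_def r_neg)
 qed simp
qed

text \<open>A new index \<open>x\<close> adds a row and a column that cancel each other, and a
  diagonal entry that vanishes by assumption. Arranged this way the argument is valid in
  characteristic two.\<close>

lemma antisymmetric_sum_zero: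
 assumes "finite K" and g: "!!k k'. g k k' : carrier G" "!!k. g k k = \<zero>"
  and anti: "!!k k'. g k k' = \<ominus> g k' k"
 shows "(\<Oplus>k\<in>K. \<Oplus>k'\<in>K. g k k') = \<zero>"
 using assms(1)
proof (induction K)
 case (insert x K)
 have "(\<Oplus>k\<in>K. \<Oplus>k'\<in>insert x K. g k k') = (\<Oplus>k\<in>K. g k x \<oplus> (\<Oplus>k'\<in>K. g k k'))"
  using insert.hyps g(1) by (intro finsum_cong') (auto simp: Pi_iff)
 also have "... = (\<Oplus>k\<in>K. g k x) \<oplus> (\<Oplus>k\<in>K. \<Oplus>k'\<in>K. g k k')"
  using g(1) by (intro finsum_addf) auto
 finally have 1: "(\<Oplus>k\<in>K. \<Oplus>k'\<in>insert x K. g k k') = (\<Oplus>k\<in>K. g k x)"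
  using insert.IH g(1) by (simp add: Pi_iff)
 have "(\<Oplus>k\<in>K. g x k) \<oplus> (\<Oplus>k\<in>K. g k x) = (\<Oplus>k\<in>K. g x k \<oplus> g k x)"
  using g(1) by (intro finsum_addf[symmetric]) auto
 also have "... = (\<Oplus>k\<in>K. \<zero>)"
 proof (rule finsum_cong')
  show "g x k \<oplus> g k x = \<zero>" for k using g(1) anti[of x k] by (simp add: l_neg)
 qed auto
 finally have 2: "(\<Oplus>k\<in>K. g x k) \<oplus> (\<Oplus>k\<in>K. g k x) = \<zero>" using finsum_zero by simp
 have "(\<Oplus>k'\<in>insert x K. g x k') = (\<Oplus>k\<in>K. g x k)" using insert.hyps g by (simp add: Pi_iff)
 moreover have "(\<Oplus>k\<in>insert x K. \<Oplus>k'\<in>insert x K. g k k')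
   = (\<Oplus>k'\<in>insert x K. g x k') \<oplus> (\<Oplus>k\<in>K. \<Oplus>k'\<in>insert x K. g k k')"
  using insert.hyps g(1) by (intro finsum_insert) auto
 ultimately show ?case using 1 2 by simp
qed simp

end

subsection \<open>Exterior monomials\<close>

text \<open>The exterior monomial with the given factors, as an alternating function: for distinct
  factors its value on a rearrangement of them is the sign of the rearrangement, and it is zero on
  all other lists.\<close>

fun ext_mono :: "('a, 'q) ring_scheme => 'k list => 'k list => 'a" where
 "ext_mono A [] = (%l. if l = [] then \<one>\<^bsub>A\<^esub> else \<zero>\<^bsub>A\<^esub>)"
| "ext_mono A (a # e) = wedge A a (ext_mono A e)"

context ring
begin

lemma ext_mono_alternating: "alternating R (ext_mono R e)"
proof (induction e)
 case Nil
 show ?case by (rule altI) auto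
qed (simp add: wedge_alternating)

lemma ext_mono_closed: "ext_mono R e l : carrier R"
 by (rule altD(1)[OF ext_mono_alternating])

lemma ext_mono_mset: "ext_mono R e l ~= \<zero> ==> mset l = mset e"
proof (induction e arbitrary: l)
 case (Cons a e)
 then obtain l' where "mset l = add_mset a (mset l')" "ext_mono R e l' ~= \<zero>"
  using wedge_nonzero by fastforce
 thus ?case using Cons.IH by simp
qed (auto split: if_splits)

text \<open>Alternation in the factors, as opposed to the argument. It is the source of the column
  relations satisfied by the cycles attached to tableaux.\<close>

lemma ext_mono_alternating_left: "alternating R (%e. ext_mono R e l)"
proof (rule altI)
 fix u a b v
 show "ext_mono R (u @ a # a # v) l = \<zero>"
 proof (induction u arbitrary: l)
  case Nil
  show ?case by (simp add: wedge_wedge(2) ext_mono_closed)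
 next
  case (Cons x u)
  thus ?case by (simp add: wedge_zero)
 qed
 show "ext_mono R (u @ a # b # v) l = \<ominus> ext_mono R (u @ b # a # v) l"
 proof (induction u arbitrary: l)
  case Nil
  show ?case unfolding append_Nil ext_mono.simps by (rule wedge_wedge(1)[OF ext_mono_closed])
 next
  case (Cons x u)
  have "ext_mono R ((x # u) @ a # b # v) l = wedge R x (%l. \<ominus> ext_mono R (u @ b # a # v) l) l"
   unfolding append_Cons ext_mono.simps by (rule wedge_cong) (rule Cons)
  thus ?case by (simp add: wedge_minus ext_mono_closed)
 qed
qed (rule ext_mono_closed)

lemma ext_mono_map: "inj g ==> ext_mono R (map g e) (map g l) = ext_mono R e l"
proof (induction e arbitrary: l)
 case (Cons a e)
 thus ?case by (simp add: wedge_map)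
qed simp

lemma ext_mono_Cons_Cons:
 "a \<notin> set e ==> ext_mono R (a # e) (a # l) = ext_mono R e l"
proof -
 assume a: "a \<notin> set e"
 have "wedge R a (%l'. ext_mono R e (a # l')) l = \<zero>"
 proof (rule wedge_zero)
  fix l'
  show "ext_mono R e (a # l') = \<zero>"
   using ext_mono_mset[of e "a # l'"] a by (metis list.set_intros(1) mset_eq_setD)
 qed
 thus ?thesis by (simp add: a_minus_def ext_mono_closed)
qed

lemma ext_mono_self: "distinct e ==> ext_mono R e e = \<one>"
 by (induction e) (simp_all add: ext_mono_Cons_Cons del: ext_mono.simps(2))

text \<open>Contracting by the factor in position \<open>r\<close> and multiplying by e_a puts e_a
  in that position: the sign for bringing the factor to the front occurs twice. On tableaux this is
  the exchange of one entry of the first column.\<close>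

lemma wedge_ext_mono:
 assumes "distinct e" "r < length e"
 shows "wedge R a (%l'. ext_mono R e (e ! r # l')) l = ext_mono R (e[r := a]) l"
 using assms
proof (induction e arbitrary: r l)
 case (Cons x e)
 show ?case
 proof (cases r)
  case 0
  have "ext_mono R (x # e) (x # l') = ext_mono R e l'" for l'
   by (rule ext_mono_Cons_Cons) (use Cons.prems in simp)
  thus ?thesis using 0 by (simp del: ext_mono.simps(2)) simp
 next
  case (Suc q)
  let ?y = "e ! q"
  let ?c = "%l'. ext_mono R e (?y # l')"
  have y: "?y ~= x" "q < length e" using Cons.prems Suc by auto
  have "ext_mono R (x # e) (?y # l') = \<ominus> wedge R x ?c l'" for l'
   using y by (simp add: a_minus_def ext_mono_closed wedge_closed)
  hence "wedge R a (%l'. ext_mono R (x # e) ((x # e) ! r # l')) l = wedge R a (%l'. \<ominus> wedge R x ?c l') l"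
   using Suc by (simp del: ext_mono.simps(2))
  also have "... = \<ominus> wedge R a (wedge R x ?c) l"
   by (rule wedge_minus) (intro wedge_closed ext_mono_closed)
  also have "... = wedge R x (wedge R a ?c) l"
   by (rule wedge_wedge(1)[symmetric]) (rule ext_mono_closed)
  also have "... = wedge R x (ext_mono R (e[q := a])) l"
   by (rule wedge_cong) (rule Cons.IH; use Cons.prems y in simp)
  finally show ?thesis using Suc by simp
 qed
qed simp

end

section \<open>The Koszul differential\<close>

text \<open>The Koszul differential in coordinates. Contraction by e_k appears as prefixing
  \<open>k\<close> to the list, and multiplication by x_k as the shift of the monomial by
  \<open>{#k#}\<close>.\<close>

definition kosz ::
 "('a, 'q) ring_scheme => nat set => (nat list => nat multiset => 'a) => nat list => nat multiset => 'a" where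
 "kosz A K c l m = (\<Oplus>\<^bsub>A\<^esub>k\<in>{k \<in> K. k \<in># m}. c (k # l) (m - {#k#}))"

text \<open>
 A contracting homotopy for the Koszul differential: divide by the variable \<open>\<kappa> M\<close>, chosen from the
 total multidegree \<open>M\<close>, and multiply by the corresponding exterior generator.
\<close>

definition contr ::
 "('a, 'q) ring_scheme => (nat multiset => nat) => (nat list => nat multiset => 'a) => nat list => nat multiset => 'a" where
 "contr A \<kappa> c l m = wedge A (\<kappa> (mset l + m)) (%l'. c l' (add_mset (\<kappa> (mset l + m)) m)) l"

context abelian_group
begin

lemma contr_closed: "(!!l m. c l m : carrier G) ==> contr G \<kappa> c l m : carrier G"
 unfolding contr_def by (rule wedge_closed)

lemma contr_alternating:
 assumes "!!m. alternating G (%l. c l m)" shows "alternating G (%l. contr G \<kappa> c l m)"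
proof (rule altI)
 show "contr G \<kappa> c l m : carrier G" for l by (rule contr_closed) (rule altD(1)[OF assms])
 note w = wedge_alternating[OF assms]
 show "contr G \<kappa> c (u @ a # a # v) m = \<zero>" for u a v
  unfolding contr_def by (rule altD(2)[OF w])
 fix u v :: "nat list" and a b :: nat
 \<comment> \<open>The index picked by \<open>\<kappa>\<close> depends on the list only through its
   multiset, so it is the same before and after the swap.\<close>
 have "mset (u @ a # b # v) = mset (u @ b # a # v)" by simp
 thus "contr G \<kappa> c (u @ a # b # v) m = \<ominus> contr G \<kappa> c (u @ b # a # v) m"
  unfolding contr_def by (simp only: altD(3)[OF w, where u = u and a = a and b = b and v = v])
qed

text \<open>The index is expressed through the multidegree of the coefficient it was taken from; the
  conditions on \<open>\<kappa>\<close> are checked in this form later.\<close>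

lemma contr_nonzero:
 assumes "contr G \<kappa> c l m ~= \<zero>"
 obtains l' k where "mset l = add_mset k (mset l')" "c l' (add_mset k m) ~= \<zero>" "k = \<kappa> (add_mset k (mset l' + m))"
proof -
 let ?k = "\<kappa> (mset l + m)"
 obtain l' where "mset l = add_mset ?k (mset l')" "c l' (add_mset ?k m) ~= \<zero>"
  using wedge_nonzero[of ?k "%l'. c l' (add_mset ?k m)" l] assms unfolding contr_def by blast
 moreover from this have "?k = \<kappa> (add_mset ?k (mset l' + m))" by (metis union_mset_add_mset_left)
 ultimately show ?thesis by (rule that)
qed

text \<open>For one fixed variable this is the usual identity that differential and homotopy,
  composed in both orders, add up to the identity; on a cycle one of the two terms drops out. The
  variable may depend on the multidegree \<open>mset l + m\<close>, because both operators preserve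
  it.\<close>

lemma kosz_contr:
 assumes K: "finite K" and c: "!!m. alternating G (%l. c l m)"
  and cyc: "!!l m. kosz G K c l m = \<zero>"
  and \<kappa>: "!!M. M ~= {#} ==> \<kappa> M \<in># M"
  and ne: "mset l + m ~= {#}" and sub: "set l <= K" "set_mset m <= K"
 shows "kosz G K (contr G \<kappa> c) l m = c l m"
proof -
 define k where "k = \<kappa> (mset l + m)"
 define I where "I = {k' : K. k' \<in># m}"
 have I: "finite I" "I = set_mset m" using K sub by (auto simp: I_def)
 have kM: "k \<in># mset l + m" unfolding k_def using \<kappa> ne by blast
 have cl: "c l m : carrier G" for l m by (rule altD(1)[OF c])
 have wcl: "wedge G k (%l'. c (k' # l') m') l : carrier G" for k' m' by (rule wedge_closed) (rule cl)
 \<comment> \<open>Moving \<open>k'\<close> from the monomial to the list keeps the multidegree, so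
   \<open>\<kappa>\<close> again selects \<open>k\<close>; the first entry of the list then splits
   off one term of the wedge.\<close>
 have tm: "contr G \<kappa> c (k' # l) (m - {#k'#}) =
   (if k = k' then c l m else \<zero>) \<ominus> wedge G k (%l'. c (k' # l') (add_mset k (m - {#k'#}))) l"
  if "k' : I" for k'
 proof -
  have e1: "mset (k' # l) + (m - {#k'#}) = mset l + m" using that I by simp
  have e2: "add_mset k' (m - {#k'#}) = m" using that I by simp
  have "contr G \<kappa> c (k' # l) (m - {#k'#})
    = wedge G k (%l'. c l' (add_mset k (m - {#k'#}))) (k' # l)"
   unfolding contr_def k_def e1 by (rule refl)
  thus ?thesis by (auto simp: e2)
 qed
 have "kosz G K (contr G \<kappa> c) l m = (\<Oplus>k'\<in>I. (if k = k' then c l m else \<zero>)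
   \<oplus> \<ominus> wedge G k (%l'. c (k' # l') (add_mset k (m - {#k'#}))) l)"
  unfolding kosz_def I_def[symmetric]
  by (rule finsum_cong') (use cl wcl in "auto simp: tm a_minus_def")
 also have "... = (\<Oplus>k'\<in>I. if k = k' then c l m else \<zero>)
   \<oplus> (\<Oplus>k'\<in>I. \<ominus> wedge G k (%l'. c (k' # l') (add_mset k (m - {#k'#}))) l)"
  using cl wcl by (intro finsum_addf) auto
 also have "(\<Oplus>k'\<in>I. \<ominus> wedge G k (%l'. c (k' # l') (add_mset k (m - {#k'#}))) l)
   = \<ominus> (\<Oplus>k'\<in>I. wedge G k (%l'. c (k' # l') (add_mset k (m - {#k'#}))) l)"
  by (rule additive_finsum[OF abelian_group_axioms abelian_group_axioms, symmetric])
   (use I wcl in "auto simp: minus_add a_comm")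
 also have "(\<Oplus>k'\<in>I. wedge G k (%l'. c (k' # l') (add_mset k (m - {#k'#}))) l)
   = wedge G k (%l'. \<Oplus>k'\<in>I. c (k' # l') (add_mset k (m - {#k'#}))) l"
  by (rule wedge_finsum[symmetric]) (use I cl in auto)
 also have "(%l'. \<Oplus>k'\<in>I. c (k' # l') (add_mset k (m - {#k'#})))
   = (%l'. \<Oplus>k'\<in>I. c (k' # l') (add_mset k m - {#k'#}))"
  by (intro ext finsum_cong') (use I cl in "auto")
 finally have main: "kosz G K (contr G \<kappa> c) l m = (\<Oplus>k'\<in>I. if k = k' then c l m else \<zero>)
   \<oplus> \<ominus> wedge G k (%l'. \<Oplus>k'\<in>I. c (k' # l') (add_mset k m - {#k'#})) l" .
 \<comment> \<open>If x_k divides the monomial, the first sum is the wanted coefficient and the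
   second vanishes by the cycle condition. Otherwise the first sum is zero, and the cycle condition
   has one further term, for \<open>k\<close>, from which \<open>wedge_contract\<close> recovers the
   coefficient.\<close>
 show ?thesis
 proof (cases "k \<in># m")
  case True
  have "{k' : K. k' \<in># add_mset k m} = I" using True by (auto simp: I_def)
  hence "(\<Oplus>k'\<in>I. c (k' # l') (add_mset k m - {#k'#})) = \<zero>" for l'
   using cyc[of l' "add_mset k m"] unfolding kosz_def by simp
  moreover have "(\<Oplus>k'\<in>I. if k = k' then c l m else \<zero>) = c l m"
   using True I cl by (intro finsum_singleton) auto
  ultimately show ?thesis using main cl by (simp add: wedge_null)
 next
  case False
  have kl: "k : set l" "k : K" using False kM sub by auto
  have "{k' : K. k' \<in># add_mset k m} = insert k I" using kl by (auto simp: I_def)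
  moreover have "k \<notin> I" using False by (simp add: I_def)
  ultimately have "c (k # l') m \<oplus> (\<Oplus>k'\<in>I. c (k' # l') (add_mset k m - {#k'#})) = \<zero>" for l'
   using cyc[of l' "add_mset k m"] I cl unfolding kosz_def by (simp add: Pi_iff)
  hence "(\<Oplus>k'\<in>I. c (k' # l') (add_mset k m - {#k'#})) = \<ominus> c (k # l') m" for l'
   using cl by (intro minus_equality[symmetric]) (auto simp: a_comm Pi_iff)
  moreover have "wedge G k (%l'. \<ominus> c (k # l') m) l = \<ominus> wedge G k (%l'. c (k # l') m) l"
   using cl by (intro wedge_minus)
  moreover have "wedge G k (%l'. c (k # l') m) l = c l m"
   by (rule wedge_contract[OF c kl(1)])
  moreover have "(\<Oplus>k'\<in>I. if k = k' then c l m else \<zero>) = (\<Oplus>k'\<in>I. \<zero>)"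
   by (rule finsum_cong') (use False I in auto)
  ultimately show ?thesis using main cl by simp
 qed
qed

lemma kosz_if:
 assumes "finite K" "!!l m. c l m : carrier G"
 shows "kosz G K c l m = (\<Oplus>k\<in>K. if k \<in># m then c (k # l) (m - {#k#}) else \<zero>)"
 unfolding kosz_def by (rule add.finprod_mono_neutral_cong_left) (use assms in auto)

lemma kosz_closed: "(!!l m. c l m : carrier G) ==> kosz G K c l m : carrier G"
 unfolding kosz_def by (rule finsum_closed) auto

text \<open>Contractions anticommute while multiplications by variables commute, so the double sum
  is antisymmetric in its two indices.\<close>

lemma kosz_kosz:
 assumes K: "finite K" and c: "!!m. alternating G (%l. c l m)"
 shows "kosz G K (kosz G K c) l m = \<zero>"
proof -
 have cl: "c l m : carrier G" for l m by (rule altD(1)[OF c])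
 \<comment> \<open>Extension by zero lets both sums run over the fixed set \<open>K\<close>, as
   \<open>antisymmetric_sum_zero\<close> requires.\<close>
 define g where "g k k' = (if k \<in># m & k' \<in># m - {#k#} then c (k' # k # l) (m - {#k#} - {#k'#}) else \<zero>)" for k k'
 have g: "g k k' : carrier G" "g k k = \<zero>" for k k' using cl altD(4)[OF c] by (simp_all add: g_def)
 have "g k k' = \<ominus> g k' k" for k k'
 proof (cases "k = k'")
  case True
  thus ?thesis using g by simp
 next
  case False
  hence "k \<in># m & k' \<in># m - {#k#} \<longleftrightarrow> k' \<in># m & k \<in># m - {#k'#}"
   by (auto simp: in_diff_count)
  moreover have "c (k' # k # l) (m - {#k#} - {#k'#}) = \<ominus> c (k # k' # l) (m - {#k'#} - {#k#})"
   using altD(5)[OF c, of k' k l] by (simp only: diff_right_commute)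
  ultimately show ?thesis by (simp add: g_def)
 qed
 hence "(\<Oplus>k\<in>K. \<Oplus>k'\<in>K. g k k') = \<zero>" by (intro antisymmetric_sum_zero K g)
 moreover have "kosz G K (kosz G K c) l m = (\<Oplus>k\<in>K. \<Oplus>k'\<in>K. g k k')"
 proof -
  have "(if k \<in># m then kosz G K c (k # l) (m - {#k#}) else \<zero>) = (\<Oplus>k'\<in>K. g k k')" for k
   unfolding kosz_if[OF K cl] g_def by (cases "k \<in># m") (simp_all add: finsum_zero)
  thus ?thesis using kosz_if[where c = "kosz G K c" and K = K, OF K kosz_closed[OF cl]] by simp
 qed
 ultimately show ?thesis by simp
qed

end

subsection \<open>The polynomial ring\<close>

lemma mpoly_simps:
 "carrier (mpoly_ring A n) = carrier (free_module A {m. set_mset m <= {1..n}})"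
 "\<zero>\<^bsub>mpoly_ring A n\<^esub> = (%m. \<zero>\<^bsub>A\<^esub>)" "\<one>\<^bsub>mpoly_ring A n\<^esub> = free_gen A {#}"
 "p \<oplus>\<^bsub>mpoly_ring A n\<^esub> q = (%m. p m \<oplus>\<^bsub>A\<^esub> q m)"
 "a \<odot>\<^bsub>mpoly_ring A n\<^esub> p = (%m. a \<otimes>\<^bsub>A\<^esub> p m)"
 "p \<otimes>\<^bsub>mpoly_ring A n\<^esub> q = (%m. \<Oplus>\<^bsub>A\<^esub>k\<in>{k. k <=# m}. p k \<otimes>\<^bsub>A\<^esub> q (m - k))"
 by (simp_all add: mpoly_ring_def free_module_def)

abbreviation "var A k == free_gen A {#k#}"

definition const_poly :: "('a, 'p) ring_scheme => nat => 'a => nat multiset => 'a" where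
 "const_poly A n a = a \<odot>\<^bsub>mpoly_ring A n\<^esub> \<one>\<^bsub>mpoly_ring A n\<^esub>"

lemma finite_submultisets: "finite {k. k <=# (m :: 'x multiset)}"
proof -
 have "{k. k <=# m} <= mset ` {l. set l <= set_mset m & length l <= size m}"
 proof
  fix k assume k: "k : {k. k <=# m}"
  obtain l where l: "mset l = k" using ex_mset by blast
  have "length l <= size m" using size_mset_mono[of k m] k l by (metis mem_Collect_eq size_mset)
  moreover have "set l <= set_mset m" using k l set_mset_mono by fastforce
  ultimately show "k : mset ` {l. set l <= set_mset m & length l <= size m}" using l by blast
 qed
 thus ?thesis using finite_lists_length_le[of "set_mset m" "size m"] finite_subset by blast
qed

context cring
begin

lemma const_poly_eq: "a : carrier R ==> const_poly R n a = (%m. if m = {#} then a else \<zero>)"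
 by (auto simp: const_poly_def mpoly_simps free_gen_def)

lemma var_closed: "k : {1..n} ==> var R k : carrier (mpoly_ring R n)"
 unfolding mpoly_simps by (rule gen_cl) simp

lemma const_poly_closed: "a : carrier R ==> const_poly R n a : carrier (mpoly_ring R n)"
 by (auto simp: const_poly_eq mpoly_simps free_simps intro: finite_subset[of _ "{{#}}"])

lemma monomial_sum:
 assumes p: "p = (%m. if m = m0 then a else \<zero>)" "a : carrier R" and g: "!!m. g m : carrier R"
 shows "(\<Oplus>k\<in>{k. k <=# m}. p k \<otimes> g (m - k)) = (if m0 <=# m then a \<otimes> g (m - m0) else \<zero>)"
proof (cases "m0 <=# m")
 case True
 have "(\<Oplus>k\<in>{k. k <=# m}. p k \<otimes> g (m - k)) = (\<Oplus>k\<in>{k. k <=# m}. if m0 = k then a \<otimes> g (m - k) else \<zero>)"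
  by (rule finsum_cong') (use p g in auto)
 also have "... = a \<otimes> g (m - m0)"
  by (rule finsum_singleton) (use p g True finite_submultisets in auto)
 finally show ?thesis using True by simp
next
 case False
 have "(\<Oplus>k\<in>{k. k <=# m}. p k \<otimes> g (m - k)) = (\<Oplus>k\<in>{k. k <=# m}. \<zero>)"
  by (rule finsum_cong') (use p g False in auto)
 thus ?thesis using False finsum_zero by simp
qed

end

section \<open>Koszul complexes of graded modules given in coordinates\<close>

definition kdiff ::
 "('a, 'p) ring_scheme => nat => (nat multiset => 'a, 'm, 'q) module_scheme => (nat list => 'm) => nat list => 'm" where
 "kdiff A n M c l = (\<Oplus>\<^bsub>M\<^esub>k\<in>{1..n}. var A k \<odot>\<^bsub>M\<^esub> c (k # l))"

text \<open>The degree \<open>j\<close> part of the \<open>b\<close>-th term of the Koszul complex of \<open>M\<close>.\<close>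

definition kchains ::
 "nat => ('m, 'q) ring_scheme => (int => 'm set) => nat => int => (nat list => 'm) set" where
 "kchains n M gr b j = {c. alternating M c & (\<forall>l. c l : gr (j - int b)) &
  (\<forall>l. length l ~= b | ~ set l <= {1..n} --> c l = \<zero>\<^bsub>M\<^esub>)}"

text \<open>
 A graded module over the polynomial ring whose elements are described by their coefficients with
 respect to the elements \<open>x\<^sup>m e\<^sub>b\<close>, \<open>(b, m) : S\<close>.
\<close>

locale coord_module =
 A: cring A + module "mpoly_ring A n" M
 for A :: "('a, 'p) ring_scheme" and n and M :: "(nat multiset => 'a, 'm, 'q) module_scheme" (structure) +
 fixes gr :: "int => 'm set" and \<psi> :: "'m => 'b \<times> nat multiset => 'a"
  and S :: "('b \<times> nat multiset) set" and deg :: "'b => int"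
 assumes coord_bij: "bij_betw \<psi> (carrier M) (carrier (free_module A S))"
  and coord_add: "x : carrier M ==> y : carrier M ==> \<psi> (x \<oplus>\<^bsub>M\<^esub> y) z = \<psi> x z \<oplus>\<^bsub>A\<^esub> \<psi> y z"
  and coord_smult: "p : carrier (mpoly_ring A n) ==> x : carrier M ==>
   \<psi> (p \<odot>\<^bsub>M\<^esub> x) (b, m) = (\<Oplus>\<^bsub>A\<^esub>k\<in>{k. k <=# m}. p k \<otimes>\<^bsub>A\<^esub> \<psi> x (b, m - k))"
  and S_vars: "(b, m) : S ==> set_mset m <= {1..n}"
  and gr_eq: "gr j = {x \<in> carrier M. \<forall>b m. \<psi> x (b, m) ~= \<zero>\<^bsub>A\<^esub> --> deg b + int (size m) = j}"
begin

abbreviation "X == var A"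

lemma coord_closed: "x : carrier M ==> \<psi> x z : carrier A"
 and coord_outside: "x : carrier M ==> z \<notin> S ==> \<psi> x z = \<zero>\<^bsub>A\<^esub>"
 and coord_finite: "x : carrier M ==> finite {z. \<psi> x z ~= \<zero>\<^bsub>A\<^esub>}"
 using bij_betwE[OF coord_bij] unfolding free_simps by blast+

lemma coord_inj: "x : carrier M ==> y : carrier M ==> (!!b m. \<psi> x (b, m) = \<psi> y (b, m)) ==> x = y"
 using inj_onD[OF bij_betw_imp_inj_on[OF coord_bij]] by (metis ext surj_pair)

definition lft :: "('b \<times> nat multiset => 'a) => 'm" where
 "lft f = inv_into (carrier M) \<psi> f"

lemma lft:
 assumes "f : carrier (free_module A S)" shows "lft f : carrier M" "\<psi> (lft f) = f"
 using assms bij_betw_inv_into_right[OF coord_bij] bij_betwE[OF bij_betw_inv_into[OF coord_bij]]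
 by (auto simp: lft_def)

lemma coord_zero: "\<psi> \<zero>\<^bsub>M\<^esub> z = \<zero>\<^bsub>A\<^esub>"
 by (rule additive_zero[OF M.abelian_group_axioms A.abelian_group_axioms, where f = "%x. \<psi> x z"])
  (auto simp: coord_closed coord_add)

lemma coord_minus: "x : carrier M ==> \<psi> (\<ominus>\<^bsub>M\<^esub> x) z = \<ominus>\<^bsub>A\<^esub> \<psi> x z"
 by (rule additive_minus[OF M.abelian_group_axioms A.abelian_group_axioms, where f = "%x. \<psi> x z"])
  (auto simp: coord_closed coord_add)

lemma coord_finsum:
 "finite I ==> (!!i. i : I ==> g i : carrier M) ==> \<psi> (\<Oplus>\<^bsub>M\<^esub>i\<in>I. g i) z = (\<Oplus>\<^bsub>A\<^esub>i\<in>I. \<psi> (g i) z)"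
 by (rule additive_finsum[OF M.abelian_group_axioms A.abelian_group_axioms, where f = "%x. \<psi> x z"])
  (auto simp: coord_closed coord_add)

lemma coord_var:
 assumes "k : {1..n}" "x : carrier M"
 shows "\<psi> (X k \<odot>\<^bsub>M\<^esub> x) (b, m) = (if k \<in># m then \<psi> x (b, m - {#k#}) else \<zero>\<^bsub>A\<^esub>)"
 unfolding coord_smult[OF A.var_closed[OF assms(1)] assms(2)]
 using A.monomial_sum[of "X k" "{#k#}" "\<one>\<^bsub>A\<^esub>" "%m. \<psi> x (b, m)" m]
 by (simp add: free_gen_def coord_closed assms fun_eq_iff)

lemma coord_const:
 assumes "a : carrier A" "x : carrier M"
 shows "\<psi> (const_poly A n a \<odot>\<^bsub>M\<^esub> x) (b, m) = a \<otimes>\<^bsub>A\<^esub> \<psi> x (b, m)"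
 unfolding coord_smult[OF A.const_poly_closed[OF assms(1)] assms(2)]
 by (subst A.monomial_sum[OF A.const_poly_eq[OF assms(1)] assms(1)]) (auto simp: coord_closed assms)

lemma coord_smult_empty:
 assumes "p : carrier (mpoly_ring A n)" "x : carrier M"
 shows "\<psi> (p \<odot>\<^bsub>M\<^esub> x) (b, {#}) = p {#} \<otimes>\<^bsub>A\<^esub> \<psi> x (b, {#})"
proof -
 have "p {#} : carrier A" using assms by (simp add: mpoly_simps free_simps)
 thus ?thesis unfolding coord_smult[OF assms] using coord_closed assms by simp
qed

lemma gr_carrier: "x : gr j ==> x : carrier M"
 by (simp add: gr_eq)

lemma gr_closed:
 "\<zero>\<^bsub>M\<^esub> : gr j" "x : gr j ==> y : gr j ==> x \<oplus>\<^bsub>M\<^esub> y : gr j" "x : gr j ==> \<ominus>\<^bsub>M\<^esub> x : gr j"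
 "x : gr j ==> y : gr j ==> x \<ominus>\<^bsub>M\<^esub> y : gr j"
 "a : carrier A ==> x : gr j ==> const_poly A n a \<odot>\<^bsub>M\<^esub> x : gr j"
proof -
 show z: "\<zero>\<^bsub>M\<^esub> : gr j" by (simp add: gr_eq coord_zero)
 show p: "x \<oplus>\<^bsub>M\<^esub> y : gr j" if "x : gr j" "y : gr j" for x y
  using that unfolding gr_eq by (auto simp: coord_add) (metis A.l_zero A.zero_closed)
 show m: "\<ominus>\<^bsub>M\<^esub> x : gr j" if "x : gr j" for x
  using that unfolding gr_eq by (auto simp: coord_minus) (metis A.neg_zero)
 show "x \<ominus>\<^bsub>M\<^esub> y : gr j" if "x : gr j" "y : gr j" for x y
  unfolding a_minus_def using p m that by blast
 show "const_poly A n a \<odot>\<^bsub>M\<^esub> x : gr j" if "a : carrier A" "x : gr j"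
  using that unfolding gr_eq
  by (auto simp: coord_const A.const_poly_closed) (metis A.r_null)
qed

lemma gr_finsum: "finite I ==> (!!i. i : I ==> g i : gr j) ==> (\<Oplus>\<^bsub>M\<^esub>i\<in>I. g i) : gr j"
proof (induction I rule: finite_induct)
 case (insert i I)
 have "(\<Oplus>\<^bsub>M\<^esub>i\<in>insert i I. g i) = g i \<oplus>\<^bsub>M\<^esub> (\<Oplus>\<^bsub>M\<^esub>i\<in>I. g i)"
  by (rule M.finsum_insert) (use insert gr_carrier in auto)
 thus ?case using insert gr_closed(2) by auto
qed (simp add: gr_closed)

lemma gr_var: "k : {1..n} ==> x : gr j ==> X k \<odot>\<^bsub>M\<^esub> x : gr (j + 1)"
proof -
 assume k: "k : {1..n}" and x: "x : gr j"
 have "deg b + int (size m) = j + 1" if "\<psi> (X k \<odot>\<^bsub>M\<^esub> x) (b, m) ~= \<zero>\<^bsub>A\<^esub>" for b m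
 proof -
  have km: "k \<in># m" "\<psi> x (b, m - {#k#}) ~= \<zero>\<^bsub>A\<^esub>"
   using that coord_var[OF k gr_carrier[OF x]] by (auto split: if_splits)
  hence "deg b + int (size (m - {#k#})) = j" using x gr_eq by auto
  moreover have "size m = Suc (size (m - {#k#}))" using km(1) by (metis insert_DiffM size_add_mset)
  ultimately show ?thesis by simp
 qed
 thus ?thesis using A.var_closed[OF k] gr_carrier[OF x] by (auto simp: gr_eq)
qed

lemma gr_homog: "p : homog A n q ==> x : gr j ==> p \<odot>\<^bsub>M\<^esub> x : gr (j + q)"
proof -
 assume p: "p : homog A n q" and x: "x : gr j"
 have pc: "p : carrier (mpoly_ring A n)" using p by (simp add: homog_def)
 have pa: "p k : carrier A" for k using pc by (simp add: mpoly_simps free_simps)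
 have "deg b + int (size m) = j + q" if nz: "\<psi> (p \<odot>\<^bsub>M\<^esub> x) (b, m) ~= \<zero>\<^bsub>A\<^esub>" for b m
 proof -
  have "\<exists>k. k <=# m & p k \<otimes>\<^bsub>A\<^esub> \<psi> x (b, m - k) ~= \<zero>\<^bsub>A\<^esub>"
  proof (rule ccontr)
   assume "~ ?thesis"
   hence "(\<Oplus>\<^bsub>A\<^esub>k\<in>{k. k <=# m}. p k \<otimes>\<^bsub>A\<^esub> \<psi> x (b, m - k)) = (\<Oplus>\<^bsub>A\<^esub>k\<in>{k. k <=# m}. \<zero>\<^bsub>A\<^esub>)"
    by (intro A.finsum_cong') auto
   thus False using nz coord_smult[OF pc gr_carrier[OF x]] A.finsum_zero by simp
  qed
  then obtain k where k: "k <=# m" "p k \<otimes>\<^bsub>A\<^esub> \<psi> x (b, m - k) ~= \<zero>\<^bsub>A\<^esub>" by blast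
  hence "p k ~= \<zero>\<^bsub>A\<^esub>" "\<psi> x (b, m - k) ~= \<zero>\<^bsub>A\<^esub>" using pa coord_closed[OF gr_carrier[OF x]] by auto
  hence "int (size k) = q" "deg b + int (size (m - k)) = j" using p x by (auto simp: homog_def gr_eq)
  moreover have "size m = size k + size (m - k)" using k(1) by (metis size_union subset_mset.add_diff_inverse)
  ultimately show ?thesis by simp
 qed
 thus ?thesis using pc gr_carrier[OF x] by (auto simp: gr_eq)
qed

lemma kchainsD:
 assumes "c : kchains n M gr b j"
 shows "alternating M c" "c l : gr (j - int b)" "c l : carrier M"
  "length l ~= b ==> c l = \<zero>\<^bsub>M\<^esub>" "~ set l <= {1..n} ==> c l = \<zero>\<^bsub>M\<^esub>"
 using assms gr_carrier by (auto simp: kchains_def)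

lemma kchainsI:
 assumes "alternating M c" "!!l. length l = b ==> set l <= {1..n} ==> c l : gr (j - int b)"
  "!!l. length l ~= b ==> c l = \<zero>\<^bsub>M\<^esub>" "!!l. ~ set l <= {1..n} ==> c l = \<zero>\<^bsub>M\<^esub>"
 shows "c : kchains n M gr b j"
proof -
 have "c l : gr (j - int b)" for l
 proof (cases "length l = b & set l <= {1..n}")
  case False
  hence "c l = \<zero>\<^bsub>M\<^esub>" using assms(3,4) by blast
  thus ?thesis using gr_closed(1) by simp
 qed (use assms(2) in blast)
 thus ?thesis using assms(1,3,4) unfolding kchains_def by blast
qed

lemma coord_alternating: "alternating M c ==> alternating A (%l. \<psi> (c l) z)"
 by (rule alternating_additive[OF M.abelian_group_axioms A.abelian_group_axioms])
  (auto simp: coord_closed coord_add)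

lemma alternating_from_coord:
 assumes cl: "!!l. c l : carrier M" and alt: "!!z. alternating A (%l. \<psi> (c l) z)"
 shows "alternating M c"
proof (rule altI[OF cl])
 show "c (u @ a # a # v) = \<zero>\<^bsub>M\<^esub>" for u a v
  by (rule coord_inj) (simp_all add: cl coord_zero altD(2)[OF alt])
 show "c (u @ a # b # v) = \<ominus>\<^bsub>M\<^esub> c (u @ b # a # v)" for u a b v
  by (rule coord_inj) (simp_all add: cl coord_minus altD(3)[OF alt, of u a b v])
qed

lemma kdiff_closed: "(!!l. c l : carrier M) ==> kdiff A n M c l : carrier M"
 unfolding kdiff_def by (rule M.finsum_closed) (auto simp: A.var_closed)

text \<open>For a fixed basis index \<open>b\<close> the differential acts on the monomial
  coordinates exactly as over the polynomial ring, so the identities and the homotopy for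
  \<open>kosz\<close> carry over to any such module.\<close>

lemma kdiff_coord:
 assumes cl: "!!l. c l : carrier M"
 shows "\<psi> (kdiff A n M c l) (b, m) = kosz A {1..n} (%l m. \<psi> (c l) (b, m)) l m"
proof -
 have "\<psi> (kdiff A n M c l) (b, m) = (\<Oplus>\<^bsub>A\<^esub>k\<in>{1..n}. \<psi> (X k \<odot>\<^bsub>M\<^esub> c (k # l)) (b, m))"
  unfolding kdiff_def by (rule coord_finsum) (auto simp: A.var_closed cl)
 also have "... = (\<Oplus>\<^bsub>A\<^esub>k\<in>{1..n}. if k \<in># m then \<psi> (c (k # l)) (b, m - {#k#}) else \<zero>\<^bsub>A\<^esub>)"
  by (rule A.finsum_cong') (use coord_var cl coord_closed in auto)
 also have "... = kosz A {1..n} (%l m. \<psi> (c l) (b, m)) l m"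
  by (rule A.kosz_if[symmetric]) (auto simp: coord_closed cl)
 finally show ?thesis .
qed

lemma kdiff_kdiff:
 assumes "alternating M c" shows "kdiff A n M (kdiff A n M c) l = \<zero>\<^bsub>M\<^esub>"
proof (rule coord_inj)
 have cl: "c l : carrier M" for l by (rule altD(1)[OF assms])
 show "\<psi> (kdiff A n M (kdiff A n M c) l) (b, m) = \<psi> \<zero>\<^bsub>M\<^esub> (b, m)" for b m
  using A.kosz_kosz[where c = "%l m. \<psi> (c l) (b, m)" and K = "{1..n}", OF _ coord_alternating[OF assms]]
  by (simp add: kdiff_coord[OF kdiff_closed[OF cl]] kdiff_coord[OF cl] coord_zero)
 show "kdiff A n M (kdiff A n M c) l : carrier M" by (intro kdiff_closed cl)
qed simp

lemma kdiff_additive: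
 assumes c: "!!l. c l : carrier M" and c': "!!l. c' l : carrier M"
 shows "kdiff A n M (%l. c l \<oplus>\<^bsub>M\<^esub> c' l) l = kdiff A n M c l \<oplus>\<^bsub>M\<^esub> kdiff A n M c' l"
  and "kdiff A n M (%l. c l \<ominus>\<^bsub>M\<^esub> c' l) l = kdiff A n M c l \<ominus>\<^bsub>M\<^esub> kdiff A n M c' l"
proof -
 have add: "kdiff A n M (%l. c l \<oplus>\<^bsub>M\<^esub> c' l) l = kdiff A n M c l \<oplus>\<^bsub>M\<^esub> kdiff A n M c' l"
  if c: "!!l. c l : carrier M" and c': "!!l. c' l : carrier M" for c c'
 proof -
  have "kdiff A n M (%l. c l \<oplus>\<^bsub>M\<^esub> c' l) l
    = (\<Oplus>\<^bsub>M\<^esub>k\<in>{1..n}. X k \<odot>\<^bsub>M\<^esub> c (k # l) \<oplus>\<^bsub>M\<^esub> X k \<odot>\<^bsub>M\<^esub> c' (k # l))"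
   unfolding kdiff_def by (rule M.finsum_cong') (auto simp: A.var_closed c c' smult_r_distr)
  also have "... = kdiff A n M c l \<oplus>\<^bsub>M\<^esub> kdiff A n M c' l"
   unfolding kdiff_def by (rule M.finsum_addf) (auto simp: A.var_closed c c')
  finally show ?thesis .
 qed
 show "kdiff A n M (%l. c l \<oplus>\<^bsub>M\<^esub> c' l) l = kdiff A n M c l \<oplus>\<^bsub>M\<^esub> kdiff A n M c' l"
  by (rule add[OF c c'])
 have "kdiff A n M (%l. c l \<ominus>\<^bsub>M\<^esub> c' l) l \<oplus>\<^bsub>M\<^esub> kdiff A n M c' l = kdiff A n M c l"
  using add[of "%l. c l \<ominus>\<^bsub>M\<^esub> c' l" c'] c c' by (simp add: a_minus_def M.a_assoc M.l_neg)
 thus "kdiff A n M (%l. c l \<ominus>\<^bsub>M\<^esub> c' l) l = kdiff A n M c l \<ominus>\<^bsub>M\<^esub> kdiff A n M c' l"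
  using kdiff_closed[where l = l, OF c] kdiff_closed[where l = l, OF c']
   kdiff_closed[where c = "%l. c l \<ominus>\<^bsub>M\<^esub> c' l" and l = l] c c'
  unfolding a_minus_def by (subst M.add.inv_solve_right) simp_all
qed

lemma kdiff_chain:
 assumes c: "c : kchains n M gr (Suc b) j" shows "kdiff A n M c : kchains n M gr b j"
proof (rule kchainsI)
 note D = kchainsD[OF c]
 show "alternating M (kdiff A n M c)"
 proof (rule altI)
  show "kdiff A n M c l : carrier M" for l by (rule kdiff_closed[OF D(3)])
  show "kdiff A n M c (u @ a # a # v) = \<zero>\<^bsub>M\<^esub>" for u a v
  proof -
   have "c (k # u @ a # a # v) = \<zero>\<^bsub>M\<^esub>" for k using altD(2)[OF D(1), of "k # u" a v] by simp
   hence "kdiff A n M c (u @ a # a # v) = (\<Oplus>\<^bsub>M\<^esub>k\<in>{1..n}. \<zero>\<^bsub>M\<^esub>)"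
    unfolding kdiff_def by (intro M.finsum_cong') (auto simp: A.var_closed)
   thus ?thesis using M.finsum_zero by simp
  qed
  show "kdiff A n M c (u @ a # b # v) = \<ominus>\<^bsub>M\<^esub> kdiff A n M c (u @ b # a # v)" for u a b v
  proof -
   have "c (k # u @ a # b # v) = \<ominus>\<^bsub>M\<^esub> c (k # u @ b # a # v)" for k
    using altD(3)[OF D(1), of "k # u" a b v] by simp
   hence "kdiff A n M c (u @ a # b # v) = (\<Oplus>\<^bsub>M\<^esub>k\<in>{1..n}. \<ominus>\<^bsub>M\<^esub> (X k \<odot>\<^bsub>M\<^esub> c (k # u @ b # a # v)))"
    unfolding kdiff_def by (intro M.finsum_cong') (auto simp: A.var_closed D(3) smult_r_minus)
   also have "... = \<ominus>\<^bsub>M\<^esub> kdiff A n M c (u @ b # a # v)"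
    unfolding kdiff_def
    by (rule additive_finsum[OF M.abelian_group_axioms M.abelian_group_axioms, symmetric])
     (auto simp: A.var_closed D(3) M.minus_add M.a_comm)
   finally show ?thesis .
  qed
 qed
 show "kdiff A n M c l : gr (j - int b)" for l
  unfolding kdiff_def
 proof (rule gr_finsum)
  fix k assume "k : {1..n}"
  thus "X k \<odot>\<^bsub>M\<^esub> c (k # l) : gr (j - int b)" using gr_var[OF _ D(2)[of "k # l"], of k] by simp
 qed simp
 have z: "kdiff A n M c l = \<zero>\<^bsub>M\<^esub>" if "!!k. c (k # l) = \<zero>\<^bsub>M\<^esub>" for l
 proof -
  have "kdiff A n M c l = (\<Oplus>\<^bsub>M\<^esub>k\<in>{1..n}. \<zero>\<^bsub>M\<^esub>)"
   unfolding kdiff_def by (intro M.finsum_cong') (auto simp: A.var_closed that)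
  thus ?thesis using M.finsum_zero by simp
 qed
 show "length l ~= b ==> kdiff A n M c l = \<zero>\<^bsub>M\<^esub>" for l by (rule z) (simp add: D(4))
 show "~ set l <= {1..n} ==> kdiff A n M c l = \<zero>\<^bsub>M\<^esub>" for l by (rule z, rule D(5)) auto
qed

lemma kchains_add:
 assumes "c : kchains n M gr b j" "c' : kchains n M gr b j"
 shows "(%l. c l \<oplus>\<^bsub>M\<^esub> c' l) : kchains n M gr b j" "(%l. c l \<ominus>\<^bsub>M\<^esub> c' l) : kchains n M gr b j"
proof -
 note D = kchainsD[OF assms(1)] and D' = kchainsD[OF assms(2)]
 have alt: "alternating M (%l. c l \<oplus>\<^bsub>M\<^esub> c' l)" if "alternating M c" "alternating M c'" for c c'
 proof (rule altI)
  show "c (u @ a # b # v) \<oplus>\<^bsub>M\<^esub> c' (u @ a # b # v) = \<ominus>\<^bsub>M\<^esub> (c (u @ b # a # v) \<oplus>\<^bsub>M\<^esub> c' (u @ b # a # v))" for u a b v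
   unfolding altD(3)[OF that(1), of u a b v] altD(3)[OF that(2), of u a b v]
   by (rule M.minus_add[symmetric]) (rule altD(1)[OF that(1)] altD(1)[OF that(2)])+
 qed (simp_all add: altD(1,2)[OF that(1)] altD(1,2)[OF that(2)])
 show "(%l. c l \<oplus>\<^bsub>M\<^esub> c' l) : kchains n M gr b j"
  by (rule kchainsI) (use alt[OF D(1) D'(1)] D(2,4,5) D'(2,4,5) gr_closed in auto)
 have "alternating M (%l. \<ominus>\<^bsub>M\<^esub> c' l)"
  by (rule alternating_additive[OF M.abelian_group_axioms M.abelian_group_axioms D'(1)])
   (auto simp: M.minus_add M.a_comm)
 hence "alternating M (%l. c l \<ominus>\<^bsub>M\<^esub> c' l)" unfolding a_minus_def by (rule alt[OF D(1)])
 thus "(%l. c l \<ominus>\<^bsub>M\<^esub> c' l) : kchains n M gr b j"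
  by (intro kchainsI) (use D(2,4,5) D'(2,4,5) gr_closed in "auto simp: a_minus_def")
qed

text \<open>The bounding chain is the contraction of \<open>c\<close>, computed separately for each
  basis index. Condition \<open>S\<kappa>\<close> says that dividing by the chosen variable never
  leaves the index set \<open>S\<close>, so that the contraction consists of elements of the
  module.\<close>

lemma kdiff_exact:
 assumes c: "c : kchains n M gr b j" and cyc: "!!l. kdiff A n M c l = \<zero>\<^bsub>M\<^esub>"
  and aug: "!!e. \<psi> (c []) (e, {#}) = \<zero>\<^bsub>A\<^esub>"
  and \<kappa>: "!!N. N ~= {#} ==> \<kappa> N \<in># N"
  and S\<kappa>: "!!e l m k. \<psi> (c l) (e, add_mset k m) ~= \<zero>\<^bsub>A\<^esub> ==> k \<notin> set l ==>
   k = \<kappa> (add_mset k (mset l + m)) ==> (e, m) : S"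
 obtains v where "v : kchains n M gr (Suc b) j" "!!l. kdiff A n M v l = c l"
proof -
 note D = kchainsD[OF c]
 define w where "w e = contr A \<kappa> (%l m. \<psi> (c l) (e, m))" for e
 define f where "f l = (%(e, m). w e l m)" for l
 have walt: "alternating A (%l. w e l m)" for e m
  unfolding w_def by (rule A.contr_alternating) (rule coord_alternating[OF D(1)])
 have w: "\<exists>l' k. mset l = add_mset k (mset l') & \<psi> (c l') (e, add_mset k m) ~= \<zero>\<^bsub>A\<^esub> & (e, m) : S"
  if nz: "w e l m ~= \<zero>\<^bsub>A\<^esub>" for e l m
 proof -
  obtain l' k where "mset l = add_mset k (mset l')" "\<psi> (c l') (e, add_mset k m) ~= \<zero>\<^bsub>A\<^esub>"
    "k = \<kappa> (add_mset k (mset l' + m))"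
   using A.contr_nonzero[of \<kappa> "%l m. \<psi> (c l) (e, m)" l m] nz unfolding w_def by blast
  \<comment> \<open>Since \<open>w\<close> alternates, a nonzero value forces \<open>l\<close> to be
    distinct; this provides the condition on \<open>k\<close> in \<open>S\<kappa>\<close>.\<close>
  moreover have "distinct l" using A.alternating_repeat[OF walt] nz by blast
  ultimately have "k \<notin> set l'" by (metis distinct.simps(2) mset.simps(2) mset_eq_imp_distinct_iff)
  thus ?thesis using S\<kappa> \<open>mset l = add_mset k (mset l')\<close> \<open>\<psi> (c l') (e, add_mset k m) ~= \<zero>\<^bsub>A\<^esub>\<close>
   \<open>k = \<kappa> (add_mset k (mset l' + m))\<close> by blast
 qed
 have f: "f l : carrier (free_module A S)" for l
 proof -
  \<comment> \<open>Every nonzero coefficient arises by dividing by an entry of \<open>l\<close>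
    from one of the finitely many coefficients of \<open>c\<close> on lists that are no longer than
    \<open>l\<close> and use its entries.\<close>
  have "{z. f l z ~= \<zero>\<^bsub>A\<^esub>} <= (\<Union>l'\<in>{l'. set l' <= set l & length l' <= length l}. \<Union>k\<in>set l.
    (%(e, m). (e, m - {#k#})) ` {z. \<psi> (c l') z ~= \<zero>\<^bsub>A\<^esub>})"
  proof
   fix z assume "z : {z. f l z ~= \<zero>\<^bsub>A\<^esub>}"
   then obtain e m where z: "z = (e, m)" "w e l m ~= \<zero>\<^bsub>A\<^esub>" by (cases z) (auto simp: f_def)
   then obtain l' k where lk: "mset l = add_mset k (mset l')" "\<psi> (c l') (e, add_mset k m) ~= \<zero>\<^bsub>A\<^esub>"
    using w by blast
   have "set l = insert k (set l')" "length l = Suc (length l')"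
    using arg_cong[OF lk(1), of set_mset] arg_cong[OF lk(1), of size] by simp_all
   moreover have "z = (%(e, m). (e, m - {#k#})) (e, add_mset k m)" using z by simp
   ultimately show "z : (\<Union>l'\<in>{l'. set l' <= set l & length l' <= length l}. \<Union>k\<in>set l.
    (%(e, m). (e, m - {#k#})) ` {z. \<psi> (c l') z ~= \<zero>\<^bsub>A\<^esub>})"
    using lk(2) by (intro UN_I[of l'] UN_I[of k] image_eqI[where x = "(e, add_mset k m)"]) auto
  qed
  hence "finite {z. f l z ~= \<zero>\<^bsub>A\<^esub>}"
   by (rule finite_subset) (auto intro!: finite_lists_length_le coord_finite D(3))
  moreover have "w e l m : carrier A" for e m by (rule altD(1)[OF walt])
  moreover have "w e l m = \<zero>\<^bsub>A\<^esub>" if "(e, m) \<notin> S" for e m using w that by blast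
  ultimately show ?thesis unfolding free_simps by (auto simp: f_def)
 qed
 define v where "v l = lft (f l)" for l
 have v: "v l : carrier M" "\<psi> (v l) (e, m) = w e l m" for l e m
  using lft[OF f[of l]] by (simp_all add: v_def f_def)
 have vz: "v l = \<zero>\<^bsub>M\<^esub>" if "!!l' k e m. mset l = add_mset k (mset l') ==> \<psi> (c l') (e, add_mset k m) = \<zero>\<^bsub>A\<^esub>" for l
 proof (rule coord_inj)
  show "\<psi> (v l) (e, m) = \<psi> \<zero>\<^bsub>M\<^esub> (e, m)" for e m
   using w[of e l m] that by (simp only: v(2) coord_zero) blast
 qed (use v(1) in auto)
 have chain: "v : kchains n M gr (Suc b) j"
 proof (rule kchainsI)
  show "alternating M v" using alternating_from_coord[of v] v walt by (metis (no_types, lifting) ext surj_pair)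
  fix l :: "nat list"
  show "v l : gr (j - int (Suc b))"
   unfolding gr_eq
  proof (intro CollectI conjI allI impI)
   fix e m assume "\<psi> (v l) (e, m) ~= \<zero>\<^bsub>A\<^esub>"
   then obtain l' k where "\<psi> (c l') (e, add_mset k m) ~= \<zero>\<^bsub>A\<^esub>" using w v by metis
   hence "deg e + int (size (add_mset k m)) = j - int b" using D(2)[of l'] unfolding gr_eq by blast
   thus "deg e + int (size m) = j - int (Suc b)" by simp
  qed (rule v(1))
  show "v l = \<zero>\<^bsub>M\<^esub>" if "length l ~= Suc b"
  proof (rule vz)
   fix l' k e m assume "mset l = add_mset k (mset l')"
   hence "length l' ~= b" using that by (metis size_add_mset size_mset)
   thus "\<psi> (c l') (e, add_mset k m) = \<zero>\<^bsub>A\<^esub>" using D(4) coord_zero by simp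
  qed
  show "v l = \<zero>\<^bsub>M\<^esub>" if "~ set l <= {1..n}"
  proof (rule vz)
   fix l' k e m assume "mset l = add_mset k (mset l')"
   hence "set l = insert k (set l')" by (metis set_mset_add_mset_insert set_mset_mset)
   hence "~ set l' <= {1..n} | (e, add_mset k m) \<notin> S" using that S_vars by fastforce
   thus "\<psi> (c l') (e, add_mset k m) = \<zero>\<^bsub>A\<^esub>" using D(3,5) coord_zero coord_outside by metis
  qed
 qed
 moreover have "kdiff A n M v l = c l" for l
 proof (rule coord_inj)
  fix e m
  show "\<psi> (kdiff A n M v l) (e, m) = \<psi> (c l) (e, m)"
  proof (cases "set l <= {1..n} & (e, m) : S")
   case True
   have K: "\<psi> (kdiff A n M v l) (e, m) = kosz A {1..n} (w e) l m"
    unfolding kdiff_coord[OF v(1)] v(2) by simp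
   \<comment> \<open>In multidegree zero there is no variable to divide by; \<open>aug\<close> makes
     the coefficient vanish there.\<close>
   show ?thesis
   proof (cases "mset l + m = {#}")
    case True
    thus ?thesis unfolding K using aug by (simp add: kosz_def)
   next
    case False
    show ?thesis unfolding K w_def
    proof (rule A.kosz_contr[OF _ _ _ \<kappa> False])
     show "kosz A {1..n} (%l m. \<psi> (c l) (e, m)) l m = \<zero>\<^bsub>A\<^esub>" for l m
      using kdiff_coord[where c = c and l = l and b = e and m = m, OF D(3)] cyc coord_zero by simp
    qed (use True S_vars coord_alternating[OF D(1)] in auto)
   qed
  next
   case False
   show ?thesis
   proof (cases "set l <= {1..n}")
    case True
    hence "(e, m) \<notin> S" using False by blast
    thus ?thesis using coord_outside[OF kdiff_closed[OF v(1)]] coord_outside[OF D(3)] by simp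
   next
    case False
    thus ?thesis using kchainsD(5)[OF kdiff_chain[OF chain] False] D(5) by simp
   qed
  qed
 qed (use kdiff_closed[OF v(1)] D(3) in auto)
 ultimately show ?thesis by (rule that)
qed

end

subsection \<open>Homogeneous components and lifts of chains\<close>

context coord_module
begin

lemma lft_add:
 assumes "f : carrier (free_module A S)" "g : carrier (free_module A S)"
 shows "lft (f \<oplus>\<^bsub>free_module A S\<^esub> g) = lft f \<oplus>\<^bsub>M\<^esub> lft g"
proof (rule coord_inj)
 interpret F: module A "free_module A S" by (rule A.free_module_is_module)
 note fg = F.M.a_closed[OF assms]
 show "lft (f \<oplus>\<^bsub>free_module A S\<^esub> g) : carrier M" by (rule lft(1)[OF fg])
 show "lft f \<oplus>\<^bsub>M\<^esub> lft g : carrier M" using lft(1) assms by blast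
 show "\<psi> (lft (f \<oplus>\<^bsub>free_module A S\<^esub> g)) (b, m) = \<psi> (lft f \<oplus>\<^bsub>M\<^esub> lft g) (b, m)" for b m
  unfolding coord_add[OF lft(1)[OF assms(1)] lft(1)[OF assms(2)]] lft(2)[OF fg]
   lft(2)[OF assms(1)] lft(2)[OF assms(2)] by (simp add: free_simps)
qed

text \<open>A coordinate vector is a sum of vectors with one nonzero coordinate, and each of these
  is homogeneous.\<close>

lemma homogeneous_induct [consumes 1, case_names zero add]:
 assumes x: "x : carrier M" and zero: "P \<zero>\<^bsub>M\<^esub>"
  and add: "!!x y j. x : carrier M ==> P x ==> y : gr j ==> P (x \<oplus>\<^bsub>M\<^esub> y)"
 shows "P x"
proof -
 have "P (lft f)" if "f : carrier (free_module A S)" for f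
  using that
 proof (induction rule: A.free_module_induct)
  case zero
  have "(%x. \<zero>\<^bsub>A\<^esub>) : carrier (free_module A S)" by (simp add: free_simps)
  hence "lft (%x. \<zero>\<^bsub>A\<^esub>) = \<zero>\<^bsub>M\<^esub>" by (intro coord_inj) (simp_all add: lft coord_zero)
  thus ?case using assms(2) by simp
 next
  case (step f a z)
  interpret F: module A "free_module A S" by (rule A.free_module_is_module)
  let ?g = "a \<odot>\<^bsub>free_module A S\<^esub> free_gen A z"
  have g: "?g : carrier (free_module A S)" by (rule F.smult_closed[OF step.hyps(2) A.gen_cl[OF step.hyps(3)]])
  obtain b m where z: "z = (b, m)" by (cases z)
  have "lft ?g : gr (deg b + int (size m))"
   unfolding gr_eq using lft[OF g] step.hyps(2) by (auto simp: free_simps free_gen_def z)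
  hence "P (lft f \<oplus>\<^bsub>M\<^esub> lft ?g)" by (rule add[OF lft(1)[OF step.hyps(1)] step.IH])
  thus ?case using lft_add[OF step.hyps(1) g] by simp
 qed
 moreover have "\<psi> x : carrier (free_module A S)" using bij_betwE[OF coord_bij] x by blast
 moreover have "lft (\<psi> x) = x" unfolding lft_def using bij_betw_inv_into_left[OF coord_bij x] .
 ultimately show ?thesis by metis
qed

text \<open>The homogeneous component of degree \<open>j\<close>. Since graded maps commute with it,
  preimages can always be chosen homogeneous.\<close>

definition proj :: "int => 'm => 'm" where
 "proj j x = lft (%(b, m). if deg b + int (size m) = j then \<psi> x (b, m) else \<zero>\<^bsub>A\<^esub>)"

lemma proj:
 assumes x: "x : carrier M"
 shows "proj j x : carrier M"
  and coord_proj: "\<psi> (proj j x) (b, m) = (if deg b + int (size m) = j then \<psi> x (b, m) else \<zero>\<^bsub>A\<^esub>)"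
  and proj_gr: "proj j x : gr j"
proof -
 let ?f = "%(b, m). if deg b + int (size m) = j then \<psi> x (b, m) else \<zero>\<^bsub>A\<^esub>"
 have "{z. ?f z ~= \<zero>\<^bsub>A\<^esub>} <= {z. \<psi> x z ~= \<zero>\<^bsub>A\<^esub>}" by (auto split: if_splits)
 hence "finite {z. ?f z ~= \<zero>\<^bsub>A\<^esub>}" using coord_finite[OF x] finite_subset by blast
 hence f: "?f : carrier (free_module A S)"
  unfolding free_simps using coord_closed[OF x] coord_outside[OF x] by auto
 show 1: "proj j x : carrier M" unfolding proj_def by (rule lft(1)[OF f])
 show 2: "\<psi> (proj j x) (b, m) = (if deg b + int (size m) = j then \<psi> x (b, m) else \<zero>\<^bsub>A\<^esub>)" for b m
  unfolding proj_def lft(2)[OF f] by simp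
 show "proj j x : gr j" unfolding gr_eq using 1 2 by auto
qed

lemma proj_same: assumes x: "x : gr j" shows "proj j x = x"
proof (rule coord_inj)
 note xc = gr_carrier[OF x]
 show "\<psi> (proj j x) (b, m) = \<psi> x (b, m)" for b m
  using x unfolding coord_proj[OF xc] gr_eq by (cases "\<psi> x (b, m) = \<zero>\<^bsub>A\<^esub>") auto
qed (use proj(1) gr_carrier[OF x] in auto)

lemma proj_other: "x : gr k ==> k ~= j ==> proj j x = \<zero>\<^bsub>M\<^esub>"
 by (rule coord_inj) (auto simp: gr_eq proj coord_proj coord_zero)

lemma proj_add: "x : carrier M ==> y : carrier M ==> proj j (x \<oplus>\<^bsub>M\<^esub> y) = proj j x \<oplus>\<^bsub>M\<^esub> proj j y"
 by (rule coord_inj) (auto simp: proj coord_proj coord_add)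

lemma proj_diff: "x : carrier M ==> y : carrier M ==> proj j (x \<ominus>\<^bsub>M\<^esub> y) = proj j x \<ominus>\<^bsub>M\<^esub> proj j y"
 by (rule additive_diff[OF M.abelian_group_axioms M.abelian_group_axioms proj(1) proj_add])

lemma kdiff_chains_additive:
 assumes c: "c : kchains n M gr b j" and c': "c' : kchains n M gr b j"
 shows "kdiff A n M (%l. c l \<oplus>\<^bsub>M\<^esub> c' l) l = kdiff A n M c l \<oplus>\<^bsub>M\<^esub> kdiff A n M c' l"
  and "kdiff A n M (%l. c l \<ominus>\<^bsub>M\<^esub> c' l) l = kdiff A n M c l \<ominus>\<^bsub>M\<^esub> kdiff A n M c' l"
 using kdiff_additive[where c = c and c' = c' and l = l] kchainsD(3)[OF c] kchainsD(3)[OF c'] by auto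

lemma proj_zero: "proj j \<zero>\<^bsub>M\<^esub> = \<zero>\<^bsub>M\<^esub>"
 by (rule proj_same) (rule gr_closed(1))

end

text \<open>One notion covers the differentials and the augmentation, multiplication by constants
  (all with \<open>\<sigma> = id\<close>), and the lifts of a permutation of the variables.\<close>

locale graded_map =
 M: coord_module A n M gr \<psi> S deg + M': coord_module A n M' gr' \<psi>' S' deg'
 for A :: "('a, 'p) ring_scheme" and n
  and M :: "(nat multiset => 'a, 'm, 'q) module_scheme" and gr \<psi> and S :: "('b \<times> nat multiset) set" and deg
  and M' :: "(nat multiset => 'a, 'k, 's) module_scheme" and gr' \<psi>' and S' :: "('c \<times> nat multiset) set" and deg' +
 fixes f :: "'m => 'k" and \<sigma> :: "nat => nat"
 assumes map_add: "x : carrier M ==> y : carrier M ==> f (x \<oplus>\<^bsub>M\<^esub> y) = f x \<oplus>\<^bsub>M'\<^esub> f y"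
  and map_gr: "x : gr j ==> f x : gr' j"
  and map_closed: "x : carrier M ==> f x : carrier M'"
  and perm: "\<sigma> permutes {1..n}"
  and map_var: "k : {1..n} ==> x : carrier M ==> f (var A k \<odot>\<^bsub>M\<^esub> x) = var A (\<sigma> k) \<odot>\<^bsub>M'\<^esub> f x"
begin

lemma map_zero: "f \<zero>\<^bsub>M\<^esub> = \<zero>\<^bsub>M'\<^esub>"
 by (rule additive_zero[OF M.M.abelian_group_axioms M'.M.abelian_group_axioms map_closed map_add])

lemma map_diff: "x : carrier M ==> y : carrier M ==> f (x \<ominus>\<^bsub>M\<^esub> y) = f x \<ominus>\<^bsub>M'\<^esub> f y"
 by (rule additive_diff[OF M.M.abelian_group_axioms M'.M.abelian_group_axioms map_closed map_add])

lemma proj_commute: "x : carrier M ==> f (M.proj j x) = M'.proj j (f x)"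
proof (induction rule: M.homogeneous_induct)
 case zero
 show ?case by (simp add: M.proj_zero M'.proj_zero map_zero)
next
 case (add x y k)
 have y: "y : carrier M" by (rule M.gr_carrier[OF add.hyps(2)])
 have "f (M.proj j y) = M'.proj j (f y)"
 proof (cases "k = j")
  case True
  thus ?thesis using add.hyps(2) map_gr M.proj_same M'.proj_same by metis
 next
  case False
  thus ?thesis using M.proj_other[OF add.hyps(2) False] M'.proj_other[OF map_gr[OF add.hyps(2)] False] map_zero by simp
 qed
 thus ?case using add.hyps(1) add.IH y by (simp add: M.proj_add M'.proj_add map_add map_closed M.proj)
qed

lemma graded_preimage:
 assumes "y : gr' j" "x : carrier M" "f x = y" shows "\<exists>x\<in>gr j. f x = y"
 using proj_commute[OF assms(2), of j] assms M'.proj_same M.proj_gr by metis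

text \<open>The degree \<open>j\<close> component of the given preimage still works: passing to it
  replaces the difference by its own component, whose constant coefficients are zero as
  well.\<close>

lemma graded_preimage_mod:
 assumes y: "y : gr' j" and x: "x : carrier M" and z: "!!b. \<psi>' (y \<ominus>\<^bsub>M'\<^esub> f x) (b, {#}) = \<zero>\<^bsub>A\<^esub>"
 shows "\<exists>x\<in>gr j. \<forall>b. \<psi>' (y \<ominus>\<^bsub>M'\<^esub> f x) (b, {#}) = \<zero>\<^bsub>A\<^esub>"
proof (intro bexI[of _ "M.proj j x"] allI)
 fix b
 have yc: "y : carrier M'" "f x : carrier M'" using M'.gr_carrier[OF y] map_closed[OF x] .
 have "y \<ominus>\<^bsub>M'\<^esub> f (M.proj j x) = M'.proj j (y \<ominus>\<^bsub>M'\<^esub> f x)"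
  using M'.proj_diff[OF yc] M'.proj_same[OF y] proj_commute[OF x] by simp
 thus "\<psi>' (y \<ominus>\<^bsub>M'\<^esub> f (M.proj j x)) (b, {#}) = \<zero>\<^bsub>A\<^esub>"
  using M'.coord_proj[OF M'.M.minus_closed[OF yc]] z by simp
qed (rule M.proj_gr[OF x])

text \<open>A permutation acts on the coefficients and on the exterior generators at the same time,
  hence the inverse relabelling of the list.\<close>

lemma map_chain:
 assumes c: "c : kchains n M gr b j"
 shows "(%l. f (c (map (inv' \<sigma>) l))) : kchains n M' gr' b j"
proof (rule M'.kchainsI)
 note D = M.kchainsD[OF c]
 show "alternating M' (%l. f (c (map (inv' \<sigma>) l)))"
  by (rule alternating_additive[OF M.M.abelian_group_axioms M'.M.abelian_group_axioms
     alternating_map[OF D(1)] map_closed map_add])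
 show "f (c (map (inv' \<sigma>) l)) : gr' (j - int b)" for l by (rule map_gr[OF D(2)])
 show "f (c (map (inv' \<sigma>) l)) = \<zero>\<^bsub>M'\<^esub>" if "length l ~= b" for l
  using D(4)[of "map (inv' \<sigma>) l"] that map_zero by simp
 show "f (c (map (inv' \<sigma>) l)) = \<zero>\<^bsub>M'\<^esub>" if "~ set l <= {1..n}" for l
 proof -
  have "~ set (map (inv' \<sigma>) l) <= {1..n}"
   using that permutes_in_image[OF permutes_inv[OF perm]] by (auto simp: subset_iff)
  thus ?thesis using D(5) map_zero by simp
 qed
qed

lemma kdiff_map:
 assumes c: "c : kchains n M gr b j"
 shows "kdiff A n M' (%l. f (c (map (inv' \<sigma>) l))) l = f (kdiff A n M c (map (inv' \<sigma>) l))"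
proof -
 let ?l = "map (inv' \<sigma>) l"
 note cl = M.kchainsD(3)[OF c]
 have \<sigma>k: "\<sigma> k : {1..n}" if "k : {1..n}" for k using that permutes_in_image[OF perm] by blast
 have cl': "var A (\<sigma> k) \<odot>\<^bsub>M'\<^esub> f (c l') : carrier M'" if "k : {1..n}" for k l'
  by (rule M'.smult_closed[OF M.A.var_closed[OF \<sigma>k[OF that]] map_closed[OF cl]])
 \<comment> \<open>The summation index is renamed by \<open>\<sigma>\<close>, which moves the
   variable and the new first entry of the list together.\<close>
 have "kdiff A n M' (%l. f (c (map (inv' \<sigma>) l))) l
   = (\<Oplus>\<^bsub>M'\<^esub>k\<in>\<sigma> ` {1..n}. var A k \<odot>\<^bsub>M'\<^esub> f (c (inv' \<sigma> k # ?l)))"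
  unfolding kdiff_def permutes_image[OF perm] by simp
 also have "... = (\<Oplus>\<^bsub>M'\<^esub>k\<in>{1..n}. var A (\<sigma> k) \<odot>\<^bsub>M'\<^esub> f (c (inv' \<sigma> (\<sigma> k) # ?l)))"
  by (rule M'.M.finsum_reindex)
   (use permutes_inj_on[OF perm] cl' in "auto simp del: atLeastAtMost_iff")
 also have "... = (\<Oplus>\<^bsub>M'\<^esub>k\<in>{1..n}. f (var A k \<odot>\<^bsub>M\<^esub> c (k # ?l)))"
  by (rule M'.M.finsum_cong')
   (use cl' in "auto simp: map_var cl permutes_inverses[OF perm] simp del: atLeastAtMost_iff")
 also have "... = f (kdiff A n M c ?l)"
  unfolding kdiff_def
  by (rule additive_finsum[OF M.M.abelian_group_axioms M'.M.abelian_group_axioms map_closed map_add, symmetric])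
   (auto simp: M.A.var_closed cl)
 finally show ?thesis .
qed

text \<open>Preimages are chosen list by list and then replaced by their alternating extension. Its
  image is \<open>c\<close>, because both sides alternate and agree on increasing lists.\<close>

lemma chain_lift:
 assumes c: "c : kchains n M' gr' b j" and lift: "!!l. \<exists>x\<in>gr (j - int b). f x = c l"
 shows "\<exists>e\<in>kchains n M gr b j. \<forall>l. f (e l) = c l"
proof -
 note D = M'.kchainsD[OF c]
 obtain y where y: "!!l. y l : gr (j - int b)" "!!l. f (y l) = c l" using lift by metis
 define y' where "y' l = (if length l = b & set l <= {1..n} then y l else \<zero>\<^bsub>M\<^esub>)" for l
 have y': "y' l : gr (j - int b)" "y' l : carrier M" "f (y' l) = c l" for l
 proof -
  have "y' l : gr (j - int b) & f (y' l) = c l"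
  proof (cases "length l = b & set l <= {1..n}")
   case True
   thus ?thesis using y unfolding y'_def by presburger
  next
   case False
   hence "c l = \<zero>\<^bsub>M'\<^esub>" using D(4,5) by blast
   thus ?thesis using False M.gr_closed(1) map_zero unfolding y'_def by presburger
  qed
  thus "y' l : gr (j - int b)" "y' l : carrier M" "f (y' l) = c l" using M.gr_carrier by auto
 qed
 define e where "e = alt_ext M y'"
 have alt: "alternating M e" unfolding e_def by (rule M.M.alt_ext_alternating[OF y'(2)])
 have e: "e l = \<zero>\<^bsub>M\<^esub> | e l = y' (sort l) | e l = \<ominus>\<^bsub>M\<^esub> y' (sort l)" for l
  by (simp add: e_def alt_ext_def)
 have "e : kchains n M gr b j"
 proof (rule M.kchainsI[OF alt])
  show "e l : gr (j - int b)" for l using e[of l] y'(1) M.gr_closed by metis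
  show "e l = \<zero>\<^bsub>M\<^esub>" if "length l ~= b" for l
   using e[of l] that by (auto simp: y'_def)
  show "e l = \<zero>\<^bsub>M\<^esub>" if "~ set l <= {1..n}" for l
   using e[of l] that by (auto simp: y'_def)
 qed
 moreover have "f (e l) = c l" for l
 proof (rule alternating_eq_sorted[OF _ D(1)])
  show "alternating M' (%l. f (e l))"
   by (rule alternating_additive[OF M.M.abelian_group_axioms M'.M.abelian_group_axioms alt map_closed map_add])
  show "f (e l) = c l" if "sorted_wrt (<) l" for l
   using alt_ext_sorted[OF that, of M y'] y'(3) by (simp add: e_def)
 qed
 ultimately show ?thesis by blast
qed

end

subsection \<open>Zigzags between a resolution and the Koszul complex\<close>

locale coord_resolution =
 fixes A :: "('a, 'p) ring_scheme" and n :: nat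
  and F :: "nat => (nat multiset => 'a, 'f) module" and G :: "nat => int => 'f set"
  and \<psi> :: "nat => 'f => 'b \<times> nat multiset => 'a" and B :: "nat => 'b set" and dg :: "nat => 'b => int"
  and I :: "(nat multiset => 'a, 'i, 's) module_scheme" and gI :: "int => 'i set"
  and \<psi>I :: "'i => 'c \<times> nat multiset => 'a" and SI :: "('c \<times> nat multiset) set" and dI :: "'c => int"
  and D :: "nat => 'f => 'f" and \<epsilon> :: "'f => 'i"
 assumes Fc: "!!i. coord_module A n (F i) (G i) (\<psi> i) {(b, m). b : B i & set_mset m <= {1..n}} (dg i)"
  and Ic: "coord_module A n I gI \<psi>I SI dI"
  and D_linear: "!!i. D i : linear_maps (mpoly_ring A n) (F (Suc i)) (F i)"
  and D_gr: "!!i j x. x : G (Suc i) j ==> D i x : G i j"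
  and \<epsilon>_linear: "\<epsilon> : linear_maps (mpoly_ring A n) (F 0) I"
  and \<epsilon>_gr: "!!j x. x : G 0 j ==> \<epsilon> x : gI j"
  and \<epsilon>_surj: "\<epsilon> ` carrier (F 0) = carrier I"
  and exact_0: "{x \<in> carrier (F 0). \<epsilon> x = \<zero>\<^bsub>I\<^esub>} = D 0 ` carrier (F 1)"
  and exact_Suc: "!!i. {x \<in> carrier (F (Suc i)). D i x = \<zero>\<^bsub>F i\<^esub>} = D (Suc i) ` carrier (F (Suc (Suc i)))"
begin

sublocale A: cring A using Fc[of 0] by (simp add: coord_module_def)
sublocale F: coord_module A n "F i" "G i" "\<psi> i" "{(b, m). b : B i & set_mset m <= {1..n}}" "dg i" for i by (rule Fc)
sublocale I: coord_module A n I gI \<psi>I SI dI by (rule Ic)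

abbreviation "ch i b j == kchains n (F i) (G i) b j"
abbreviation "chI b j == kchains n I gI b j"
abbreviation "d i c == kdiff A n (F i) c"
abbreviation "dI' c == kdiff A n I c"

lemma D_graded_map: "graded_map A n (F (Suc i)) (G (Suc i)) (\<psi> (Suc i)) {(b, m). b : B (Suc i) & set_mset m <= {1..n}} (dg (Suc i))
  (F i) (G i) (\<psi> i) {(b, m). b : B i & set_mset m <= {1..n}} (dg i) (D i) id"
 using slinearD[OF D_linear[of i]] D_gr permutes_id A.var_closed
 by (intro graded_map.intro Fc graded_map_axioms.intro) auto

lemma \<epsilon>_graded_map: "graded_map A n (F 0) (G 0) (\<psi> 0) {(b, m). b : B 0 & set_mset m <= {1..n}} (dg 0)
  I gI \<psi>I SI dI \<epsilon> id"
 using slinearD[OF \<epsilon>_linear] \<epsilon>_gr permutes_id A.var_closed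
 by (intro graded_map.intro Fc Ic graded_map_axioms.intro) auto

sublocale D: graded_map A n "F (Suc i)" "G (Suc i)" "\<psi> (Suc i)" "{(b, m). b : B (Suc i) & set_mset m <= {1..n}}" "dg (Suc i)"
  "F i" "G i" "\<psi> i" "{(b, m). b : B i & set_mset m <= {1..n}}" "dg i" "D i" id for i
 by (rule D_graded_map)
sublocale \<epsilon>: graded_map A n "F 0" "G 0" "\<psi> 0" "{(b, m). b : B 0 & set_mset m <= {1..n}}" "dg 0"
  I gI \<psi>I SI dI \<epsilon> id
 by (rule \<epsilon>_graded_map)

lemma D_chain: "c : ch (Suc i) b j ==> (%l. D i (c l)) : ch i b j"
 using D.map_chain[of c i b j] by simp

lemma \<epsilon>_chain: "c : ch 0 b j ==> (%l. \<epsilon> (c l)) : chI b j"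
 using \<epsilon>.map_chain[of c b j] by simp

lemma d_D: "c : ch (Suc i) b j ==> d i (%l. D i (c l)) l = D i (d (Suc i) c l)"
 using D.kdiff_map[of c i b j l] by simp

lemma d_\<epsilon>: "c : ch 0 b j ==> dI' (%l. \<epsilon> (c l)) l = \<epsilon> (d 0 c l)"
 using \<epsilon>.kdiff_map[of c b j l] by simp

lemma \<epsilon>_D: "x : carrier (F 1) ==> \<epsilon> (D 0 x) = \<zero>\<^bsub>I\<^esub>"
 using exact_0 by blast

lemma D_D: "x : carrier (F (Suc (Suc i))) ==> D i (D (Suc i) x) = \<zero>\<^bsub>F i\<^esub>"
 using exact_Suc[of i] by blast

text \<open>Exactness in the direction of the resolution persists for Koszul chains with values in
  it, with the internal degree under control: each value has a homogeneous preimage, and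
  \<open>chain_lift\<close> assembles the choices.\<close>

lemma lift_0:
 assumes c: "c : ch 0 b j" and z: "!!l. \<epsilon> (c l) = \<zero>\<^bsub>I\<^esub>"
 shows "\<exists>e\<in>ch 1 b j. \<forall>l. D 0 (e l) = c l"
 unfolding One_nat_def
proof (rule D.chain_lift[OF c])
 fix l
 have "c l : D 0 ` carrier (F 1)" unfolding exact_0[symmetric] using z F.kchainsD(3)[OF c] by simp
 then obtain x where x: "c l = D 0 x" "x : carrier (F 1)" by (rule imageE)
 show "\<exists>x\<in>G (Suc 0) (j - int b). D 0 x = c l"
  by (rule D.graded_preimage[OF F.kchainsD(2)[OF c] x(2)[unfolded One_nat_def] x(1)[symmetric]])
qed

lemma lift_Suc:
 assumes c: "c : ch (Suc i) b j" and z: "!!l. D i (c l) = \<zero>\<^bsub>F i\<^esub>"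
 shows "\<exists>e\<in>ch (Suc (Suc i)) b j. \<forall>l. D (Suc i) (e l) = c l"
proof (rule D.chain_lift[OF c])
 fix l
 have "c l : D (Suc i) ` carrier (F (Suc (Suc i)))"
  unfolding exact_Suc[symmetric] using z F.kchainsD(3)[OF c] by simp
 then obtain x where x: "c l = D (Suc i) x" "x : carrier (F (Suc (Suc i)))" by (rule imageE)
 show "\<exists>x\<in>G (Suc (Suc i)) (j - int b). D (Suc i) x = c l"
  by (rule D.graded_preimage[OF F.kchainsD(2)[OF c] x(2) x(1)[symmetric]])
qed

lemma lift_\<epsilon>:
 assumes w: "w : chI b j" shows "\<exists>e\<in>ch 0 b j. \<forall>l. \<epsilon> (e l) = w l"
proof (rule \<epsilon>.chain_lift[OF w])
 fix l
 have "w l : \<epsilon> ` carrier (F 0)" unfolding \<epsilon>_surj by (rule I.kchainsD(3)[OF w])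
 then obtain x where x: "w l = \<epsilon> x" "x : carrier (F 0)" by (rule imageE)
 show "\<exists>x\<in>G 0 (j - int b). \<epsilon> x = w l"
  by (rule \<epsilon>.graded_preimage[OF I.kchainsD(2)[OF w] x(2) x(1)[symmetric]])
qed

text \<open>Exactness in the Koszul direction: for a free module any variable occurring in the
  multidegree may serve in the contraction. At \<open>b = 0\<close> the cokernel is the module
  modulo the variables, hence the condition on constant coefficients.\<close>

lemma free_exact:
 assumes c: "c : ch i b j" and cyc: "!!l. d i c l = \<zero>\<^bsub>F i\<^esub>"
  and aug: "b = 0 ==> (!!e. \<psi> i (c []) (e, {#}) = \<zero>\<^bsub>A\<^esub>)"
 shows "\<exists>v\<in>ch i (Suc b) j. \<forall>l. d i v l = c l"
proof -
 have "\<psi> i (c []) (e, {#}) = \<zero>\<^bsub>A\<^esub>" for e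
  using aug F.kchainsD(4)[OF c, of "[]"] F.coord_zero by (cases "b = 0") auto
 moreover have "(e, m) : {(b, m). b : B i & set_mset m <= {1..n}}"
  if "\<psi> i (c l) (e, add_mset k m) ~= \<zero>\<^bsub>A\<^esub>" for e l m k
  using F.coord_outside[OF F.kchainsD(3)[OF c], of "(e, add_mset k m)" l] that by auto
 moreover have "(SOME k. k \<in># N) \<in># N" if "N ~= {#}" for N :: "nat multiset"
  using that by (metis multiset_nonemptyE someI_ex)
 ultimately show ?thesis using F.kdiff_exact[OF c cyc, of "%N. SOME k. k \<in># N"] by metis
qed

text \<open>Each step applies the resolution differential and lifts the result along the Koszul
  differential, trading one resolution degree for one Koszul degree; the last step is the
  augmentation. It is a relation because every lift is a choice.\<close>

primrec zig :: "int => nat => nat => (nat list => 'f) => (nat list => 'i) => bool" where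
 "zig j 0 b c w \<longleftrightarrow> w = (%l. \<epsilon> (c l))"
| "zig j (Suc a) b c w \<longleftrightarrow> (\<exists>c'\<in>ch a (Suc b) j. (\<forall>l. D a (c l) = d a c' l) & zig j a (Suc b) c' w)"

text \<open>As the two differentials commute, this says that the image of \<open>c\<close> under the
  resolution differential, or under the augmentation, is a Koszul cycle. That is what the next step
  of a zigzag requires.\<close>

definition diff_cycle :: "nat => (nat list => 'f) => bool" where
 "diff_cycle a c \<longleftrightarrow> (case a of 0 => \<forall>l. \<epsilon> (d 0 c l) = \<zero>\<^bsub>I\<^esub> | Suc a' => \<forall>l. D a' (d a c l) = \<zero>\<^bsub>F a'\<^esub>)"

lemma zig_chain: "c : ch a b j ==> zig j a b c w ==> w : chI (a + b) j"
 by (induction a arbitrary: b c) (fastforce simp: \<epsilon>_chain)+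

text \<open>Koszul exactness of the free terms provides each lift. It fails only at
  \<open>b = 0\<close>, where the condition on constant coefficients says that \<open>c []\<close>
  is a cycle of the resolution modulo the variables.\<close>

lemma zig_ex:
 assumes "c : ch a b j" "diff_cycle a c"
  and "b = 0 ==> 0 < a ==> (!!e. \<psi> (a - 1) (D (a - 1) (c [])) (e, {#}) = \<zero>\<^bsub>A\<^esub>)"
 shows "\<exists>w. zig j a b c w & (\<forall>l. dI' w l = \<zero>\<^bsub>I\<^esub>)"
 using assms
proof (induction a arbitrary: b c)
 case 0
 thus ?case using d_\<epsilon>[OF 0(1)] by (simp add: diff_cycle_def)
next
 case (Suc a)
 note c = F.kchainsD(3)[OF Suc.prems(1)]
 have "d a (%l. D a (c l)) l = \<zero>\<^bsub>F a\<^esub>" for l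
  using Suc.prems(2) d_D[OF Suc.prems(1)] by (simp add: diff_cycle_def)
 then obtain c' where c': "c' : ch a (Suc b) j" "!!l. d a c' l = D a (c l)"
  using free_exact[OF D_chain[OF Suc.prems(1)]] Suc.prems(3) by auto
 have "d a c' = (%l. D a (c l))" using c'(2) by auto
 moreover have "D a' (D (Suc a') (c l)) = \<zero>\<^bsub>F a'\<^esub>" if "a = Suc a'" for a' l
  using D_D c that by simp
 ultimately have "diff_cycle a c'"
  using \<epsilon>_D c by (cases a) (simp_all add: diff_cycle_def)
 then obtain w where "zig j a (Suc b) c' w" "\<forall>l. dI' w l = \<zero>\<^bsub>I\<^esub>" using Suc.IH[OF c'(1)] by auto
 thus ?case using c' by (auto intro!: exI[of _ w] bexI[of _ c'])
qed

text \<open>The same path walked backwards: the cycle is lifted along the augmentation, and then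
  Koszul differentials are lifted along the exact resolution.\<close>

lemma zig_ex_inv:
 assumes "w : chI (a + b) j" "!!l. dI' w l = \<zero>\<^bsub>I\<^esub>"
 shows "\<exists>c\<in>ch a b j. zig j a b c w & diff_cycle a c"
 using assms
proof (induction a arbitrary: b)
 case 0
 then obtain e where e: "e : ch 0 b j" "!!l. \<epsilon> (e l) = w l" using lift_\<epsilon>[of w b j] by fastforce
 have w: "(%l. \<epsilon> (e l)) = w" using e by auto
 hence "\<epsilon> (d 0 e l) = \<zero>\<^bsub>I\<^esub>" for l using d_\<epsilon>[OF e(1), of l] 0(2) by simp
 thus ?case using e w by (auto simp: diff_cycle_def intro!: bexI[of _ e])
next
 case (Suc a)
 obtain c' where c': "c' : ch a (Suc b) j" "zig j a (Suc b) c' w" "diff_cycle a c'"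
  using Suc.IH[of "Suc b"] Suc.prems by auto
 note dc = F.kdiff_chain[OF c'(1)]
 have "\<exists>e\<in>ch (Suc a) b j. \<forall>l. D a (e l) = d a c' l"
  using lift_0[of "d a c'"] lift_Suc[of "d a c'"] dc c'(3) by (cases a) (auto simp: diff_cycle_def)
 then obtain c where c: "c : ch (Suc a) b j" "!!l. D a (c l) = d a c' l" by blast
 have "(%l. D a (c l)) = d a c'" using c by auto
 hence "D a (d (Suc a) c l) = \<zero>\<^bsub>F a\<^esub>" for l
  using d_D[OF c(1), of l] F.kdiff_kdiff[OF F.kchainsD(1)[OF c'(1)]] by simp
 hence "diff_cycle (Suc a) c" by (simp add: diff_cycle_def)
 moreover have "zig j (Suc a) b c w" using c(2) c' by auto
 ultimately show ?case using c(1) by blast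
qed

lemma diff_eq_imp: 
 assumes "x : carrier (F i)" "y : carrier (F i)" "z : carrier (F i)" "z = x \<ominus>\<^bsub>F i\<^esub> y"
 shows "x = z \<oplus>\<^bsub>F i\<^esub> y"
 using assms by (simp add: a_minus_def F.M.a_assoc F.M.l_neg)

text \<open>Injectivity on homology. A lift of the bounding chain is subtracted at the end of the
  zigzag, and the correction is pushed back step by step; each remainder is killed by the next
  resolution differential and therefore lies in the image of the previous one.\<close>

lemma zig_boundary:
 assumes "c : ch a b j" "zig j a b c w" "v : chI (Suc (a + b)) j" "!!l. dI' v l = w l"
 shows "\<exists>e\<in>ch (Suc a) b j. \<exists>e'\<in>ch a (Suc b) j. \<forall>l. c l = D a (e l) \<oplus>\<^bsub>F a\<^esub> d a e' l"
 using assms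
proof (induction a arbitrary: b c)
 case 0
 obtain e' where e': "e' : ch 0 (Suc b) j" "!!l. \<epsilon> (e' l) = v l" using lift_\<epsilon>[of v "Suc b" j] 0(3) by auto
 have v: "(%l. \<epsilon> (e' l)) = v" using e' by auto
 note de = F.kdiff_chain[OF e'(1)]
 note c = F.kchainsD(3)[OF 0(1)] and e'c = F.kchainsD(3)[OF de]
 have "\<epsilon> (c l \<ominus>\<^bsub>F 0\<^esub> d 0 e' l) = \<zero>\<^bsub>I\<^esub>" for l
 proof -
  have "\<epsilon> (d 0 e' l) = w l" using d_\<epsilon>[OF e'(1), of l] v 0(4) by simp
  thus ?thesis using \<epsilon>.map_diff[OF c e'c] 0(2) I.kchainsD(3)[OF zig_chain[OF 0(1,2)], of l]
   by (simp add: I.M.diff_eq_zero_iff)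
 qed
 then obtain e where "e : ch 1 b j" "!!l. D 0 (e l) = c l \<ominus>\<^bsub>F 0\<^esub> d 0 e' l"
  using lift_0[OF F.kchains_add(2)[OF 0(1) de]] by auto
 thus ?case using e'(1) diff_eq_imp[OF c e'c] D.map_closed F.kchainsD(3)
  by (metis (no_types, lifting) One_nat_def)
next
 case (Suc a)
 obtain c' where c': "c' : ch a (Suc b) j" "!!l. D a (c l) = d a c' l" "zig j a (Suc b) c' w"
  using Suc.prems(2) by auto
 obtain e1 e2 where e: "e1 : ch (Suc a) (Suc b) j" "e2 : ch a (Suc (Suc b)) j"
  "!!l. c' l = D a (e1 l) \<oplus>\<^bsub>F a\<^esub> d a e2 l"
  using Suc.IH[OF c'(1,3)] Suc.prems(3,4) by auto
 note de = F.kdiff_chain[OF e(1)] and c = F.kchainsD(3)[OF Suc.prems(1)]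
 note dec = F.kchainsD(3)[OF de]
 have "D a (c l) = D a (d (Suc a) e1 l)" for l
 proof -
  have "c' = (%l. D a (e1 l) \<oplus>\<^bsub>F a\<^esub> d a e2 l)" using e(3) by auto
  hence "d a c' l = d a (%l. D a (e1 l)) l \<oplus>\<^bsub>F a\<^esub> d a (d a e2) l"
   using F.kdiff_chains_additive(1)[OF D_chain[OF e(1)] F.kdiff_chain[OF e(2)]]
   by simp
  thus ?thesis
   using c'(2) d_D[OF e(1), of l] F.kdiff_kdiff[OF F.kchainsD(1)[OF e(2)], of l]
    D.map_closed[OF dec, of l] by simp
 qed
 hence "D a (c l \<ominus>\<^bsub>F (Suc a)\<^esub> d (Suc a) e1 l) = \<zero>\<^bsub>F a\<^esub>" for l
  using D.map_diff[OF c dec] D.map_closed[OF dec] by (simp add: F.M.diff_eq_zero_iff)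
 then obtain e' where "e' : ch (Suc (Suc a)) b j" "!!l. D (Suc a) (e' l) = c l \<ominus>\<^bsub>F (Suc a)\<^esub> d (Suc a) e1 l"
  using lift_Suc[OF F.kchains_add(2)[OF Suc.prems(1) de]] by auto
 thus ?case using e(1) diff_eq_imp[OF c dec] D.map_closed F.kchainsD(3)
  by (metis (no_types, lifting))
qed

text \<open>The zigzag relation is well defined on homology. From D c = D (d e'), the chain c' - D
  e' at the next corner is a Koszul cycle in positive degree, hence a boundary, and the induction
  continues with e' in the role of e.\<close>

lemma zig_boundary_inv:
 assumes "c : ch a b j" "zig j a b c w" "e : ch (Suc a) b j" "e' : ch a (Suc b) j"
  and "!!l. c l = D a (e l) \<oplus>\<^bsub>F a\<^esub> d a e' l"
 shows "\<exists>v\<in>chI (Suc (a + b)) j. \<forall>l. dI' v l = w l"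
 using assms
proof (induction a arbitrary: b c e e')
 case 0
 note de = F.kchainsD(3)[OF F.kdiff_chain[OF 0(4)]]
 have "\<epsilon> (c l) = dI' (%l. \<epsilon> (e' l)) l" for l
 proof -
  note ec = F.kchainsD(3)[OF 0(3)]
  have "\<epsilon> (c l) = \<epsilon> (D 0 (e l)) \<oplus>\<^bsub>I\<^esub> \<epsilon> (d 0 e' l)"
   unfolding 0(5) by (rule \<epsilon>.map_add[OF D.map_closed[OF ec] de])
  also have "... = \<epsilon> (d 0 e' l)" using \<epsilon>_D[of "e l"] ec \<epsilon>.map_closed[OF de] by simp
  finally show ?thesis using d_\<epsilon>[OF 0(4)] by simp
 qed
 thus ?case using \<epsilon>_chain[OF 0(4)] 0(2) by auto
next
 case (Suc a)
 obtain c' where c': "c' : ch a (Suc b) j" "!!l. D a (c l) = d a c' l" "zig j a (Suc b) c' w"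
  using Suc.prems(2) by auto
 note De = D_chain[OF Suc.prems(4)]
 note ec = F.kchainsD(3)[OF Suc.prems(3)] and dec = F.kchainsD(3)[OF F.kdiff_chain[OF Suc.prems(4)]]
 have "d a (%l. c' l \<ominus>\<^bsub>F a\<^esub> D a (e' l)) l = \<zero>\<^bsub>F a\<^esub>" for l
 proof -
  have "D a (c l) = D a (d (Suc a) e' l)"
   using Suc.prems(5)[of l] D.map_add[of "D (Suc a) (e l)" a "d (Suc a) e' l"] dec D_D[OF ec]
    D.map_closed[OF ec] D.map_closed[OF dec] by simp
  hence "d a c' l = d a (%l. D a (e' l)) l" using c'(2) d_D[OF Suc.prems(4)] by simp
  thus ?thesis
   using F.kdiff_chains_additive(2)[OF c'(1) De, of l]
    F.kchainsD(3)[OF F.kdiff_chain[OF De], of l] by (simp add: F.M.diff_eq_zero_iff)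
 qed
 then obtain f where f: "f : ch a (Suc (Suc b)) j" "!!l. d a f l = c' l \<ominus>\<^bsub>F a\<^esub> D a (e' l)"
  using free_exact[OF F.kchains_add(2)[OF c'(1) De]] by auto
 have "c' l = D a (e' l) \<oplus>\<^bsub>F a\<^esub> d a f l" for l
  using diff_eq_imp[OF F.kchainsD(3)[OF c'(1)] F.kchainsD(3)[OF De] F.kchainsD(3)[OF F.kdiff_chain[OF f(1)]] f(2), of l]
   F.kchainsD(3)[OF De] F.kchainsD(3)[OF F.kdiff_chain[OF f(1)]] by (simp add: F.M.a_comm)
 thus ?case using Suc.IH[OF c'(1,3) Suc.prems(4) f(1)] by simp
qed

lemma zig_add:
 assumes "c : ch a b j" "c2 : ch a b j" "zig j a b c w" "zig j a b c2 w2"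
 shows "zig j a b (%l. c l \<oplus>\<^bsub>F a\<^esub> c2 l) (%l. w l \<oplus>\<^bsub>I\<^esub> w2 l)"
  "zig j a b (%l. c l \<ominus>\<^bsub>F a\<^esub> c2 l) (%l. w l \<ominus>\<^bsub>I\<^esub> w2 l)"
proof -
 have "zig j a b (%l. c l \<oplus>\<^bsub>F a\<^esub> c2 l) (%l. w l \<oplus>\<^bsub>I\<^esub> w2 l) &
  zig j a b (%l. c l \<ominus>\<^bsub>F a\<^esub> c2 l) (%l. w l \<ominus>\<^bsub>I\<^esub> w2 l)"
  using assms
 proof (induction a arbitrary: b c c2)
  case 0
  thus ?case using F.kchainsD(3)[OF 0(1)] F.kchainsD(3)[OF 0(2)]
   by (auto simp: fun_eq_iff \<epsilon>.map_add \<epsilon>.map_diff)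
 next
  case (Suc a)
  obtain c' where c': "c' : ch a (Suc b) j" "!!l. D a (c l) = d a c' l" "zig j a (Suc b) c' w"
   using Suc.prems(3) by auto
  obtain c2' where c2': "c2' : ch a (Suc b) j" "!!l. D a (c2 l) = d a c2' l" "zig j a (Suc b) c2' w2"
   using Suc.prems(4) by auto
  have dd: "D a (c l \<oplus>\<^bsub>F (Suc a)\<^esub> c2 l) = d a (%l. c' l \<oplus>\<^bsub>F a\<^esub> c2' l) l"
   "D a (c l \<ominus>\<^bsub>F (Suc a)\<^esub> c2 l) = d a (%l. c' l \<ominus>\<^bsub>F a\<^esub> c2' l) l" for l
   using F.kchainsD(3)[OF Suc.prems(1), of l] F.kchainsD(3)[OF Suc.prems(2), of l]
    F.kdiff_chains_additive[OF c'(1) c2'(1), of l] c'(2)[of l] c2'(2)[of l]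
   by (simp_all add: D.map_add D.map_diff)
  note IH = Suc.IH[OF c'(1) c2'(1) c'(3) c2'(3)] and ch = F.kchains_add[OF c'(1) c2'(1)]
  show ?case
  proof (intro conjI)
   show "zig j (Suc a) b (%l. c l \<oplus>\<^bsub>F (Suc a)\<^esub> c2 l) (%l. w l \<oplus>\<^bsub>I\<^esub> w2 l)"
    unfolding zig.simps using IH ch(1) dd(1) by blast
   show "zig j (Suc a) b (%l. c l \<ominus>\<^bsub>F (Suc a)\<^esub> c2 l) (%l. w l \<ominus>\<^bsub>I\<^esub> w2 l)"
    unfolding zig.simps using IH ch(2) dd(2) by blast
  qed
 qed
 thus "zig j a b (%l. c l \<oplus>\<^bsub>F a\<^esub> c2 l) (%l. w l \<oplus>\<^bsub>I\<^esub> w2 l)"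
  "zig j a b (%l. c l \<ominus>\<^bsub>F a\<^esub> c2 l) (%l. w l \<ominus>\<^bsub>I\<^esub> w2 l)" by auto
qed

text \<open>A lift of the action commutes with every map in the double complex, so applying it to
  all corners of a zigzag gives a zigzag again. Each permutation is treated on its own.\<close>

lemma zig_act:
 assumes \<phi>: "!!i. graded_map A n (F i) (G i) (\<psi> i) {(b, m). b : B i & set_mset m <= {1..n}} (dg i)
   (F i) (G i) (\<psi> i) {(b, m). b : B i & set_mset m <= {1..n}} (dg i) (\<phi> i) \<sigma>"
  and \<phi>D: "!!i x. x : carrier (F (Suc i)) ==> D i (\<phi> (Suc i) x) = \<phi> i (D i x)"
  and \<phi>\<epsilon>: "!!x. x : carrier (F 0) ==> \<epsilon> (\<phi> 0 x) = act (\<epsilon> x)"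
  and "c : ch a b j" "zig j a b c w"
 shows "zig j a b (%l. \<phi> a (c (map (inv' \<sigma>) l))) (%l. act (w (map (inv' \<sigma>) l)))"
 using assms(4,5)
proof (induction a arbitrary: b c)
 case 0
 thus ?case using \<phi>\<epsilon> F.kchainsD(3)[OF 0(1)] by simp
next
 case (Suc a)
 obtain c' where c': "c' : ch a (Suc b) j" "!!l. D a (c l) = d a c' l" "zig j a (Suc b) c' w"
  using Suc.prems(2) by auto
 have "D a (\<phi> (Suc a) (c (map (inv' \<sigma>) l))) = d a (%l. \<phi> a (c' (map (inv' \<sigma>) l))) l" for l
  using \<phi>D[OF F.kchainsD(3)[OF Suc.prems(1)]] c'(2) graded_map.kdiff_map[OF \<phi> c'(1)]
  by simp
 thus ?case using Suc.IH[OF c'(1,3)] graded_map.map_chain[OF \<phi> c'(1)] by auto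
qed

end

section \<open>Coordinates on the modules of a resolution\<close>

lemma mpoly_smult_alg:
 "monoid.mult (regular_module R) = monoid.mult R" "one (regular_module R) = one R" "carrier (regular_module R) = carrier R"
 "zero (regular_module R) = zero R" "add (regular_module R) = add R" "smult (regular_module R) = monoid.mult R"
 by (simp_all add: regular_module_def)

lemma module_change_fields:
 assumes "module R M" "carrier M' = carrier M" "add M' = add M" "zero M' = zero M" "smult M' = smult M"
 shows "module R M'"
proof -
 interpret module R M by fact
 show ?thesis
  by (rule module_transport[where f = "%x. x", OF assms(1)]) (simp_all add: assms)
qed

lemma (in cring) regular_is_module: "module R (regular_module R)"
proof (rule moduleI)
 show "cring R" by unfold_locales
 show "abelian_group (regular_module R)"
  by (rule abelian_groupI) (auto simp: mpoly_smult_alg a_ac intro: exI[of _ "\<ominus> _"] bexI[of _ "\<ominus> _"] l_neg)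
qed (auto simp: mpoly_smult_alg l_distr r_distr m_assoc)

lemma (in cring) ideal_submodule:
 assumes "ideal J R" shows "submodule J R (regular_module R)"
proof -
 interpret J: ideal J R by fact
 interpret reg: module R "regular_module R" by (rule regular_is_module)
 show ?thesis
 proof (rule reg.submoduleI)
  fix a assume a: "a : J"
  hence ac: "a : carrier (regular_module R)" using J.a_subset by (auto simp: mpoly_smult_alg)
  have "(\<ominus> \<one>) \<otimes> a : J" using a by (intro J.I_l_closed) auto
  moreover have "(\<ominus> \<one>) \<otimes> a = \<ominus>\<^bsub>regular_module R\<^esub> a"
   using reg.smult_l_minus[OF one_closed ac] reg.smult_one[OF ac] by (simp add: mpoly_smult_alg)
  ultimately show "\<ominus>\<^bsub>regular_module R\<^esub> a : J" by simp
 qed (use J.a_subset in "auto simp: mpoly_smult_alg J.I_l_closed J.zero_closed J.a_closed")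
qed

text \<open>Coordinates in a homogeneous basis, followed by the coefficients of the polynomials that
  occur, give coordinates over \<open>A\<close> with respect to the products of monomials and basis
  elements.\<close>

lemma graded_free_coord:
 fixes M :: "(nat multiset => 'a, 'm, 'q) module_scheme"
 assumes A: "cring A" and gf: "graded_free A n M gr"
 shows "\<exists>\<psi> (B :: 'm set) deg. coord_module A n M gr \<psi> {(b, m). b : B & set_mset m <= {1..n}} deg"
proof -
 let ?R = "mpoly_ring A n"
 obtain B deg where M: "module ?R M" and basis: "module_basis ?R M B"
  and gr: "!!j. gr j = (%f. \<Oplus>\<^bsub>M\<^esub>b\<in>{b. f b ~= \<zero>\<^bsub>?R\<^esub>}. f b \<odot>\<^bsub>M\<^esub> b) `
   {f \<in> carrier (free_module ?R B). \<forall>b\<in>B. f b : homog A n (j - deg b)}"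
  using gf unfolding graded_free_def Let_def by blast
 interpret A: cring A by fact
 interpret module ?R M by fact
 let ?FR = "free_module ?R B"
 interpret FR: module ?R ?FR by (rule R.free_module_is_module)
 define g where "g = free_lift ?R M (%b. b)"
 have g_alt: "(%f. \<Oplus>\<^bsub>M\<^esub>b\<in>{b. f b ~= \<zero>\<^bsub>?R\<^esub>}. f b \<odot>\<^bsub>M\<^esub> b) = g"
  by (simp add: g_def free_lift_def fun_eq_iff)
 have BM: "B <= carrier M" and bij: "bij_betw g (carrier ?FR) (carrier M)"
  using basis unfolding module_basis_def g_alt by auto
 have lin: "g : linear_maps ?R ?FR M" unfolding g_def by (rule free_lift_linear) (use BM in auto)
 define \<phi> where "\<phi> = inv_into (carrier ?FR) g"
 have \<phi>: "\<phi> x : carrier ?FR" "g (\<phi> x) = x" if "x : carrier M" for x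
  using that bij_betw_inv_into_right[OF bij] bij_betwE[OF bij_betw_inv_into[OF bij]] by (auto simp: \<phi>_def)
 have \<phi>g: "\<phi> (g f) = f" if "f : carrier ?FR" for f
  using that bij_betw_inv_into_left[OF bij] by (simp add: \<phi>_def)
 have \<phi>_add: "\<phi> (x \<oplus>\<^bsub>M\<^esub> y) = \<phi> x \<oplus>\<^bsub>?FR\<^esub> \<phi> y" if "x : carrier M" "y : carrier M" for x y
  using \<phi>g[OF FR.M.a_closed[OF \<phi>(1)[OF that(1)] \<phi>(1)[OF that(2)]]]
   slinearD(2)[OF lin \<phi>(1)[OF that(1)] \<phi>(1)[OF that(2)]] \<phi>(2) that by simp
 have \<phi>_smult: "\<phi> (p \<odot>\<^bsub>M\<^esub> x) = p \<odot>\<^bsub>?FR\<^esub> \<phi> x" if "p : carrier ?R" "x : carrier M" for p x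
  using \<phi>g[OF FR.smult_closed[OF that(1) \<phi>(1)[OF that(2)]]]
   slinearD(3)[OF lin that(1) \<phi>(1)[OF that(2)]] \<phi>(2) that by simp
 have \<phi>R: "\<phi> x b : carrier ?R" "b \<notin> B ==> \<phi> x b = \<zero>\<^bsub>?R\<^esub>" "finite {b. \<phi> x b ~= \<zero>\<^bsub>?R\<^esub>}"
  if "x : carrier M" for x b
  using \<phi>(1)[OF that] unfolding free_simps by auto
 have R: "p m : carrier A" "~ set_mset m <= {1..n} ==> p m = \<zero>\<^bsub>A\<^esub>" "finite {m. p m ~= \<zero>\<^bsub>A\<^esub>}"
  if "p : carrier ?R" for p m
  using that unfolding mpoly_simps free_simps by auto
 define \<psi> where "\<psi> x = (%(b, m). \<phi> x b m)" for x
 let ?S = "{(b, m). b : B & set_mset m <= {1..n}}"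
 have \<psi>: "\<psi> x : carrier (free_module A ?S)" if x: "x : carrier M" for x
 proof -
  have "{z. \<psi> x z ~= \<zero>\<^bsub>A\<^esub>} <= Sigma {b. \<phi> x b ~= \<zero>\<^bsub>?R\<^esub>} (%b. {m. \<phi> x b m ~= \<zero>\<^bsub>A\<^esub>})"
   by (auto simp: \<psi>_def mpoly_simps)
  hence "finite {z. \<psi> x z ~= \<zero>\<^bsub>A\<^esub>}"
   by (rule finite_subset) (use \<phi>R[OF x] R(3) in auto)
  moreover have "\<psi> x (b, m) : carrier A" for b m using R(1)[OF \<phi>R(1)[OF x]] by (simp add: \<psi>_def)
  moreover have "\<psi> x (b, m) = \<zero>\<^bsub>A\<^esub>" if "(b, m) \<notin> ?S" for b m
   using that R(2)[OF \<phi>R(1)[OF x]] \<phi>R(2)[OF x] by (auto simp: \<psi>_def mpoly_simps)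
  ultimately show ?thesis unfolding free_simps by auto
 qed
 have "coord_module A n M gr \<psi> ?S deg"
 proof (intro coord_module.intro coord_module_axioms.intro)
  show "bij_betw \<psi> (carrier M) (carrier (free_module A ?S))"
  proof (rule bij_betw_imageI)
   show "inj_on \<psi> (carrier M)"
   proof (rule inj_onI)
    fix x y assume x: "x : carrier M" and y: "y : carrier M" and "\<psi> x = \<psi> y"
    hence "\<phi> x b m = \<phi> y b m" for b m by (auto simp: \<psi>_def dest: fun_cong[of _ _ "(b, m)"])
    hence "\<phi> x = \<phi> y" by blast
    thus "x = y" using \<phi>(2) x y by metis
   qed
   show "\<psi> ` carrier M = carrier (free_module A ?S)"
   proof (intro equalityI subsetI)
    fix f assume f: "f : carrier (free_module A ?S)"
    define h where "h b = (%m. f (b, m))" for b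
    have fD: "f z : carrier A" "z \<notin> ?S ==> f z = \<zero>\<^bsub>A\<^esub>" "finite {z. f z ~= \<zero>\<^bsub>A\<^esub>}" for z
     using f unfolding free_simps by blast+
    have "{m. h b m ~= \<zero>\<^bsub>A\<^esub>} <= snd ` {z. f z ~= \<zero>\<^bsub>A\<^esub>}" for b by (force simp: h_def)
    hence "finite {m. h b m ~= \<zero>\<^bsub>A\<^esub>}" for b using fD(3) finite_subset by blast
    hence hR: "h b : carrier ?R" for b
     unfolding mpoly_simps free_simps using fD(1,2) by (auto simp: h_def)
    have "{b. h b ~= \<zero>\<^bsub>?R\<^esub>} <= fst ` {z. f z ~= \<zero>\<^bsub>A\<^esub>}"
     by (force simp: h_def mpoly_simps fun_eq_iff)
    hence "finite {b. h b ~= \<zero>\<^bsub>?R\<^esub>}" using fD(3) finite_subset by blast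
    moreover have "h b = \<zero>\<^bsub>?R\<^esub>" if "b \<notin> B" for b
     using that fD(2) by (auto simp: h_def mpoly_simps)
    ultimately have h: "h : carrier ?FR" unfolding free_simps(1)[of h] using hR by blast
    have "\<psi> (g h) = f" using \<phi>g[OF h] by (auto simp: \<psi>_def h_def)
    thus "f : \<psi> ` carrier M" using slinearD(1)[OF lin h] by blast
   qed (use \<psi> in blast)
  qed
  show "\<psi> (x \<oplus>\<^bsub>M\<^esub> y) z = \<psi> x z \<oplus>\<^bsub>A\<^esub> \<psi> y z" if "x : carrier M" "y : carrier M" for x y z
   unfolding \<psi>_def \<phi>_add[OF that] by (cases z) (simp add: free_simps mpoly_simps)
  show "\<psi> (p \<odot>\<^bsub>M\<^esub> x) (b, m) = (\<Oplus>\<^bsub>A\<^esub>k\<in>{k. k <=# m}. p k \<otimes>\<^bsub>A\<^esub> \<psi> x (b, m - k))"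
   if "p : carrier ?R" "x : carrier M" for p x b m
   unfolding \<psi>_def \<phi>_smult[OF that] by (simp add: free_simps mpoly_simps)
  show "gr j = {x \<in> carrier M. \<forall>b m. \<psi> x (b, m) ~= \<zero>\<^bsub>A\<^esub> --> deg b + int (size m) = j}" for j
  proof -
   have iff: "(\<forall>b\<in>B. \<phi> x b : homog A n (j - deg b)) \<longleftrightarrow>
     (\<forall>b m. \<psi> x (b, m) ~= \<zero>\<^bsub>A\<^esub> --> deg b + int (size m) = j)" if x: "x : carrier M" for x
   proof -
    have "\<phi> x b : homog A n (j - deg b) \<longleftrightarrow> (\<forall>m. \<psi> x (b, m) ~= \<zero>\<^bsub>A\<^esub> --> deg b + int (size m) = j)" for b
     using \<phi>R(1)[OF x, of b] by (auto simp: homog_def \<psi>_def)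
    moreover have "\<psi> x (b, m) = \<zero>\<^bsub>A\<^esub>" if "b \<notin> B" for b m
     using \<phi>R(2)[OF x that] by (simp add: \<psi>_def mpoly_simps)
    ultimately show ?thesis by metis
   qed
   show ?thesis
   proof (intro equalityI subsetI)
    fix x assume "x : gr j"
    then obtain f where f: "f : carrier ?FR" "\<forall>b\<in>B. f b : homog A n (j - deg b)" "x = g f"
     unfolding gr g_alt by blast
    have x: "x : carrier M" using f slinearD(1)[OF lin] by blast
    moreover have "\<phi> x = f" using f \<phi>g by blast
    ultimately show "x : {x \<in> carrier M. \<forall>b m. \<psi> x (b, m) ~= \<zero>\<^bsub>A\<^esub> --> deg b + int (size m) = j}"
     using iff[OF x] f(2) by blast
   next
    fix x assume "x : {x \<in> carrier M. \<forall>b m. \<psi> x (b, m) ~= \<zero>\<^bsub>A\<^esub> --> deg b + int (size m) = j}"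
    hence x: "x : carrier M" and "\<forall>b\<in>B. \<phi> x b : homog A n (j - deg b)" using iff by blast+
    hence mem: "\<phi> x : {f \<in> carrier ?FR. \<forall>b\<in>B. f b : homog A n (j - deg b)}" using \<phi>(1) by blast
    show "x : gr j" unfolding gr g_alt 
     by (rule image_eqI[where f = g and x = "\<phi> x"]) (use mem \<phi>(2)[OF x] in simp_all)
   qed
  qed
 qed (use A M in "auto")
 thus ?thesis by blast
qed

subsection \<open>The squarefree ideal\<close>

lemma (in cring) mpoly_monomial_ideal:
 assumes R': "cring (mpoly_ring R n)" and up: "!!k m. P m ==> P (k + m)"
 shows "ideal {f \<in> carrier (mpoly_ring R n). \<forall>m. f m ~= \<zero> --> P m} (mpoly_ring R n)"
proof -
 let ?R = "mpoly_ring R n"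
 let ?I = "{f \<in> carrier ?R. \<forall>m. f m ~= \<zero> --> P m}"
 interpret R: cring ?R by fact
 interpret F: module R "free_module R {m. set_mset m <= {1..n}}" by (rule free_module_is_module)
 have neg: "\<ominus>\<^bsub>?R\<^esub> f = (%m. \<ominus> f m)" if f: "f : carrier ?R" for f
 proof (rule R.minus_equality)
  have fF: "f : carrier (free_module R {m. set_mset m <= {1..n}})" using f by (simp add: mpoly_simps)
  show "(%m. \<ominus> f m) : carrier ?R"
   using F.M.a_inv_closed[OF fF] unfolding free_module_minus[OF fF] mpoly_simps .
  show "(%m. \<ominus> f m) \<oplus>\<^bsub>?R\<^esub> f = \<zero>\<^bsub>?R\<^esub>"
   using f unfolding mpoly_simps free_simps by (auto simp: l_neg)
 qed (use f in auto)
 have mult: "r \<otimes>\<^bsub>?R\<^esub> f : ?I" if r: "r : carrier ?R" and f: "f : ?I" for r f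
 proof -
  have "P m" if nz: "(r \<otimes>\<^bsub>?R\<^esub> f) m ~= \<zero>" for m
  proof -
   have rk: "r k : carrier R" for k using r by (simp add: mpoly_simps free_simps)
   have "\<exists>k. k <=# m & f (m - k) ~= \<zero>"
   proof (rule ccontr)
    assume "~ ?thesis"
    hence "(\<Oplus>k\<in>{k. k <=# m}. r k \<otimes> f (m - k)) = (\<Oplus>k\<in>{k. k <=# m}. \<zero>)"
     using rk by (intro finsum_cong') auto
    thus False using nz finsum_zero by (simp add: mpoly_simps)
   qed
   then obtain k where "k <=# m" "f (m - k) ~= \<zero>" by blast
   hence "P (m - k)" "m = k + (m - k)" using f by auto
   thus ?thesis using up by metis
  qed
  thus ?thesis using r f by auto
 qed
 show ?thesis
 proof (rule idealI)
  show "ring ?R" by unfold_locales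
  show "subgroup ?I (add_monoid ?R)"
  proof (rule subgroup.intro)
   fix x y assume x: "x : ?I" and y: "y : ?I"
   have "y m : carrier R" for m using y by (simp add: mpoly_simps free_simps)
   hence "P m" if "x m \<oplus> y m ~= \<zero>" for m using that x y by (cases "x m = \<zero>") auto
   thus "x \<otimes>\<^bsub>add_monoid ?R\<^esub> y : ?I" using x y R.a_closed[of x y] by (auto simp: mpoly_simps(4))
  next
   fix x assume x: "x : ?I"
   have "P m" if "\<ominus> x m ~= \<zero>" for m using that x by (cases "x m = \<zero>") auto
   thus "inv\<^bsub>add_monoid ?R\<^esub> x : ?I" using x neg[of x] R.a_inv_closed[of x] unfolding a_inv_def[symmetric] by auto
  qed (use R.zero_closed in "auto simp: mpoly_simps(2)")
  show "x \<otimes>\<^bsub>?R\<^esub> a : ?I" if "a : ?I" "x : carrier ?R" for a x using mult that by blast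
  show "a \<otimes>\<^bsub>?R\<^esub> x : ?I" if "a : ?I" "x : carrier ?R" for a x
   using mult[OF that(2,1)] R.m_comm[of a x] that by auto
 qed
qed

lemma (in cring) monomial_mult:
 assumes "a : carrier R" and f: "f : carrier (mpoly_ring R n)"
 shows "(%m. if m = k then a else \<zero>) \<otimes>\<^bsub>mpoly_ring R n\<^esub> f = (%m. if k <=# m then a \<otimes> f (m - k) else \<zero>)"
 unfolding mpoly_simps
 using monomial_sum[OF refl assms(1), of f k] f by (auto simp: mpoly_simps free_simps)

text \<open>The polynomials whose monomials all involve at least \<open>d\<close> variables form an
  ideal containing the generators. Conversely such a monomial is divisible by the product of any
  \<open>d\<close> of its variables.\<close>

lemma (in cring) sqfree_ideal_eq:
 assumes R': "cring (mpoly_ring R n)"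
 shows "sqfree_ideal R d n = {f \<in> carrier (mpoly_ring R n). \<forall>m. f m ~= \<zero> --> d <= card (set_mset m)}"
  (is "_ = ?I")
proof
 let ?R = "mpoly_ring R n"
 let ?G = "{free_gen R (mset_set S) | S. S <= {1..n} & card S = d}"
 interpret R: cring ?R by fact
 have up: "d <= card (set_mset (k + m))" if "d <= card (set_mset m)" for k m :: "nat multiset"
  using that card_mono[of "set_mset (k + m)" "set_mset m"] by auto
 have fin: "finite S" if "S <= {1..n}" for S :: "nat set" using that finite_subset by blast
 have GR: "?G <= carrier ?R"
  unfolding mpoly_simps using fin by (auto intro!: gen_cl simp del: atLeastAtMost_iff)
 have "?G <= ?I"
 proof
  fix f assume f: "f : ?G"
  then obtain S where S: "f = free_gen R (mset_set S)" "S <= {1..n}" "card S = d" by blast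
  have "d <= card (set_mset m)" if "f m ~= \<zero>" for m
   using that S fin[OF S(2)] by (cases "m = mset_set S") (auto simp: free_gen_def)
  thus "f : ?I" using GR f by blast
 qed
 moreover have "ideal ?I ?R" by (rule mpoly_monomial_ideal[OF R']) (rule up)
 ultimately show "sqfree_ideal R d n <= ?I"
  unfolding sqfree_ideal_def by (intro R.genideal_minimal)
 interpret J: ideal "sqfree_ideal R d n" ?R
  unfolding sqfree_ideal_def by (rule R.genideal_ideal[OF GR])
 let ?X = "{m. set_mset m <= {1..n} & d <= card (set_mset m)}"
 show "?I <= sqfree_ideal R d n"
 proof
  fix f assume "f : ?I"
  hence "f : carrier (free_module R ?X)" unfolding mpoly_simps free_simps by blast
  thus "f : sqfree_ideal R d n"
  proof (induction rule: free_module_induct)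
   case zero
   show ?case using J.zero_closed by (simp add: mpoly_simps(2))
  next
   case (step f a m)
   \<comment> \<open>Any \<open>d\<close> variables of \<open>m\<close> give a generator dividing
     it, with cofactor \<open>m - mset_set S\<close>.\<close>
   obtain S where S: "S <= set_mset m" "card S = d" "finite S"
    using obtain_subset_with_card_n[of d "set_mset m"] step.hyps(3) by blast
   let ?p = "%k. if k = m - mset_set S then a else \<zero>"
   have "mset_set S <=# mset_set (set_mset m)" using S by (simp add: subset_imp_msubset_mset_set)
   hence Sm: "mset_set S <=# m" using mset_set_set_mset_msubset subset_mset.order_trans by blast
   have g: "free_gen R (mset_set S) : ?G" using S step.hyps(3) by auto
   have "set_mset (m - mset_set S) <= {1..n}" using step.hyps(3) by (auto dest: in_diffD)
   hence p: "?p : carrier ?R"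
    unfolding mpoly_simps free_simps using step.hyps(2) by (auto intro: finite_subset[of _ "{m - mset_set S}"])
   have "free_gen R (mset_set S) : sqfree_ideal R d n"
    using R.genideal_self[OF GR] g unfolding sqfree_ideal_def by blast
   hence "?p \<otimes>\<^bsub>?R\<^esub> free_gen R (mset_set S) : sqfree_ideal R d n" using p by (rule J.I_l_closed)
   moreover have "?p \<otimes>\<^bsub>?R\<^esub> free_gen R (mset_set S) = (%k. a \<otimes> free_gen R m k)"
   proof -
    have "m - mset_set S <=# k & k - (m - mset_set S) = mset_set S \<longleftrightarrow> k = m" for k
     using Sm by (metis add_diff_cancel_left' mset_subset_eq_add_left subset_mset.diff_add)
    hence "(if m - mset_set S <=# k then a \<otimes> free_gen R (mset_set S) (k - (m - mset_set S)) else \<zero>)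
      = a \<otimes> free_gen R m k" for k
     using step.hyps(2) by (auto simp: free_gen_def)
    thus ?thesis using monomial_mult[OF step.hyps(2), of "free_gen R (mset_set S)" n] GR g by auto
   qed
   ultimately have "f \<oplus>\<^bsub>?R\<^esub> (%k. a \<otimes> free_gen R m k) : sqfree_ideal R d n"
    using step.IH J.a_closed by metis
   thus ?case by (simp add: mpoly_simps(4) free_simps)
  qed
 qed
qed

abbreviation "sqfree_mons d n == {(u :: unit, m :: nat multiset). set_mset m <= {1..n} & d <= card (set_mset m)}"

lemma sqfree_module_simps:
 "carrier (sqfree_ideal_module A d n) = sqfree_ideal A d n"
 "zero (sqfree_ideal_module A d n) = zero (mpoly_ring A n)"
 "add (sqfree_ideal_module A d n) = add (mpoly_ring A n)"
 "smult (sqfree_ideal_module A d n) = monoid.mult (mpoly_ring A n)"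
 "gact (sqfree_ideal_module A d n) = perm_vars"
 "grade (sqfree_ideal_module A d n) = (%j. sqfree_ideal A d n \<inter> homog A n j)"
 by (simp_all add: sqfree_ideal_module_def with_action_grade_def Let_def mpoly_smult_alg)

text \<open>The ideal is not free, but it inherits the coordinates of the ambient ring: one basis
  element of degree zero, with the admissible monomials restricted to those of the ideal.\<close>

lemma (in cring) sqfree_coord:
 assumes R': "cring (mpoly_ring R n)"
 shows "coord_module R n (sqfree_ideal_module R d n) (grade (sqfree_ideal_module R d n))
  (%f (u, m). f m) (sqfree_mons d n) (%_. 0)"
proof -
 let ?R = "mpoly_ring R n"
 let ?I = "sqfree_ideal R d n"
 interpret R: cring ?R by fact
 have up: "d <= card (set_mset (k + m))" if "d <= card (set_mset m)" for k m :: "nat multiset"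
  using that card_mono[of "set_mset (k + m)" "set_mset m"] by auto
 interpret J: ideal ?I ?R unfolding sqfree_ideal_eq[OF R'] by (rule mpoly_monomial_ideal[where P = "%m. d <= card (set_mset m)", OF R' up])
 interpret reg: module ?R "regular_module ?R" by (rule R.regular_is_module)
 have "submodule ?I ?R (regular_module ?R)" by (rule R.ideal_submodule[OF J.ideal_axioms])
 from submodule.submodule_is_module[OF this reg.module_axioms]
 have M: "module ?R (sqfree_ideal_module R d n)"
  by (rule module_change_fields) (simp_all add: sqfree_module_simps mpoly_smult_alg)
 have mem: "f : ?I \<longleftrightarrow> f : carrier (free_module R {m. set_mset m <= {1..n} & d <= card (set_mset m)})" for f
  unfolding sqfree_ideal_eq[OF R'] mpoly_simps free_simps by blast
 show ?thesis
 proof (intro coord_module.intro coord_module_axioms.intro)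
  show "bij_betw (%f (u, m). f m) (carrier (sqfree_ideal_module R d n)) (carrier (free_module R (sqfree_mons d n)))"
  proof (rule bij_betw_byWitness[where f' = "%h m. h ((), m)"])
   show "(%f (u, m). f m) ` carrier (sqfree_ideal_module R d n) <= carrier (free_module R (sqfree_mons d n))"
   proof
    fix h :: "unit \<times> nat multiset => 'a" assume "h : (%f (u, m). f m) ` carrier (sqfree_ideal_module R d n)"
    then obtain f where f: "f : ?I" "h = (%(u, m). f m)" by (auto simp: sqfree_module_simps)
    have "{z. h z ~= \<zero>} = Pair () ` {m. f m ~= \<zero>}" by (auto simp: f(2))
    thus "h : carrier (free_module R (sqfree_mons d n))"
     using f(1) unfolding mem free_simps by (auto simp: f(2))
   qed
   show "(%h m. h ((), m)) ` carrier (free_module R (sqfree_mons d n)) <= carrier (sqfree_ideal_module R d n)"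
   proof
    fix f assume "f : (%h m. h ((), m)) ` carrier (free_module R (sqfree_mons d n))"
    then obtain h where h: "h : carrier (free_module R (sqfree_mons d n))" "f = (%m. h ((), m))" by blast
    have "{m. f m ~= \<zero>} <= snd ` {z. h z ~= \<zero>}" by (force simp: h(2))
    hence "finite {m. f m ~= \<zero>}" using h(1) finite_subset unfolding free_simps by blast
    thus "f : carrier (sqfree_ideal_module R d n)"
     unfolding sqfree_module_simps mem free_simps using h unfolding free_simps by auto
   qed
  qed auto
  show "(case z of (u, m) => (f \<oplus>\<^bsub>sqfree_ideal_module R d n\<^esub> g) m) = (case z of (u, m) => f m) \<oplus> (case z of (u, m) => g m)"
   for f g and z :: "unit \<times> nat multiset"
   by (cases z) (simp add: sqfree_module_simps mpoly_simps)
  show "(case (b, m) of (u, m) => (p \<odot>\<^bsub>sqfree_ideal_module R d n\<^esub> x) m) =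
   (\<Oplus>k\<in>{k. k <=# m}. p k \<otimes> (case (b, m - k) of (u, m) => x m))" for p x b m
   by (simp add: sqfree_module_simps mpoly_simps)
  show "grade (sqfree_ideal_module R d n) j = {x \<in> carrier (sqfree_ideal_module R d n).
    \<forall>b m. (case (b, m) of (u, m) => x m) ~= \<zero> --> 0 + int (size m) = j}" for j
   using J.a_subset by (auto simp: sqfree_module_simps homog_def)
 qed (use M in "auto intro: cring_axioms")
qed

subsection \<open>Permuting the variables\<close>

lemma (in cring) perm_vars_endo:
 assumes R': "cring (mpoly_ring R n)" and \<sigma>: "\<sigma> permutes {1..n}"
 shows "ring_endo (mpoly_ring R n) (perm_vars \<sigma>)"
proof -
 let ?R = "mpoly_ring R n"
 interpret R: cring ?R by fact
 let ?i = "image_mset (inv' \<sigma>)"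
 have inj_i: "inj (inv' \<sigma>)" and inj: "inj \<sigma>"
  using permutes_inj[OF permutes_inv[OF \<sigma>]] permutes_inj[OF \<sigma>] by auto
 have ii: "image_mset \<sigma> (?i m) = m" "?i (image_mset \<sigma> m) = m" for m
  using permutes_inverses[OF \<sigma>] by (simp_all add: multiset.map_comp comp_def)
 have bij: "bij ?i" by (rule o_bij[of "image_mset \<sigma>"]) (auto simp: fun_eq_iff ii)
 show ?thesis
 proof (intro ring_endo.intro ring_endo_axioms.intro)
  show "cring ?R" by fact
  fix r assume r: "r : carrier ?R"
  have rD: "r m : carrier R" "~ set_mset m <= {1..n} ==> r m = \<zero>" "finite {m. r m ~= \<zero>}" for m
   using r unfolding mpoly_simps free_simps by auto
  show "perm_vars \<sigma> r : carrier ?R"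
   unfolding mpoly_simps free_simps
  proof (intro conjI allI impI)
   show "perm_vars \<sigma> r m : carrier R" for m using rD by (simp add: perm_vars_def)
   have "{m. perm_vars \<sigma> r m ~= \<zero>} = ?i -` {m. r m ~= \<zero>}" by (auto simp: perm_vars_def)
   thus "finite {m. perm_vars \<sigma> r m ~= \<zero>}" using finite_vimageI[OF rD(3) bij_is_inj[OF bij]] by simp
   fix m assume "m \<notin> {m. set_mset m <= {1..n}}"
   hence "~ set_mset (?i m) <= {1..n}"
    using permutes_in_image[OF permutes_inv[OF \<sigma>]] by (auto simp: subset_iff)
   thus "perm_vars \<sigma> r m = \<zero>" using rD(2) by (simp add: perm_vars_def)
  qed
  fix s assume s: "s : carrier ?R"
  show "perm_vars \<sigma> (r \<oplus>\<^bsub>?R\<^esub> s) = perm_vars \<sigma> r \<oplus>\<^bsub>?R\<^esub> perm_vars \<sigma> s"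
   by (simp add: mpoly_simps perm_vars_def)
  have sD: "s m : carrier R" for m using s by (simp add: mpoly_simps free_simps)
  show "perm_vars \<sigma> (r \<otimes>\<^bsub>?R\<^esub> s) = perm_vars \<sigma> r \<otimes>\<^bsub>?R\<^esub> perm_vars \<sigma> s"
  proof
   fix m
   have set: "{k. k <=# ?i m} = ?i ` {k. k <=# m}"
   proof (intro equalityI subsetI)
    fix k assume "k : {k. k <=# ?i m}"
    hence "image_mset \<sigma> k <=# m" using image_mset_subseteq_mono[of k "?i m" \<sigma>] ii by simp
    thus "k : ?i ` {k. k <=# m}" using ii by (metis image_eqI mem_Collect_eq)
   qed (auto intro: image_mset_subseteq_mono)
   have "perm_vars \<sigma> (r \<otimes>\<^bsub>?R\<^esub> s) m = (\<Oplus>k\<in>?i ` {k. k <=# m}. r k \<otimes> s (?i m - k))"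
    by (simp add: perm_vars_def mpoly_simps set)
   also have "... = (\<Oplus>k\<in>{k. k <=# m}. r (?i k) \<otimes> s (?i m - ?i k))"
    by (rule finsum_reindex) (use bij_is_inj[OF bij] rD sD in "auto intro: inj_on_subset")
   also have "... = (\<Oplus>k\<in>{k. k <=# m}. perm_vars \<sigma> r k \<otimes> perm_vars \<sigma> s (m - k))"
    by (rule finsum_cong') (use rD sD in "auto simp: perm_vars_def image_mset_Diff")
   finally show "perm_vars \<sigma> (r \<otimes>\<^bsub>?R\<^esub> s) m = (perm_vars \<sigma> r \<otimes>\<^bsub>?R\<^esub> perm_vars \<sigma> s) m"
    by (simp add: mpoly_simps)
  qed
 next
  show "perm_vars \<sigma> \<one>\<^bsub>?R\<^esub> = \<one>\<^bsub>?R\<^esub>" by (auto simp: perm_vars_def mpoly_simps free_gen_def)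
 qed
qed

lemma perm_vars_var: "\<sigma> permutes S ==> perm_vars \<sigma> (var A k) = var A (\<sigma> k)"
proof
 fix m assume \<sigma>: "\<sigma> permutes S"
 have "image_mset (inv' \<sigma>) m = {#k#} \<longleftrightarrow> m = {#\<sigma> k#}"
 proof
  assume "image_mset (inv' \<sigma>) m = {#k#}"
  hence "image_mset \<sigma> (image_mset (inv' \<sigma>) m) = {#\<sigma> k#}" by simp
  thus "m = {#\<sigma> k#}" using permutes_inverses[OF \<sigma>] by (simp add: multiset.map_comp comp_def)
 qed (use permutes_inverses[OF \<sigma>] in simp)
 thus "perm_vars \<sigma> (var A k) m = var A (\<sigma> k) m" by (simp add: perm_vars_def free_gen_def)
qed

text \<open>The case \<open>d = 1\<close> of the squarefree ideal; its monomial description then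
  says that the constant coefficient vanishes, as stated in \<open>J_eq\<close>.\<close>

lemma irrelevant_ideal_eq: "irrelevant_ideal A n = sqfree_ideal A 1 n"
proof -
 have "{free_gen A {#k#} | k. k : {1..n}} = {free_gen A (mset_set S) | S. S <= {1..n} & card S = 1}"
 proof (intro equalityI subsetI)
  fix f assume "f : {free_gen A {#k#} | k. k : {1..n}}"
  then obtain k where "f = free_gen A {#k#}" "k : {1..n}" by blast
  thus "f : {free_gen A (mset_set S) | S. S <= {1..n} & card S = 1}"
   by (intro CollectI exI[of _ "{k}"]) simp
 next
  fix f assume "f : {free_gen A (mset_set S) | S. S <= {1..n} & card S = 1}"
  then obtain S where S: "f = free_gen A (mset_set S)" "S <= {1..n}" "card S = 1" by blast
  then obtain k where "S = {k}" using card_1_singletonE by blast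
  thus "f : {free_gen A {#k#} | k. k : {1..n}}" using S by auto
 qed
 thus ?thesis by (simp only: irrelevant_ideal_def sqfree_ideal_def)
qed

section \<open>Tor and the Koszul complex\<close>

text \<open>With multiplication by a constant viewed as a graded map over the identity permutation,
  linearity over \<open>A\<close> becomes a case of the equivariance of zigzags.\<close>

lemma (in coord_module) const_graded_map:
 assumes a: "a : carrier A"
 shows "graded_map A n M gr \<psi> S deg M gr \<psi> S deg (%x. const_poly A n a \<odot> x) id"
proof (intro graded_map.intro coord_module_axioms graded_map_axioms.intro)
 note c = A.const_poly_closed[OF a, of n]
 show "const_poly A n a \<odot> (var A k \<odot> x) = var A (id k) \<odot> (const_poly A n a \<odot> x)"
  if "k : {1..n}" "x : carrier M" for k x
  using smult_assoc1[OF c A.var_closed[OF that(1)] that(2)] smult_assoc1[OF A.var_closed[OF that(1)] c that(2)]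
   R.m_comm[OF c A.var_closed[OF that(1)]] by simp
qed (use a A.const_poly_closed in "auto simp: smult_r_distr gr_closed permutes_id")

locale coord_tor =
 coord_resolution A n "res_term P" "res_grade P" \<psi> B dg I gI \<psi>I SI dI "res_diff P" "res_aug P"
 for A :: "('a, 'p) ring_scheme" and n
  and P :: "(nat multiset => 'a, 'f, 'i) resolution"
  and \<psi> :: "nat => 'f => 'b \<times> nat multiset => 'a" and B dg
  and I :: "(nat multiset => 'a, 'i, 's) module_scheme" and gI \<psi>I
  and SI :: "('c \<times> nat multiset) set" and dI
begin

abbreviation "F == res_term P"
abbreviation "G == res_grade P"
abbreviation "D == res_diff P"
abbreviation "R == mpoly_ring A n"
abbreviation "K == residue_module A n"
abbreviation "J == irrelevant_ideal A n"
abbreviation "reg == regular_module R"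

lemma R_cring: "cring R"
 by (rule module_cring[OF F.module_axioms])

interpretation reg: module R reg by (rule F.R.regular_is_module)

lemma J_eq: "J = {f \<in> carrier R. f {#} = \<zero>\<^bsub>A\<^esub>}"
 unfolding irrelevant_ideal_eq A.sqfree_ideal_eq[OF R_cring]
 by (auto simp: Suc_le_eq card_gt_0_iff)

lemma J_ideal: "ideal J R"
proof -
 have *: "J = {f \<in> carrier R. \<forall>m. f m ~= \<zero>\<^bsub>A\<^esub> --> m ~= {#}}" unfolding J_eq by auto
 show ?thesis unfolding * by (rule A.mpoly_monomial_ideal[OF R_cring]) simp
qed

interpretation J: quotient R reg J
 by (rule quotientI[OF reg.module_axioms F.R.ideal_submodule[OF J_ideal]])

lemma residue_simps:
 "carrier K = carrier J.Q" "add K = add J.Q" "zero K = zero J.Q" "smult K = smult J.Q"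
 "gact K \<sigma> = quot_map reg J (perm_vars \<sigma>)" "grade K q = (%f. J +>\<^bsub>reg\<^esub> f) ` homog A n q"
 by (simp_all add: residue_module_def Let_def with_action_grade_def)

lemma K_module: "module R K"
 by (rule module_change_fields[OF J.quot_is_module]) (simp_all add: residue_simps)

interpretation K: module R K by (rule K_module)

definition one_K :: "(nat multiset => 'a) set" where "one_K = J +>\<^bsub>reg\<^esub> \<one>\<^bsub>R\<^esub>"

lemma regc: "f : carrier R ==> f : carrier reg"
 by (simp add: mpoly_smult_alg)

lemma coset_one: "f : carrier R ==> J +>\<^bsub>reg\<^esub> f = f \<odot>\<^bsub>K\<^esub> one_K"
 using J.quot_smult[OF _ regc[OF F.R.one_closed], of f] by (simp add: one_K_def residue_simps mpoly_smult_alg)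

lemma one_K_closed: "one_K : carrier K"
 unfolding one_K_def residue_simps by (rule J.coset_closed[OF regc[OF F.R.one_closed]])

lemma K_cases:
 assumes "y : carrier K" obtains f where "f : carrier R" "y = f \<odot>\<^bsub>K\<^esub> one_K"
proof -
 obtain f where "f : carrier reg" "y = J +>\<^bsub>reg\<^esub> f" using assms unfolding residue_simps by (rule J.quot_cases)
 thus ?thesis by (intro that[of f]) (simp_all add: mpoly_smult_alg coset_one)
qed

lemma homog_closed: "f : homog A n q ==> f : carrier R"
 by (simp add: homog_def)

lemma one_homog: "\<one>\<^bsub>R\<^esub> : homog A n 0"
 using F.R.one_closed by (auto simp: homog_def mpoly_simps(3) free_gen_def)

lemma smult_J: "f : J ==> f \<odot>\<^bsub>K\<^esub> one_K = \<zero>\<^bsub>K\<^esub>"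
proof -
 assume f: "f : J"
 hence fR: "f : carrier R" by (simp add: J_eq)
 have "J +>\<^bsub>reg\<^esub> f = J" using f by (metis J.N.a_rcos_const)
 thus ?thesis using coset_one[OF fR] by (simp add: residue_simps J.quot_zero(2))
qed

lemma var_J: "k : {1..n} ==> var A k : J"
 using A.var_closed by (simp add: J_eq free_gen_def)

lemma gact_K:
 assumes \<sigma>: "\<sigma> permutes {1..n}"
 shows "gact K \<sigma> : semilinear_maps R (perm_vars \<sigma>) K K" "gact K \<sigma> one_K = one_K"
proof -
 interpret E: ring_endo R "perm_vars \<sigma>" by (rule A.perm_vars_endo[OF R_cring \<sigma>])
 have sl: "perm_vars \<sigma> : semilinear_maps R (perm_vars \<sigma>) reg reg"
  by (rule slinearI) (simp_all add: mpoly_smult_alg E.endo_closed E.endo_add E.endo_mult)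
 have JJ: "perm_vars \<sigma> f : J" if "f : J" for f
  using that E.endo_closed by (simp add: J_eq perm_vars_def)
 have "quot_map reg J (perm_vars \<sigma>) : semilinear_maps R (perm_vars \<sigma>) J.Q J.Q"
  by (rule quot_map_semilinear[OF reg.module_axioms reg.module_axioms J.N_submodule J.N_submodule sl])
   (use JJ E.endo_closed in auto)
 thus "gact K \<sigma> : semilinear_maps R (perm_vars \<sigma>) K K"
  unfolding semilinear_maps_def by (simp add: residue_simps)
 have "gact K \<sigma> one_K = J +>\<^bsub>reg\<^esub> perm_vars \<sigma> \<one>\<^bsub>R\<^esub>"
  unfolding residue_simps one_K_def
  by (rule quot_map_coset[OF reg.module_axioms reg.module_axioms J.N_submodule J.N_submodule])
   (use slinearD[OF sl] JJ regc[OF F.R.one_closed] in auto)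
 thus "gact K \<sigma> one_K = one_K" by (simp add: one_K_def E.endo_one)
qed

text \<open>The ring \<open>A\<close> with polynomials acting through their constant coefficients.
  It is a copy of the residue module in which elements can be compared by their values.\<close>

definition const_module :: "(nat multiset => 'a, 'a) module" where
 "const_module = \<lparr>carrier = carrier A, monoid.mult = monoid.mult A, one = \<one>\<^bsub>A\<^esub>, zero = \<zero>\<^bsub>A\<^esub>,
  add = add A, smult = (%f a. f {#} \<otimes>\<^bsub>A\<^esub> a)\<rparr>"

lemma const_simps:
 "carrier const_module = carrier A" "\<zero>\<^bsub>const_module\<^esub> = \<zero>\<^bsub>A\<^esub>"
 "a \<oplus>\<^bsub>const_module\<^esub> b = a \<oplus>\<^bsub>A\<^esub> b" "f \<odot>\<^bsub>const_module\<^esub> a = f {#} \<otimes>\<^bsub>A\<^esub> a"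
 by (simp_all add: const_module_def)

lemma coeff_closed: "f : carrier R ==> f m : carrier A"
 by (simp add: mpoly_simps free_simps)

lemma mult_const_coeff: "f : carrier R ==> g : carrier R ==> (f \<otimes>\<^bsub>R\<^esub> g) {#} = f {#} \<otimes>\<^bsub>A\<^esub> g {#}"
 using coeff_closed by (simp add: mpoly_simps(6))

lemma const_is_module: "module R const_module"
proof (rule moduleI)
 show "abelian_group const_module"
  by (rule abelian_groupI) (auto simp: const_simps A.a_ac intro: bexI[of _ "\<ominus>\<^bsub>A\<^esub> _"] A.l_neg)
qed (use coeff_closed R_cring in "auto simp: const_simps mult_const_coeff mpoly_simps(3,4) free_gen_def
  A.l_distr A.r_distr A.m_assoc")

lemma residue_coeff:
 obtains g where "g : linear_maps R K const_module" "g one_K = \<one>\<^bsub>A\<^esub>"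
proof -
 have "(%f. f {#}) : linear_maps R reg const_module"
  by (rule slinearI)
   (simp_all add: mpoly_smult_alg const_simps coeff_closed mult_const_coeff mpoly_simps(4))
 then obtain g where g: "g : linear_maps R J.Q const_module"
   "!!x. x : carrier reg ==> g (J +>\<^bsub>reg\<^esub> x) = x {#}"
  using J.quot_lift[OF const_is_module, of "%f. f {#}"] by (auto simp: J_eq const_simps)
 show ?thesis
 proof (rule that)
  show "g : linear_maps R K const_module" using g(1) unfolding semilinear_maps_def by (simp add: residue_simps)
  show "g one_K = \<one>\<^bsub>A\<^esub>"
   using g(2)[OF regc[OF F.R.one_closed]] by (simp add: one_K_def mpoly_simps(3) free_gen_def)
 qed
qed

subsection \<open>Tensoring a resolution with the residue module\<close>

abbreviation "T i == tor_chains A n P K i"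

text \<open>Every element of the tensor product with the residue module has this form
  (\<open>T_cases\<close>), and a homogeneous \<open>x\<close> is sent to zero exactly when its
  constant coefficients vanish (\<open>t_zero_imp\<close>, \<open>t_zero_if\<close>). All
  computations with tensors are thereby reduced to elements of \<open>F i\<close>.\<close>

definition t :: "nat => 'f => ('f \<times> (nat multiset => 'a) set => nat multiset => 'a) set" where
 "t i x = pure_tensor R (F i) K x one_K"

lemma tensorsFK: "tensors R (F i) K"
 by (intro tensors.intro F.module_axioms K_module)

lemma T_module: "module R (T i)"
 unfolding tor_chains_def by (rule tensors.tensor_module[OF tensorsFK])

interpretation T: module R "T i" for i by (rule T_module)

lemma t_linear: "t i : linear_maps R (F i) (T i)"
 unfolding tor_chains_def t_def
 by (rule slinearI)
  (use tensors.pure_closed[OF tensorsFK] tensors.pure_add_left[OF tensorsFK]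
   tensors.pure_smult_left[OF tensorsFK] one_K_closed in auto)

lemmas tD = slinearD[OF t_linear, unfolded id_apply]

lemma t_diff: "x : carrier (F i) ==> y : carrier (F i) ==> t i (x \<ominus>\<^bsub>F i\<^esub> y) = t i x \<ominus>\<^bsub>T i\<^esub> t i y"
 by (rule semilinear_diff[OF F.module_axioms T_module t_linear])

lemma t_neg: "x : carrier (F i) ==> t i (\<ominus>\<^bsub>F i\<^esub> x) = \<ominus>\<^bsub>T i\<^esub> t i x"
 by (rule semilinear_minus[OF F.module_axioms T_module t_linear])

lemma t_zero: "t i \<zero>\<^bsub>F i\<^esub> = \<zero>\<^bsub>T i\<^esub>"
 by (rule semilinear_zero[OF F.module_axioms T_module t_linear])

lemma pure_t:
 assumes "x : carrier (F i)" "f : carrier R"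
 shows "pure_tensor R (F i) K x (f \<odot>\<^bsub>K\<^esub> one_K) = t i (f \<odot>\<^bsub>F i\<^esub> x)"
 unfolding t_def
 by (simp only: tensors.pure_smult_right[OF tensorsFK assms(2,1) one_K_closed]
   tensors.pure_smult_left[OF tensorsFK assms(2,1) one_K_closed])

lemma T_cases:
 assumes v: "v : carrier (T i)" obtains x where "x : carrier (F i)" "v = t i x"
proof -
 have "submodule (t i ` carrier (F i)) R (T i)"
 proof (rule T.submoduleI)
  show "\<zero>\<^bsub>T i\<^esub> : t i ` carrier (F i)" using t_zero by (metis F.M.zero_closed image_eqI)
  fix u assume "u : t i ` carrier (F i)"
  then obtain x where x: "u = t i x" "x : carrier (F i)" by (rule imageE)
  show "\<ominus>\<^bsub>T i\<^esub> u : t i ` carrier (F i)" unfolding x(1) t_neg[OF x(2), symmetric]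
   by (rule imageI[OF F.M.a_inv_closed[OF x(2)]])
  show "r \<odot>\<^bsub>T i\<^esub> u : t i ` carrier (F i)" if "r : carrier R" for r
   unfolding x(1) tD(3)[OF that x(2), symmetric] by (rule imageI[OF F.smult_closed[OF that x(2)]])
  fix w assume "w : t i ` carrier (F i)"
  then obtain y where y: "w = t i y" "y : carrier (F i)" by (rule imageE)
  show "u \<oplus>\<^bsub>T i\<^esub> w : t i ` carrier (F i)" unfolding x(1) y(1) tD(2)[OF x(2) y(2), symmetric]
   by (rule imageI[OF F.M.a_closed[OF x(2) y(2)]])
 qed (use tD(1) in auto)
 moreover have "pure_tensor R (F i) K x y : t i ` carrier (F i)" if x: "x : carrier (F i)" and "y : carrier K" for x y
 proof -
  obtain f where f: "f : carrier R" "y = f \<odot>\<^bsub>K\<^esub> one_K" using K_cases \<open>y : carrier K\<close> by blast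
  show ?thesis unfolding f(2) pure_t[OF x f(1)] by (rule imageI[OF F.smult_closed[OF f(1) x]])
 qed
 ultimately have "v : t i ` carrier (F i)"
  using tensors.tensor_closure[OF tensorsFK, of "t i ` carrier (F i)" i v] v unfolding tor_chains_def by blast
 thus ?thesis using that by blast
qed

abbreviation mP :: "nat => 'f => bool" where
 "mP i x == \<forall>b. \<psi> i x (b, {#}) = \<zero>\<^bsub>A\<^esub>"

text \<open>A bilinear map detects the constant coefficient at \<open>b\<close>: the product of that
  coefficient of \<open>x\<close> with the residue of \<open>y\<close> factors through the tensor
  product.\<close>

lemma t_zero_imp:
 assumes x: "x : carrier (F i)" and z: "t i x = \<zero>\<^bsub>T i\<^esub>" shows "mP i x"
proof
 fix b
 obtain g where g: "g : linear_maps R K const_module" "g one_K = \<one>\<^bsub>A\<^esub>" by (rule residue_coeff)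
 note gD = slinearD[OF g(1), unfolded const_simps id_apply]
 define \<beta> where "\<beta> x y = g y \<otimes>\<^bsub>A\<^esub> \<psi> i x (b, {#})" for x y
 have \<beta>: "\<beta> x y : carrier const_module"
  "x' : carrier (F i) ==> \<beta> (x \<oplus>\<^bsub>F i\<^esub> x') y = \<beta> x y \<oplus>\<^bsub>const_module\<^esub> \<beta> x' y"
  "y' : carrier K ==> \<beta> x (y \<oplus>\<^bsub>K\<^esub> y') = \<beta> x y \<oplus>\<^bsub>const_module\<^esub> \<beta> x y'"
  "r : carrier R ==> \<beta> (r \<odot>\<^bsub>F i\<^esub> x) y = r \<odot>\<^bsub>const_module\<^esub> \<beta> x y"
  "r : carrier R ==> \<beta> x (r \<odot>\<^bsub>K\<^esub> y) = r \<odot>\<^bsub>const_module\<^esub> \<beta> x y"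
  if "x : carrier (F i)" "y : carrier K" for x y x' y' r
  using that gD F.coord_closed coeff_closed
  by (simp_all add: \<beta>_def const_simps F.coord_add F.coord_smult_empty A.r_distr A.l_distr A.m_lcomm A.m_assoc)
 obtain f where f: "f : linear_maps R (tensor R (F i) K) const_module"
  "!!x y. x : carrier (F i) ==> y : carrier K ==> f (pure_tensor R (F i) K x y) = \<beta> x y"
 proof (rule tensors.tensor_lift[OF tensorsFK const_is_module, of i \<beta>])
  fix f assume "f : linear_maps R (tensor R (F i) K) const_module"
   "!!x y. x : carrier (F i) ==> y : carrier K ==> f (pure_tensor R (F i) K x y) = \<beta> x y"
  thus thesis by (rule that)
 qed (rule \<beta>; assumption)+
 have "\<psi> i x (b, {#}) = f (t i x)" using f(2)[OF x one_K_closed] g(2) F.coord_closed[OF x] by (simp add: t_def \<beta>_def)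
 also have "... = \<zero>\<^bsub>A\<^esub>"
  using semilinear_zero[OF T_module const_is_module f(1)[folded tor_chains_def]] z by (simp add: const_simps)
 finally show "\<psi> i x (b, {#}) = \<zero>\<^bsub>A\<^esub>" .
qed

text \<open>An element viewed as a Koszul chain of degree zero, the starting point of a zigzag with
  \<open>b = 0\<close>.\<close>

definition point :: "nat => 'f => nat list => 'f" where
 "point i x l = (if l = [] then x else \<zero>\<^bsub>F i\<^esub>)"

lemma point_chain: "x : G i j ==> point i x : ch i 0 j"
 by (rule F.kchainsI) (auto simp: point_def F.gr_closed F.gr_carrier intro!: altI)

lemma chain_point: "c : ch i 0 j ==> c = point i (c [])"
 using F.kchainsD(4)[of c i 0 j] by (auto simp: point_def fun_eq_iff)

lemma kdiff_empty_mP: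
 assumes "c : ch i b j" shows "mP i (d i c l)"
proof
 fix e
 have "\<psi> i (d i c l) (e, {#}) = kosz A {1..n} (%l m. \<psi> i (c l) (e, m)) l {#}"
  by (rule F.kdiff_coord) (rule F.kchainsD(3)[OF assms])
 thus "\<psi> i (d i c l) (e, {#}) = \<zero>\<^bsub>A\<^esub>" by (simp add: kosz_def)
qed

lemma kdiff_point: "x : G i j ==> d i (point i x) l = \<zero>\<^bsub>F i\<^esub>"
proof -
 assume "x : G i j"
 have "d i (point i x) l = (\<Oplus>\<^bsub>F i\<^esub>k\<in>{1..n}. \<zero>\<^bsub>F i\<^esub>)"
  unfolding kdiff_def by (rule F.M.finsum_cong') (auto simp: point_def A.var_closed)
 thus ?thesis by (simp only: F.M.finsum_zero)
qed

text \<open>Writing an element without constant coefficients as a combination of the variables is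
  exactness of the Koszul complex of a free module at degree zero.\<close>

lemma mP_boundary:
 assumes "x : G i j" "mP i x" shows "\<exists>v\<in>ch i 1 j. \<forall>l. d i v l = point i x l"
 unfolding One_nat_def
 by (rule free_exact[OF point_chain[OF assms(1)]]) (use kdiff_point[OF assms(1)] assms(2) in "auto simp: point_def")

lemma t_zero_if:
 assumes x: "x : G i j" "mP i x" shows "t i x = \<zero>\<^bsub>T i\<^esub>"
proof -
 obtain v where v: "v : ch i 1 j" "!!l. d i v l = point i x l" using mP_boundary[OF assms] by auto
 note vc = F.kchainsD(3)[OF v(1)]
 have "x = (\<Oplus>\<^bsub>F i\<^esub>k\<in>{1..n}. var A k \<odot>\<^bsub>F i\<^esub> v [k])" using v(2)[of "[]"] by (simp add: point_def kdiff_def)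
 hence "t i x = (\<Oplus>\<^bsub>T i\<^esub>k\<in>{1..n}. t i (var A k \<odot>\<^bsub>F i\<^esub> v [k]))"
  using semilinear_finsum[OF F.module_axioms T_module t_linear, of "{1..n}" "%k. var A k \<odot>\<^bsub>F i\<^esub> v [k]" i]
  by (simp add: A.var_closed vc)
 also have "... = (\<Oplus>\<^bsub>T i\<^esub>k\<in>{1..n}. \<zero>\<^bsub>T i\<^esub>)"
 proof (rule T.M.finsum_cong')
  fix k assume k: "k : {1..n}"
  \<comment> \<open>The variable moves across the tensor sign and annihilates the residue class of
    one.\<close>
  have "t i (var A k \<odot>\<^bsub>F i\<^esub> v [k]) = pure_tensor R (F i) K (v [k]) \<zero>\<^bsub>K\<^esub>"
   using pure_t[OF vc A.var_closed[OF k], of "[k]"] smult_J[OF var_J[OF k]] by simp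
  also have "... = pure_tensor R (F i) K (v [k]) (\<zero>\<^bsub>R\<^esub> \<odot>\<^bsub>K\<^esub> one_K)" by (simp add: one_K_closed)
  also have "... = t i \<zero>\<^bsub>F i\<^esub>" unfolding pure_t[OF vc F.R.zero_closed] using F.smult_l_null[OF vc] by simp
  finally show "t i (var A k \<odot>\<^bsub>F i\<^esub> v [k]) = \<zero>\<^bsub>T i\<^esub>" using t_zero by simp
 qed auto
 finally show ?thesis using T.M.finsum_zero by simp
qed

lemma tor_diff_t: "x : carrier (F (Suc i)) ==> tor_diff A n P K i (t (Suc i) x) = t i (D i x)"
proof -
 assume x: "x : carrier (F (Suc i))"
 have "(id :: (nat multiset => 'a) set => _) : semilinear_maps R id K K" by (rule slinearI) simp_all
 from tensor_map_props(2)[OF tensorsFK tensorsFK F.R.ring_endo_id D_linear this x one_K_closed]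
 show ?thesis by (simp add: tor_diff_def t_def)
qed

lemma tensor_map_t:
 assumes "\<sigma> permutes {1..n}" "\<phi> : semilinear_maps R (perm_vars \<sigma>) (F i) (F i)" "x : carrier (F i)"
 shows "tensor_map R (F i) K (F i) K (perm_vars \<sigma>) \<phi> (gact K \<sigma>) (t i x) = t i (\<phi> x)"
 using tensor_map_props(2)[OF tensorsFK tensorsFK A.perm_vars_endo[OF R_cring assms(1)] assms(2)
   gact_K(1)[OF assms(1)] assms(3) one_K_closed] gact_K(2)[OF assms(1)] by (simp add: t_def)

lemma tor_grade_eq: "tor_grade A n P K i j = t i ` G i j"
proof -
 let ?H = "{pure_tensor R (F i) K x y | x y p q. x : G i p & y : grade K q & p + q = j}"
 have "?H <= t i ` G i j"
 proof
  fix u assume "u : ?H"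
  then obtain x y p q where u: "u = pure_tensor R (F i) K x y" "x : G i p" "y : grade K q" "p + q = j" by blast
  obtain f where f: "f : homog A n q" "y = J +>\<^bsub>reg\<^esub> f" using u(3) unfolding residue_simps by blast
  have "u = t i (f \<odot>\<^bsub>F i\<^esub> x)"
   unfolding u(1) f(2) coset_one[OF homog_closed[OF f(1)]]
   by (rule pure_t[OF F.gr_carrier[OF u(2)] homog_closed[OF f(1)]])
  moreover have "f \<odot>\<^bsub>F i\<^esub> x : G i j" using F.gr_homog[OF f(1) u(2)] u(4) by simp
  ultimately show "u : t i ` G i j" by blast
 qed
 moreover have "t i ` G i j <= ?H"
 proof
  fix u assume "u : t i ` G i j"
  then obtain x where x: "u = t i x" "x : G i j" by blast
  have "one_K : grade K 0" unfolding residue_simps one_K_def by (rule imageI[OF one_homog])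
  thus "u : ?H" using x unfolding t_def by (intro CollectI exI[of _ x] exI[of _ one_K] exI[of _ j] exI[of _ 0]) simp
 qed
 ultimately have H: "?H = t i ` G i j" by blast
 have sub: "subgroup (t i ` G i j) (add_monoid (T i))"
 proof (rule subgroup.intro)
  show "t i ` G i j <= carrier (add_monoid (T i))" using tD(1) F.gr_carrier by auto
  show "\<one>\<^bsub>add_monoid (T i)\<^esub> : t i ` G i j" using t_zero F.gr_closed(1) by (simp, metis image_eqI)
  fix u assume "u : t i ` G i j"
  then obtain x where x: "u = t i x" "x : G i j" by (rule imageE)
  show "inv\<^bsub>add_monoid (T i)\<^esub> u : t i ` G i j"
   using t_neg[OF F.gr_carrier[OF x(2)]] F.gr_closed(3)[OF x(2)] unfolding x(1) a_inv_def[symmetric] by (metis image_eqI)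
  fix w assume "w : t i ` G i j"
  then obtain y where y: "w = t i y" "y : G i j" by (rule imageE)
  show "u \<otimes>\<^bsub>add_monoid (T i)\<^esub> w : t i ` G i j"
   using tD(2)[OF F.gr_carrier[OF x(2)] F.gr_carrier[OF y(2)]] F.gr_closed(2)[OF x(2) y(2)]
   unfolding x(1) y(1) by (simp, metis image_eqI)
 qed
 show ?thesis unfolding tor_grade_def H
 proof
  show "generate (add_monoid (T i)) (t i ` G i j) <= t i ` G i j"
   by (rule group.generate_subgroup_incl[OF _ _ sub]) (use T.M.a_group in auto)
 qed (auto intro: generate.incl)
qed

abbreviation "bd i == tor_boundaries A n P K i"

lemma bd_eq: "bd i = (%z. t i (D i z)) ` carrier (F (Suc i))"
proof -
 have "carrier (T (Suc i)) = t (Suc i) ` carrier (F (Suc i))" using T_cases tD(1) by blast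
 thus ?thesis unfolding tor_boundaries_def by (auto simp: tor_diff_t image_image)
qed

lemma bd_submodule: "submodule (bd i) R (T i)"
proof -
 have lin: "(%z. t i (D i z)) : semilinear_maps R (%r. id (id r)) (F (Suc i)) (T i)"
  by (rule semilinear_comp[OF D_linear t_linear]) simp
 note L = slinearD[OF lin, unfolded id_apply]
 show ?thesis unfolding bd_eq
 proof (rule T.submoduleI)
  show "\<zero>\<^bsub>T i\<^esub> : (%z. t i (D i z)) ` carrier (F (Suc i))"
   using semilinear_zero[OF F.module_axioms T_module lin] by (metis F.M.zero_closed image_eqI)
  fix u assume "u : (%z. t i (D i z)) ` carrier (F (Suc i))"
  then obtain x where x: "u = t i (D i x)" "x : carrier (F (Suc i))" by (rule imageE)
  show "\<ominus>\<^bsub>T i\<^esub> u : (%z. t i (D i z)) ` carrier (F (Suc i))"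
   unfolding x(1) semilinear_minus[OF F.module_axioms T_module lin x(2), symmetric]
   by (rule imageI[OF F.M.a_inv_closed[OF x(2)]])
  show "r \<odot>\<^bsub>T i\<^esub> u : (%z. t i (D i z)) ` carrier (F (Suc i))" if "r : carrier R" for r
   unfolding x(1) L(3)[OF that x(2), symmetric] by (rule imageI[OF F.smult_closed[OF that x(2)]])
  fix w assume "w : (%z. t i (D i z)) ` carrier (F (Suc i))"
  then obtain y where y: "w = t i (D i y)" "y : carrier (F (Suc i))" by (rule imageE)
  show "u \<oplus>\<^bsub>T i\<^esub> w : (%z. t i (D i z)) ` carrier (F (Suc i))"
   unfolding x(1) y(1) L(2)[OF x(2) y(2), symmetric] by (rule imageI[OF F.M.a_closed[OF x(2) y(2)]])
 qed (use L(1) in auto)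
qed

interpretation Q: quotient R "T i" "bd i" for i
 by (rule quotientI[OF T_module bd_submodule])

definition cls :: "nat => 'f => ('f \<times> (nat multiset => 'a) set => nat multiset => 'a) set set" where
 "cls i x = bd i +>\<^bsub>T i\<^esub> t i x"

text \<open>Representatives in the resolution itself of the homogeneous cycles modulo the variables:
  the differential need not vanish, only its constant coefficients.\<close>

definition Z :: "nat => int => 'f set" where
 "Z i j = {x \<in> G i j. case i of 0 => True | Suc k => mP k (D k x)}"

abbreviation "TD i j == tor_degree A n P K i j"

lemma cycle_iff: "x : G i j ==> t i x : tor_cycles A n P K i \<longleftrightarrow> x : Z i j"
proof -
 assume x: "x : G i j"
 note xc = F.gr_carrier[OF x]
 show ?thesis
 proof (cases i)
  case 0
  thus ?thesis using x tD(1)[OF xc] by (simp add: tor_cycles_def Z_def)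
 next
  case (Suc k)
  have x': "x : G (Suc k) j" "x : carrier (F (Suc k))" using x xc Suc by auto
  have "t k (D k x) = \<zero>\<^bsub>T k\<^esub> \<longleftrightarrow> mP k (D k x)"
   using t_zero_imp[OF D.map_closed[OF x'(2)]] t_zero_if[OF D_gr[OF x'(1)]] by blast
  thus ?thesis using x x' tD(1)[OF xc] unfolding Suc by (simp add: tor_cycles_def Z_def tor_diff_t)
 qed
qed

lemma td_carrier: "carrier (TD i j) = cls i ` Z i j"
proof -
 have "tor_cycles A n P K i \<inter> t i ` G i j = t i ` Z i j"
 proof
  show "tor_cycles A n P K i \<inter> t i ` G i j <= t i ` Z i j" using cycle_iff by blast
  have "Z i j <= G i j" by (auto simp: Z_def)
  thus "t i ` Z i j <= tor_cycles A n P K i \<inter> t i ` G i j" using cycle_iff by blast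
 qed
 thus ?thesis
  by (simp add: tor_degree_def Let_def tor_grade_eq image_image cls_def)
qed

lemma Z_carrier: "x : Z i j ==> x : G i j" "x : Z i j ==> x : carrier (F i)"
 using F.gr_carrier by (auto simp: Z_def)

text \<open>In \<open>tor\<close> the quotient is formed inside the cycles, here inside all chains.
  The operations on cosets depend only on those of the ambient module and not on its carrier, so
  they agree.\<close>

lemma td_ops:
 "X \<oplus>\<^bsub>TD i j\<^esub> Y = X \<oplus>\<^bsub>Q.Q i\<^esub> Y" "\<zero>\<^bsub>TD i j\<^esub> = \<zero>\<^bsub>Q.Q i\<^esub>" "a \<odot>\<^bsub>TD i j\<^esub> X = const_poly A n a \<odot>\<^bsub>Q.Q i\<^esub> X"
 by (simp_all add: tor_degree_def tor_def Let_def quot_module_def set_add_def set_mult_def const_poly_def)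

lemma td_add: "x : carrier (F i) ==> y : carrier (F i) ==> cls i x \<oplus>\<^bsub>TD i j\<^esub> cls i y = cls i (x \<oplus>\<^bsub>F i\<^esub> y)"
 unfolding td_ops cls_def by (simp add: Q.quot_add tD)

lemma td_smult: "a : carrier A ==> x : carrier (F i) ==> a \<odot>\<^bsub>TD i j\<^esub> cls i x = cls i (const_poly A n a \<odot>\<^bsub>F i\<^esub> x)"
 unfolding td_ops cls_def by (simp add: Q.quot_smult tD A.const_poly_closed)

lemma td_zero: "\<zero>\<^bsub>TD i j\<^esub> = cls i \<zero>\<^bsub>F i\<^esub>"
 unfolding td_ops cls_def t_zero by (rule Q.quot_zero(1))

lemma td_act:
 assumes "\<sigma> permutes {1..n}" and \<phi>: "!!i. \<phi> i : semilinear_maps R (perm_vars \<sigma>) (F i) (F i)"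
  and \<phi>D: "!!i x. x : carrier (F (Suc i)) ==> D i (\<phi> (Suc i) x) = \<phi> i (D i x)"
  and x: "x : carrier (F i)"
 shows "quot_map (T i) (bd i) (tensor_map R (F i) K (F i) K (perm_vars \<sigma>) (\<phi> i) (gact K \<sigma>)) (cls i x)
  = cls i (\<phi> i x)"
proof -
 let ?f = "tensor_map R (F i) K (F i) K (perm_vars \<sigma>) (\<phi> i) (gact K \<sigma>)"
 have sl: "?f : semilinear_maps R (perm_vars \<sigma>) (T i) (T i)"
  unfolding tor_chains_def
  by (rule tensor_map_props(1)[OF tensorsFK tensorsFK A.perm_vars_endo[OF R_cring assms(1)] \<phi> gact_K(1)[OF assms(1)]])
 have "?f u : bd i" if u: "u : bd i" for u
 proof -
  obtain z where z: "u = t i (D i z)" "z : carrier (F (Suc i))" using u unfolding bd_eq by (rule imageE)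
  have "?f u = t i (D i (\<phi> (Suc i) z))"
   unfolding z(1) tensor_map_t[OF assms(1) \<phi> D.map_closed[OF z(2)]] \<phi>D[OF z(2)] by simp
  thus ?thesis unfolding bd_eq using slinearD(1)[OF \<phi> z(2)] by simp
 qed
 from quot_map_coset[OF T_module T_module bd_submodule bd_submodule slinearD(1,2)[OF sl] this tD(1)[OF x]]
 show ?thesis unfolding cls_def tensor_map_t[OF assms(1) \<phi> x] by simp
qed

text \<open>Equality after tensoring means equality of constant coefficients, so the question is
  pulled back to \<open>F i\<close>; the preimage of the boundary can be replaced by its component
  of degree \<open>j\<close>.\<close>

lemma cls_eq_iff:
 assumes x: "x : G i j" and y: "y : G i j"
 shows "cls i x = cls i y \<longleftrightarrow> (\<exists>z\<in>G (Suc i) j. mP i (x \<ominus>\<^bsub>F i\<^esub> y \<ominus>\<^bsub>F i\<^esub> D i z))"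
proof -
 note xc = F.gr_carrier[OF x] and yc = F.gr_carrier[OF y]
 note xy = F.gr_closed(4)[OF x y] and xyc = F.M.minus_closed[OF xc yc]
 have "cls i x = cls i y \<longleftrightarrow> t i (x \<ominus>\<^bsub>F i\<^esub> y) : bd i"
  unfolding cls_def Q.coset_eq_iff[OF tD(1)[OF xc] tD(1)[OF yc]] t_diff[OF xc yc] ..
 also have "... \<longleftrightarrow> (\<exists>z\<in>carrier (F (Suc i)). t i (x \<ominus>\<^bsub>F i\<^esub> y \<ominus>\<^bsub>F i\<^esub> D i z) = \<zero>\<^bsub>T i\<^esub>)"
 proof -
  have "t i (x \<ominus>\<^bsub>F i\<^esub> y \<ominus>\<^bsub>F i\<^esub> D i z) = \<zero>\<^bsub>T i\<^esub> \<longleftrightarrow> t i (x \<ominus>\<^bsub>F i\<^esub> y) = t i (D i z)"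
   if "z : carrier (F (Suc i))" for z
   unfolding t_diff[OF xyc D.map_closed[OF that]]
   by (rule T.M.diff_eq_zero_iff[OF tD(1)[OF xyc] tD(1)[OF D.map_closed[OF that]]])
  thus ?thesis unfolding bd_eq by auto
 qed
 also have "... \<longleftrightarrow> (\<exists>z\<in>G (Suc i) j. mP i (x \<ominus>\<^bsub>F i\<^esub> y \<ominus>\<^bsub>F i\<^esub> D i z))"
 proof
  assume "\<exists>z\<in>carrier (F (Suc i)). t i (x \<ominus>\<^bsub>F i\<^esub> y \<ominus>\<^bsub>F i\<^esub> D i z) = \<zero>\<^bsub>T i\<^esub>"
  then obtain z where z: "z : carrier (F (Suc i))" "t i (x \<ominus>\<^bsub>F i\<^esub> y \<ominus>\<^bsub>F i\<^esub> D i z) = \<zero>\<^bsub>T i\<^esub>" ..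
  show "\<exists>z\<in>G (Suc i) j. mP i (x \<ominus>\<^bsub>F i\<^esub> y \<ominus>\<^bsub>F i\<^esub> D i z)"
   by (rule D.graded_preimage_mod[OF xy z(1)])
    (use t_zero_imp[OF F.M.minus_closed[OF xyc D.map_closed[OF z(1)]] z(2)] in blast)
 next
  assume "\<exists>z\<in>G (Suc i) j. mP i (x \<ominus>\<^bsub>F i\<^esub> y \<ominus>\<^bsub>F i\<^esub> D i z)"
  then obtain z where z: "z : G (Suc i) j" "mP i (x \<ominus>\<^bsub>F i\<^esub> y \<ominus>\<^bsub>F i\<^esub> D i z)" ..
  show "\<exists>z\<in>carrier (F (Suc i)). t i (x \<ominus>\<^bsub>F i\<^esub> y \<ominus>\<^bsub>F i\<^esub> D i z) = \<zero>\<^bsub>T i\<^esub>"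
  proof (rule bexI[of _ z])
   show "t i (x \<ominus>\<^bsub>F i\<^esub> y \<ominus>\<^bsub>F i\<^esub> D i z) = \<zero>\<^bsub>T i\<^esub>"
    by (rule t_zero_if[OF F.gr_closed(4)[OF xy D_gr[OF z(1)]] z(2)])
  qed (rule F.gr_carrier[OF z(1)])
 qed
 finally show ?thesis .
qed

subsection \<open>Comparison with Koszul cycles\<close>

definition W :: "nat => int => (nat list => 'i) set" where
 "W i j = {w \<in> chI i j. \<forall>l. dI' w l = \<zero>\<^bsub>I\<^esub>}"

abbreviation "rel i j x w == zig j i 0 (point i x) w"

lemma rel_ex: "x : Z i j ==> \<exists>w\<in>W i j. rel i j x w"
proof -
 assume x: "x : Z i j"
 note xG = Z_carrier(1)[OF x]
 note pc = point_chain[OF xG]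
 have cyc: "diff_cycle i (point i x)"
  using \<epsilon>.map_zero D.map_zero kdiff_point[OF xG] by (cases i) (simp_all add: diff_cycle_def)
 have "mP (i - 1) (D (i - 1) (point i x []))" if "0 < i"
  using x that by (cases i) (simp_all add: Z_def point_def)
 then obtain w where w: "rel i j x w" "!!l. dI' w l = \<zero>\<^bsub>I\<^esub>" using zig_ex[OF pc cyc] by auto
 moreover have "w : chI i j" using zig_chain[OF pc w(1)] by simp
 ultimately show ?thesis unfolding W_def by blast
qed

lemma rel_ex_inv: "w : W i j ==> \<exists>x\<in>Z i j. rel i j x w"
proof -
 assume w: "w : W i j"
 then obtain c where c: "c : ch i 0 j" "zig j i 0 c w" using zig_ex_inv[of w i 0 j] by (auto simp: W_def)
 have p: "c = point i (c [])" by (rule chain_point[OF c(1)])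
 have "c [] : G i j" using F.kchainsD(2)[OF c(1), of "[]"] by simp
 moreover have "mP k (D k (c []))" if "i = Suc k" for k
 proof -
  obtain c' where "c' : ch k (Suc 0) j" "D k (c []) = d k c' []" using c(2) \<open>i = Suc k\<close> by auto
  thus ?thesis using kdiff_empty_mP by metis
 qed
 ultimately have "c [] : Z i j" unfolding Z_def by (cases i) simp_all
 thus ?thesis using c(2) p by metis
qed

lemma point_add:
 "x : carrier (F i) ==> y : carrier (F i) ==> point i (x \<oplus>\<^bsub>F i\<^esub> y) = (%l. point i x l \<oplus>\<^bsub>F i\<^esub> point i y l)"
 "x : carrier (F i) ==> y : carrier (F i) ==> point i (x \<ominus>\<^bsub>F i\<^esub> y) = (%l. point i x l \<ominus>\<^bsub>F i\<^esub> point i y l)"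
 by (auto simp: point_def fun_eq_iff a_minus_def)

lemma Z_add: "x : Z i j ==> y : Z i j ==> x \<oplus>\<^bsub>F i\<^esub> y : Z i j"
proof (cases i)
 case (Suc k)
 assume "x : Z i j" "y : Z i j"
 hence x: "x : G (Suc k) j" "mP k (D k x)" and y: "y : G (Suc k) j" "mP k (D k y)"
  using Suc by (simp_all add: Z_def)
 note xc = F.gr_carrier[OF x(1)] and yc = F.gr_carrier[OF y(1)]
 have "mP k (D k (x \<oplus>\<^bsub>F (Suc k)\<^esub> y))"
  unfolding D.map_add[OF xc yc] F.coord_add[OF D.map_closed[OF xc] D.map_closed[OF yc]] using x(2) y(2) by simp
 thus ?thesis using x(1) y(1) Suc by (simp add: Z_def F.gr_closed)
qed (simp add: Z_def F.gr_closed)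

lemma rel_add:
 assumes "x : Z i j" "y : Z i j" "rel i j x w" "rel i j y v"
 shows "rel i j (x \<oplus>\<^bsub>F i\<^esub> y) (%l. w l \<oplus>\<^bsub>I\<^esub> v l)" "rel i j (x \<ominus>\<^bsub>F i\<^esub> y) (%l. w l \<ominus>\<^bsub>I\<^esub> v l)"
 using zig_add[OF point_chain[OF Z_carrier(1)[OF assms(1)]] point_chain[OF Z_carrier(1)[OF assms(2)]] assms(3,4)]
 unfolding point_add[OF Z_carrier(2)[OF assms(1)] Z_carrier(2)[OF assms(2)]] by blast+

text \<open>Zigzags subtract, so the question concerns a single zigzag from the difference. An
  element of \<open>F i\<close> bounds modulo the variables exactly if, as a point, it is the sum of
  a resolution boundary and a Koszul boundary; this is the condition in \<open>zig_boundary\<close>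
  and its converse.\<close>

lemma rel_cls:
 assumes x: "x : Z i j" and y: "y : Z i j" and "rel i j x w" "rel i j y v"
 shows "cls i x = cls i y \<longleftrightarrow> (\<exists>u\<in>chI (Suc i) j. \<forall>l. dI' u l = w l \<ominus>\<^bsub>I\<^esub> v l)"
proof -
 note xG = Z_carrier(1)[OF x] and yG = Z_carrier(1)[OF y]
 let ?x = "x \<ominus>\<^bsub>F i\<^esub> y"
 have xyG: "?x : G i j" by (rule F.gr_closed(4)[OF xG yG])
 note pc = point_chain[OF xyG] and rel = rel_add(2)[OF assms]
 show ?thesis unfolding cls_eq_iff[OF xG yG]
 proof
  assume "\<exists>z\<in>G (Suc i) j. mP i (?x \<ominus>\<^bsub>F i\<^esub> D i z)"
  then obtain z where z: "z : G (Suc i) j" "mP i (?x \<ominus>\<^bsub>F i\<^esub> D i z)" ..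
  have Dz: "D i z : G i j" by (rule D_gr[OF z(1)])
  obtain e' where e': "e' : ch i 1 j" "!!l. d i e' l = point i (?x \<ominus>\<^bsub>F i\<^esub> D i z) l"
   using mP_boundary[OF F.gr_closed(4)[OF xyG Dz] z(2)] by auto
  have eq: "point i ?x l = D i (point (Suc i) z l) \<oplus>\<^bsub>F i\<^esub> d i e' l" for l
  proof -
   have "?x = D i z \<oplus>\<^bsub>F i\<^esub> (?x \<ominus>\<^bsub>F i\<^esub> D i z)"
    using F.gr_carrier[OF xyG] F.gr_carrier[OF Dz]
    by (simp only: F.M.a_comm[of "D i z"] F.M.minus_closed) (simp add: a_minus_def F.M.a_assoc F.M.l_neg)
   thus ?thesis unfolding e'(2) by (auto simp: point_def D.map_zero)
  qed
  show "\<exists>u\<in>chI (Suc i) j. \<forall>l. dI' u l = w l \<ominus>\<^bsub>I\<^esub> v l"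
   using zig_boundary_inv[OF pc rel point_chain[OF z(1)] e'(1)[unfolded One_nat_def] eq] by simp
 next
  assume "\<exists>u\<in>chI (Suc i) j. \<forall>l. dI' u l = w l \<ominus>\<^bsub>I\<^esub> v l"
  then obtain u where u: "u : chI (Suc i) j" "!!l. dI' u l = w l \<ominus>\<^bsub>I\<^esub> v l" by blast
  obtain e e' where e: "e : ch (Suc i) 0 j" "e' : ch i (Suc 0) j"
   "!!l. point i ?x l = D i (e l) \<oplus>\<^bsub>F i\<^esub> d i e' l"
   using zig_boundary[OF pc rel, of u] u by auto
  have ec: "e [] : G (Suc i) j" using F.kchainsD(2)[OF e(1), of "[]"] by simp
  note Dc = D.map_closed[OF F.gr_carrier[OF ec]] and dc = F.kchainsD(3)[OF F.kdiff_chain[OF e(2)], of "[]"]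
  have "?x = D i (e []) \<oplus>\<^bsub>F i\<^esub> d i e' []" using e(3)[of "[]"] by (simp add: point_def)
  hence "?x \<ominus>\<^bsub>F i\<^esub> D i (e []) = d i e' []"
   using Dc dc by (simp add: a_minus_def F.M.a_ac F.M.r_neg2 F.M.r_neg1) 
    (metis F.M.a_assoc F.M.a_comm F.M.a_inv_closed F.M.r_neg F.M.r_zero)
  hence "mP i (?x \<ominus>\<^bsub>F i\<^esub> D i (e []))" using kdiff_empty_mP[OF e(2)] by simp
  thus "\<exists>z\<in>G (Suc i) j. mP i (?x \<ominus>\<^bsub>F i\<^esub> D i z)" using ec by (rule bexI)
 qed
qed

lemma D_const: "a : carrier A ==> x : carrier (F (Suc i)) ==>
  D i (const_poly A n a \<odot>\<^bsub>F (Suc i)\<^esub> x) = const_poly A n a \<odot>\<^bsub>F i\<^esub> D i x"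
 using slinearD(3)[OF D_linear A.const_poly_closed] by simp

lemma Z_const: "a : carrier A ==> x : Z i j ==> const_poly A n a \<odot>\<^bsub>F i\<^esub> x : Z i j"
proof (cases i)
 case (Suc k)
 assume a: "a : carrier A" and "x : Z i j"
 hence x: "x : G (Suc k) j" "mP k (D k x)" using Suc by (simp_all add: Z_def)
 note xc = F.gr_carrier[OF x(1)]
 have "mP k (D k (const_poly A n a \<odot>\<^bsub>F (Suc k)\<^esub> x))"
  unfolding D_const[OF a xc] F.coord_const[OF a D.map_closed[OF xc]] using x(2) a by simp
 thus ?thesis using x(1) a Suc by (simp add: Z_def F.gr_closed)
qed (simp add: Z_def F.gr_closed)

lemma rel_act:
 assumes \<phi>: "!!i. graded_map A n (F i) (G i) (\<psi> i) {(b, m). b : B i & set_mset m <= {1..n}} (dg i)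
   (F i) (G i) (\<psi> i) {(b, m). b : B i & set_mset m <= {1..n}} (dg i) (\<phi> i) \<sigma>"
  and \<phi>D: "!!i x. x : carrier (F (Suc i)) ==> D i (\<phi> (Suc i) x) = \<phi> i (D i x)"
  and \<phi>\<epsilon>: "!!x. x : carrier (F 0) ==> res_aug P (\<phi> 0 x) = act (res_aug P x)"
  and x: "x : Z i j" and w: "rel i j x w"
 shows "rel i j (\<phi> i x) (%l. act (w (map (inv' \<sigma>) l)))"
proof -
 have "(%l. \<phi> i (point i x (map (inv' \<sigma>) l))) = point i (\<phi> i x)"
  using graded_map.map_zero[OF \<phi>, of i] by (auto simp: point_def)
 thus ?thesis using zig_act[where \<phi> = \<phi> and \<sigma> = \<sigma> and act = act, OF \<phi> \<phi>D \<phi>\<epsilon> point_chain[OF Z_carrier(1)[OF x]] w] by simp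
qed

lemma rel_const:
 assumes a: "a : carrier A" and x: "x : Z i j" and w: "rel i j x w"
 shows "rel i j (const_poly A n a \<odot>\<^bsub>F i\<^esub> x) (%l. const_poly A n a \<odot>\<^bsub>I\<^esub> w l)"
 using rel_act[where \<phi> = "%i x. const_poly A n a \<odot>\<^bsub>F i\<^esub> x" and \<sigma> = id and act = "%x. const_poly A n a \<odot>\<^bsub>I\<^esub> x",
   OF F.const_graded_map[OF a] D_const[OF a] _ x w]
  slinearD(3)[OF \<epsilon>_linear A.const_poly_closed[OF a]] by simp

text \<open>The description denotes a cycle under the assumption of the context below: without
  nonzero Koszul chains in degree \<open>Suc i\<close> there are no boundaries, so the end of the
  zigzag is determined by the class and not only up to homology.\<close>

definition tor_map :: "nat => int => _ => nat list => 'i" where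
 "tor_map i j X = (THE w. \<exists>x\<in>Z i j. X = cls i x & w : W i j & rel i j x w)"

lemma W_map:
 assumes "graded_map A n I gI \<psi>I SI dI I gI \<psi>I SI dI act \<sigma>" "w : W i j"
 shows "(%l. act (w (map (inv' \<sigma>) l))) : W i j"
proof -
 have w: "w : chI i j" "!!l. dI' w l = \<zero>\<^bsub>I\<^esub>" using assms(2) by (auto simp: W_def)
 show ?thesis
  using graded_map.map_chain[OF assms(1) w(1)] graded_map.kdiff_map[OF assms(1) w(1)] graded_map.map_zero[OF assms(1)] w(2)
  by (simp add: W_def)
qed

lemma W_chain: "w : W i j ==> w : chI i j"
 by (simp add: W_def)

context
 fixes i j
 assumes top: "!!u. u : chI (Suc i) j ==> u = (%l. \<zero>\<^bsub>I\<^esub>)"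
begin

lemma dI_zero: "dI' (%l. \<zero>\<^bsub>I\<^esub>) l = \<zero>\<^bsub>I\<^esub>"
proof -
 have "dI' (%l. \<zero>\<^bsub>I\<^esub>) l = (\<Oplus>\<^bsub>I\<^esub>k\<in>{1..n}. \<zero>\<^bsub>I\<^esub>)"
  unfolding kdiff_def by (rule I.M.finsum_cong') (auto simp: A.var_closed)
 thus ?thesis by (simp only: I.M.finsum_zero)
qed

lemma zero_chainI: "(%l. \<zero>\<^bsub>I\<^esub>) : chI b k"
 by (rule I.kchainsI) (auto intro!: altI I.gr_closed)

lemma cls_eq_top:
 assumes "x : Z i j" "y : Z i j" "rel i j x w" "rel i j y v" "w : W i j" "v : W i j"
 shows "cls i x = cls i y \<longleftrightarrow> w = v"
proof -
 note wc = I.kchainsD(3)[OF W_chain[OF assms(5)]] and vc = I.kchainsD(3)[OF W_chain[OF assms(6)]]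
 have "(\<exists>u\<in>chI (Suc i) j. \<forall>l. dI' u l = w l \<ominus>\<^bsub>I\<^esub> v l) \<longleftrightarrow> (\<forall>l. w l \<ominus>\<^bsub>I\<^esub> v l = \<zero>\<^bsub>I\<^esub>)"
  using top zero_chainI dI_zero by metis
 also have "... \<longleftrightarrow> w = v" using I.M.diff_eq_zero_iff[OF wc vc] by (auto simp: fun_eq_iff)
 finally show ?thesis unfolding rel_cls[OF assms(1-4)] .
qed

lemma tor_map:
 assumes x: "x : Z i j" and w: "w : W i j" "rel i j x w" shows "tor_map i j (cls i x) = w"
 unfolding tor_map_def
proof (rule the_equality)
 show "\<exists>y\<in>Z i j. cls i x = cls i y & w : W i j & rel i j y w" using assms by blast
 fix v assume "\<exists>y\<in>Z i j. cls i x = cls i y & v : W i j & rel i j y v"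
 then obtain y where y: "y : Z i j" "cls i x = cls i y" "v : W i j" "rel i j y v" by blast
 show "v = w" using cls_eq_top[OF x y(1) w(2) y(4) w(1) y(3)] y(2) by simp
qed

lemma tor_map_ex: "x : Z i j ==> tor_map i j (cls i x) : W i j & rel i j x (tor_map i j (cls i x))"
 using rel_ex[of x i j] tor_map by auto

lemma tor_map_bij: "bij_betw (tor_map i j) (carrier (TD i j)) (W i j)"
proof (rule bij_betw_imageI)
 show "inj_on (tor_map i j) (carrier (TD i j))"
 proof (rule inj_onI)
  fix X Y assume "X : carrier (TD i j)" "Y : carrier (TD i j)" and eq: "tor_map i j X = tor_map i j Y"
  then obtain x y where x: "X = cls i x" "x : Z i j" and y: "Y = cls i y" "y : Z i j"
   unfolding td_carrier by blast
  show "X = Y" using cls_eq_top[OF x(2) y(2)] tor_map_ex[OF x(2)] tor_map_ex[OF y(2)] eq x y by metis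
 qed
 show "tor_map i j ` carrier (TD i j) = W i j"
 proof (intro equalityI subsetI)
  fix w assume w: "w : W i j"
  obtain x where "x : Z i j" "rel i j x w" using rel_ex_inv[OF w] by blast
  thus "w : tor_map i j ` carrier (TD i j)" unfolding td_carrier image_image using tor_map w by (metis image_eqI)
 qed (use tor_map_ex in "auto simp: td_carrier")
qed

lemma tor_map_add:
 assumes "X : carrier (TD i j)" "Y : carrier (TD i j)"
 shows "X \<oplus>\<^bsub>TD i j\<^esub> Y : carrier (TD i j)"
  "tor_map i j (X \<oplus>\<^bsub>TD i j\<^esub> Y) = (%l. tor_map i j X l \<oplus>\<^bsub>I\<^esub> tor_map i j Y l)"
proof -
 obtain x y where x: "X = cls i x" "x : Z i j" and y: "Y = cls i y" "y : Z i j"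
  using assms unfolding td_carrier by blast
 have XY: "X \<oplus>\<^bsub>TD i j\<^esub> Y = cls i (x \<oplus>\<^bsub>F i\<^esub> y)"
  unfolding x(1) y(1) by (rule td_add[OF Z_carrier(2)[OF x(2)] Z_carrier(2)[OF y(2)]])
 note xy = Z_add[OF x(2) y(2)]
 show "X \<oplus>\<^bsub>TD i j\<^esub> Y : carrier (TD i j)" unfolding XY td_carrier by (rule imageI[OF xy])
 let ?w = "%l. tor_map i j X l \<oplus>\<^bsub>I\<^esub> tor_map i j Y l"
 have wx: "tor_map i j X : W i j" "rel i j x (tor_map i j X)" and wy: "tor_map i j Y : W i j" "rel i j y (tor_map i j Y)"
  using tor_map_ex[OF x(2)] tor_map_ex[OF y(2)] unfolding x(1) y(1) by blast+
 have "dI' ?w l = \<zero>\<^bsub>I\<^esub>" for l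
  using I.kdiff_chains_additive(1)[OF W_chain[OF wx(1)] W_chain[OF wy(1)], of l] wx(1) wy(1) by (simp add: W_def)
 hence "?w : W i j" using I.kchains_add(1)[OF W_chain[OF wx(1)] W_chain[OF wy(1)]] by (simp add: W_def)
 thus "tor_map i j (X \<oplus>\<^bsub>TD i j\<^esub> Y) = ?w"
  unfolding XY by (rule tor_map[OF xy _ rel_add(1)[OF x(2) y(2) wx(2) wy(2)]])
qed

lemma tor_map_zero: "\<zero>\<^bsub>TD i j\<^esub> : carrier (TD i j)" "tor_map i j \<zero>\<^bsub>TD i j\<^esub> = (%l. \<zero>\<^bsub>I\<^esub>)"
proof -
 have z: "\<zero>\<^bsub>F i\<^esub> : Z i j"
  by (cases i) (simp_all add: Z_def F.gr_closed D.map_zero F.coord_zero)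
 show "\<zero>\<^bsub>TD i j\<^esub> : carrier (TD i j)" unfolding td_zero td_carrier by (rule imageI[OF z])
 have ex: "tor_map i j (cls i \<zero>\<^bsub>F i\<^esub>) : W i j" "rel i j \<zero>\<^bsub>F i\<^esub> (tor_map i j (cls i \<zero>\<^bsub>F i\<^esub>))"
  using tor_map_ex[OF z] by auto
 let ?w = "tor_map i j (cls i \<zero>\<^bsub>F i\<^esub>)"
 have "rel i j (\<zero>\<^bsub>F i\<^esub> \<ominus>\<^bsub>F i\<^esub> \<zero>\<^bsub>F i\<^esub>) (%l. ?w l \<ominus>\<^bsub>I\<^esub> ?w l)" by (rule rel_add(2)[OF z z ex(2) ex(2)])
 moreover have "\<zero>\<^bsub>F i\<^esub> \<ominus>\<^bsub>F i\<^esub> \<zero>\<^bsub>F i\<^esub> = \<zero>\<^bsub>F i\<^esub>" by (simp add: F.M.diff_eq_zero_iff)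
 moreover have "(%l. ?w l \<ominus>\<^bsub>I\<^esub> ?w l) = (%l. \<zero>\<^bsub>I\<^esub>)"
  by (intro ext) (simp add: I.M.diff_eq_zero_iff I.kchainsD(3)[OF W_chain[OF ex(1)]])
 ultimately have "rel i j \<zero>\<^bsub>F i\<^esub> (%l. \<zero>\<^bsub>I\<^esub>)" by simp
 moreover have "(%l. \<zero>\<^bsub>I\<^esub>) : W i j" using zero_chainI dI_zero by (simp add: W_def)
 ultimately show "tor_map i j \<zero>\<^bsub>TD i j\<^esub> = (%l. \<zero>\<^bsub>I\<^esub>)" unfolding td_zero using tor_map[OF z] by blast
qed

lemma tor_map_smult:
 assumes a: "a : carrier A" and "X : carrier (TD i j)"
 shows "a \<odot>\<^bsub>TD i j\<^esub> X : carrier (TD i j)"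
  "tor_map i j (a \<odot>\<^bsub>TD i j\<^esub> X) = (%l. const_poly A n a \<odot>\<^bsub>I\<^esub> tor_map i j X l)"
proof -
 obtain x where x: "X = cls i x" "x : Z i j" using assms unfolding td_carrier by blast
 have aX: "a \<odot>\<^bsub>TD i j\<^esub> X = cls i (const_poly A n a \<odot>\<^bsub>F i\<^esub> x)"
  unfolding x(1) by (rule td_smult[OF a Z_carrier(2)[OF x(2)]])
 note ax = Z_const[OF a x(2)]
 show "a \<odot>\<^bsub>TD i j\<^esub> X : carrier (TD i j)" unfolding aX td_carrier by (rule imageI[OF ax])
 have wx: "tor_map i j X : W i j" "rel i j x (tor_map i j X)"
  using tor_map_ex[OF x(2)] unfolding x(1) by blast+
 obtain v where v: "v : W i j" "rel i j (const_poly A n a \<odot>\<^bsub>F i\<^esub> x) v" using rel_ex[OF ax] by blast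
 have "(%l. const_poly A n a \<odot>\<^bsub>I\<^esub> tor_map i j X l) = v"
  using cls_eq_top[OF ax ax rel_const[OF a x(2) wx(2)] v(2) _ v(1)] W_map[OF I.const_graded_map[OF a] wx(1)] by simp
 thus "tor_map i j (a \<odot>\<^bsub>TD i j\<^esub> X) = (%l. const_poly A n a \<odot>\<^bsub>I\<^esub> tor_map i j X l)"
  unfolding aX using tor_map[OF ax v] by simp
qed

lemma tor_map_act:
 assumes \<sigma>: "\<sigma> permutes {1..n}" and \<phi>: "!!i. \<phi> i : semilinear_maps R (perm_vars \<sigma>) (F i) (F i)"
  and \<phi>G: "!!i j x. x : G i j ==> \<phi> i x : G i j"
  and \<phi>D: "!!i x. x : carrier (F (Suc i)) ==> D i (\<phi> (Suc i) x) = \<phi> i (D i x)"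
  and \<phi>\<epsilon>: "!!x. x : carrier (F 0) ==> res_aug P (\<phi> 0 x) = act (res_aug P x)"
  and act: "graded_map A n I gI \<psi>I SI dI I gI \<psi>I SI dI act \<sigma>"
  and X: "X : carrier (TD i j)"
 defines "Y == quot_map (T i) (bd i) (tensor_map R (F i) K (F i) K (perm_vars \<sigma>) (\<phi> i) (gact K \<sigma>)) X"
 shows "Y : carrier (TD i j)" "tor_map i j Y = (%l. act (tor_map i j X (map (inv' \<sigma>) l)))"
proof -
 obtain x where x: "X = cls i x" "x : Z i j" using X unfolding td_carrier by blast
 have Y: "Y = cls i (\<phi> i x)" unfolding Y_def x(1) by (rule td_act[OF \<sigma> \<phi> \<phi>D Z_carrier(2)[OF x(2)]])
 have gm: "graded_map A n (F i) (G i) (\<psi> i) {(b, m). b : B i & set_mset m <= {1..n}} (dg i)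
   (F i) (G i) (\<psi> i) {(b, m). b : B i & set_mset m <= {1..n}} (dg i) (\<phi> i) \<sigma>" for i
  by (intro graded_map.intro F.coord_module_axioms graded_map_axioms.intro)
   (use slinearD[OF \<phi>] \<phi>G \<sigma> A.var_closed in "simp_all add: perm_vars_var[OF \<sigma>]")
 \<comment> \<open>Elements with vanishing constant coefficients are those sent to zero by
   \<open>t k\<close>, and the lift induces a map on the tensor product.\<close>
 have mP: "mP k (\<phi> k y)" if y: "y : G k j" "mP k y" for k y
 proof (rule t_zero_imp)
  note yc = F.gr_carrier[OF y(1)]
  show "\<phi> k y : carrier (F k)" by (rule slinearD(1)[OF \<phi> yc])
  let ?f = "tensor_map R (F k) K (F k) K (perm_vars \<sigma>) (\<phi> k) (gact K \<sigma>)"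
  have sl: "?f : semilinear_maps R (perm_vars \<sigma>) (T k) (T k)"
   unfolding tor_chains_def
   by (rule tensor_map_props(1)[OF tensorsFK tensorsFK A.perm_vars_endo[OF R_cring \<sigma>] \<phi> gact_K(1)[OF \<sigma>]])
  have "t k (\<phi> k y) = ?f (t k y)" using tensor_map_t[OF \<sigma> \<phi> yc] by simp
  also have "... = \<zero>\<^bsub>T k\<^esub>" unfolding t_zero_if[OF y] by (rule semilinear_zero[OF T_module T_module sl])
  finally show "t k (\<phi> k y) = \<zero>\<^bsub>T k\<^esub>" .
 qed
 have \<phi>x: "\<phi> i x : Z i j"
 proof (cases i)
  case 0
  thus ?thesis using x(2) \<phi>G by (simp add: Z_def)
 next
  case (Suc k)
  hence xk: "x : G (Suc k) j" "mP k (D k x)" using x(2) by (simp_all add: Z_def)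
  have "mP k (D k (\<phi> (Suc k) x))" unfolding \<phi>D[OF F.gr_carrier[OF xk(1)]] by (rule mP[OF D_gr[OF xk(1)] xk(2)])
  thus ?thesis using \<phi>G[OF xk(1)] Suc by (simp add: Z_def)
 qed
 show "Y : carrier (TD i j)" unfolding Y td_carrier by (rule imageI[OF \<phi>x])
 have wx: "tor_map i j X : W i j" "rel i j x (tor_map i j X)"
  using tor_map_ex[OF x(2)] unfolding x(1) by blast+
 show "tor_map i j Y = (%l. act (tor_map i j X (map (inv' \<sigma>) l)))"
  unfolding Y
  by (rule tor_map[OF \<phi>x W_map[OF act wx(1)] rel_act[where act = act, OF gm \<phi>D \<phi>\<epsilon> x(2) wx(2)]])
qed

end

text \<open>Zigzags from any class and from the zero class end in cycles whose difference bounds by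
  assumption, so the two classes coincide.\<close>

lemma tor_trivial:
 assumes "!!w. w : W i j ==> \<exists>u\<in>chI (Suc i) j. \<forall>l. dI' u l = w l"
 shows "carrier (TD i j) = {\<zero>\<^bsub>TD i j\<^esub>}"
proof -
 have z: "\<zero>\<^bsub>F i\<^esub> : Z i j"
  by (cases i) (simp_all add: Z_def F.gr_closed D.map_zero F.coord_zero)
 have "cls i x = cls i \<zero>\<^bsub>F i\<^esub>" if x: "x : Z i j" for x
 proof -
  obtain w v where w: "w : W i j" "rel i j x w" and v: "v : W i j" "rel i j \<zero>\<^bsub>F i\<^esub> v"
   using rel_ex[OF x] rel_ex[OF z] by blast
  have "dI' (%l. w l \<ominus>\<^bsub>I\<^esub> v l) l = \<zero>\<^bsub>I\<^esub>" for l
   using I.kdiff_chains_additive(2)[OF W_chain[OF w(1)] W_chain[OF v(1)], of l] w(1) v(1)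
   by (simp add: W_def I.M.diff_eq_zero_iff)
  hence "(%l. w l \<ominus>\<^bsub>I\<^esub> v l) : W i j"
   using I.kchains_add(2)[OF W_chain[OF w(1)] W_chain[OF v(1)]] by (simp add: W_def)
  thus ?thesis using rel_cls[OF x z w(2) v(2)] assms by blast
 qed
 thus ?thesis unfolding td_carrier td_zero using z by blast
qed

end

section \<open>Koszul cycles of squarefree multidegree\<close>

context abelian_group
begin

text \<open>Rearranging the entries of a list changes the value at most by a sign.\<close>

lemma alternating_zero_iff:
 assumes c: "alternating G c" and eq: "mset l = mset (l' :: nat list)"
 shows "c l = \<zero> \<longleftrightarrow> c l' = \<zero>"
proof -
 have *: "c l = \<zero> \<longleftrightarrow> ~ distinct l | c (sort l) = \<zero>" for l
 proof -
  have "c l = alt_ext G c l"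
   by (rule alternating_eq_sorted[OF c alt_ext_alternating[OF altD(1)[OF c]]])
    (simp add: alt_ext_sorted)
  moreover have "\<ominus> c (sort l) = \<zero> \<longleftrightarrow> c (sort l) = \<zero>"
   using altD(1)[OF c, of "sort l"] by (metis minus_minus neg_zero)
  ultimately show ?thesis by (simp add: alt_ext_def)
 qed
 have "distinct l \<longleftrightarrow> distinct l'" "sort l = sort l'"
  using eq by (metis mset_eq_imp_distinct_iff, metis properties_for_sort sorted_sort mset_sort)
 thus ?thesis using *[of l] *[of l'] by simp
qed

lemma kosz_cong:
 "(!!k. k : K ==> k \<in># m ==> c (k # l) (m - {#k#}) = c' (k # l) (m - {#k#})) ==>
 (!!l m. c' l m : carrier G) ==> kosz G K c l m = kosz G K c' l m"
 unfolding kosz_def by (rule finsum_cong') auto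

lemma kosz_add:
 assumes "!!l m. c l m : carrier G" "!!l m. c' l m : carrier G"
 shows "kosz G K (%l m. c l m \<oplus> c' l m) l m = kosz G K c l m \<oplus> kosz G K c' l m"
 unfolding kosz_def by (rule finsum_addf) (use assms in auto)

lemma kosz_additive:
 assumes K: "finite K" and H: "abelian_group H" and c: "!!l m. c l m : carrier G"
  and f: "!!x. x : carrier G ==> f x : carrier H" "!!x y. x : carrier G ==> y : carrier G ==> f (x \<oplus> y) = f x \<oplus>\<^bsub>H\<^esub> f y"
 shows "kosz H K (%l m. f (c l m)) l m = f (kosz G K c l m)"
 unfolding kosz_def
 by (rule additive_finsum[OF abelian_group_axioms H f, symmetric]) (use K c in auto)

lemma kosz_minus:
 assumes "finite K" "!!l m. c l m : carrier G"
 shows "kosz G K (%l m. \<ominus> c l m) l m = \<ominus> kosz G K c l m"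
 by (rule kosz_additive[OF assms(1) abelian_group_axioms assms(2)]) (auto simp: minus_add)

lemma kosz_null: "kosz G K (%l m. \<zero>) l m = \<zero>"
 unfolding kosz_def by (rule finsum_zero)

lemma kosz_finsum:
 assumes "finite I" "!!i l m. i : I ==> c i l m : carrier G"
 shows "kosz G K (%l m. \<Oplus>i\<in>I. c i l m) l m = (\<Oplus>i\<in>I. kosz G K (c i) l m)"
 using assms
proof (induction I)
 case (insert i I)
 have "kosz G K (%l m. \<Oplus>j\<in>insert i I. c j l m) l m = kosz G K (%l m. c i l m \<oplus> (\<Oplus>j\<in>I. c j l m)) l m"
  using insert by (intro kosz_cong) (simp_all add: Pi_iff)
 also have "... = kosz G K (c i) l m \<oplus> kosz G K (%l m. \<Oplus>j\<in>I. c j l m) l m"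
  using insert by (intro kosz_add) auto
 finally show ?case using insert by (simp add: Pi_iff kosz_closed)
qed (simp add: kosz_null)

lemma kosz_alternating:
 assumes K: "finite K" and c: "!!m. alternating G (%l. c l m)"
 shows "alternating G (%l. kosz G K c l m)"
proof (rule altI)
 have cl: "c l m : carrier G" for l m by (rule altD(1)[OF c])
 show "kosz G K c l m : carrier G" for l by (rule kosz_closed) (rule cl)
 fix u v :: "nat list" and a b :: nat
 have "c (k # u @ a # a # v) m' = \<zero>" for k m' using altD(2)[OF c, of "k # u" a v] by simp
 hence "kosz G K c (u @ a # a # v) m = kosz G K (%l m. \<zero>) (u @ a # a # v) m" by (intro kosz_cong) auto
 thus "kosz G K c (u @ a # a # v) m = \<zero>" by (simp add: kosz_null)
 have "c (k # u @ a # b # v) m' = \<ominus> c (k # u @ b # a # v) m'" for k m'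
  using altD(3)[OF c, of "k # u" a b v m'] by simp
 hence "kosz G K c (u @ a # b # v) m = kosz G K (%l m. \<ominus> c l m) (u @ b # a # v) m"
  unfolding kosz_def using cl by (intro finsum_cong') auto
 thus "kosz G K c (u @ a # b # v) m = \<ominus> kosz G K c (u @ b # a # v) m"
  using kosz_minus[OF K cl] by simp
qed

lemma kosz_single:
 assumes c: "!!l m. c l m : carrier G" and k: "k : K" "k \<in># m" and K: "finite K"
  and z: "!!k'. k' : K ==> k' \<in># m ==> k' ~= k ==> c (k' # l) (m - {#k'#}) = \<zero>"
 shows "kosz G K c l m = c (k # l) (m - {#k#})"
proof -
 have "kosz G K c l m = (\<Oplus>k'\<in>{k' : K. k' \<in># m}. if k = k' then c (k' # l) (m - {#k'#}) else \<zero>)"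
  unfolding kosz_def by (rule finsum_cong') (use c z in auto)
 also have "... = c (k # l) (m - {#k#})" by (rule finsum_singleton) (use c k K in auto)
 finally show ?thesis .
qed

lemma kosz_permute:
 assumes p: "p permutes K" and c: "!!l m. c l m : carrier G"
 shows "kosz G K (%l m. c (map (inv' p) l) (image_mset (inv' p) m)) l m
  = kosz G K c (map (inv' p) l) (image_mset (inv' p) m)"
proof -
 let ?l = "map (inv' p) l" and ?m = "image_mset (inv' p) m"
 have mem: "inv' p k \<in># ?m \<longleftrightarrow> k \<in># m" for k
 proof
  assume "inv' p k \<in># ?m"
  then obtain k' where "k' \<in># m" "inv' p k = inv' p k'" by auto
  thus "k \<in># m" using permutes_inverses(1)[OF p] by metis
 qed auto
 have set: "{k \<in> K. k \<in># ?m} = inv' p ` {k \<in> K. k \<in># m}"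
 proof (intro equalityI subsetI)
  fix k assume "k : {k \<in> K. k \<in># ?m}"
  hence "p k : {k \<in> K. k \<in># m}" using mem[of "p k"] permutes_inverses[OF p] permutes_in_image[OF p] by simp
  moreover have "k = inv' p (p k)" using permutes_inverses[OF p] by simp
  ultimately show "k : inv' p ` {k \<in> K. k \<in># m}" by blast
 qed (use permutes_in_image[OF permutes_inv[OF p]] in auto)
 have "kosz G K c ?l ?m = (\<Oplus>k\<in>{k \<in> K. k \<in># m}. c (inv' p k # ?l) (?m - {#inv' p k#}))"
  unfolding kosz_def set
  by (rule finsum_reindex) (use c permutes_inj_on[OF permutes_inv[OF p]] in auto)
 also have "... = kosz G K (%l m. c (map (inv' p) l) (image_mset (inv' p) m)) l m"
  unfolding kosz_def by (rule finsum_cong') (use c in "auto simp: image_mset_Diff")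
 finally show ?thesis by simp
qed

end

subsection \<open>Standard cycles\<close>

lemma diff_single_eq_iff: "k \<in># m ==> m - {#k#} = X \<longleftrightarrow> m = add_mset k X"
 by (metis add_mset_remove_trivial insert_DiffM)

text \<open>\<open>mono_ext\<close> is the element \<open>x\<^sup>Q e\<^sub>c\<close> of the Koszul complex, for a list \<open>c\<close> of indices and a set \<open>Q\<close>.\<close>

definition mono_ext :: "('a, 'p) ring_scheme => nat list => nat set => nat list => nat multiset => 'a" where
 "mono_ext A c Q l m = (if m = mset_set Q then ext_mono A c l else \<zero>\<^bsub>A\<^esub>)"

text \<open>The Koszul boundary of x^Q e_c. For a set Q of \<open>d - 1\<close> indices disjoint
  from c, every term gains one variable and lands in the ideal, although x^Q itself does not lie
  there.\<close>

definition wel :: "('a, 'p) ring_scheme => nat => nat list => nat set => nat list => nat multiset => 'a" where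
 "wel A n c Q = kosz A {1..n} (mono_ext A c Q)"

context cring
begin

lemma mono_ext_alternating: "alternating R (%l. mono_ext R c Q l m)"
proof (cases "m = mset_set Q")
 case False
 thus ?thesis by (auto simp: mono_ext_def intro: altI)
qed (simp add: mono_ext_def ext_mono_alternating)

lemma mono_ext_closed: "mono_ext R c Q l m : carrier R"
 by (simp add: mono_ext_def ext_mono_closed)

lemma wel_closed: "wel R n c Q l m : carrier R"
 unfolding wel_def by (rule kosz_closed) (rule mono_ext_closed)

lemma wel_alternating: "alternating R (%l. wel R n c Q l m)"
 unfolding wel_def by (rule kosz_alternating[OF _ mono_ext_alternating]) simp

lemma wel_cycle: "kosz R {1..n} (wel R n c Q) l m = \<zero>"
 unfolding wel_def by (rule kosz_kosz[OF _ mono_ext_alternating]) simp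

lemma wel_nonzero:
 assumes "wel R n c Q l m ~= \<zero>"
 obtains k where "k : {1..n}" "m = add_mset k (mset_set Q)" "mset c = add_mset k (mset l)"
proof -
 have "\<exists>k. k : {1..n} & k \<in># m & mono_ext R c Q (k # l) (m - {#k#}) ~= \<zero>"
 proof (rule ccontr)
  assume "~ ?thesis"
  hence "wel R n c Q l m = kosz R {1..n} (%l m. \<zero>) l m" unfolding wel_def by (intro kosz_cong) auto
  thus False using assms by (simp add: kosz_null)
 qed
 then obtain k where k: "k : {1..n}" "k \<in># m" "mono_ext R c Q (k # l) (m - {#k#}) ~= \<zero>" by blast
 hence "m - {#k#} = mset_set Q" "ext_mono R c (k # l) ~= \<zero>" by (auto simp: mono_ext_def split: if_splits)
 thus ?thesis using k ext_mono_mset[of c "k # l"]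
  by (intro that[of k]) (auto simp: diff_single_eq_iff)
qed

lemma wel_alternating_left: "alternating R (%c. wel R n c Q l m)"
proof (rule altI)
 fix u v :: "nat list" and a b :: nat
 note D = altD[OF ext_mono_alternating_left]
 have "wel R n (u @ a # a # v) Q l m = kosz R {1..n} (%l m. \<zero>) l m"
  unfolding wel_def by (rule kosz_cong) (simp_all add: mono_ext_def D(2))
 thus "wel R n (u @ a # a # v) Q l m = \<zero>" by (simp add: kosz_null)
 have "wel R n (u @ a # b # v) Q l m = kosz R {1..n} (%l m. \<ominus> mono_ext R (u @ b # a # v) Q l m) l m"
  unfolding wel_def
  by (rule kosz_cong) (auto simp: mono_ext_def D(3)[of u a b v] ext_mono_closed)
 thus "wel R n (u @ a # b # v) Q l m = \<ominus> wel R n (u @ b # a # v) Q l m"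
  unfolding wel_def using kosz_minus[OF _ mono_ext_closed] by simp
qed (rule wel_closed)

lemma wel_permute:
 assumes p: "p permutes {1..n}" and Q: "finite Q"
 shows "wel R n (map p c) (p ` Q) l m = wel R n c Q (map (inv' p) l) (image_mset (inv' p) m)"
proof -
 have inj: "inj p" by (rule permutes_inj[OF p])
 have ll: "map p (map (inv' p) l) = l" for l using permutes_inverses[OF p] by (simp add: map_idI)
 have mm: "image_mset p (image_mset (inv' p) m) = m" for m
  using permutes_inverses[OF p] by (simp add: multiset.map_comp comp_def)
 have m_iff: "image_mset (inv' p) m = mset_set Q \<longleftrightarrow> m = mset_set (p ` Q)" for m
 proof -
  have pQ: "mset_set (p ` Q) = image_mset p (mset_set Q)"
   using image_mset_mset_set[of p Q] inj by (metis inj_on_subset subset_UNIV)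
  have "image_mset (inv' p) (image_mset p (mset_set Q)) = mset_set Q"
   using permutes_inverses[OF p] by (simp add: multiset.map_comp comp_def)
  thus ?thesis unfolding pQ using mm[of m] by metis
 qed
 have eq: "mono_ext R (map p c) (p ` Q) l m = mono_ext R c Q (map (inv' p) l) (image_mset (inv' p) m)" for l m
  using ext_mono_map[OF inj, of c "map (inv' p) l"] m_iff[of m] unfolding ll by (simp add: mono_ext_def)
 have "wel R n (map p c) (p ` Q) l m
   = kosz R {1..n} (%l m. mono_ext R c Q (map (inv' p) l) (image_mset (inv' p) m)) l m"
  unfolding wel_def by (rule kosz_cong) (simp_all add: eq mono_ext_closed)
 thus ?thesis unfolding wel_def using kosz_permute[OF p mono_ext_closed] by simp
qed

text \<open>Applying the differential twice to x^Q e_a e_c gives zero. The first application yields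
  x_a x^Q e_c minus the terms in which a factor of e_c is replaced by e_a and its variable joins
  x^Q; the second turns this into the stated identity.\<close>

lemma wel_shuffle:
 assumes c: "distinct c" "set c <= {1..n}" and a: "a : {1..n}" "a \<notin> set c" "a \<notin> Q"
  and Q: "finite Q" "Q \<inter> set c = {}"
 shows "wel R n c (insert a Q) l m = (\<Oplus>r\<in>{..<length c}. wel R n (c[r := a]) (insert (c ! r) Q) l m)"
proof -
 define f where "f l m = kosz R {1..n} (mono_ext R (a # c) Q) l m" for l m
 define h where "h r l m = mono_ext R (c[r := a]) (insert (c ! r) Q) l m" for r l m
 have hc: "h r l m : carrier R" for r l m unfolding h_def by (rule mono_ext_closed)
 \<comment> \<open>Contracting e_a e_c by e_a leaves e_c. Contracting by the factor in position
   \<open>r\<close> of e_c passes e_a, hence the minus sign, and puts e_a in its place.\<close>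
 have f: "f l m = mono_ext R c (insert a Q) l m \<oplus> (\<Oplus>r\<in>{..<length c}. \<ominus> h r l m)" for l m
 proof -
  define g where "g k = (if m = add_mset k (mset_set Q) then ext_mono R (a # c) (k # l) else \<zero>)" for k
  have gc: "g k : carrier R" for k unfolding g_def using ext_mono_closed[of "a # c" "k # l"] by simp
  have ca: "set (a # c) <= {1..n}" using c a by simp
  have "f l m = (\<Oplus>k\<in>set (a # c). g k)"
  proof -
   have eq: "mono_ext R (a # c) Q (k # l) (m - {#k#}) = g k" if "k \<in># m" for k
    unfolding mono_ext_def g_def diff_single_eq_iff[OF that] by (rule refl)
   have "f l m = (\<Oplus>k\<in>{k \<in> {1..n}. k \<in># m}. g k)"
    unfolding f_def kosz_def by (rule finsum_cong') (use eq gc in auto)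
   also have "... = (\<Oplus>k\<in>{k \<in> set (a # c). k \<in># m}. g k)"
   proof (rule add.finprod_mono_neutral_cong_right)
    show "{k \<in> set (a # c). k \<in># m} <= {k \<in> {1..n}. k \<in># m}" using ca by blast
    fix k assume "k : {k \<in> {1..n}. k \<in># m} - {k \<in> set (a # c). k \<in># m}"
    hence "k \<notin> set (a # c)" by blast
    hence "ext_mono R (a # c) (k # l) = \<zero>"
     using ext_mono_mset[of "a # c" "k # l"] by (metis list.set_intros(1) mset_eq_setD)
    thus "g k = \<zero>" by (simp add: g_def del: ext_mono.simps)
   qed (use gc in auto)
   also have "... = (\<Oplus>k\<in>set (a # c). g k)"
    by (rule add.finprod_mono_neutral_cong_left) (use gc in "auto simp: g_def")
   finally show ?thesis .
  qed
  also have "... = g a \<oplus> (\<Oplus>k\<in>set c. g k)" using a(2) gc by (simp add: Pi_iff)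
  also have "g a = mono_ext R c (insert a Q) l m"
   using ext_mono_Cons_Cons[OF a(2), of l] Q(1) a(3) by (simp add: g_def mono_ext_def del: ext_mono.simps)
  also have "(\<Oplus>k\<in>set c. g k) = (\<Oplus>r\<in>{..<length c}. g (c ! r))"
  proof -
   have im: "set c = (%r. c ! r) ` {..<length c}" by (auto simp: set_conv_nth)
   show ?thesis unfolding im
    by (rule finsum_reindex) (use gc c(1) in "auto simp: inj_on_nth")
  qed
  also have "... = (\<Oplus>r\<in>{..<length c}. \<ominus> h r l m)"
  proof (rule finsum_cong')
   fix r assume r: "r : {..<length c}"
   have ne: "c ! r ~= a" "c ! r \<notin> Q" using r a(2) Q(2) nth_mem[of r c] by auto
   have "ext_mono R (a # c) (c ! r # l) = \<ominus> ext_mono R (c[r := a]) l"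
    using wedge_ext_mono[OF c(1), of r a l] r ne(1) ext_mono_closed[of "c[r := a]" l] by (simp add: a_minus_def)
   thus "g (c ! r) = \<ominus> h r l m"
    using ne(2) Q(1) by (simp add: g_def h_def mono_ext_def del: ext_mono.simps)
  qed (use hc in auto)
  finally show ?thesis .
 qed
 have ff: "f = kosz R {1..n} (mono_ext R (a # c) Q)" by (intro ext) (rule f_def)
 have "\<zero> = kosz R {1..n} f l m"
  unfolding ff by (rule kosz_kosz[OF _ mono_ext_alternating, symmetric]) simp
 also have "... = kosz R {1..n} (%l m. mono_ext R c (insert a Q) l m \<oplus> (\<Oplus>r\<in>{..<length c}. \<ominus> h r l m)) l m"
  by (rule kosz_cong) (use f mono_ext_closed hc in "auto")
 also have "... = wel R n c (insert a Q) l m \<oplus> kosz R {1..n} (%l m. \<Oplus>r\<in>{..<length c}. \<ominus> h r l m) l m"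
  unfolding wel_def by (rule kosz_add) (use mono_ext_closed hc in auto)
 also have "kosz R {1..n} (%l m. \<Oplus>r\<in>{..<length c}. \<ominus> h r l m) l m
   = (\<Oplus>r\<in>{..<length c}. kosz R {1..n} (%l m. \<ominus> h r l m) l m)"
  by (rule kosz_finsum) (use hc in auto)
 also have "... = (\<Oplus>r\<in>{..<length c}. \<ominus> wel R n (c[r := a]) (insert (c ! r) Q) l m)"
 proof (rule finsum_cong')
  fix r
  show "kosz R {1..n} (%l m. \<ominus> h r l m) l m = \<ominus> wel R n (c[r := a]) (insert (c ! r) Q) l m"
   using kosz_minus[where c = "h r" and K = "{1..n}", OF _ hc] by (simp add: wel_def h_def[abs_def])
 qed (use wel_closed in auto)
 also have "... = \<ominus> (\<Oplus>r\<in>{..<length c}. wel R n (c[r := a]) (insert (c ! r) Q) l m)"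
  by (rule additive_finsum[OF abelian_group_axioms abelian_group_axioms, symmetric])
   (auto simp: wel_closed minus_add)
 finally have "wel R n c (insert a Q) l m \<ominus> (\<Oplus>r\<in>{..<length c}. wel R n (c[r := a]) (insert (c ! r) Q) l m) = \<zero>"
  by (simp add: a_minus_def)
 thus ?thesis
  by (subst (asm) diff_eq_zero_iff) (auto simp: wel_closed intro: finsum_closed)
qed

end

subsection \<open>Standard index pairs\<close>

text \<open>First column and arm of a standard hook tableau. The corner belongs to the column, which
  leaves \<open>d - 1\<close> entries for the arm; the arm is a set because its order is forced. The
  last condition makes the corner the least of all entries.\<close>

definition std_pairs :: "nat => nat => nat => (nat list \<times> nat set) set" where
 "std_pairs n d i = {(c, Q). length c = Suc i & sorted_wrt (<) c & set c <= {1..n} & Q <= {1..n} &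
  card Q = d - 1 & set c \<inter> Q = {} & (\<forall>r\<in>Q. hd c < r)}"

lemma finite_std_pairs: "finite (std_pairs n d i)"
proof (rule finite_subset)
 show "std_pairs n d i <= {c. set c <= {1..n} & length c = Suc i} \<times> Pow {1..n}" by (auto simp: std_pairs_def)
qed (simp add: finite_lists_length_eq)

text \<open>The coordinate dual to \<open>wel A n c Q\<close>.\<close>

definition pair_coord :: "nat list \<times> nat set => (nat list => nat multiset => 'a) => 'a" where
 "pair_coord x w = w (tl (fst x)) (mset_set (insert (hd (fst x)) (snd x)))"

lemma sorted_wrt_unique: "sorted_wrt (<) (a :: nat list) ==> sorted_wrt (<) b ==> set a = set b ==> a = b"
 by (metis sorted_distinct_set_unique strict_sorted_iff)

text \<open>A nonzero coefficient makes the two pairs have the same union of column and arm. The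
  head of each column is the least index of that union, so the heads agree; removing them identifies
  the arms and then the columns.\<close>

lemma (in cring) pair_coord_wel:
 assumes x: "(c, Q) : std_pairs n d i" and y: "(c', Q') : std_pairs n d i"
 shows "pair_coord (c, Q) (wel R n c' Q') = (if (c, Q) = (c', Q') then \<one> else \<zero>)"
proof -
 obtain s t where c: "c = s # t" using x by (cases c) (auto simp: std_pairs_def)
 obtain s' t' where c': "c' = s' # t'" using y by (cases c') (auto simp: std_pairs_def)
 have X: "sorted_wrt (<) t" "!!r. r : set t \<union> Q ==> s < r" "finite Q" "s : {1..n}" "set t \<inter> Q = {}"
  using x finite_subset[of Q "{1..n}"] by (auto simp: c std_pairs_def)
 have Y: "sorted_wrt (<) t'" "!!r. r : set t' \<union> Q' ==> s' < r" "finite Q'"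
  using y finite_subset[of Q' "{1..n}"] by (auto simp: c' std_pairs_def)
 have sQ: "s \<notin> Q" "s \<notin> set t" using X(2) by blast+
 have m: "mset_set (insert s Q) = add_mset s (mset_set Q)" using sQ X(3) by simp
 have pc: "pair_coord (c, Q) (wel R n c' Q') = wel R n c' Q' t (mset_set (insert s Q))"
  by (simp add: pair_coord_def c)
 show ?thesis
 proof (cases "(c, Q) = (c', Q')")
  case True
  hence eq: "c' = c" "Q' = Q" by auto
  have "wel R n c Q t (mset_set (insert s Q)) = mono_ext R c Q (s # t) (mset_set (insert s Q) - {#s#})"
   unfolding wel_def
  proof (rule kosz_single)
   fix k assume k: "k \<in># mset_set (insert s Q)" "k ~= s"
   hence kQ: "k : Q" using X(3) by auto
   have "mset_set (insert s Q) - {#k#} ~= mset_set Q"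
   proof
    assume "mset_set (insert s Q) - {#k#} = mset_set Q"
    hence "add_mset s (mset_set Q) = add_mset k (mset_set Q)" unfolding m using k m by (metis insert_DiffM)
    hence "count (add_mset s (mset_set Q)) k = count (add_mset k (mset_set Q)) k" by simp
    thus False using k(2) by simp
   qed
   thus "mono_ext R c Q (k # t) (mset_set (insert s Q) - {#k#}) = \<zero>" by (simp add: mono_ext_def)
  qed (use X(3,4) mono_ext_closed in auto)
  also have "... = \<one>"
   using ext_mono_self[of c] X(1) sQ(2) strict_sorted_iff[of t] by (simp add: m mono_ext_def c del: ext_mono.simps)
  finally show ?thesis using True eq unfolding pc by simp
 next
  case False
  have "wel R n c' Q' t (mset_set (insert s Q)) = \<zero>"
  proof (rule ccontr)
   assume "wel R n c' Q' t (mset_set (insert s Q)) ~= \<zero>"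
   then obtain k where k: "mset_set (insert s Q) = add_mset k (mset_set Q')" "mset c' = add_mset k (mset t)"
    by (rule wel_nonzero)
   have s1: "insert s Q = insert k Q'" using arg_cong[OF k(1), of set_mset] X(3) Y(3) by simp
   have s2: "insert s' (set t') = insert k (set t)" using arg_cong[OF k(2), of set_mset] c' by simp
   have tot: "insert s (set t \<union> Q) = insert s' (set t' \<union> Q')" using s1 s2 by blast
   \<comment> \<open>Both are the least element of the same set.\<close>
   have ss: "s = s'"
   proof (rule ccontr)
    assume "s ~= s'"
    moreover have "s : insert s' (set t' \<union> Q')" unfolding tot[symmetric] by (rule insertI1)
    moreover have "s' : insert s (set t \<union> Q)" unfolding tot by (rule insertI1)
    ultimately have "s : set t' \<union> Q'" "s' : set t \<union> Q" by auto
    thus False using X(2)[of s'] Y(2)[of s] by simp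
   qed
   have "s : insert k (set t)" unfolding s2[symmetric] using ss by simp
   hence ks: "k = s" using sQ(2) by simp
   have "mset_set Q = mset_set Q'" using k(1) m ks by simp
   hence QQ: "Q = Q'" using X(3) Y(3) by (metis finite_set_mset_mset_set)
   have "s \<notin> set t'" using Y(2)[of s] ss by auto
   hence "set t' = set t" using s2 insert_ident[of s "set t'" "set t"] sQ(2) unfolding ks ss by simp
   hence "t' = t" by (rule sorted_wrt_unique[OF Y(1) X(1)])
   thus False using False QQ ss c c' by simp
  qed
  thus ?thesis unfolding pc using False by auto
 qed
qed

section \<open>The module of Koszul cycles of the squarefree ideal\<close>

lemma mset_squarefree:
 assumes "card (set_mset m) \<ge> size m" shows "m = mset_set (set_mset m)"
proof -
 have "size (mset_set (set_mset m)) = card (set_mset m)" by simp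
 thus ?thesis
  using assms mset_set_set_mset_msubset[of m] by (metis mset_subset_size not_le subset_mset.less_le)
qed

locale sqfree = cring A for A (structure) +
 fixes n d :: nat
 assumes R_cring: "cring (mpoly_ring A n)" and d_pos: "1 <= d"
begin

abbreviation "Isq == sqfree_ideal_module A d n"
abbreviation "gI == grade Isq"
abbreviation "co == %f (u :: unit, m). f m"

sublocale I: coord_module A n Isq gI co "sqfree_mons d n" "%_. 0"
 by (rule sqfree_coord[OF R_cring])

lemma Im_zero: "\<zero>\<^bsub>Isq\<^esub> = (%m. \<zero>)" and Im_add: "f \<oplus>\<^bsub>Isq\<^esub> g = (%m. f m \<oplus> g m)"
 by (simp_all add: sqfree_module_simps mpoly_simps)

lemma Im_carrier: "f : carrier Isq \<longleftrightarrow> f : carrier (mpoly_ring A n) & (\<forall>m. f m ~= \<zero> --> d <= card (set_mset m))"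
 by (simp add: sqfree_module_simps sqfree_ideal_eq[OF R_cring])

lemma gI_iff: "f : gI j \<longleftrightarrow> f : carrier Isq & (\<forall>m. f m ~= \<zero> --> int (size m) = j)"
 unfolding I.gr_eq by simp

definition cyc :: "nat => int => (nat list => nat multiset => 'a) set" where
 "cyc i j = {w \<in> kchains n Isq gI i j. \<forall>l. kdiff A n Isq w l = \<zero>\<^bsub>Isq\<^esub>}"

lemma kdiff_kosz: "(!!l. w l : carrier Isq) ==> kdiff A n Isq w l m = kosz A {1..n} w l m"
 using I.kdiff_coord[of w l "()" m] by simp

lemma finite_monomials: "finite {m :: nat multiset. set_mset m <= {1..n} & size m = k}"
proof (rule finite_subset)
 show "{m :: nat multiset. set_mset m <= {1..n} & size m = k} <= mset ` {l. set l <= {1..n} & length l = k}"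
 proof
  fix m assume m: "m : {m :: nat multiset. set_mset m <= {1..n} & size m = k}"
  obtain l where "mset l = m" using ex_mset by blast
  thus "m : mset ` {l. set l <= {1..n} & length l = k}" using m by (intro image_eqI[of _ _ l]) auto
 qed
qed (simp add: finite_lists_length_eq)

lemma cyc_iff:
 "w : cyc i j \<longleftrightarrow> (\<forall>m. alternating A (%l. w l m)) &
  (\<forall>l m. w l m ~= \<zero> --> length l = i & set l <= {1..n} & set_mset m <= {1..n} &
    d <= card (set_mset m) & int (size m) = j - int i) &
  (\<forall>l m. kosz A {1..n} w l m = \<zero>)" (is "_ \<longleftrightarrow> ?alt & ?supp & ?cyc")
proof
 assume w: "w : cyc i j"
 hence c: "w : kchains n Isq gI i j" "!!l. kdiff A n Isq w l = \<zero>\<^bsub>Isq\<^esub>" by (auto simp: cyc_def)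
 note D = I.kchainsD[OF c(1)]
 have "alternating A (%l. w l m)" for m using I.coord_alternating[OF D(1), of "((), m)"] by simp
 hence ?alt by blast
 moreover have ?supp
 proof (intro allI impI)
  fix l m assume nz: "w l m ~= \<zero>"
  hence "w l ~= \<zero>\<^bsub>Isq\<^esub>" by (auto simp: Im_zero)
  hence "length l = i" "set l <= {1..n}" using D(4,5) by blast+
  moreover have "d <= card (set_mset m)" "int (size m) = j - int i" using D(2)[of l] nz unfolding gI_iff Im_carrier by blast+
  moreover have "set_mset m <= {1..n}" using I.coord_outside[OF D(3), of "((), m)" l] nz by auto
  ultimately show "length l = i & set l <= {1..n} & set_mset m <= {1..n} &
    d <= card (set_mset m) & int (size m) = j - int i" by blast
 qed
 moreover have ?cyc using kdiff_kosz[where w = w, OF D(3)] c(2) by (simp add: Im_zero)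
 ultimately show "?alt & ?supp & ?cyc" by blast
next
 assume "?alt & ?supp & ?cyc"
 hence alt: ?alt and supp: "!!l m. w l m ~= \<zero> ==> length l = i & set l <= {1..n} & set_mset m <= {1..n} &
    d <= card (set_mset m) & int (size m) = j - int i" and cyc: ?cyc by blast+
 have wl: "w l : carrier Isq" for l
 proof -
  \<comment> \<open>The degree is fixed, so only finitely many monomials can occur.\<close>
  have "{m. w l m ~= \<zero>} <= {m. set_mset m <= {1..n} & size m = nat (j - int i)}" using supp by fastforce
  hence "finite {m. w l m ~= \<zero>}" using finite_monomials finite_subset by blast
  moreover have "w l m : carrier A" for m using alt altD(1) by blast
  ultimately show ?thesis unfolding Im_carrier mpoly_simps free_simps using supp by blast
 qed
 have "w : kchains n Isq gI i j"
 proof (rule I.kchainsI)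
  show "alternating Isq w" by (rule I.alternating_from_coord[OF wl]) (use alt in auto)
  show "w l : gI (j - int i)" for l unfolding gI_iff using wl supp by blast
  show "w l = \<zero>\<^bsub>Isq\<^esub>" if "length l ~= i" for l unfolding Im_zero using supp that by blast
  show "w l = \<zero>\<^bsub>Isq\<^esub>" if "~ set l <= {1..n}" for l unfolding Im_zero using supp that by blast
 qed
 moreover have "kdiff A n Isq w l = \<zero>\<^bsub>Isq\<^esub>" for l unfolding Im_zero using kdiff_kosz[where w = w, OF wl] cyc by (simp add: fun_eq_iff)
 ultimately show "w : cyc i j" by (simp add: cyc_def)
qed

lemma cyc_alternating: "w : cyc i j ==> alternating A (%l. w l m)"
 unfolding cyc_iff by blast

lemma cyc_closed: "w : cyc i j ==> w l m : carrier A"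
 by (rule altD(1)[OF cyc_alternating])

lemma cyc_kosz: "w : cyc i j ==> kosz A {1..n} w l m = \<zero>"
 unfolding cyc_iff by blast

lemma cyc_support:
 assumes "w : cyc i j" "w l m ~= \<zero>"
 shows "length l = i" "set l <= {1..n}" "set_mset m <= {1..n}" "d <= card (set_mset m)" "int (size m) = j - int i"
 using assms unfolding cyc_iff by blast+

lemma cyc_distinct: "w : cyc i j ==> w l m ~= \<zero> ==> distinct l"
 using alternating_repeat[OF cyc_alternating] by blast

lemmas cycD = cyc_alternating cyc_closed cyc_kosz cyc_support cyc_distinct

text \<open>The coefficients of such a chain have degree \<open>d - 1\<close>, too small for a
  monomial with \<open>d\<close> distinct variables.\<close>

lemma top_chains_zero:
 assumes "u : kchains n Isq gI (Suc i) (int (d + i))" shows "u = (%l. \<zero>\<^bsub>Isq\<^esub>)"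
proof (rule ext)
 fix l
 have u: "u l : gI (int d - 1)" using I.kchainsD(2)[OF assms, of l] by simp
 have "u l m = \<zero>" for m
 proof (rule ccontr)
  assume "u l m ~= \<zero>"
  hence "int (size m) = int d - 1" "d <= card (set_mset m)" using u by (auto simp: gI_iff Im_carrier)
  moreover have "card (set_mset m) <= size m" by (metis mset_set_set_mset_msubset size_mset_mono size_mset_set)
  ultimately show False by simp
 qed
 thus "u l = \<zero>\<^bsub>Isq\<^esub>" by (auto simp: Im_zero)
qed

text \<open>The contraction divides coefficients by a variable and must not leave the ideal. It is
  safe to divide by a variable that remains in the monomial afterwards; in a squarefree multidegree
  it is safe as soon as the monomial has more than \<open>d\<close> variables, and this is where
  \<open>j\<close> matters.\<close>

lemma cyc_acyclic:
 assumes w: "w : cyc i j" and j: "j ~= int (d + i)"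
 shows "\<exists>u\<in>kchains n Isq gI (Suc i) j. \<forall>l. kdiff A n Isq u l = w l"
proof -
 have c: "w : kchains n Isq gI i j" "!!l. kdiff A n Isq w l = \<zero>\<^bsub>Isq\<^esub>" using w by (auto simp: cyc_def)
 note D = cycD[OF w]
 \<comment> \<open>A repeated index of the multidegree is preferred. Lists are distinct, so dividing
   by it leaves another copy of the variable in the monomial.\<close>
 define \<kappa> where "\<kappa> N = (if \<exists>k. 2 <= count N k then SOME k. 2 <= count N k else SOME k. k \<in># N)" for N :: "nat multiset"
 have \<kappa>2: "2 <= count N (\<kappa> N)" if "\<exists>k. 2 <= count N k" for N
  unfolding \<kappa>_def using that someI_ex[OF that] by simp
 have \<kappa>: "\<kappa> N \<in># N" if "N ~= {#}" for N
 proof (cases "\<exists>k. 2 <= count N k")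
  case True
  thus ?thesis using \<kappa>2[OF True] by (metis count_eq_zero_iff not_numeral_le_zero)
 next
  case False
  have "\<exists>k. k \<in># N" using that by (metis multiset_nonemptyE)
  thus ?thesis unfolding \<kappa>_def using False someI_ex[of "%k. k \<in># N"] by simp
 qed
 have aug: "co (w []) (e, {#}) = \<zero>" for e using D(7)[of "[]" "{#}"] d_pos by fastforce
 have Sk: "(e, m) : sqfree_mons d n"
  if nz: "co (w l) (e, add_mset k m) ~= \<zero>" and kl: "k \<notin> set l" and k: "k = \<kappa> (add_mset k (mset l + m))" for e l m k
 proof -
  have nz': "w l (add_mset k m) ~= \<zero>" using nz by simp
  note E = D(4-9)[OF nz']
  let ?N = "add_mset k (mset l + m)"
  have cm: "card (set_mset M) <= size M" for M :: "nat multiset"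
   by (metis mset_set_set_mset_msubset size_mset_mono size_mset_set)
  \<comment> \<open>The coefficient involves at least \<open>d\<close> variables, hence j - i is at
    least \<open>d\<close>, and equality is excluded; after one division the degree is still at
    least \<open>d\<close>.\<close>
  have size: "d <= size m"
   using cm[of "add_mset k m"] E(4,5) j by simp
  have "d <= card (set_mset m)"
  proof (cases "\<exists>k. 2 <= count ?N k")
   case True
   hence "2 <= count ?N k" using \<kappa>2[OF True] k by simp
   moreover have "count (mset l) k = 0" using kl by (simp add: count_mset_0_iff)
   ultimately have "1 <= count m k" by simp
   hence "k \<in># m" by (simp add: Suc_le_eq)
   thus ?thesis using E(4) by (simp add: insert_absorb)
  next
   \<comment> \<open>The multidegree is squarefree, so degree and number of variables of the
     monomial coincide.\<close>
   case False
   have "count m x <= 1" for x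
   proof (rule ccontr)
    assume "~ count m x <= 1"
    hence "2 <= count ?N x" by simp
    thus False using False by blast
   qed
   hence "m = mset_set (set_mset m)"
    by (intro multiset_eqI) (metis count_eq_zero_iff count_mset_set(1,3) finite_set_mset le_neq_implies_less less_one)
   hence "size m = card (set_mset m)" by (metis size_mset_set)
   thus ?thesis using size by simp
  qed
  thus ?thesis using E(3) by simp
 qed
 show ?thesis
 proof (rule I.kdiff_exact[OF c, of \<kappa>])
  fix u assume "u : kchains n Isq gI (Suc i) j" "!!l. kdiff A n Isq u l = w l"
  thus ?thesis by blast
 qed (use aug Sk \<kappa> in auto)
qed

abbreviation "Z i == cyc i (int (d + i))"

text \<open>Degree \<open>d\<close> with at least \<open>d\<close> variables forces a squarefree
  monomial. That it shares no index with the list follows from the cycle condition, as this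
  condition isolates each coefficient with a shared index.\<close>

lemma Z_support:
 assumes w: "w : Z i" and nz: "w l m ~= \<zero>"
 obtains Q where "m = mset_set Q" "finite Q" "card Q = d" "Q \<inter> set l = {}" "Q <= {1..n}" "set_mset m = Q"
proof -
 note D = cycD[OF w]
 have sqf: "m = mset_set (set_mset m) & size m = d" if "w l m ~= \<zero>" for l m
  using D(7,8)[OF that] mset_squarefree[of m] by simp
 let ?Q = "set_mset m"
 have disj: "?Q \<inter> set l = {}"
 proof (rule ccontr)
  assume "?Q \<inter> set l ~= {}"
  then obtain k where k: "k \<in># m" "k : set l" by blast
  let ?l = "remove1 k l"
  have ml: "mset l = mset (k # ?l)" using k(2) by simp
  have kn: "k : {1..n}" using D(6)[OF nz] k(1) by blast
  \<comment> \<open>All terms but one vanish: their monomials contain \<open>k\<close> twice and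
    have degree \<open>d\<close>, so they involve fewer than \<open>d\<close> variables.\<close>
  have "kosz A {1..n} w ?l (add_mset k m) = w (k # ?l) (add_mset k m - {#k#})"
  proof (rule kosz_single[OF D(2) kn])
   fix k' assume k': "k' \<in># add_mset k m" "k' ~= k"
   hence "add_mset k m - {#k'#} = add_mset k (m - {#k'#})" "k \<in># m - {#k'#}"
    using k(1) by (auto simp: in_diff_count)
   note e = this
   have "0 < count (m - {#k'#}) k" using e(2) by (simp only: count_greater_zero_iff)
   hence two: "2 <= count (add_mset k m - {#k'#}) k" unfolding e(1) by simp
   show "w (k' # ?l) (add_mset k m - {#k'#}) = \<zero>"
   proof (rule ccontr)
    assume "w (k' # ?l) (add_mset k m - {#k'#}) ~= \<zero>"
    from sqf[OF this]
    have "count (add_mset k m - {#k'#}) k = count (mset_set (set_mset (add_mset k m - {#k'#}))) k" by simp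
    also have "... <= 1" by (simp only: count_mset_set') simp
    finally show False using two by simp
   qed
  qed simp_all
  hence "w (k # ?l) m = \<zero>" using D(3) by simp
  thus False using alternating_zero_iff[OF D(1) ml] nz by simp
 qed
 have m: "m = mset_set ?Q" "size m = d" using sqf[OF nz] by auto
 have "card ?Q = d" using m by (metis size_mset_set)
 show ?thesis by (rule that[OF m(1) _ \<open>card ?Q = d\<close> disj D(6)[OF nz]]) simp_all
qed

text \<open>Since \<open>c\<close> and \<open>Q\<close> are disjoint, each monomial x_k x^Q of the
  boundary is squarefree with exactly \<open>d\<close> variables and thus lies in the ideal.\<close>

lemma wel_Z:
 assumes c: "length c = Suc i" "set c <= {1..n}" "Q <= {1..n}" "card Q = d - 1" "set c \<inter> Q = {}"
 shows "wel A n c Q : Z i"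
 unfolding cyc_iff
proof (intro conjI allI impI)
 show "alternating A (%l. wel A n c Q l m)" for m by (rule wel_alternating)
 show "kosz A {1..n} (wel A n c Q) l m = \<zero>" for l m by (rule wel_cycle)
 fix l m assume "wel A n c Q l m ~= \<zero>"
 then obtain k where k: "k : {1..n}" "m = add_mset k (mset_set Q)" "mset c = add_mset k (mset l)" by (rule wel_nonzero)
 have fQ: "finite Q" using c(3) finite_subset by blast
 have cl: "length c = Suc (length l)" "set c = insert k (set l)"
  using arg_cong[OF k(3), of size] arg_cong[OF k(3), of set_mset] by simp_all
 have kQ: "k \<notin> Q" using c(5) cl(2) by blast
 show "length l = i" using cl(1) c(1) by simp
 show "set l <= {1..n}" using cl(2) c(2) by blast
 show "set_mset m <= {1..n}" using k(1,2) c(3) fQ by simp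
 show "d <= card (set_mset m)" using k(2) fQ kQ c(4) by simp
 show "int (size m) = int (d + i) - int i" using k(2) c(4) d_pos by simp
qed

text \<open>The common target of two isomorphisms: Tor in degree \<open>d + i\<close> and the
  induced module are each compared with these cycles. The action permutes the variables in the
  coefficients and the exterior generators together.\<close>

definition Wmod :: "nat => ('a, nat list => nat multiset => 'a, nat => nat) gmodule" where
 "Wmod i = \<lparr>carrier = Z i, monoid.mult = undefined, one = undefined, zero = (%l m. \<zero>),
  add = (%w v l m. w l m \<oplus> v l m), smult = (%a w l m. a \<otimes> w l m),
  gact = (%\<sigma> w l. perm_vars \<sigma> (w (map (inv' \<sigma>) l)))\<rparr>"

lemma W_simps:
 "carrier (Wmod i) = Z i" "\<zero>\<^bsub>Wmod i\<^esub> = (%l m. \<zero>)" "w \<oplus>\<^bsub>Wmod i\<^esub> v = (%l m. w l m \<oplus> v l m)"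
 "a \<odot>\<^bsub>Wmod i\<^esub> w = (%l m. a \<otimes> w l m)" "gact (Wmod i) \<sigma> w = (%l. perm_vars \<sigma> (w (map (inv' \<sigma>) l)))"
 by (simp_all add: Wmod_def)

lemma Z_zero: "(%l m. \<zero>) : Z i"
 unfolding cyc_iff by (auto simp: kosz_null intro: altI)

lemma Z_add:
 assumes w: "w : Z i" and v: "v : Z i" shows "(%l m. w l m \<oplus> v l m) : Z i"
 unfolding cyc_iff
proof (intro conjI allI impI)
 note D = cycD[OF w] and E = cycD[OF v]
 show "alternating A (%l. w l m \<oplus> v l m)" for m
 proof (rule altI)
  show "w (x @ a # b # y) m \<oplus> v (x @ a # b # y) m = \<ominus> (w (x @ b # a # y) m \<oplus> v (x @ b # a # y) m)" for x a b y
   unfolding altD(3)[OF D(1), of x a b y] altD(3)[OF E(1), of x a b y]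
   by (rule minus_add[symmetric]) (rule D(2) E(2))+
 qed (simp_all add: D(2) E(2) altD(2)[OF D(1)] altD(2)[OF E(1)])
 show "kosz A {1..n} (%l m. w l m \<oplus> v l m) l m = \<zero>" for l m
  using kosz_add[of w v, OF D(2) E(2)] D(3) E(3) by simp
qed (use cycD[OF w] cycD[OF v] in "metis r_zero zero_closed")+

lemma Z_smult:
 assumes a: "a : carrier A" and w: "w : Z i" shows "(%l m. a \<otimes> w l m) : Z i"
 unfolding cyc_iff
proof (intro conjI allI impI)
 note D = cycD[OF w]
 have add: "a \<otimes> (x \<oplus> y) = a \<otimes> x \<oplus> a \<otimes> y" if "x : carrier A" "y : carrier A" for x y
  using that a by (simp add: r_distr)
 show "alternating A (%l. a \<otimes> w l m)" for m
  by (rule alternating_additive[OF abelian_group_axioms abelian_group_axioms D(1)]) (use a add in auto)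
 show "kosz A {1..n} (%l m. a \<otimes> w l m) l m = \<zero>" for l m
  using kosz_additive[where c = w and f = "%x. a \<otimes> x" and l = l and m = m, OF finite_atLeastAtMost abelian_group_axioms D(2)] add a D(3) by simp
qed (use cycD[OF w] a in "metis r_null")+

lemma W_module: "module A (Wmod i)"
proof (rule moduleI)
 show "cring A" by unfold_locales
 show "abelian_group (Wmod i)"
 proof (rule abelian_groupI)
  fix w assume w: "w : carrier (Wmod i)"
  have "(%l m. (\<ominus> \<one>) \<otimes> w l m) : Z i" using Z_smult[of "\<ominus> \<one>" w i] w by (simp add: W_simps)
  moreover have "(%l m. (\<ominus> \<one>) \<otimes> w l m \<oplus> w l m) = (%l m. \<zero>)"
   using cycD(2) w by (intro ext) (simp add: W_simps l_minus l_neg)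
  ultimately show "\<exists>y\<in>carrier (Wmod i). y \<oplus>\<^bsub>Wmod i\<^esub> w = \<zero>\<^bsub>Wmod i\<^esub>"
   unfolding W_simps by (intro bexI[where x = "%l m. \<ominus> \<one> \<otimes> w l m"])
 qed (auto simp: W_simps Z_zero Z_add fun_eq_iff cycD(2) a_assoc simp del: of_nat_add intro!: a_comm cycD(2))
qed (auto simp: W_simps Z_smult fun_eq_iff cycD(2) l_distr r_distr m_assoc simp del: of_nat_add)

end

section \<open>The action of permutations on the cycles, and a basis of them\<close>

context sqfree
begin

lemma W_act:
 "gact (Wmod i) \<sigma> w = (%l m. w (map (inv' \<sigma>) l) (image_mset (inv' \<sigma>) m))"
 by (simp add: W_simps perm_vars_def)

lemma Z_act:
 assumes \<sigma>: "\<sigma> permutes {1..n}" and w: "w : Z i"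
 shows "gact (Wmod i) \<sigma> w : Z i"
 unfolding cyc_iff W_act
proof (intro conjI allI impI)
 note D = cycD[OF w]
 let ?i = "inv' \<sigma>"
 have p: "?i permutes {1..n}" by (rule permutes_inv[OF \<sigma>])
 show "alternating A (%l. w (map ?i l) (image_mset ?i m))" for m by (rule alternating_map[OF D(1)])
 show "kosz A {1..n} (%l m. w (map ?i l) (image_mset ?i m)) l m = \<zero>" for l m
  using kosz_permute[where c = w, OF \<sigma> D(2)] D(3) by simp
 fix l m assume nz: "w (map ?i l) (image_mset ?i m) ~= \<zero>"
 show "length l = i" using D(4)[OF nz] by simp
 show "set l <= {1..n}" using D(5)[OF nz] permutes_in_image[OF p] by (auto simp: subset_iff)
 show "set_mset m <= {1..n}" using D(6)[OF nz] permutes_in_image[OF p] by (auto simp: subset_iff)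
 show "d <= card (set_mset m)" using D(7)[OF nz] card_image[OF permutes_inj_on[OF p], of "set_mset m"] by simp
 show "int (size m) = int (d + i) - int i" using D(8)[OF nz] by simp
qed

lemma W_group_ring_module: "group_ring_module A (sym_group n) (Wmod i)"
 unfolding group_ring_module_def sym_group_carrier sym_group_mult sym_group_one Ball_def
proof (intro conjI allI impI)
 show "module A (Wmod i)" by (rule W_module)
 fix \<sigma> assume \<sigma>: "\<sigma> permutes {1..n}"
 show "gact (Wmod i) \<sigma> : linear_maps A (Wmod i) (Wmod i)"
  by (rule slinearI) (use Z_act[OF \<sigma>] in "simp_all add: W_simps(1) W_act W_simps(3,4)")
 fix \<tau> w assume \<tau>: "\<tau> permutes {1..n}" and "w : carrier (Wmod i)"
 have "inv' (\<sigma> \<circ> \<tau>) = inv' \<tau> \<circ> inv' \<sigma>"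
  by (rule o_inv_distrib[OF permutes_bij[OF \<sigma>] permutes_bij[OF \<tau>]])
 thus "gact (Wmod i) (\<sigma> \<circ> \<tau>) w = gact (Wmod i) \<sigma> (gact (Wmod i) \<tau> w)"
  by (simp add: W_act multiset.map_comp)
next
 fix w show "gact (Wmod i) id w = w" by (simp add: W_act)
qed

lemma W_wel_act:
 assumes "\<sigma> permutes {1..n}" "finite Q"
 shows "gact (Wmod i) \<sigma> (wel A n c Q) = wel A n (map \<sigma> c) (\<sigma> ` Q)"
 unfolding W_act by (intro ext) (rule wel_permute[OF assms, symmetric])

lemma W_finsum:
 assumes "finite J" "!!x. x : J ==> g x : Z i"
 shows "(\<Oplus>\<^bsub>Wmod i\<^esub>x\<in>J. g x) l m = (\<Oplus>x\<in>J. g x l m)"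
proof -
 interpret W: module A "Wmod i" by (rule W_module)
 show ?thesis
  by (rule additive_finsum[OF W.M.abelian_group_axioms abelian_group_axioms, where f = "%w. w l m"])
   (use assms in "auto simp: W_simps cycD(2)")
qed

text \<open>Let \<open>s\<close> be the least index in the multidegree of a coefficient. If
  \<open>s\<close> lies in the monomial, the coefficient is a standard coordinate up to sign. If it
  lies in the list, the cycle condition expresses the coefficient through others that have
  \<open>s\<close> in the monomial.\<close>

lemma Z_coord_zero:
 assumes w: "w : Z i" and z: "!!x. x : std_pairs n d i ==> pair_coord x w = \<zero>"
 shows "w l m = \<zero>"
proof -
 note D = cycD[OF w]
 \<comment> \<open>Moving \<open>s\<close> from the monomial to the head of the sorted list produces
   a standard pair.\<close>
 have case1: "w l m = \<zero>" if s: "s \<in># m" and min: "!!r. r : set l \<union> set_mset m ==> s <= r" for s l m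
 proof (rule ccontr)
  assume nz: "w l m ~= \<zero>"
  obtain Q where Q: "m = mset_set Q" "finite Q" "card Q = d" "Q \<inter> set l = {}" "Q <= {1..n}" "set_mset m = Q"
   by (rule Z_support[OF w nz])
  have sQ: "s : Q" using s Q(6) by simp
  let ?c = "s # sort l"
  have less: "s < r" if "r : set l \<union> (Q - {s})" for r
  proof -
   have "s ~= r" using that sQ Q(4) by auto
   moreover have "s <= r" using that min[of r] Q(6) by auto
   ultimately show ?thesis by simp
  qed
  have "sorted_wrt (<) (sort l)" using D(9)[OF nz] strict_sorted_iff[of "sort l"] by simp
  hence "(?c, Q - {s}) : std_pairs n d i"
   using less D(4,5)[OF nz] Q sQ by (auto simp: std_pairs_def)
  moreover have "pair_coord (?c, Q - {s}) w = w (sort l) m"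
   using sQ Q(1) by (simp add: pair_coord_def insert_absorb)
  ultimately have "w (sort l) m = \<zero>" using z by metis
  thus False using alternating_zero_iff[OF D(1), of "sort l" l m] nz by simp
 qed
 show "w l m = \<zero>"
 proof (rule ccontr)
  assume nz: "w l m ~= \<zero>"
  obtain Q where Q: "m = mset_set Q" "finite Q" "card Q = d" "Q \<inter> set l = {}" "Q <= {1..n}" "set_mset m = Q"
   by (rule Z_support[OF w nz])
  define S where "S = set l \<union> Q"
  have S: "finite S" "S ~= {}" using Q(2,3) d_pos by (auto simp: S_def)
  define s where "s = Min S"
  have sS: "s : S" and min: "!!r. r : S ==> s <= r" using S by (auto simp: s_def)
  show False
  proof (cases "s : Q")
   case True
   thus False using case1[of s m l] min nz Q(6) by (auto simp: S_def)
  next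
   case False
   hence sl: "s : set l" using sS by (auto simp: S_def)
   let ?l = "remove1 s l"
   have ml: "mset l = mset (s # ?l)" using sl by simp
   have sn: "s : {1..n}" using D(5)[OF nz] sl by blast
   \<comment> \<open>The remaining terms have the least index \<open>s\<close> in their monomials,
     so the first case applies to them.\<close>
   have "kosz A {1..n} w ?l (add_mset s m) = w (s # ?l) (add_mset s m - {#s#})"
   proof (rule kosz_single[OF D(2) sn])
    fix k assume k: "k \<in># add_mset s m" "k ~= s"
    have sub: "set (k # ?l) \<union> set_mset (add_mset s m - {#k#}) <= S"
     using k sl Q(6) set_remove1_subset[of s l] by (auto simp: S_def dest: in_diffD)
    show "w (k # ?l) (add_mset s m - {#k#}) = \<zero>"
     by (rule case1[of s]) (use k(2) sub min in "auto simp: in_diff_count")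
   qed simp_all
   hence "w (s # ?l) m = \<zero>" using D(3) by simp
   thus False using alternating_zero_iff[OF D(1) ml] nz by simp
  qed
 qed
qed

lemma std_wel_Z: "x : std_pairs n d i ==> wel A n (fst x) (snd x) : Z i"
 by (rule wel_Z) (auto simp: std_pairs_def)

definition comb :: "nat => (nat list \<times> nat set => 'a) => nat list => nat multiset => 'a" where
 "comb i a = (\<Oplus>\<^bsub>Wmod i\<^esub>x\<in>std_pairs n d i. a x \<odot>\<^bsub>Wmod i\<^esub> wel A n (fst x) (snd x))"

lemma comb_closed:
 assumes "!!x. x : std_pairs n d i ==> a x : carrier A" shows "comb i a : Z i"
proof -
 interpret W: module A "Wmod i" by (rule W_module)
 have wZ: "a x \<odot>\<^bsub>Wmod i\<^esub> wel A n (fst x) (snd x) : carrier (Wmod i)" if "x : std_pairs n d i" for x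
  using W.smult_closed[OF assms[OF that], of "wel A n (fst x) (snd x)"] std_wel_Z[OF that] by (simp add: W_simps(1))
 have "comb i a : carrier (Wmod i)"
  unfolding comb_def by (rule W.M.finsum_closed) (rule funcsetI, rule wZ)
 thus ?thesis by (simp add: W_simps)
qed

lemma pair_coord_comb:
 assumes a: "!!x. x : std_pairs n d i ==> a x : carrier A" and y: "y : std_pairs n d i"
 shows "pair_coord y (comb i a) = a y"
proof -
 interpret W: module A "Wmod i" by (rule W_module)
 have wZ: "a x \<odot>\<^bsub>Wmod i\<^esub> wel A n (fst x) (snd x) : Z i" if "x : std_pairs n d i" for x
  using W.smult_closed[OF a[OF that], of "wel A n (fst x) (snd x)"] std_wel_Z[OF that] by (simp add: W_simps(1))
 have "pair_coord y (comb i a)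
   = (\<Oplus>x\<in>std_pairs n d i. pair_coord y (a x \<odot>\<^bsub>Wmod i\<^esub> wel A n (fst x) (snd x)))"
  unfolding comb_def pair_coord_def by (rule W_finsum[OF finite_std_pairs wZ])
 also have "... = (\<Oplus>x\<in>std_pairs n d i. if y = x then a x else \<zero>)"
 proof (rule finsum_cong')
  fix x assume x: "x : std_pairs n d i"
  have "pair_coord y (a x \<odot>\<^bsub>Wmod i\<^esub> wel A n (fst x) (snd x)) = a x \<otimes> pair_coord y (wel A n (fst x) (snd x))"
   by (simp add: W_simps pair_coord_def)
  also have "pair_coord y (wel A n (fst x) (snd x)) = (if y = x then \<one> else \<zero>)"
   using pair_coord_wel[of "fst y" "snd y" n d i "fst x" "snd x"] x y by simp
  finally show "pair_coord y (a x \<odot>\<^bsub>Wmod i\<^esub> wel A n (fst x) (snd x)) = (if y = x then a x else \<zero>)"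
   using a[OF x] by simp
 qed (use a in auto)
 also have "... = a y" by (rule finsum_singleton[OF y finite_std_pairs]) (use a in auto)
 finally show ?thesis .
qed

text \<open>Subtracting the combination with the same coordinates leaves a cycle all of whose
  standard coordinates vanish.\<close>

lemma Z_expand:
 assumes w: "w : Z i" shows "w = comb i (%x. pair_coord x w)"
proof -
 interpret W: module A "Wmod i" by (rule W_module)
 define a where "a = (%x. pair_coord x w)"
 have a: "a x : carrier A" for x unfolding a_def pair_coord_def by (rule cycD(2)[OF w])
 note cZ = comb_closed[of i a, OF a]
 define v where "v = w \<ominus>\<^bsub>Wmod i\<^esub> comb i a"
 have wc: "w : carrier (Wmod i)" "comb i a : carrier (Wmod i)" using w cZ by (simp_all add: W_simps(1))
 have v: "v : Z i" using W.M.minus_closed[OF wc] by (simp add: W_simps(1) v_def)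
 have ev: "v l m = w l m \<ominus> comb i a l m" for l m
  unfolding v_def by (rule additive_diff[OF W.M.abelian_group_axioms abelian_group_axioms, where f = "%w. w l m", OF _ _ wc])
   (auto simp: W_simps cycD(2))
 have "pair_coord x v = \<zero>" if "x : std_pairs n d i" for x
 proof -
  have "pair_coord x v = a x \<ominus> pair_coord x (comb i a)" unfolding a_def pair_coord_def by (rule ev[unfolded a_def pair_coord_def])
  thus ?thesis using pair_coord_comb[of i a, OF a that] a by (simp add: diff_eq_zero_iff)
 qed
 hence "v l m = \<zero>" for l m using Z_coord_zero[OF v] by blast
 hence "w l m = comb i a l m" for l m
  using ev[of l m] diff_eq_zero_iff[OF cycD(2)[OF w] cycD(2)[OF cZ]] by metis
 thus ?thesis unfolding a_def by blast
qed

end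

section \<open>Specht modules of hooks and rows\<close>

lemma action_simps:
 "carrier (with_action M \<rho>) = carrier M" "\<zero>\<^bsub>with_action M \<rho>\<^esub> = \<zero>\<^bsub>M\<^esub>" "add (with_action M \<rho>) = add M"
 "smult (with_action M \<rho>) = smult M" "gact (with_action M \<rho>) = \<rho>"
 by (simp_all add: with_action_def)

lemma module_with_action: "module R M ==> module R (with_action M \<rho>)"
 by (rule module_change_fields) (simp_all add: action_simps)

lemma slinear_action:
 "semilinear_maps R \<theta> (with_action M \<rho>) N = semilinear_maps R \<theta> M N"
 "semilinear_maps R \<theta> L (with_action M \<rho>) = semilinear_maps R \<theta> L M"
 by (simp_all add: semilinear_maps_def action_simps)

lemma submodule_with_action: "submodule K R (with_action M \<rho>) \<longleftrightarrow> submodule K R M"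
 by (simp add: submodule_def submodule_axioms_def subgroup_def m_inv_def action_simps)

lemma (in module) submodule_finsum:
 assumes K: "submodule K R M" and "finite I" "!!x. x : I ==> g x : K"
 shows "(\<Oplus>\<^bsub>M\<^esub>x\<in>I. g x) : K"
 using assms(2,3)
proof (induction I rule: finite_induct)
 note S = submodule.axioms(1)[OF K]
 case empty
 show ?case using subgroup.one_closed[OF S] by simp
next
 note S = submodule.axioms(1)[OF K]
 have KM: "x : K ==> x : carrier M" for x using subgroup.subset[OF S] by auto
 case (insert x I)
 have "g : I \<rightarrow> carrier M" "g x : carrier M" using insert.prems KM by auto
 thus ?case using insert subgroup.m_closed[OF S] by simp
qed

section \<open>Permutations and exchanges of entries of tableaux\<close>

lemma tableaux_iff:
 "T : tableaux \<mu> E \<longleftrightarrow> (\<forall>x\<in>diagram \<mu>. T x : E) & (\<forall>x. x \<notin> diagram \<mu> --> T x = undefined) & inj_on T (diagram \<mu>)"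
 by (auto simp: tableaux_def PiE_iff extensional_def)

lemma tab_act: "tableau_act \<mu> \<sigma> T x = (if x : diagram \<mu> then \<sigma> (T x) else undefined)"
 by (simp add: tableau_act_def)

lemma tableau_act_closed:
 assumes "T : tableaux \<mu> E" "inj_on \<sigma> E" "\<sigma> ` E <= E"
 shows "tableau_act \<mu> \<sigma> T : tableaux \<mu> E"
 unfolding tableaux_iff
proof (intro conjI ballI allI impI)
 have T: "!!x. x : diagram \<mu> ==> T x : E" "inj_on T (diagram \<mu>)" using assms(1) by (simp_all add: tableaux_iff)
 show "tableau_act \<mu> \<sigma> T x : E" if "x : diagram \<mu>" for x
  using T(1)[OF that] assms(3) that by (simp add: tab_act image_subset_iff)
 show "inj_on (tableau_act \<mu> \<sigma> T) (diagram \<mu>)"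
 proof (rule inj_onI)
  fix x y assume "x : diagram \<mu>" "y : diagram \<mu>" "tableau_act \<mu> \<sigma> T x = tableau_act \<mu> \<sigma> T y"
  thus "x = y" using inj_onD[OF assms(2)] inj_onD[OF T(2)] T(1) by (simp add: tab_act)
 qed
qed (simp add: tab_act)

lemma tableau_act_comp: "tableau_act \<mu> \<sigma> (tableau_act \<mu> \<tau> T) = tableau_act \<mu> (\<sigma> \<circ> \<tau>) T"
 by (auto simp: tab_act)

text \<open>With one entry on each side there is no vertical order to keep, and the exchange
  transposes two letters.\<close>

lemma exchange_single:
 fixes \<mu> :: "nat list" and r j :: nat
 assumes T: "T : tableaux \<mu> E" and p: "(r, j) : diagram \<mu>" and q: "(0, Suc j) : diagram \<mu>"
 shows "exchange \<mu> j {r} T = tableau_act \<mu> (transpose (T (r, j)) (T (0, Suc j))) T"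
proof
 fix x :: "nat \<times> nat"
 have inj: "T u = T v \<longleftrightarrow> u = v" if "u : diagram \<mu>" "v : diagram \<mu>" for u v
  using T that unfolding tableaux_iff inj_on_def by blast
 have c0: "{s. s = r & s < r} = {}" by auto
 obtain a b where x: "x = (a, b)" by fastforce
 show "exchange \<mu> j {r} T x = tableau_act \<mu> (transpose (T (r, j)) (T (0, Suc j))) T x"
 proof (cases "x : diagram \<mu>")
  case True
  have "transpose (T (r, j)) (T (0, Suc j)) (T x)
    = (if x = (r, j) then T (0, Suc j) else if x = (0, Suc j) then T (r, j) else T x)"
   by (simp add: transpose_def inj True p q)
  thus ?thesis using True unfolding exchange_def tab_act x
   by (auto simp: c0)
 qed (simp add: exchange_def tab_act)
qed

lemma permutes_conjugate:
 fixes \<sigma> \<tau> :: "'b => 'b"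
 assumes \<tau>: "\<tau> permutes S" and \<sigma>: "bij \<sigma>"
 shows "\<sigma> \<circ> \<tau> \<circ> inv' \<sigma> permutes \<sigma> ` S"
 unfolding permutes_def
proof (intro conjI allI impI)
 have s: "\<sigma> (inv' \<sigma> x) = x" "inv' \<sigma> (\<sigma> x) = x" for x
  using \<sigma> by (simp_all add: bij_is_surj surj_f_inv_f bij_is_inj)
 fix x
 show "(\<sigma> \<circ> \<tau> \<circ> inv' \<sigma>) x = x" if "x \<notin> \<sigma> ` S"
 proof -
  have "inv' \<sigma> x \<notin> S" using that s(1) by (metis image_eqI)
  thus ?thesis using permutes_not_in[OF \<tau>] s by simp
 qed
 have "bij (\<sigma> \<circ> \<tau> \<circ> inv' \<sigma>)"
  by (intro bij_comp \<sigma> permutes_bij[OF \<tau>] bij_imp_bij_inv)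
 thus "\<exists>!y. (\<sigma> \<circ> \<tau> \<circ> inv' \<sigma>) y = x" by (simp add: bij_iff)
qed

text \<open>Hooks and rows are the shapes all of whose columns but the first have at most one cell.\<close>

locale thin_shape = cring R for R (structure) +
 fixes \<mu> :: "nat list" and E :: "nat set"
 assumes finite_diagram: "finite (diagram \<mu>)"
  and thin: "(r, Suc c) : diagram \<mu> ==> r = 0"
begin

abbreviation "X == tableaux \<mu> E"
abbreviation "FX == free_module R X"
abbreviation "act == tableau_act \<mu>"
abbreviation "first_col T == (%r. T (r, 0)) ` column \<mu> 0"
abbreviation "sg \<sigma> == if evenperm \<sigma> then \<one> else \<ominus> \<one>"
abbreviation "swap j r T == act (transpose (T (r, j)) (T (0, Suc j))) T"
abbreviation "alt_rel \<sigma> T == free_gen R (act \<sigma> T) \<ominus>\<^bsub>FX\<^esub> sg \<sigma> \<odot>\<^bsub>FX\<^esub> free_gen R T"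
abbreviation "shuf_rel j T == free_gen R T \<ominus>\<^bsub>FX\<^esub> (\<Oplus>\<^bsub>FX\<^esub>r\<in>column \<mu> j. free_gen R (swap j r T))"
abbreviation "S == specht R \<mu> E"

sublocale FX: module R FX by (rule free_module_is_module)

lemma finite_column: "finite (column \<mu> j)"
proof (rule finite_subset)
 show "column \<mu> j <= fst ` diagram \<mu>" by (force simp: column_def)
qed (simp add: finite_diagram)

lemma column_Suc: "column \<mu> (Suc j) = (if (0, Suc j) : diagram \<mu> then {0} else {})"
 using thin by (auto simp: column_def)

lemma in_E: "T : X ==> x : diagram \<mu> ==> T x : E" by (simp add: tableaux_iff)

lemma tab_eq: "T : X ==> x : diagram \<mu> ==> y : diagram \<mu> ==> T x = T y \<longleftrightarrow> x = y"
 unfolding tableaux_iff inj_on_def by blast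

lemma act_permutes: "T : X ==> \<sigma> permutes D ==> D <= E ==> act \<sigma> T : X"
 using permutes_inj_on[OF permutes_subset[of \<sigma> D E], of E] permutes_image[OF permutes_subset[of \<sigma> D E]]
 by (intro tableau_act_closed) auto

lemma swap_closed:
 assumes "T : X" "r : column \<mu> j" "(0, Suc j) : diagram \<mu>" shows "swap j r T : X"
proof (rule act_permutes[OF assms(1)])
 show "transpose (T (r, j)) (T (0, Suc j)) permutes {T (r, j), T (0, Suc j)}" by (rule permutes_swap_id) auto
 show "{T (r, j), T (0, Suc j)} <= E" using in_E[OF assms(1)] assms by (auto simp: column_def)
qed

lemma first_col_subset: "T : X ==> first_col T <= E" using in_E by (auto simp: column_def)

text \<open>A permutation that preserves a column with one cell fixes its entry, so only the first
  column can be moved.\<close>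

lemma alternating_rels_eq:
 "alternating_rels R \<mu> E = {alt_rel \<sigma> T | \<sigma> T. T : X & \<sigma> permutes first_col T}"
proof -
 have "\<sigma> permutes (T ` diagram \<mu>) & (\<forall>c. \<sigma> ` (%r. T (r, c)) ` column \<mu> c = (%r. T (r, c)) ` column \<mu> c)
   \<longleftrightarrow> \<sigma> permutes first_col T" (is "?l \<longleftrightarrow> ?r") if T: "T : X" for \<sigma> T
 proof
  assume ?l
  hence l: "\<sigma> permutes (T ` diagram \<mu>)" "\<sigma> ` (%r. T (r, c)) ` column \<mu> c = (%r. T (r, c)) ` column \<mu> c" for c by auto
  show ?r
  proof (rule permutes_superset[OF l(1)])
   show "\<sigma> x = x" if x: "x : T ` diagram \<mu> - first_col T" for x
   proof -
    obtain r c where rc: "(r, c) : diagram \<mu>" "x = T (r, c)" using x by auto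
    have "c ~= 0" using x rc by (auto simp: column_def)
    then obtain c' where c': "c = Suc c'" using not0_implies_Suc by blast
    hence r0: "r = 0" using thin rc(1) by blast
    hence "column \<mu> c = {0}" using rc(1) by (simp add: c' column_Suc)
    thus "\<sigma> x = x" using l(2)[of c] by (simp add: rc(2) r0)
   qed
  qed
 next
  assume r: ?r
  have sub: "first_col T <= T ` diagram \<mu>" by (auto simp: column_def)
  have "\<sigma> ` (%r. T (r, c)) ` column \<mu> c = (%r. T (r, c)) ` column \<mu> c" for c
  proof (cases c)
   case 0 thus ?thesis using permutes_image[OF r] by simp
  next
   case (Suc c')
   have "\<sigma> (T (r, c)) = T (r, c)" if rc: "r : column \<mu> c" for r
   proof (rule permutes_not_in[OF r])
    show "T (r, c) \<notin> first_col T"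
    proof
     assume "T (r, c) : first_col T"
     then obtain r' where "r' : column \<mu> 0" "T (r, c) = T (r', 0)" by blast
     thus False using tab_eq[OF T, of "(r, c)" "(r', 0)"] rc Suc by (simp add: column_def)
    qed
   qed
   thus ?thesis by (simp add: image_image)
  qed
  thus ?l using permutes_subset[OF r sub] by blast
 qed
 thus ?thesis unfolding alternating_rels_def Let_def by (intro Collect_cong) blast
qed

text \<open>Column \<open>j + 1\<close> has at most one cell, which leaves only
  \<open>k = 1\<close>: the sum runs over the entries of column \<open>j\<close>, each transposed
  with that single entry.\<close>

lemma shuffling_rels_eq:
 "shuffling_rels R \<mu> E = {shuf_rel j T | T j. T : X & (0, Suc j) : diagram \<mu>}"
proof -
 have sum: "(\<Oplus>\<^bsub>FX\<^esub>B\<in>{B. B <= column \<mu> j & card B = Suc 0}. free_gen R (exchange \<mu> j B T))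
   = (\<Oplus>\<^bsub>FX\<^esub>r\<in>column \<mu> j. free_gen R (swap j r T))" if T: "T : X" and j: "(0, Suc j) : diagram \<mu>" for T j
 proof -
  have ex: "exchange \<mu> j {r} T = swap j r T" if "r : column \<mu> j" for r
   using that by (intro exchange_single[OF T _ j]) (simp add: column_def)
  have eq: "{B. B <= column \<mu> j & card B = Suc 0} = (%r. {r}) ` column \<mu> j" by (auto simp: card_1_singleton_iff)
  have cl: "free_gen R (exchange \<mu> j {r} T) : carrier FX" if "r : column \<mu> j" for r
   unfolding ex[OF that] by (rule gen_cl[OF swap_closed[OF T that j]])
  have "(\<Oplus>\<^bsub>FX\<^esub>B\<in>(%r. {r}) ` column \<mu> j. free_gen R (exchange \<mu> j B T))
    = (\<Oplus>\<^bsub>FX\<^esub>r\<in>column \<mu> j. free_gen R (exchange \<mu> j {r} T))"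
   by (rule FX.M.finsum_reindex) (use cl in auto)
  also have "... = (\<Oplus>\<^bsub>FX\<^esub>r\<in>column \<mu> j. free_gen R (swap j r T))"
   by (rule FX.M.finsum_cong') (use cl ex in auto)
  finally show ?thesis unfolding eq .
 qed
 have k: "1 <= k & k <= card (column \<mu> (Suc j)) \<longleftrightarrow> k = Suc 0 & (0, Suc j) : diagram \<mu>" for j k
  by (auto simp: column_Suc)
 show ?thesis unfolding shuffling_rels_def Let_def k
  by (intro Collect_cong iffI; elim exE conjE; intro exI conjI; (assumption | simp only: sum)?)
qed

lemma specht_presented: "presented R X (alternating_rels R \<mu> E \<union> shuffling_rels R \<mu> E)"
proof (unfold_locales, rule Un_least)
 show "alternating_rels R \<mu> E <= carrier FX"
 proof
  fix g assume "g : alternating_rels R \<mu> E"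
  then obtain T \<sigma> where g: "g = alt_rel \<sigma> T" and T: "T : X" and \<sigma>: "\<sigma> permutes first_col T"
   unfolding alternating_rels_eq by blast
  have "sg \<sigma> : carrier R" by simp
  thus "g : carrier FX" unfolding g
   by (intro FX.M.minus_closed FX.smult_closed gen_cl T act_permutes[OF T \<sigma> first_col_subset[OF T]])
 qed
 show "shuffling_rels R \<mu> E <= carrier FX"
  unfolding shuffling_rels_eq
  by (auto intro!: FX.M.minus_closed FX.M.finsum_closed gen_cl swap_closed simp del: free_simps)
qed

sublocale Sp: presented R X "alternating_rels R \<mu> E \<union> shuffling_rels R \<mu> E"
 by (rule specht_presented)

abbreviation "sp == Sp.gen"

lemma specht_eq: "S = with_action Sp.P (%\<sigma>. quot_map FX Sp.N (free_map R X id (act \<sigma>)))"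
 by (simp only: specht_def Let_def)

lemma specht_module: "module R S"
 unfolding specht_eq by (rule module_with_action[OF Sp.pres_module])

lemma sp_closed: "T : X ==> sp T : carrier S"
 unfolding specht_eq action_simps by (rule Sp.gen_closed)

lemma sp_closure: "submodule K R S ==> (!!T. T : X ==> sp T : K) ==> v : carrier S ==> v : K"
 unfolding specht_eq action_simps submodule_with_action by (rule Sp.pres_closure)

lemma sp_alt:
 assumes "T : X" "\<sigma> permutes first_col T" shows "sp (act \<sigma> T) = sg \<sigma> \<odot>\<^bsub>S\<^esub> sp T"
proof -
 have "alt_rel \<sigma> T : Sp.N" by (rule FX.span_incl) (intro UnI1, unfold alternating_rels_eq, use assms in blast)
 thus ?thesis unfolding specht_eq action_simps
  by (intro FX.coset_relation_eqs(3)[OF Sp.Q.N_submodule])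
   (use gen_cl assms act_permutes[OF assms first_col_subset] in "simp_all del: free_simps")
qed

text \<open>The shuffling relation as a closure rule for submodules, the form in which straightening
  uses it.\<close>

lemma sp_shuffle:
 assumes T: "T : X" and j: "(0, Suc j) : diagram \<mu>"
  and K: "submodule K R S" and sw: "!!r. r : column \<mu> j ==> sp (swap j r T) : K"
 shows "sp T : K"
proof -
 have K': "submodule K R Sp.P" using K unfolding specht_eq submodule_with_action .
 interpret P: module R Sp.P by (rule Sp.pres_module)
 interpret K: submodule K R Sp.P by (rule K')
 have "shuf_rel j T : Sp.N" by (rule FX.span_incl) (intro UnI2, unfold shuffling_rels_eq, use assms(1,2) in blast)
 moreover have cl: "free_gen R (swap j r T) : carrier FX" if "r : column \<mu> j" for r
  by (rule gen_cl[OF swap_closed[OF T that j]])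
 moreover have "(\<Oplus>\<^bsub>FX\<^esub>r\<in>column \<mu> j. free_gen R (swap j r T)) : carrier FX"
  by (rule FX.M.finsum_closed) (use cl in auto)
 ultimately have "sp T = Sp.cls (\<Oplus>\<^bsub>FX\<^esub>r\<in>column \<mu> j. free_gen R (swap j r T))"
  by (intro FX.coset_relation_eqs(2)[OF Sp.Q.N_submodule]) (use gen_cl[OF T] in auto)
 also have "... = (\<Oplus>\<^bsub>Sp.P\<^esub>r\<in>column \<mu> j. sp (swap j r T))"
  by (rule semilinear_finsum[OF FX.module_axioms Sp.pres_module Sp.Q.coset_linear finite_column]) (rule cl)
 also have "... : K" by (rule P.submodule_finsum[OF K' finite_column]) (rule sw)
 finally show ?thesis .
qed

lemma sp_lift:
 assumes L: "module R L" and h: "h : X \<rightarrow> carrier L"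
  and alt: "!!T \<sigma>. T : X ==> \<sigma> permutes first_col T ==> h (act \<sigma> T) = (if evenperm \<sigma> then h T else \<ominus>\<^bsub>L\<^esub> h T)"
  and shuf: "!!T j. T : X ==> (0, Suc j) : diagram \<mu> ==> h T = (\<Oplus>\<^bsub>L\<^esub>r\<in>column \<mu> j. h (swap j r T))"
 obtains f where "f : linear_maps R S L" "!!T. T : X ==> f (sp T) = h T"
proof -
 interpret L: module R L by fact
 note lin = L.free_lift_linear[OF h] and ge = L.free_lift_gen[OF h]
 have hc: "T : X ==> h T : carrier L" for T using h by auto
 have "free_lift R L h g = \<zero>\<^bsub>L\<^esub>" if "g : alternating_rels R \<mu> E \<union> shuffling_rels R \<mu> E" for g
  using that
 proof
  assume "g : alternating_rels R \<mu> E"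
  then obtain T \<sigma> where g: "g = alt_rel \<sigma> T" and T: "T : X" and \<sigma>: "\<sigma> permutes first_col T"
   unfolding alternating_rels_eq by blast
  note T' = act_permutes[OF T \<sigma> first_col_subset[OF T]]
  have sg: "sg \<sigma> : carrier R" by simp
  have e: "sg \<sigma> \<odot>\<^bsub>L\<^esub> h T = h (act \<sigma> T)" using alt[OF T \<sigma>] hc[OF T] by (simp add: L.smult_l_minus)
  have "free_lift R L h g = free_lift R L h (free_gen R (act \<sigma> T)) \<ominus>\<^bsub>L\<^esub> free_lift R L h (sg \<sigma> \<odot>\<^bsub>FX\<^esub> free_gen R T)"
   unfolding g by (rule semilinear_diff[OF FX.module_axioms L lin gen_cl[OF T'] FX.smult_closed[OF sg gen_cl[OF T]]])
  also have "free_lift R L h (sg \<sigma> \<odot>\<^bsub>FX\<^esub> free_gen R T) = h (act \<sigma> T)"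
   unfolding slinearD(3)[OF lin sg gen_cl[OF T]] ge[OF T] id_apply by (rule e)
  finally show ?thesis using hc[OF T'] by (simp add: ge[OF T'] L.M.diff_eq_zero_iff)
 next
  assume "g : shuffling_rels R \<mu> E"
  then obtain T j where g: "g = shuf_rel j T" and T: "T : X" and j: "(0, Suc j) : diagram \<mu>"
   unfolding shuffling_rels_eq by blast
  have cl: "free_gen R (swap j r T) : carrier FX" if "r : column \<mu> j" for r
   by (rule gen_cl[OF swap_closed[OF T that j]])
  have cs: "(\<Oplus>\<^bsub>FX\<^esub>r\<in>column \<mu> j. free_gen R (swap j r T)) : carrier FX"
   by (rule FX.M.finsum_closed) (use cl in auto)
  have "free_lift R L h (\<Oplus>\<^bsub>FX\<^esub>r\<in>column \<mu> j. free_gen R (swap j r T))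
    = (\<Oplus>\<^bsub>L\<^esub>r\<in>column \<mu> j. free_lift R L h (free_gen R (swap j r T)))"
   by (rule semilinear_finsum[OF FX.module_axioms L lin finite_column]) (rule cl)
  also have "... = (\<Oplus>\<^bsub>L\<^esub>r\<in>column \<mu> j. h (swap j r T))"
   by (rule L.M.finsum_cong') (use ge swap_closed[OF T _ j] hc in auto)
  also have "... = h T" by (rule shuf[OF T j, symmetric])
  finally have e: "free_lift R L h (\<Oplus>\<^bsub>FX\<^esub>r\<in>column \<mu> j. free_gen R (swap j r T)) = h T" .
  have "free_lift R L h g = h T \<ominus>\<^bsub>L\<^esub> h T"
   unfolding g semilinear_diff[OF FX.module_axioms L lin gen_cl[OF T] cs] e ge[OF T] ..
  thus ?thesis using hc[OF T] by (simp add: L.M.diff_eq_zero_iff)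
 qed
 from Sp.pres_lift[OF L h this] obtain f where
  "f : linear_maps R Sp.P L" "!!T. T : X ==> f (sp T) = h T" by blast
 thus ?thesis by (intro that[of f]) (simp_all add: specht_eq slinear_action)
qed

text \<open>Relabelling by \<open>\<sigma>\<close> turns a column permutation \<open>\<tau>\<close>
  into its conjugate, which has the same sign and preserves the relabelled column; exchanges are
  conjugated likewise. Hence relations go to relations.\<close>

lemma sp_act:
 assumes bij: "bij \<sigma>" and perm: "permutation \<sigma>" and E: "\<sigma> ` E = E"
 shows "gact S \<sigma> : linear_maps R S S" and "T : X ==> gact S \<sigma> (sp T) = sp (act \<sigma> T)"
proof -
 have inj: "inj \<sigma>" by (rule bij_is_inj[OF bij])
 have cl: "act \<sigma> T : X" if "T : X" for T
  by (rule tableau_act_closed[OF that inj_on_subset[OF inj]]) (simp_all add: E)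
 have ai: "act \<sigma> T x = \<sigma> (T x)" if "x : diagram \<mu>" for T x using that by (simp add: tab_act)
 interpret ring_endo R id by (rule ring_endo_id)
 have lin: "free_map R X id (act \<sigma>) : linear_maps R FX FX" by (rule free_map_semilinear) (rule cl)
 note d = semilinear_diff[OF FX.module_axioms FX.module_axioms lin]
 have rel: "free_map R X id (act \<sigma>) g : Sp.N" if "g : alternating_rels R \<mu> E \<union> shuffling_rels R \<mu> E" for g
 proof (rule FX.span_incl)
  show "free_map R X id (act \<sigma>) g : alternating_rels R \<mu> E \<union> shuffling_rels R \<mu> E"
   using that
  proof
   assume "g : alternating_rels R \<mu> E"
   then obtain T \<tau> where g: "g = alt_rel \<tau> T" and T: "T : X" and \<tau>: "\<tau> permutes first_col T"
    unfolding alternating_rels_eq by blast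
   note T' = act_permutes[OF T \<tau> first_col_subset[OF T]]
   define \<rho> where "\<rho> = \<sigma> \<circ> \<tau> \<circ> inv' \<sigma>"
   have "first_col (act \<sigma> T) = \<sigma> ` first_col T"
    unfolding image_image by (rule image_cong) (simp_all add: column_def tab_act)
   hence \<rho>: "\<rho> permutes first_col (act \<sigma> T)" unfolding \<rho>_def using permutes_conjugate[OF \<tau> bij] by simp
   have fin: "finite (first_col T)" using finite_column by simp
   have p\<tau>: "permutation \<tau>" using \<tau> fin permutation_permutes by blast
   have ev: "evenperm \<rho> = evenperm \<tau>" unfolding \<rho>_def
    using evenperm_comp[OF permutation_compose[OF perm p\<tau>] permutation_inverse[OF perm]]
     evenperm_comp[OF perm p\<tau>] evenperm_inv[OF perm] by auto
   have ac: "act \<sigma> (act \<tau> T) = act \<rho> (act \<sigma> T)"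
    unfolding tableau_act_comp \<rho>_def using inj by (simp add: comp_assoc inv_o_cancel)
   have sg: "sg \<tau> : carrier R" by simp
   have "free_map R X id (act \<sigma>) g = alt_rel \<rho> (act \<sigma> T)"
    unfolding g ev d[OF gen_cl[OF T'] FX.smult_closed[OF sg gen_cl[OF T]]]
     slinearD(3)[OF lin sg gen_cl[OF T]] free_map_gen[OF T] free_map_gen[OF T'] ac id_apply ..
   thus ?thesis unfolding alternating_rels_eq using \<rho> cl[OF T] by blast
  next
   assume "g : shuffling_rels R \<mu> E"
   then obtain T j where g: "g = shuf_rel j T" and T: "T : X" and j: "(0, Suc j) : diagram \<mu>"
    unfolding shuffling_rels_eq by blast
   have fc: "free_gen R (swap j r T) : carrier FX" if "r : column \<mu> j" for r
    by (rule gen_cl[OF swap_closed[OF T that j]])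
   have cs: "(\<Oplus>\<^bsub>FX\<^esub>r\<in>column \<mu> j. free_gen R (swap j r T)) : carrier FX"
    by (rule FX.M.finsum_closed) (use fc in auto)
   have sw: "act \<sigma> (swap j r T) = swap j r (act \<sigma> T)" if "r : column \<mu> j" for r
   proof -
    have "\<sigma> \<circ> transpose a b = transpose (\<sigma> a) (\<sigma> b) \<circ> \<sigma>" for a b
     using inj by (auto simp: fun_eq_iff transpose_def inj_eq)
    thus ?thesis unfolding tableau_act_comp using that j by (simp add: ai column_def)
   qed
   have "free_map R X id (act \<sigma>) (\<Oplus>\<^bsub>FX\<^esub>r\<in>column \<mu> j. free_gen R (swap j r T))
     = (\<Oplus>\<^bsub>FX\<^esub>r\<in>column \<mu> j. free_map R X id (act \<sigma>) (free_gen R (swap j r T)))"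
    by (rule semilinear_finsum[OF FX.module_axioms FX.module_axioms lin finite_column]) (rule fc)
   also have "... = (\<Oplus>\<^bsub>FX\<^esub>r\<in>column \<mu> j. free_gen R (swap j r (act \<sigma> T)))"
   proof (rule FX.M.finsum_cong')
    show "(%r. free_gen R (swap j r (act \<sigma> T))) : column \<mu> j \<rightarrow> carrier FX"
     by (rule funcsetI) (rule gen_cl[OF swap_closed[OF cl[OF T] _ j]])
    fix r assume r: "r : column \<mu> j"
    show "free_map R X id (act \<sigma>) (free_gen R (swap j r T)) = free_gen R (swap j r (act \<sigma> T))"
     unfolding free_map_gen[OF swap_closed[OF T r j]] sw[OF r] ..
   qed simp
   finally have "free_map R X id (act \<sigma>) g = shuf_rel j (act \<sigma> T)"
    unfolding g d[OF gen_cl[OF T] cs] free_map_gen[OF T] by simp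
   thus ?thesis unfolding shuffling_rels_eq using cl[OF T] j by blast
  qed
 qed
 note pm = presented_map[OF specht_presented specht_presented ring_endo_id cl rel]
 show "gact S \<sigma> : linear_maps R S S"
  unfolding specht_eq action_simps slinear_action by (rule pm(1))
 show "T : X ==> gact S \<sigma> (sp T) = sp (act \<sigma> T)"
  unfolding specht_eq action_simps by (rule pm(2))
qed

end

lemma diagram_hook: "1 <= d ==> (r, c) : diagram (hook d i) \<longleftrightarrow> (r = 0 & c < d) | (r <= i & c = 0)"
 by (cases r) (auto simp: diagram_def hook_def)

lemma diagram_one_row: "(r, c) : diagram (one_row k) \<longleftrightarrow> r = 0 & c < k"
 by (auto simp: diagram_def one_row_def)

lemma (in cring) thin_hook: "1 <= d ==> thin_shape R (hook d i)"
proof (unfold_locales)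
 assume d: "1 <= d"
 show "finite (diagram (hook d i))"
  by (rule finite_subset[of _ "{0..i} \<times> {0..d}"]) (auto simp: diagram_hook[OF d])
qed (auto simp: diagram_hook)

lemma (in cring) thin_one_row: "thin_shape R (one_row k)"
proof (unfold_locales)
 show "finite (diagram (one_row k))"
  by (rule finite_subset[of _ "{0} \<times> {0..k}"]) (auto simp: diagram_one_row)
qed (auto simp: diagram_one_row)

section \<open>Induced modules\<close>

text \<open>The relations inside \<open>induced_rel\<close> before the span is taken, for use as an
  instance of \<open>presented\<close>.\<close>

definition induced_gens ::
 "('a, 'p) ring_scheme => ('g, 'q) monoid_scheme => 'g set => ('a, 'b, 'g, 's) gmodule_scheme
  => ('g \<times> 'b => 'a) set" where
 "induced_gens A G H V = (let F = free_module A (carrier G \<times> carrier V); e = free_gen A in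
   ({e (g, v \<oplus>\<^bsub>V\<^esub> w) \<ominus>\<^bsub>F\<^esub> e (g, v) \<ominus>\<^bsub>F\<^esub> e (g, w) | g v w.
     g : carrier G & v : carrier V & w : carrier V} \<union>
   {e (g, a \<odot>\<^bsub>V\<^esub> v) \<ominus>\<^bsub>F\<^esub> a \<odot>\<^bsub>F\<^esub> e (g, v) | g a v.
     g : carrier G & a : carrier A & v : carrier V} \<union>
   {e (g \<otimes>\<^bsub>G\<^esub> h, v) \<ominus>\<^bsub>F\<^esub> e (g, gact V h v) | g h v.
     g : carrier G & h : H & v : carrier V}))"

locale induced_module = V: module R V + G: group G
 for R (structure) and V :: "('a, 'b, 'g, 's) gmodule_scheme" (structure) and G :: "('g, 'q) monoid_scheme" (structure) +
 fixes H :: "'g set"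
 assumes H_sub: "h : H ==> h : carrier G"
  and H_act: "h : H ==> gact V h : linear_maps R V V"
begin

abbreviation "X == carrier G \<times> carrier V"
abbreviation "FX == free_module R X"
abbreviation "ind == induced R G H V"

sublocale FX: module R FX by (rule V.free_module_is_module)

lemma fg: "g : carrier G ==> v : carrier V ==> free_gen R (g, v) : carrier FX"
 by (rule V.gen_cl) auto

lemma act_closed: "h : H ==> v : carrier V ==> gact V h v : carrier V"
 by (rule slinearD(1)[OF H_act])

lemma GH_closed: "g : carrier G ==> h : H ==> g \<otimes>\<^bsub>G\<^esub> h : carrier G"
 using H_sub by simp

lemma induced_gens_I:
 "g : carrier G ==> v : carrier V ==> w : carrier V ==>
  free_gen R (g, v \<oplus>\<^bsub>V\<^esub> w) \<ominus>\<^bsub>FX\<^esub> free_gen R (g, v) \<ominus>\<^bsub>FX\<^esub> free_gen R (g, w) : induced_gens R G H V"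
 "g : carrier G ==> a : carrier R ==> v : carrier V ==>
  free_gen R (g, a \<odot>\<^bsub>V\<^esub> v) \<ominus>\<^bsub>FX\<^esub> a \<odot>\<^bsub>FX\<^esub> free_gen R (g, v) : induced_gens R G H V"
 "g : carrier G ==> h : H ==> v : carrier V ==>
  free_gen R (g \<otimes>\<^bsub>G\<^esub> h, v) \<ominus>\<^bsub>FX\<^esub> free_gen R (g, gact V h v) : induced_gens R G H V"
 unfolding induced_gens_def Let_def by blast+

lemma induced_presented: "presented R X (induced_gens R G H V)"
proof (unfold_locales)
 show "induced_gens R G H V <= carrier FX"
  unfolding induced_gens_def Let_def
  by (intro subsetI) (elim UnE CollectE exE conjE; simp only:;
    (intro FX.M.minus_closed FX.smult_closed fg V.M.a_closed V.smult_closed GH_closed act_closed; assumption?)+)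
qed

sublocale I: presented R X "induced_gens R G H V" by (rule induced_presented)

abbreviation "ig g v == I.gen (g, v)"

lemma ind_eq: "ind = with_action I.P (%k. quot_map FX I.N (free_map R X id (%(g, v). (k \<otimes>\<^bsub>G\<^esub> g, v))))"
 by (simp only: induced_def induced_rel_def induced_gens_def Let_def)

lemma ind_module: "module R ind"
 unfolding ind_eq by (rule module_with_action[OF I.pres_module])

lemma ig_closed: "g : carrier G ==> v : carrier V ==> ig g v : carrier ind"
 unfolding ind_eq action_simps by (rule I.gen_closed) simp

lemma ind_closure:
 "submodule K R ind ==> (!!g v. g : carrier G ==> v : carrier V ==> ig g v : K) ==> u : carrier ind ==> u : K"
 unfolding ind_eq action_simps submodule_with_action using I.pres_closure[of K u] by auto

lemma ind_ext:
 "module R L ==> f : semilinear_maps R \<theta> ind L ==> f' : semilinear_maps R \<theta> ind L ==>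
  (!!g v. g : carrier G ==> v : carrier V ==> f (ig g v) = f' (ig g v)) ==> u : carrier ind ==> f u = f' u"
 unfolding ind_eq action_simps slinear_action using I.pres_ext[of L f \<theta> f' u] by auto

lemma ig_linear: "g : carrier G ==> ig g : linear_maps R V ind"
proof (rule slinearI)
 assume g: "g : carrier G"
 show "v : carrier V ==> ig g v : carrier ind" for v by (rule ig_closed[OF g])
 show "ig g (v \<oplus>\<^bsub>V\<^esub> w) = ig g v \<oplus>\<^bsub>ind\<^esub> ig g w" if "v : carrier V" "w : carrier V" for v w
  unfolding ind_eq action_simps
  by (rule FX.coset_relation_eqs(1)[OF I.Q.N_submodule fg fg fg FX.span_incl[OF induced_gens_I(1)]])
   (use that g in auto)
 show "ig g (a \<odot>\<^bsub>V\<^esub> v) = id a \<odot>\<^bsub>ind\<^esub> ig g v" if "a : carrier R" "v : carrier V" for a v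
  unfolding ind_eq action_simps id_apply
  by (rule FX.coset_relation_eqs(3)[OF I.Q.N_submodule fg fg fg _ FX.span_incl[OF induced_gens_I(2)]])
   (use that g in auto)
qed

lemma ig_H: 
 assumes "g : carrier G" "h : H" "v : carrier V" shows "ig (g \<otimes>\<^bsub>G\<^esub> h) v = ig g (gact V h v)"
 by (rule FX.coset_relation_eqs(2)[OF I.Q.N_submodule fg fg fg FX.span_incl[OF induced_gens_I(3)]])
  (use assms H_sub act_closed in auto)

lemma ind_lift:
 assumes L: "module R L" and \<beta>: "!!g. g : carrier G ==> \<beta> g : linear_maps R V L"
  and H: "!!g h v. g : carrier G ==> h : H ==> v : carrier V ==> \<beta> (g \<otimes>\<^bsub>G\<^esub> h) v = \<beta> g (gact V h v)"
 obtains f where "f : linear_maps R ind L"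
  "!!g v. g : carrier G ==> v : carrier V ==> f (ig g v) = \<beta> g v"
proof -
 interpret L: module R L by fact
 let ?h = "%(g, v). \<beta> g v"
 note \<beta>D = slinearD[OF \<beta>]
 have h: "?h : X \<rightarrow> carrier L" using \<beta>D(1) by auto
 note lin = L.free_lift_linear[OF h]
 note d = semilinear_diff[OF FX.module_axioms L lin]
 have ge: "free_lift R L ?h (free_gen R (g, v)) = \<beta> g v" if "g : carrier G" "v : carrier V" for g v
  using L.free_lift_gen[OF h, of "(g, v)"] that by simp
 have cancel: "a \<oplus>\<^bsub>L\<^esub> b \<ominus>\<^bsub>L\<^esub> a \<ominus>\<^bsub>L\<^esub> b = \<zero>\<^bsub>L\<^esub>" if "a : carrier L" "b : carrier L" for a b
 proof -
  have "a \<oplus>\<^bsub>L\<^esub> b \<ominus>\<^bsub>L\<^esub> a \<ominus>\<^bsub>L\<^esub> b = (a \<oplus>\<^bsub>L\<^esub> b) \<ominus>\<^bsub>L\<^esub> (a \<oplus>\<^bsub>L\<^esub> b)"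
   using that by (simp add: a_minus_def L.M.minus_add L.M.a_assoc)
  thus ?thesis using that by (simp add: L.M.diff_eq_zero_iff)
 qed
 have "free_lift R L ?h u = \<zero>\<^bsub>L\<^esub>" if "u : induced_gens R G H V" for u
  using that unfolding induced_gens_def Let_def
  by (elim UnE CollectE exE conjE)
   (simp_all add: d fg ge \<beta>D H cancel L.M.diff_eq_zero_iff slinearD(3)[OF lin] FX.M.minus_closed FX.smult_closed
    H_sub act_closed)
 from I.pres_lift[OF L h this] obtain f where
  "f : linear_maps R I.P L" "!!x. x : X ==> f (I.gen x) = ?h x" by blast
 thus ?thesis by (intro that[of f]) (simp_all add: ind_eq slinear_action)
qed

lemma ind_act:
 assumes k: "k : carrier G"
 shows "gact ind k : linear_maps R ind ind"
  and "!!g v. g : carrier G ==> v : carrier V ==> gact ind k (ig g v) = ig (k \<otimes>\<^bsub>G\<^esub> g) v"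
proof -
 let ?h = "%(g, v). (k \<otimes>\<^bsub>G\<^esub> g, v)"
 interpret ring_endo R id by (rule V.ring_endo_id)
 have h: "?h x : X" if "x : X" for x using that k by auto
 have lin: "free_map R X id ?h : linear_maps R FX FX"
  by (rule free_map_semilinear) (rule h)
 note d = semilinear_diff[OF FX.module_axioms FX.module_axioms lin]
 have ge: "free_map R X id ?h (free_gen R (g, v)) = free_gen R (k \<otimes>\<^bsub>G\<^esub> g, v)"
  if "g : carrier G" "v : carrier V" for g v
  using free_map_gen[of "(g, v)" X ?h] that by simp
 have rel: "free_map R X id ?h u : I.N" if "u : induced_gens R G H V" for u
 proof (rule FX.span_incl)
  \<comment> \<open>Left translation by \<open>k\<close> respects the relation for \<open>H\<close>,
    which multiplies on the right.\<close>
  have *: "free_gen R (k \<otimes>\<^bsub>G\<^esub> (g \<otimes>\<^bsub>G\<^esub> h), v) \<ominus>\<^bsub>FX\<^esub> free_gen R (k \<otimes>\<^bsub>G\<^esub> g, gact V h v) : induced_gens R G H V"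
   if "g : carrier G" "h : H" "v : carrier V" for g h v
   using induced_gens_I(3)[of "k \<otimes>\<^bsub>G\<^esub> g" h v] that k H_sub by (simp add: G.m_assoc)
  show "free_map R X id ?h u : induced_gens R G H V"
   using that[unfolded induced_gens_def Let_def]
   by (elim UnE CollectE exE conjE)
   (simp_all add: d fg ge slinearD(3)[OF lin] FX.M.minus_closed
    FX.smult_closed induced_gens_I(1,2) * k H_sub act_closed)
 qed
 note pm = presented_map[OF induced_presented induced_presented V.ring_endo_id h rel]
 show "gact ind k : linear_maps R ind ind"
  unfolding ind_eq action_simps slinear_action by (rule pm(1))
 fix g v assume "g : carrier G" "v : carrier V"
 thus "gact ind k (ig g v) = ig (k \<otimes>\<^bsub>G\<^esub> g) v"
  unfolding ind_eq action_simps using pm(2)[of "(g, v)"] by simp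
qed

end

section \<open>Straightening\<close>

text \<open>The first letter of the target is brought to the front by adjacent swaps, and the rest
  follows by induction on the target.\<close>

lemma adjacent_swaps_closed:
 assumes "mset xs = mset ys" and "P xs"
  and sw: "!!u a b v. mset (u @ a # b # v) = mset xs ==> P (u @ a # b # v) ==> P (u @ b # a # v)"
 shows "P ys"
 using assms
proof (induction ys arbitrary: xs P)
 case Nil thus ?case by simp
next
 case (Cons y ys)
 have front: "P (y # u @ v)" if "P (u @ y # v)" "mset (u @ y # v) = mset xs" for u v
  using that
 proof (induction u arbitrary: v rule: rev_induct)
  case (snoc a u)
  have "P (u @ y # a # v)"
   by (rule Cons.prems(3)) (use snoc.prems in auto)
  thus ?case using snoc.IH[of "a # v"] snoc.prems(2) by (simp add: add_mset_commute)
 qed simp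
 have "y : set xs" using Cons.prems(1) by (metis list.set_intros(1) set_mset_mset)
 then obtain u v where xs: "xs = u @ y # v" by (meson split_list)
 have "P (y # u @ v)" using front[of u v] Cons.prems(2) xs by simp
 show ?case
 proof (rule Cons.IH[where P = "%l. P (y # l)" and xs = "u @ v"])
  show "mset (u @ v) = mset ys" using Cons.prems(1) xs by simp
  show "P (y # u @ v)" by fact
  fix u' a b v' assume "mset (u' @ a # b # v') = mset (u @ v)" "P (y # u' @ a # b # v')"
  thus "P (y # u' @ b # a # v')" using Cons.prems(3)[of "y # u'" a b v'] xs by simp
 qed
qed

text \<open>The three blocks are the first column, the arm and the one-row tableau; all remaining
  letters go into the row in increasing order.\<close>

definition std_word :: "nat => nat list \<times> nat set => nat list" where
 "std_word n x = fst x @ sorted_list_of_set (snd x) @ sorted_list_of_set ({1..n} - set (fst x) - snd x)"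

text \<open>
 A word in the letters \<open>1, ..., n\<close> is cut into a column \<open>c\<close>, an arm \<open>q\<close> and a rest \<open>z\<close>. If the least letter
 \<open>s\<close> of \<open>c @ q\<close> lies in "q", a single shuffle brings it into the column.
\<close>

lemma straighten:
 assumes M: "M = mset [1..<Suc n]"
  and word: "mset (c @ q @ z) = M" "length c = Suc i" "length q = d - 1"
  and swap_c: "!!u a b v q z. mset (u @ a # b # v @ q @ z) = M ==> length (u @ a # b # v) = Suc i ==>
   length q = d - 1 ==> P (u @ a # b # v @ q @ z) ==> P (u @ b # a # v @ q @ z)"
  and swap_q: "!!c u a b v z. mset (c @ u @ a # b # v @ z) = M ==> length c = Suc i ==>
   length (u @ a # b # v) = d - 1 ==> P (c @ u @ a # b # v @ z) ==> P (c @ u @ b # a # v @ z)"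
  and swap_z: "!!c q u a b v. mset (c @ q @ u @ a # b # v) = M ==> length c = Suc i ==>
   length q = d - 1 ==> P (c @ q @ u @ a # b # v) ==> P (c @ q @ u @ b # a # v)"
  and shuffle: "!!c a q z. mset (c @ a # q @ z) = M ==> length c = Suc i ==> length (a # q) = d - 1 ==>
   (!!r. r <= i ==> P (c[r := a] @ (c ! r) # q @ z)) ==> P (c @ a # q @ z)"
  and std: "!!x. x : std_pairs n d i ==> P (std_word n x)"
 shows "P (c @ q @ z)"
proof -
 \<comment> \<open>The three kinds of adjacent swaps make \<open>P\<close> independent of the order
   of the letters within each block.\<close>
 have reorder: "P (c @ q @ z)"
  if P: "P (c' @ q' @ z')" and m: "mset c' = mset c" "mset q' = mset q" "mset z' = mset z"
   and w: "mset (c @ q @ z) = M" "length c = Suc i" "length q = d - 1" for c q z c' q' z'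
 proof -
  have l: "length c' = Suc i" "length q' = d - 1" using m w by (metis size_mset)+
  have "P (c @ q' @ z')"
  proof (rule adjacent_swaps_closed[where P = "%c. P (c @ q' @ z')" and xs = c', OF m(1) P])
   fix u a b v assume a: "mset (u @ a # b # v) = mset c'" "P ((u @ a # b # v) @ q' @ z')"
   have "P (u @ b # a # v @ q' @ z')"
   proof (rule swap_c)
    have e: "mset (u @ a # b # v @ q' @ z') = mset (u @ a # b # v) + mset q' + mset z'" by simp
    show "mset (u @ a # b # v @ q' @ z') = M" unfolding e a(1) m using w(1) by (simp add: add.assoc)
    show "length (u @ a # b # v) = Suc i" using mset_eq_length[OF a(1)] l by simp
   qed (use a l in simp_all)
   thus "P ((u @ b # a # v) @ q' @ z')" by simp
  qed
  hence "P (c @ q @ z')"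
  proof (rule adjacent_swaps_closed[where P = "%q. P (c @ q @ z')" and xs = q', OF m(2)])
   fix u a b v assume a: "mset (u @ a # b # v) = mset q'" "P (c @ (u @ a # b # v) @ z')"
   have "P (c @ u @ b # a # v @ z')"
   proof (rule swap_q)
    have e: "mset (c @ u @ a # b # v @ z') = mset c + mset (u @ a # b # v) + mset z'" by simp
    show "mset (c @ u @ a # b # v @ z') = M" unfolding e a(1) m using w(1) by (simp add: add.assoc)
    show "length (u @ a # b # v) = d - 1" using mset_eq_length[OF a(1)] l by simp
   qed (use a w in simp_all)
   thus "P (c @ (u @ b # a # v) @ z')" by simp
  qed
  thus "P (c @ q @ z)"
  proof (rule adjacent_swaps_closed[where P = "%z. P (c @ q @ z)" and xs = z', OF m(3)])
   fix u a b v assume a: "mset (u @ a # b # v) = mset z'" "P (c @ q @ u @ a # b # v)"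
   show "P (c @ q @ u @ b # a # v)"
   proof (rule swap_z)
    have e: "mset (c @ q @ u @ a # b # v) = mset c + mset q + mset (u @ a # b # v)" by simp
    show "mset (c @ q @ u @ a # b # v) = M" unfolding e a(1) m using w(1) by (simp add: add.assoc)
   qed (use a w in simp_all)
  qed
 qed
 \<comment> \<open>If the least letter of column and arm is in the column, sorting the blocks gives
   a standard word.\<close>
 have in_col: "P (c @ q @ z)"
  if w: "mset (c @ q @ z) = M" "length c = Suc i" "length q = d - 1"
   and s: "s : set c" "!!r. r : set c \<union> set q ==> s <= r" for c q z s
 proof -
  have dist: "distinct (c @ q @ z)" using w(1) M by (metis distinct_upt mset_eq_imp_distinct_iff)
  have sets: "set (c @ q @ z) = {1..n}" 
   unfolding mset_eq_setD[OF w(1)[unfolded M]] by (simp only: set_upt atLeastLessThanSuc_atLeastAtMost)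
  have srt: "sorted_wrt (<) (sort c)" using dist strict_sorted_iff[of "sort c"] by simp
  have hd: "hd (sort c) = s"
  proof -
   have "sort c ~= []" using w(2) by (metis length_sort length_0_conv nat.distinct(1))
   then obtain t ts where t: "sort c = t # ts" by (cases "sort c") auto
   have "t : set c" using t by (metis list.set_intros(1) set_sort)
   moreover have "t <= s" using s(1) srt t by (metis order.refl less_imp_le set_ConsD set_sort sorted_wrt.simps(2))
   ultimately show ?thesis using s(2)[of t] t by simp
  qed
  let ?x = "(sort c, set q)"
  have "s < r" if "r : set q" for r using s(2)[of r] s(1) dist that by (auto simp: le_less)
  hence "?x : std_pairs n d i"
   using dist sets w(2,3) srt hd by (auto simp: std_pairs_def distinct_card)
  note std[OF this]
  moreover have "std_word n ?x = sort c @ sort q @ sort z"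
  proof -
   have "{1..n} - set c - set q = set z" unfolding sets[symmetric] using dist by auto
   thus ?thesis using dist by (simp add: std_word_def sorted_list_of_set_sort_remdups distinct_remdups_id)
  qed
  ultimately have "P (sort c @ sort q @ sort z)" by simp
  thus ?thesis by (rule reorder[OF _ mset_sort mset_sort mset_sort w])
 qed
 define s where "s = Min (set c \<union> set q)"
 have "set c \<union> set q ~= {}" using word(2) by auto
 hence s: "s : set c \<union> set q" unfolding s_def by (intro Min_in) simp_all
 have min: "s <= r" if "r : set c \<union> set q" for r unfolding s_def by (rule Min_le[OF _ that]) simp
 show ?thesis
 proof (cases "s : set c")
  case True
  thus ?thesis using in_col[OF word] min by blast
 next
  case False
  hence sq: "s : set q" using s by blast
  let ?q = "remove1 s q"
  have mq: "mset (s # ?q) = mset q" using sq by simp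
  \<comment> \<open>One exchange is enough: whatever letter of the column is replaced by
    \<open>s\<close>, the column then contains the least letter.\<close>
  have "P (c @ s # ?q @ z)"
  proof (rule shuffle)
   show "mset (c @ s # ?q @ z) = M" using word(1) mq by (metis append_Cons mset_append)
   show "length (s # ?q) = d - 1" using mq word(3) by (metis size_mset)
   fix r assume r: "r <= i"
   have rc: "r < length c" using r word(2) by simp
   have mr: "mset (c[r := s]) + {#c ! r#} = mset c + {#s#}"
    using mset_update[OF rc, of s] rc by (simp add: add_mset_remove_trivial_If)
   have sr: "s : set (c[r := s])" by (rule set_update_memI[OF rc])
   have mm: "mset (c[r := s]) + mset ((c ! r) # ?q) = mset c + mset q"
   proof -
    have "mset (c[r := s]) + mset ((c ! r) # ?q) = (mset (c[r := s]) + {#c ! r#}) + mset ?q" by simp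
    also have "... = mset c + mset (s # ?q)" unfolding mr by simp
    finally show ?thesis unfolding mq .
   qed
   have "P (c[r := s] @ ((c ! r) # ?q) @ z)"
   proof (rule in_col[OF _ _ _ sr])
    have e: "mset (c[r := s] @ ((c ! r) # ?q) @ z) = mset (c[r := s]) + mset ((c ! r) # ?q) + mset z" by simp
    show "mset (c[r := s] @ ((c ! r) # ?q) @ z) = M" unfolding e mm using word(1) by (simp add: add.assoc)
    show "length ((c ! r) # ?q) = d - 1" using mset_eq_length[OF mq] word(3) by simp
    fix t assume "t : set (c[r := s]) \<union> set ((c ! r) # ?q)"
    hence "t \<in># mset (c[r := s]) + mset ((c ! r) # ?q)" by (simp only: union_iff set_mset_mset Un_iff)
    thus "s <= t" unfolding mm using min by simp
   qed (use word in simp)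
   thus "P (c[r := s] @ (c ! r) # ?q @ z)" by simp
  qed (rule word(2))
  hence "P (c @ (s # ?q) @ z)" by simp
  thus ?thesis by (rule reorder[OF _ refl mq refl word])
 qed
qed

section \<open>The comparison map\<close>

lemma linear_comp:
 "f : linear_maps R L M ==> g : linear_maps R M N ==> (%x. g (f x)) : linear_maps R L N"
 using semilinear_comp[of f R id L M g id N] by (simp add: id_def)

lemma (in tensors) pure_linear_left: "y : carrier N ==> (%x. pt x y) : linear_maps R M T"
 by (rule slinearI) (simp_all add: pure_closed pure_add_left pure_smult_left)

lemma (in tensors) pure_linear_right: "x : carrier M ==> (%y. pt x y) : linear_maps R N T"
 by (rule slinearI) (simp_all add: pure_closed pure_add_right pure_smult_right)

lemma (in thin_shape) swap_apply:
 assumes "T : X" "p : diagram \<mu>" "q : diagram \<mu>" "x : diagram \<mu>"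
 shows "transpose (T p) (T q) (T x) = (if x = p then T q else if x = q then T p else T x)"
 using tab_eq[OF assms(1)] assms(2-) by (auto simp: transpose_def)

context sqfree
begin

lemma W_minus:
 assumes w: "w : Z i" shows "\<ominus>\<^bsub>Wmod i\<^esub> w = (%l m. \<ominus> w l m)"
proof (intro ext)
 fix l m
 interpret W: module A "Wmod i" by (rule W_module)
 show "(\<ominus>\<^bsub>Wmod i\<^esub> w) l m = \<ominus> w l m"
  by (rule additive_minus[OF W.M.abelian_group_axioms abelian_group_axioms, where f = "%w. w l m"])
   (use w in "auto simp: W_simps cycD(2)")
qed

lemma W_act_linear: "\<sigma> permutes {1..n} ==> gact (Wmod i) \<sigma> : linear_maps A (Wmod i) (Wmod i)"
 using W_group_ring_module[of i] by (simp add: group_ring_module_def sym_group_carrier)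

lemma W_act_comp: "\<sigma> permutes {1..n} ==> \<tau> permutes {1..n} ==> w : Z i ==>
  gact (Wmod i) (\<sigma> \<circ> \<tau>) w = gact (Wmod i) \<sigma> (gact (Wmod i) \<tau> w)"
 using W_group_ring_module[of i]
 by (simp add: group_ring_module_def sym_group_carrier sym_group_mult W_simps(1) del: of_nat_add)

end

section \<open>The map from hook tableaux to Koszul cycles\<close>

locale hook_module = sqfree A n d for A (structure) and n d +
 fixes i :: nat
 assumes le: "d + i <= n"
begin

abbreviation "S1 == specht A (hook d i) {1..d + i}"
abbreviation "S2 == specht A (one_row (n - d - i)) {d + i + 1..n}"

sublocale S1: thin_shape A "hook d i" "{1..d + i}" by (rule thin_hook[OF d_pos])
sublocale S2: thin_shape A "one_row (n - d - i)" "{d + i + 1..n}" by (rule thin_one_row)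
sublocale TS: tensors A S1 S2
 by (rule tensors.intro[OF S1.specht_module S2.specht_module])

definition col :: "(nat \<times> nat => nat) => nat list" where "col T = map (%r. T (r, 0)) [0..<Suc i]"
definition arm :: "(nat \<times> nat => nat) => nat set" where "arm T = (%c. T (0, c)) ` {1..<d}"
abbreviation "pw T == wel A n (col T) (arm T)"

lemma cells: "r <= i ==> (r, 0) : diagram (hook d i)" "c < d ==> (0, c) : diagram (hook d i)"
 by (simp_all add: diagram_hook[OF d_pos])

lemma column0: "column (hook d i) 0 = {..i}"
 using d_pos by (auto simp: column_def diagram_hook[OF d_pos])

lemma set_col: "set (col T) = S1.first_col T"
 unfolding col_def column0 set_map set_upt by (auto simp: less_Suc_eq_le)

lemma col_arm:
 assumes T: "T : S1.X"
 shows "length (col T) = Suc i" "distinct (col T)" "set (col T) <= {1..n}" "arm T <= {1..n}"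
  "card (arm T) = d - 1" "set (col T) \<inter> arm T = {}" "finite (arm T)"
proof -
 note e = S1.tab_eq[OF T]
 have b: "T x : {1..n}" if "x : diagram (hook d i)" for x using S1.in_E[OF T that] le by simp
 show "length (col T) = Suc i" by (simp add: col_def)
 show "distinct (col T)" unfolding col_def distinct_map by (auto intro!: inj_onI simp: e cells less_Suc_eq_le simp del: upt_Suc)
 show "set (col T) <= {1..n}" using b cells(1) unfolding set_col column0 by blast
 show "arm T <= {1..n}" using b cells(2) unfolding arm_def by fastforce
 have "inj_on (%c. T (0, c)) {1..<d}" by (rule inj_onI) (simp add: e cells)
 thus "card (arm T) = d - 1" unfolding arm_def by (simp add: card_image)
 show "set (col T) \<inter> arm T = {}"
 proof (rule ccontr)
  assume "set (col T) \<inter> arm T ~= {}"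
  then obtain r c where "r <= i" "c : {1..<d}" "T (r, 0) = T (0, c)" unfolding set_col column0 arm_def by blast
  thus False using e[OF cells(1)[of r] cells(2)[of c]] by simp
 qed
 show "finite (arm T)" by (simp add: arm_def)
qed

lemma col_act: "col (S1.act \<sigma> T) = map \<sigma> (col T)"
 by (simp add: col_def tab_act cells less_Suc_eq_le del: upt_Suc)

lemma arm_act: "arm (S1.act \<sigma> T) = \<sigma> ` arm T"
 unfolding arm_def image_image by (rule image_cong) (simp_all add: tab_act cells)

lemma pw_Z: "T : S1.X ==> pw T : Z i"
 by (rule wel_Z[OF col_arm(1,3,4,5,6)])

text \<open>A permutation of the first column fixes every entry of the arm, and \<open>wel\<close>
  alternates in its column.\<close>

lemma pw_alt:
 assumes T: "T : S1.X" and \<sigma>: "\<sigma> permutes S1.first_col T"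
 shows "pw (S1.act \<sigma> T) = (if evenperm \<sigma> then pw T else \<ominus>\<^bsub>Wmod i\<^esub> pw T)"
proof -
 have "\<sigma> x = x" if "x : arm T" for x
  by (rule permutes_not_in[OF \<sigma>]) (use that col_arm(6)[OF T] set_col in blast)
 hence "\<sigma> ` arm T = arm T" by simp
 moreover have "wel A n (map \<sigma> (col T)) (arm T) l m = (if evenperm \<sigma> then pw T l m else \<ominus> pw T l m)" for l m
  by (rule alternating_permute[where c = "%c. wel A n c (arm T) l m", OF wel_alternating_left \<sigma> _ set_col col_arm(2)[OF T]])
   (use set_col[of T, symmetric] in simp)
 ultimately show ?thesis unfolding col_act arm_act W_minus[OF pw_Z[OF T]] by (cases "evenperm \<sigma>") (simp_all add: fun_eq_iff)
qed

text \<open>For the first two columns this is \<open>wel_shuffle\<close>. For two later columns the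
  exchange transposes two entries of the arm, which enters only as a set, so the cycle is
  unchanged.\<close>

lemma pw_shuffle:
 assumes T: "T : S1.X" and j: "(0, Suc j) : diagram (hook d i)"
 shows "pw T = (\<Oplus>\<^bsub>Wmod i\<^esub>r\<in>column (hook d i) j. pw (S1.swap j r T))"
proof -
 interpret W: module A "Wmod i" by (rule W_module)
 have jd: "Suc j < d" using j d_pos by (auto simp: diagram_hook)
 have swX: "S1.swap j r T : S1.X" if "r : column (hook d i) j" for r by (rule S1.swap_closed[OF T that j])
 note C = col_arm[OF T]
 show ?thesis
 proof (cases j)
  case 0
  let ?a = "T (0, Suc 0)"
  define Q where "Q = arm T - {?a}"
  have aA: "?a : arm T" using jd 0 unfolding arm_def by simp
  have AQ: "arm T = insert ?a Q" using aA unfolding Q_def by blast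
  have Q: "?a \<notin> Q" "finite Q" "Q \<inter> set (col T) = {}" using C(6,7) unfolding Q_def by auto
  have aC: "?a \<notin> set (col T)" using aA C(6) by blast
  have sw: "col (S1.swap 0 r T) = (col T)[r := ?a]" "arm (S1.swap 0 r T) = insert (col T ! r) Q" if r: "r <= i" for r
  proof -
   have cr: "col T ! r' = T (r', 0)" if "r' <= i" for r'
    using that by (simp add: col_def less_Suc_eq_le del: upt_Suc)
   show "col (S1.swap 0 r T) = (col T)[r := ?a]"
    unfolding col_act
   proof (rule nth_equalityI)
    fix k assume "k < length (map (transpose (T (r, 0)) ?a) (col T))"
    hence k: "k <= i" using C(1) by simp
    have "transpose (T (r, 0)) ?a (T (k, 0)) = (if k = r then ?a else T (k, 0))"
     using S1.swap_apply[OF T cells(1)[OF r] j[unfolded 0] cells(1)[OF k]] by simp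
    thus "map (transpose (T (r, 0)) ?a) (col T) ! k = (col T)[r := ?a] ! k"
     using k C(1) by (simp add: cr nth_list_update)
   qed simp
   have rC: "T (r, 0) : set (col T)" unfolding set_col column0 using r by simp
   hence "T (r, 0) \<notin> Q" using Q(3) by blast
   hence tQ: "transpose (T (r, 0)) ?a ` Q = Q" using Q(1) by (force simp: transpose_def)
   show "arm (S1.swap 0 r T) = insert (col T ! r) Q"
    unfolding arm_act cr[OF r] AQ image_insert transpose_apply_second tQ ..
  qed
  have "pw T l m = (\<Oplus>\<^bsub>Wmod i\<^esub>r\<in>{..i}. pw (S1.swap 0 r T)) l m" for l m
  proof -
   have "pw T l m = wel A n (col T) (insert ?a Q) l m" unfolding AQ ..
   also have "... = (\<Oplus>r\<in>{..<length (col T)}. wel A n ((col T)[r := ?a]) (insert (col T ! r) Q) l m)"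
    by (rule wel_shuffle) (use C(2,3,4) aA aC Q in auto)
   also have "... = (\<Oplus>r\<in>{..i}. pw (S1.swap 0 r T) l m)"
    by (rule finsum_cong') (auto simp: C(1) sw lessThan_Suc_atMost wel_closed)
   also have "... = (\<Oplus>\<^bsub>Wmod i\<^esub>r\<in>{..i}. pw (S1.swap 0 r T)) l m"
    by (rule W_finsum[symmetric]) (use pw_Z[OF swX] in "simp_all add: 0 column0")
   finally show ?thesis .
  qed
  thus ?thesis unfolding 0 column0 by blast
 next
  case (Suc j')
  have c: "column (hook d i) j = {0}" using jd by (simp add: Suc S1.column_Suc cells)
  let ?\<tau> = "transpose (T (0, j)) (T (0, Suc j))"
  have ab: "T (0, j) : arm T" "T (0, Suc j) : arm T" using jd Suc unfolding arm_def by auto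
  have "map ?\<tau> (col T) = col T"
   by (rule map_idI) (use ab C(6) in "auto simp: transpose_def")
  moreover have "?\<tau> ` arm T = arm T" using ab by (simp add: transpose_image_eq)
  ultimately have "pw (S1.swap j 0 T) = pw T" by (simp only: col_act arm_act)
  thus ?thesis using pw_Z[OF T] by (simp add: c W_simps(1))
 qed
qed

text \<open>In a one-row shape every column has a single cell, so column permutations are trivial
  and each shuffling relation equates two tableaux. Sending all of them to one respects both kinds
  of relations.\<close>

lemma row_trivial:
 obtains f where "f : linear_maps A S2 (regular_module A)" "!!U. U : S2.X ==> f (S2.sp U) = \<one>"
proof -
 interpret reg: module A "regular_module A" by (rule regular_is_module)
 have reg: "carrier (regular_module A) = carrier A" by (simp add: regular_module_def)
 have ev: "evenperm \<sigma>" if "\<sigma> permutes S2.first_col U" for \<sigma> U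
 proof -
  have "S2.first_col U <= {U (0, 0)}" by (auto simp: column_def diagram_one_row)
  hence "\<sigma> permutes {U (0, 0)}" by (rule permutes_subset[OF that])
  thus ?thesis by simp
 qed
 have c: "column (one_row (n - d - i)) j = {0}" if "(0, Suc j) : diagram (one_row (n - d - i))" for j
  using that by (auto simp: column_def diagram_one_row)
 show ?thesis
 proof (rule S2.sp_lift[OF reg.module_axioms, where h = "%_. \<one>"])
  fix f assume "f : linear_maps A S2 (regular_module A)" "!!U. U : S2.X ==> f (S2.sp U) = \<one>"
  thus ?thesis by (rule that)
 next
  fix U j assume j: "(0, Suc j) : diagram (one_row (n - d - i))"
  show "\<one> = (\<Oplus>\<^bsub>regular_module A\<^esub>r\<in>column (one_row (n - d - i)) j. \<one>)"
   unfolding c[OF j] by (simp add: reg)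
 next
  show "\<one> = (if evenperm \<sigma> then \<one> else \<ominus>\<^bsub>regular_module A\<^esub> \<one>)" if "\<sigma> permutes S2.first_col U" for \<sigma> U
   using ev[OF that] by simp
 qed (simp add: reg)
qed

abbreviation "Yg == young_subgroup n (d + i)"
abbreviation "V == tensor_gmodule A S1 S2"
abbreviation "vt T U == pure_tensor A S1 S2 (S1.sp T) (S2.sp U)"

lemma young:
 assumes "h : Yg"
 shows "h permutes {1..n}" "h ` {1..d + i} = {1..d + i}" "h ` {d + i + 1..n} = {d + i + 1..n}" "bij h" "permutation h"
 using assms permutes_bij[of h "{1..n}"] permutation_permutes[of h] by (auto simp: young_subgroup_def sym_group_carrier)

lemma S1_act:
 assumes "h : Yg"
 shows "gact S1 h : linear_maps A S1 S1" "T : S1.X ==> gact S1 h (S1.sp T) = S1.sp (S1.act h T)" "T : S1.X ==> S1.act h T : S1.X"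
 using S1.sp_act[OF young(4,5,2)[OF assms]] tableau_act_closed[of T "hook d i" "{1..d + i}" h]
  permutes_inj_on[OF young(1)[OF assms]] young(2)[OF assms] by auto

lemma S2_act:
 assumes "h : Yg"
 shows "gact S2 h : linear_maps A S2 S2" "U : S2.X ==> gact S2 h (S2.sp U) = S2.sp (S2.act h U)" "U : S2.X ==> S2.act h U : S2.X"
 using S2.sp_act[OF young(4,5,3)[OF assms]] tableau_act_closed[of U "one_row (n - d - i)" "{d + i + 1..n}" h]
  permutes_inj_on[OF young(1)[OF assms]] young(3)[OF assms] by auto

lemma V_module: "module A V"
 unfolding tensor_gmodule_def by (rule module_with_action[OF TS.tensor_module])

lemma V_act:
 assumes h: "h : Yg"
 shows "gact V h : linear_maps A V V"
  and "x : carrier S1 ==> y : carrier S2 ==>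
   gact V h (pure_tensor A S1 S2 x y) = pure_tensor A S1 S2 (gact S1 h x) (gact S2 h y)"
 unfolding tensor_gmodule_def action_simps slinear_action
 using tensor_map_props[OF TS.tensors_axioms TS.tensors_axioms ring_endo_id S1_act(1)[OF h] S2_act(1)[OF h]] by blast+

lemma vt_closed: "T : S1.X ==> U : S2.X ==> vt T U : carrier V"
 unfolding tensor_gmodule_def action_simps by (rule TS.pure_closed[OF S1.sp_closed S2.sp_closed])

lemma V_act_vt: "h : Yg ==> T : S1.X ==> U : S2.X ==> gact V h (vt T U) = vt (S1.act h T) (S2.act h U)"
 by (simp only: V_act(2) S1.sp_closed S2.sp_closed S1_act(2) S2_act(2))

sublocale Ind: induced_module A V "sym_group n" Yg
proof (intro induced_module.intro V_module sym_group_is_group induced_module_axioms.intro)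
 show "h : carrier (sym_group n)" if "h : Yg" for h using that by (simp add: young_subgroup_def)
qed (rule V_act(1))

lemma U_eq: "U_module A d n i = Ind.ind"
 using le d_pos by (simp add: U_module_def)

lemma vt_closure:
 assumes K: "submodule K A V" "!!T U. T : S1.X ==> U : S2.X ==> vt T U : K" and v: "v : carrier V"
 shows "v : K"
proof -
 have K': "submodule K A (tensor A S1 S2)" using K(1) unfolding tensor_gmodule_def submodule_with_action .
 have 1: "pure_tensor A S1 S2 x (S2.sp U) : K" if x: "x : carrier S1" and U: "U : S2.X" for x U
 proof -
  have "x : {x \<in> carrier S1. pure_tensor A S1 S2 x (S2.sp U) : K}"
   by (rule S1.sp_closure[OF TS.M.vimage_submodule[OF TS.tensor_module TS.pure_linear_left[OF S2.sp_closed[OF U]] K'] _ x])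
    (use K(2) U S1.sp_closed in auto)
  thus ?thesis by simp
 qed
 have 2: "pure_tensor A S1 S2 x y : K" if x: "x : carrier S1" and y: "y : carrier S2" for x y
 proof -
  have "y : {y \<in> carrier S2. pure_tensor A S1 S2 x y : K}"
   by (rule S2.sp_closure[OF TS.N.vimage_submodule[OF TS.tensor_module TS.pure_linear_right[OF x] K'] _ y])
    (use 1 x S2.sp_closed in auto)
  thus ?thesis by simp
 qed
 show ?thesis
  by (rule TS.tensor_closure[OF K' 2]) (use v in "simp_all add: tensor_gmodule_def action_simps")
qed

text \<open>The universal properties are used from the inside out: Specht modules, tensor product,
  induction. The row factor contributes only a scalar, and equivariance under the Young subgroup is
  what lets the map extend to the induced module.\<close>

lemma comparison_map:
 obtains f where "f : linear_maps A Ind.ind (Wmod i)"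
  "!!g T U. g permutes {1..n} ==> T : S1.X ==> U : S2.X ==> f (Ind.ig g (vt T U)) = gact (Wmod i) g (pw T)"
  "!!\<sigma> u. \<sigma> permutes {1..n} ==> u : carrier Ind.ind ==> f (gact Ind.ind \<sigma> u) = gact (Wmod i) \<sigma> (f u)"
proof -
 interpret W: module A "Wmod i" by (rule W_module)
 have Wc: "carrier (Wmod i) = Z i" by (rule W_simps(1))
 have "pw : S1.X \<rightarrow> carrier (Wmod i)" unfolding Wc using pw_Z by blast
 from S1.sp_lift[OF W_module this pw_alt pw_shuffle]
 obtain f1 where f1: "f1 : linear_maps A S1 (Wmod i)" "!!T. T : S1.X ==> f1 (S1.sp T) = pw T" by blast
 obtain f2 where f2: "f2 : linear_maps A S2 (regular_module A)" "!!U. U : S2.X ==> f2 (S2.sp U) = \<one>"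
  using row_trivial by blast
 have reg: "carrier (regular_module A) = carrier A" "add (regular_module A) = add A" "smult (regular_module A) = monoid.mult A"
  by (simp_all add: regular_module_def)
 note D1 = slinearD[OF f1(1)] and D2 = slinearD[OF f2(1), unfolded reg]
 obtain f3 where f3: "f3 : linear_maps A (tensor A S1 S2) (Wmod i)"
  "!!x y. x : carrier S1 ==> y : carrier S2 ==> f3 (pure_tensor A S1 S2 x y) = f2 y \<odot>\<^bsub>Wmod i\<^esub> f1 x"
 proof (rule TS.tensor_lift[OF W_module, where \<beta> = "%x y. f2 y \<odot>\<^bsub>Wmod i\<^esub> f1 x"])
  show "f2 (r \<odot>\<^bsub>S2\<^esub> y) \<odot>\<^bsub>Wmod i\<^esub> f1 x = r \<odot>\<^bsub>Wmod i\<^esub> (f2 y \<odot>\<^bsub>Wmod i\<^esub> f1 x)"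
   if "r : carrier A" "x : carrier S1" "y : carrier S2" for r x y
   using that D1 D2 by (simp add: W.smult_assoc1)
  show "f2 y \<odot>\<^bsub>Wmod i\<^esub> f1 (r \<odot>\<^bsub>S1\<^esub> x) = r \<odot>\<^bsub>Wmod i\<^esub> (f2 y \<odot>\<^bsub>Wmod i\<^esub> f1 x)"
   if "r : carrier A" "x : carrier S1" "y : carrier S2" for r x y
   using that D1 D2 by (simp add: W.smult_assoc1[symmetric] m_comm)
 qed (use D1 D2 that in "simp_all add: W.smult_l_distr W.smult_r_distr")
 have f3V: "f3 : linear_maps A V (Wmod i)" using f3(1) by (simp only: tensor_gmodule_def slinear_action)
 have f3vt: "f3 (vt T U) = pw T" if "T : S1.X" "U : S2.X" for T U
  unfolding f3(2)[OF S1.sp_closed[OF that(1)] S2.sp_closed[OF that(2)]] f1(2)[OF that(1)] f2(2)[OF that(2)]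
  by (rule W.smult_one) (unfold Wc, rule pw_Z[OF that(1)])
 \<comment> \<open>The elements on which both sides agree form a submodule, so pairs of tableaux
   suffice.\<close>
 have f3act: "f3 (gact V h v) = gact (Wmod i) h (f3 v)" if h: "h : Yg" and v: "v : carrier V" for h v
 proof -
  have hp: "h permutes {1..n}" by (rule young(1)[OF h])
  have a: "(%v. f3 (gact V h v)) : linear_maps A V (Wmod i)"
   by (rule linear_comp[OF V_act(1)[OF h] f3V])
  have b: "(%v. gact (Wmod i) h (f3 v)) : linear_maps A V (Wmod i)"
   by (rule linear_comp[OF f3V W_act_linear[OF hp]])
  have "v : {v \<in> carrier V. f3 (gact V h v) = gact (Wmod i) h (f3 v)}"
  proof (rule vt_closure[OF Ind.V.eq_submodule[OF W_module a b] _ v])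
   fix T U assume T: "T : S1.X" and U: "U : S2.X"
   have "f3 (gact V h (vt T U)) = gact (Wmod i) h (f3 (vt T U))"
    unfolding V_act_vt[OF h T U] f3vt[OF T U] f3vt[OF S1_act(3)[OF h T] S2_act(3)[OF h U]] col_act arm_act
    by (rule W_wel_act[OF hp col_arm(7)[OF T], symmetric])
   thus "vt T U : {v \<in> carrier V. f3 (gact V h v) = gact (Wmod i) h (f3 v)}"
    using vt_closed[OF T U] by blast
  qed
  thus ?thesis by simp
 qed
 have perm: "g : carrier (sym_group n) \<longleftrightarrow> g permutes {1..n}" for g by (rule sym_group_carrier)
 have f3c: "f3 v : Z i" if "v : carrier V" for v using slinearD(1)[OF f3V that] by (simp only: Wc)
 obtain f where f: "f : linear_maps A Ind.ind (Wmod i)"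
  "!!g v. g : carrier (sym_group n) ==> v : carrier V ==> f (Ind.ig g v) = gact (Wmod i) g (f3 v)"
 proof (rule Ind.ind_lift[OF W_module, where \<beta> = "%g v. gact (Wmod i) g (f3 v)"])
  show "(%v. gact (Wmod i) g (f3 v)) : linear_maps A V (Wmod i)" if "g : carrier (sym_group n)" for g
   by (rule linear_comp[OF f3V W_act_linear]) (rule perm[THEN iffD1, OF that])
  show "gact (Wmod i) (g \<otimes>\<^bsub>sym_group n\<^esub> h) (f3 v) = gact (Wmod i) g (f3 (gact V h v))"
   if "g : carrier (sym_group n)" "h : Yg" "v : carrier V" for g h v
   unfolding sym_group_mult f3act[OF that(2,3)]
   by (rule W_act_comp[OF perm[THEN iffD1, OF that(1)] young(1)[OF that(2)] f3c[OF that(3)]])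
 qed (use that in blast)
 show ?thesis
 proof (rule that[OF f(1)])
  show "f (Ind.ig g (vt T U)) = gact (Wmod i) g (pw T)" if "g permutes {1..n}" "T : S1.X" "U : S2.X" for g T U
   unfolding f(2)[OF perm[THEN iffD2, OF that(1)] vt_closed[OF that(2,3)]] f3vt[OF that(2,3)] ..
  fix \<sigma> u assume \<sigma>: "\<sigma> permutes {1..n}" and u: "u : carrier Ind.ind"
  hence \<sigma>': "\<sigma> : carrier (sym_group n)" by (simp add: perm)
  have a: "(%u. f (gact Ind.ind \<sigma> u)) : linear_maps A Ind.ind (Wmod i)"
   by (rule linear_comp[OF Ind.ind_act(1)[OF \<sigma>'] f(1)])
  have b: "(%u. gact (Wmod i) \<sigma> (f u)) : linear_maps A Ind.ind (Wmod i)"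
   by (rule linear_comp[OF f(1) W_act_linear[OF \<sigma>]])
  show "f (gact Ind.ind \<sigma> u) = gact (Wmod i) \<sigma> (f u)"
  proof (rule Ind.ind_ext[OF W_module a b _ u])
   fix g v assume g: "g : carrier (sym_group n)" and v: "v : carrier V"
   have m: "\<sigma> \<otimes>\<^bsub>sym_group n\<^esub> g : carrier (sym_group n)" by (rule Ind.G.m_closed[OF \<sigma>' g])
   show "f (gact Ind.ind \<sigma> (Ind.ig g v)) = gact (Wmod i) \<sigma> (f (Ind.ig g v))"
    unfolding Ind.ind_act(2)[OF \<sigma>' g v] f(2)[OF m v] f(2)[OF g v] unfolding sym_group_mult
    by (rule W_act_comp[OF \<sigma> perm[THEN iffD1, OF g] f3c[OF v]])
  qed
 qed
qed

end

text \<open>The action axioms on \<open>V\<close> are consequences: an equation between elements of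
  \<open>V\<close> is checked after applying the injective \<open>f\<close>. This yields an action
  on Tor although the chosen lifts satisfy the action laws only up to homotopy.\<close>

lemma group_ring_module_isoI:
 assumes G: "group G" and W: "group_ring_module A G W" and bij: "bij_betw f (carrier V) (carrier W)"
  and add: "!!x y. x : carrier V ==> y : carrier V ==>
   x \<oplus>\<^bsub>V\<^esub> y : carrier V & f (x \<oplus>\<^bsub>V\<^esub> y) = f x \<oplus>\<^bsub>W\<^esub> f y"
  and smult: "!!r x. r : carrier A ==> x : carrier V ==>
   r \<odot>\<^bsub>V\<^esub> x : carrier V & f (r \<odot>\<^bsub>V\<^esub> x) = r \<odot>\<^bsub>W\<^esub> f x"
  and zero: "\<zero>\<^bsub>V\<^esub> : carrier V" "f \<zero>\<^bsub>V\<^esub> = \<zero>\<^bsub>W\<^esub>"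
  and act: "!!g x. g : carrier G ==> x : carrier V ==> gact V g x : carrier V & f (gact V g x) = gact W g (f x)"
 shows "group_ring_module_iso A G V W"
proof -
 interpret G: group G by fact
 have inj: "inj_on f (carrier V)" and fW: "!!x. x : carrier V ==> f x : carrier W" using bij by (auto simp: bij_betw_def)
 have Wm: "module A W" and Wlin: "!!g. g : carrier G ==> gact W g : linear_maps A W W"
  and W1: "!!v. v : carrier W ==> gact W \<one>\<^bsub>G\<^esub> v = v"
  and Wm2: "!!g h v. g : carrier G ==> h : carrier G ==> v : carrier W ==>
   gact W (g \<otimes>\<^bsub>G\<^esub> h) v = gact W g (gact W h v)"
  using W unfolding group_ring_module_def by blast+
 have V: "module A V" by (rule module_transport[OF Wm inj fW add smult zero])
 have "gact V g : linear_maps A V V" if g: "g : carrier G" for g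
 proof (rule slinearI)
  note L = slinearD[OF Wlin[OF g]]
  fix x assume x: "x : carrier V"
  show "gact V g x : carrier V" using act[OF g x] by blast
  show "gact V g (a \<odot>\<^bsub>V\<^esub> x) = id a \<odot>\<^bsub>V\<^esub> gact V g x" if a: "a : carrier A" for a
   by (rule inj_onD[OF inj]) (use act g x a smult L fW in simp_all)
  show "gact V g (x \<oplus>\<^bsub>V\<^esub> y) = gact V g x \<oplus>\<^bsub>V\<^esub> gact V g y" if y: "y : carrier V" for y
   by (rule inj_onD[OF inj]) (use act g x y add L fW in simp_all)
 qed
 moreover have "gact V \<one>\<^bsub>G\<^esub> v = v" if v: "v : carrier V" for v
  by (rule inj_onD[OF inj]) (use act v W1 fW in simp_all)
 moreover have "gact V (g \<otimes>\<^bsub>G\<^esub> h) v = gact V g (gact V h v)" if "g : carrier G" "h : carrier G" "v : carrier V" for g h v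
  by (rule inj_onD[OF inj]) (use act that Wm2 fW in simp_all)
 ultimately have "group_ring_module A G V" unfolding group_ring_module_def using V by blast
 moreover have "f : linear_maps A V W" by (rule slinearI) (use fW add smult in simp_all)
 ultimately show ?thesis unfolding group_ring_module_iso_def using W bij act by blast
qed

section \<open>Words as generators of the induced module\<close>

definition word_perm :: "nat => nat list => nat => nat" where
 "word_perm n l x = (if x : {1..n} then l ! (x - 1) else x)"

lemma word_perm_Suc: "k < n ==> word_perm n l (Suc k) = l ! k"
 by (simp add: word_perm_def)

lemma word_length: "mset l = mset [1..<Suc n] ==> length l = n"
 by (drule mset_eq_length) simp

lemma word_set: "mset l = mset [1..<Suc n] ==> set l = {1..n}"
 by (drule mset_eq_setD) (simp only: set_upt atLeastLessThanSuc_atLeastAtMost)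

lemma word_distinct: "mset l = mset [1..<Suc n] ==> distinct l"
 by (drule mset_eq_imp_distinct_iff) simp

lemma word_perm_permutes:
 assumes l: "mset l = mset [1..<Suc n]" shows "word_perm n l permutes {1..n}"
proof (rule bij_imp_permutes)
 note L = word_length[OF l] word_set[OF l] word_distinct[OF l]
 have "inj_on (word_perm n l) {1..n}"
  by (rule inj_onI) (use L in "auto simp: word_perm_def nth_eq_iff_index_eq")
 moreover have "word_perm n l ` {1..n} <= {1..n}"
 proof
  fix y assume "y : word_perm n l ` {1..n}"
  then obtain x where "x : {1..n}" "y = l ! (x - 1)" by (auto simp: word_perm_def)
  thus "y : {1..n}" using L(1) nth_mem[of "x - 1" l] unfolding L(2)[symmetric] by (auto simp: L)
 qed
 ultimately show "bij_betw (word_perm n l) {1..n} {1..n}"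
  using endo_inj_surj[of "{1..n}"] by (simp add: bij_betw_def)
qed (simp only: word_perm_def if_False)

text \<open>Exchanging two positions of a word multiplies its permutation on the right, the side on
  which the Young subgroup enters the relations of the induced module.\<close>

lemma word_perm_swap:
 assumes "length l = n" "p < n" "q < n"
 shows "word_perm n (l[p := l ! q, q := l ! p]) = word_perm n l \<circ> transpose (Suc p) (Suc q)"
proof
 fix x
 show "word_perm n (l[p := l ! q, q := l ! p]) x = (word_perm n l \<circ> transpose (Suc p) (Suc q)) x"
 proof (cases "x : {1..n}")
  case True
  then obtain k where k: "x = Suc k" "k < n" by (cases x) auto
  show ?thesis using assms k by (auto simp: word_perm_def transpose_def nth_list_update)
 next
  case False
  thus ?thesis using assms by (auto simp: word_perm_def transpose_def)
 qed
qed

lemma word_perm_map: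
 assumes p: "p permutes {1..n}"
 shows "p = word_perm n (map p [1..<Suc n])" "mset (map p [1..<Suc n]) = mset [1..<Suc n]"
proof -
 show "p = word_perm n (map p [1..<Suc n])"
 proof
  fix x show "p x = word_perm n (map p [1..<Suc n]) x"
   using permutes_not_in[OF p, of x] by (auto simp: word_perm_def simp del: upt_Suc)
 qed
 have "set (map p [1..<Suc n]) = set [1..<Suc n]"
  unfolding set_map set_upt atLeastLessThanSuc_atLeastAtMost by (rule permutes_image[OF p])
 moreover have "distinct (map p [1..<Suc n])" unfolding distinct_map using permutes_inj_on[OF p] by simp
 ultimately show "mset (map p [1..<Suc n]) = mset [1..<Suc n]"
  using set_eq_iff_mset_eq_distinct[of "map p [1..<Suc n]" "[1..<Suc n]"] distinct_upt by blast
qed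

lemma mset_std_word:
 assumes "x : std_pairs n d i"
 shows "mset (std_word n x) = mset [1..<Suc n]" "length (fst x) = Suc i" "length (sorted_list_of_set (snd x)) = d - 1"
proof -
 obtain c Q where x: "x = (c, Q)" by fastforce
 have c: "length c = Suc i" "sorted_wrt (<) c" "set c <= {1..n}" "Q <= {1..n}" "card Q = d - 1" "set c \<inter> Q = {}"
  using assms by (auto simp: std_pairs_def x)
 have f: "finite Q" using c(4) finite_subset by blast
 show "length (fst x) = Suc i" "length (sorted_list_of_set (snd x)) = d - 1" using c by (simp_all add: x)
 have "set (std_word n x) = set [1..<Suc n]"
  unfolding set_upt atLeastLessThanSuc_atLeastAtMost using c f by (auto simp: std_word_def x)
 moreover have "distinct (std_word n x)" using c f by (auto simp: std_word_def x strict_sorted_iff)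
 ultimately show "mset (std_word n x) = mset [1..<Suc n]"
  using set_eq_iff_mset_eq_distinct[of "std_word n x" "[1..<Suc n]"] distinct_upt by blast
qed

lemma if_split_mem: "x : S ==> y : S ==> (if P then x else y) : S"
 by simp

context hook_module
begin

text \<open>The reference filling: positions \<open>1\<close> to \<open>i + 1\<close> of a word are
  the first column and the next \<open>d - 1\<close> the arm, so a word is read as column, arm and
  row. The remaining positions belong to \<open>U0\<close>.\<close>

definition T0 :: "nat \<times> nat => nat" where
 "T0 = restrict (%(r, c). if c = 0 then Suc r else Suc (i + c)) (diagram (hook d i))"

definition U0 :: "nat \<times> nat => nat" where
 "U0 = restrict (%(r, c). Suc (d + i + c)) (diagram (one_row (n - d - i)))"

lemma T0_cell: "r <= i ==> T0 (r, 0) = Suc r" "0 < c ==> c < d ==> T0 (0, c) = Suc (i + c)"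
 by (simp_all add: T0_def cells)

lemma U0_cell: "c < n - d - i ==> U0 (0, c) = Suc (d + i + c)"
 by (simp add: U0_def diagram_one_row)

lemma T0_X: "T0 : S1.X"
 unfolding tableaux_iff
proof (intro conjI ballI allI impI)
 show "T0 x : {1..d + i}" if "x : diagram (hook d i)" for x
  using that d_pos by (cases x) (auto simp: T0_def diagram_hook)
 show "inj_on T0 (diagram (hook d i))"
  using d_pos by (auto intro!: inj_onI simp: T0_def diagram_hook split: if_splits)
qed (simp add: T0_def)

lemma U0_X: "U0 : S2.X"
 unfolding tableaux_iff
proof (intro conjI ballI allI impI)
 show "U0 x : {d + i + 1..n}" if "x : diagram (one_row (n - d - i))" for x
  using that le by (cases x) (auto simp: U0_def diagram_one_row)
 show "inj_on U0 (diagram (one_row (n - d - i)))"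
  by (auto intro!: inj_onI simp: U0_def diagram_one_row)
qed (simp add: U0_def)

text \<open>Both fillings use all letters of their blocks, so the two relabellings combine to a
  permutation in the Young subgroup. Hence pairs of tableaux are absorbed into the group element,
  and words alone generate the induced module.\<close>

lemma young_transitive:
 assumes T: "T : S1.X" and U: "U : S2.X"
 obtains \<sigma> where "\<sigma> : Yg" "T = S1.act \<sigma> T0" "U = S2.act \<sigma> U0"
proof -
 \<comment> \<open>The cell of the hook that carries a given letter in \<open>T0\<close>.\<close>
 define p where "p x = (if x <= Suc i then (x - 1, 0) else (0, x - Suc i))" for x :: nat
 define \<sigma> where "\<sigma> x = (if x : {1..d + i} then T (p x) else if x : {d + i + 1..n} then U (0, x - Suc (d + i)) else x)" for x
 have p: "p x : diagram (hook d i)" if "x : {1..d + i}" for x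
  using that d_pos by (auto simp: p_def diagram_hook[OF d_pos])
 have pinj: "x = y" if "x : {1..d + i}" "y : {1..d + i}" "p x = p y" for x y
  using that by (auto simp: p_def split: if_splits)
 have s1: "\<sigma> x = T (p x)" if "x : {1..d + i}" for x using that unfolding \<sigma>_def by (rule if_P)
 have s2: "\<sigma> x = U (0, x - Suc (d + i))" if "x : {d + i + 1..n}" for x using that by (simp add: \<sigma>_def)
 have u: "(0, x - Suc (d + i)) : diagram (one_row (n - d - i))" if "x : {d + i + 1..n}" for x
  using that by (auto simp: diagram_one_row)
 have i1: "inj_on \<sigma> {1..d + i}"
 proof (rule inj_onI)
  fix x y assume xy: "x : {1..d + i}" "y : {1..d + i}" "\<sigma> x = \<sigma> y"
  hence "p x = p y" using S1.tab_eq[OF T p[OF xy(1)] p[OF xy(2)]] by (simp only: s1)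
  thus "x = y" by (rule pinj[OF xy(1,2)])
 qed
 have i2: "inj_on \<sigma> {d + i + 1..n}"
 proof (rule inj_onI)
  fix x y assume xy: "x : {d + i + 1..n}" "y : {d + i + 1..n}" "\<sigma> x = \<sigma> y"
  hence "x - Suc (d + i) = y - Suc (d + i)" using S2.tab_eq[OF U u[OF xy(1)] u[OF xy(2)]] by (simp only: s2 prod.inject)
  thus "x = y" using xy by auto
 qed
 have "\<sigma> ` {1..d + i} <= {1..d + i}"
 proof
  fix y assume "y : \<sigma> ` {1..d + i}"
  then obtain x where x: "x : {1..d + i}" "y = \<sigma> x" by blast
  show "y : {1..d + i}" unfolding x(2) s1[OF x(1)] by (rule S1.in_E[OF T p[OF x(1)]])
 qed
 hence e1: "\<sigma> ` {1..d + i} = {1..d + i}" by (intro endo_inj_surj i1) simp_all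
 have "\<sigma> ` {d + i + 1..n} <= {d + i + 1..n}"
 proof
  fix y assume "y : \<sigma> ` {d + i + 1..n}"
  then obtain x where x: "x : {d + i + 1..n}" "y = \<sigma> x" by blast
  show "y : {d + i + 1..n}" unfolding x(2) s2[OF x(1)] by (rule S2.in_E[OF U u[OF x(1)]])
 qed
 hence e2: "\<sigma> ` {d + i + 1..n} = {d + i + 1..n}" by (intro endo_inj_surj i2) simp_all
 have un: "{1..d + i} \<union> {d + i + 1..n} = {1..n}" using le by auto
 have "bij_betw \<sigma> ({1..d + i} \<union> {d + i + 1..n}) ({1..d + i} \<union> {d + i + 1..n})"
  by (rule bij_betw_combine) (use i1 i2 e1 e2 in "auto simp: bij_betw_def")
 hence "\<sigma> permutes {1..n}" unfolding un
  by (rule bij_imp_permutes) (use le in "auto simp: \<sigma>_def")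
 hence Y: "\<sigma> : Yg" using e1 e2 by (simp add: young_subgroup_def sym_group_carrier)
 have "T x = S1.act \<sigma> T0 x" for x
 proof (cases "x : diagram (hook d i)")
  case True
  have "p (T0 x) = x" using True by (cases x) (auto simp: T0_def p_def diagram_hook[OF d_pos])
  thus ?thesis using True s1[OF S1.in_E[OF T0_X True]] by (simp add: tab_act)
 next
  case False
  thus ?thesis using T unfolding tableaux_iff tab_act by metis
 qed
 moreover have "U x = S2.act \<sigma> U0 x" for x
 proof (cases "x : diagram (one_row (n - d - i))")
  case True
  obtain c where c: "x = (0, c)" "c < n - d - i" using True by (cases x) (auto simp: diagram_one_row)
  have "\<sigma> (U0 x) = U x" using s2[OF S2.in_E[OF U0_X True]] c by (simp add: U0_cell)
  thus ?thesis using True by (simp only: tab_act if_True)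
 next
  case False
  thus ?thesis using U unfolding tableaux_iff tab_act by metis
 qed
 ultimately show ?thesis by (intro that[OF Y]) auto
qed

abbreviation "v0 == vt T0 U0"
text \<open>The pair of tableaux obtained by writing the word into the reference shapes, as an
  element of the induced module.\<close>

definition "wd l = Ind.ig (word_perm n l) v0"

lemma v0: "v0 : carrier V" by (rule vt_closed[OF T0_X U0_X])

lemma wp_sym: "mset l = mset [1..<Suc n] ==> word_perm n l : carrier (sym_group n)"
 by (simp only: sym_group_carrier word_perm_permutes)

lemma wd_closed: "mset l = mset [1..<Suc n] ==> wd l : carrier Ind.ind"
 unfolding wd_def by (rule Ind.ig_closed[OF wp_sym v0])

text \<open>A transposition of positions that respects the two blocks lies in the Young subgroup, so
  it can be moved from the group element into the tableaux.\<close>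

lemma wd_swap:
 assumes l: "mset l = mset [1..<Suc n]" and pq: "p < d + i & q < d + i | d + i <= p & d + i <= q & p < n & q < n"
 shows "wd (l[p := l ! q, q := l ! p])
  = Ind.ig (word_perm n l) (vt (S1.act (transpose (Suc p) (Suc q)) T0) (S2.act (transpose (Suc p) (Suc q)) U0))"
proof -
 let ?\<tau> = "transpose (Suc p) (Suc q)"
 have pqn: "p < n" "q < n" using pq le by auto
 have "?\<tau> permutes {1..n}" by (rule permutes_swap_id) (use pqn in auto)
 moreover have "?\<tau> ` {1..d + i} = {1..d + i}" "?\<tau> ` {d + i + 1..n} = {d + i + 1..n}"
  by (rule transpose_image_eq; use pq pqn in auto)+
 ultimately have Y: "?\<tau> : Yg" by (simp only: young_subgroup_def sym_group_carrier mem_Collect_eq)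
 have "wd (l[p := l ! q, q := l ! p]) = Ind.ig (word_perm n l \<otimes>\<^bsub>sym_group n\<^esub> ?\<tau>) v0"
  unfolding wd_def word_perm_swap[OF word_length[OF l] pqn] sym_group_mult ..
 also have "... = Ind.ig (word_perm n l) (gact V ?\<tau> v0)" by (rule Ind.ig_H[OF wp_sym[OF l] Y v0])
 finally show ?thesis unfolding V_act_vt[OF Y T0_X U0_X] .
qed

lemma act_trivial: "T : tableaux \<mu> E ==> (!!x. x : E ==> \<sigma> x = x) ==> tableau_act \<mu> \<sigma> T = T"
 by (auto simp: tableaux_iff tab_act fun_eq_iff)

lemma wd_swap1:
 assumes l: "mset l = mset [1..<Suc n]" and pq: "p < d + i" "q < d + i"
 shows "wd (l[p := l ! q, q := l ! p]) = Ind.ig (word_perm n l) (vt (S1.act (transpose (Suc p) (Suc q)) T0) U0)"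
proof -
 have "S2.act (transpose (Suc p) (Suc q)) U0 = U0"
  by (rule act_trivial[OF U0_X]) (use pq in "auto simp: transpose_def")
 thus ?thesis using wd_swap[OF l, of p q] pq by simp
qed

lemma wd_swap2:
 assumes l: "mset l = mset [1..<Suc n]" and pq: "d + i <= p" "d + i <= q" "p < n" "q < n"
 shows "wd (l[p := l ! q, q := l ! p]) = Ind.ig (word_perm n l) (vt T0 (S2.act (transpose (Suc p) (Suc q)) U0))"
proof -
 have "S1.act (transpose (Suc p) (Suc q)) T0 = T0"
  by (rule act_trivial[OF T0_X]) (use pq in "auto simp: transpose_def")
 thus ?thesis using wd_swap[OF l, of p q] pq by simp
qed

lemma adjacent_update: "(u @ a # b # v)[length u := b, Suc (length u) := a] = u @ b # a # v"
 by (simp add: list_update_append)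

text \<open>Relations of a Specht module are used inside the induced module by pulling submodules
  back along these maps.\<close>

lemma ig_linear_left: "g : carrier (sym_group n) ==> y : carrier S2 ==>
  (%s. Ind.ig g (pure_tensor A S1 S2 s y)) : linear_maps A S1 Ind.ind"
 by (rule linear_comp[OF TS.pure_linear_left])
  (use Ind.ig_linear[of g] in "simp_all only: tensor_gmodule_def slinear_action")

lemma ig_linear_right: "g : carrier (sym_group n) ==> x : carrier S1 ==>
  (%s. Ind.ig g (pure_tensor A S1 S2 x s)) : linear_maps A S2 Ind.ind"
 by (rule linear_comp[OF TS.pure_linear_right])
  (use Ind.ig_linear[of g] in "simp_all only: tensor_gmodule_def slinear_action")

context
 fixes K
 assumes K: "submodule K A Ind.ind"
begin

lemma T0_shuffle:
 assumes l: "mset l = mset [1..<Suc n]" and j: "Suc j < d"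
  and sw: "!!r. r : column (hook d i) j ==> Ind.ig (word_perm n l) (vt (S1.swap j r T0) U0) : K"
 shows "wd l : K"
proof -
 note u0 = S2.sp_closed[OF U0_X]
 let ?K = "{s \<in> carrier S1. Ind.ig (word_perm n l) (pure_tensor A S1 S2 s (S2.sp U0)) : K}"
 have j': "(0, Suc j) : diagram (hook d i)" using j by (simp add: cells)
 have "S1.sp T0 : ?K"
  by (rule S1.sp_shuffle[OF T0_X j' TS.M.vimage_submodule[OF Ind.ind_module ig_linear_left[OF wp_sym[OF l] u0] K]])
   (use sw S1.sp_closed[OF S1.swap_closed[OF T0_X _ j']] in auto)
 thus ?thesis by (simp add: wd_def)
qed

lemma U0_shuffle:
 assumes l: "mset l = mset [1..<Suc n]" and j: "Suc j < n - d - i"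
  and sw: "Ind.ig (word_perm n l) (vt T0 (S2.swap j 0 U0)) : K"
 shows "wd l : K"
proof -
 note t0 = S1.sp_closed[OF T0_X]
 let ?K = "{s \<in> carrier S2. Ind.ig (word_perm n l) (pure_tensor A S1 S2 (S1.sp T0) s) : K}"
 have j': "(0, Suc j) : diagram (one_row (n - d - i))" using j by (simp add: diagram_one_row)
 have c: "r = 0" if "r : column (one_row (n - d - i)) j" for r using that by (simp add: column_def diagram_one_row)
 have "S2.sp U0 : ?K"
  by (rule S2.sp_shuffle[OF U0_X j' TS.N.vimage_submodule[OF Ind.ind_module ig_linear_right[OF wp_sym[OF l] t0] K]])
   (use sw c S2.sp_closed[OF S2.swap_closed[OF U0_X _ j']] in auto)
 thus ?thesis by (simp add: wd_def)
qed

text \<open>Each hypothesis of \<open>straighten\<close> is a relation: swaps in the column are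
  alternating relations, swaps in the arm or the row are shuffling relations between columns with
  one cell, and the exchange with the first letter of the arm is the shuffling relation of the first
  two columns.\<close>

lemma word_straighten:
 assumes std: "!!x. x : std_pairs n d i ==> wd (std_word n x) : K" and w: "mset l = mset [1..<Suc n]"
 shows "wd l : K"
proof -
 define c q z where "c = take (Suc i) l" and "q = take (d - 1) (drop (Suc i) l)" and "z = drop (d - 1) (drop (Suc i) l)"
 have l: "l = c @ q @ z" unfolding c_def q_def z_def by (simp only: append_take_drop_id)
 have lens: "length c = Suc i" "length q = d - 1" using word_length[OF w] le d_pos by (auto simp: c_def q_def)
 have "wd (c @ q @ z) : K"
 proof (rule straighten[where P = "%l. wd l : K", OF refl _ lens])
  show "mset (c @ q @ z) = mset [1..<Suc n]" using w unfolding l .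
 next
  fix u a b v q z
  assume m: "mset (u @ a # b # v @ q @ z) = mset [1..<Suc n]" and len: "length (u @ a # b # v) = Suc i"
   and P: "wd (u @ a # b # v @ q @ z) : K"
  let ?l = "u @ a # b # v @ q @ z" and ?p = "length u"
  let ?\<tau> = "transpose (Suc ?p) (Suc (Suc ?p))"
  have p: "Suc ?p <= i" using len by simp
  have "wd (?l[?p := ?l ! Suc ?p, Suc ?p := ?l ! ?p]) = Ind.ig (word_perm n ?l) (vt (S1.act ?\<tau> T0) U0)"
   by (rule wd_swap1[OF m]) (use p d_pos in auto)
  moreover have "?l[?p := ?l ! Suc ?p, Suc ?p := ?l ! ?p] = u @ b # a # v @ q @ z"
   using adjacent_update[of u a b "v @ q @ z"] by (simp add: nth_append)
  moreover have "?\<tau> permutes S1.first_col T0"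
  proof (rule permutes_swap_id)
   show "Suc ?p : S1.first_col T0" by (rule image_eqI[of _ _ ?p]) (use p in "simp_all add: T0_cell column0")
   show "Suc (Suc ?p) : S1.first_col T0" by (rule image_eqI[of _ _ "Suc ?p"]) (use p in "simp_all add: T0_cell column0")
  qed
  from S1.sp_alt[OF T0_X this]
  have "Ind.ig (word_perm n ?l) (vt (S1.act ?\<tau> T0) U0) = S1.sg ?\<tau> \<odot>\<^bsub>Ind.ind\<^esub> wd ?l"
   unfolding wd_def
   using slinearD(3)[OF ig_linear_left[OF wp_sym[OF m] S2.sp_closed[OF U0_X]], of "S1.sg ?\<tau>" "S1.sp T0"]
    S1.sp_closed[OF T0_X] by simp
  moreover have "S1.sg ?\<tau> \<odot>\<^bsub>Ind.ind\<^esub> wd ?l : K" by (rule submodule.smult_closed[OF K _ P]) simp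
  ultimately show "wd (u @ b # a # v @ q @ z) : K" by simp
 next
  fix c u a b v z
  assume m: "mset (c @ u @ a # b # v @ z) = mset [1..<Suc n]" and len: "length c = Suc i" "length (u @ a # b # v) = d - 1"
   and P: "wd (c @ u @ a # b # v @ z) : K"
  \<comment> \<open>The relation is applied to the word to be reached; its only exchange gives back
    the word already known to lie in \<open>K\<close>.\<close>
  let ?l = "c @ u @ b # a # v @ z" and ?p = "Suc (i + length u)" and ?j = "Suc (length u)"
  have m': "mset ?l = mset [1..<Suc n]" using m by (simp add: add_mset_commute)
  have j: "Suc ?j < d" using len by simp
  have "wd (?l[?p := ?l ! Suc ?p, Suc ?p := ?l ! ?p]) = Ind.ig (word_perm n ?l) (vt (S1.act (transpose (Suc ?p) (Suc (Suc ?p))) T0) U0)"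
   by (rule wd_swap1[OF m']) (use j in auto)
  moreover have "?l[?p := ?l ! Suc ?p, Suc ?p := ?l ! ?p] = c @ u @ a # b # v @ z"
   using adjacent_update[of "c @ u" b a "v @ z"] len(1) by (simp add: nth_append)
  ultimately have sw: "Ind.ig (word_perm n ?l) (vt (S1.swap ?j 0 T0) U0) : K" using P j by (simp add: T0_cell)
  show "wd ?l : K"
  proof (rule T0_shuffle[OF m' j])
   fix r assume "r : column (hook d i) ?j"
   hence "r = 0" by (simp add: column_def diagram_hook[OF d_pos])
   thus "Ind.ig (word_perm n ?l) (vt (S1.swap ?j r T0) U0) : K" using sw by (simp only:)
  qed
 next
  fix c q u a b v
  assume m: "mset (c @ q @ u @ a # b # v) = mset [1..<Suc n]" and len: "length c = Suc i" "length q = d - 1"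
   and P: "wd (c @ q @ u @ a # b # v) : K"
  let ?l = "c @ q @ u @ b # a # v" and ?p = "d + i + length u" and ?j = "length u"
  have m': "mset ?l = mset [1..<Suc n]" using m by (simp add: add_mset_commute)
  have n: "Suc ?p < n" using word_length[OF m] len d_pos by simp
  have "wd (?l[?p := ?l ! Suc ?p, Suc ?p := ?l ! ?p]) = Ind.ig (word_perm n ?l) (vt T0 (S2.act (transpose (Suc ?p) (Suc (Suc ?p))) U0))"
   by (rule wd_swap2[OF m']) (use n in auto)
  moreover have "?l[?p := ?l ! Suc ?p, Suc ?p := ?l ! ?p] = c @ q @ u @ a # b # v"
  proof -
   have lp: "length (c @ q @ u) = ?p" using len d_pos by simp
   have e: "?l = (c @ q @ u) @ b # a # v" by simp
   have "?l ! Suc ?p = a" "?l ! ?p = b" unfolding e lp[symmetric] by (simp_all only: nth_append_length nth_append) simp_all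
   thus ?thesis using adjacent_update[of "c @ q @ u" b a v] unfolding lp by simp
  qed
  ultimately have "Ind.ig (word_perm n ?l) (vt T0 (S2.swap ?j 0 U0)) : K" using P n by (simp add: U0_cell)
  thus "wd ?l : K" by (rule U0_shuffle[OF m', rotated]) (use n in simp)
 next
  fix c a q z
  assume m: "mset (c @ a # q @ z) = mset [1..<Suc n]" and len: "length c = Suc i" "length (a # q) = d - 1"
   and P: "!!r. r <= i ==> wd (c[r := a] @ (c ! r) # q @ z) : K"
  let ?l = "c @ a # q @ z"
  have d: "Suc 0 < d" using len(2) by simp
  show "wd ?l : K"
  proof (rule T0_shuffle[OF m d])
   fix r assume "r : column (hook d i) 0"
   hence r: "r <= i" by (simp add: column0)
   have "wd (?l[r := ?l ! Suc i, Suc i := ?l ! r]) = Ind.ig (word_perm n ?l) (vt (S1.act (transpose (Suc r) (Suc (Suc i))) T0) U0)"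
    by (rule wd_swap1[OF m]) (use r d in auto)
   moreover have "?l[r := ?l ! Suc i, Suc i := ?l ! r] = c[r := a] @ (c ! r) # q @ z"
    using len(1) r by (simp add: list_update_append nth_append)
   ultimately show "Ind.ig (word_perm n ?l) (vt (S1.swap 0 r T0) U0) : K" using P[OF r] d r by (simp add: T0_cell)
  qed
 qed (rule std)
 thus ?thesis unfolding l .
qed

text \<open>Every generator g \<otimes> (T, U) is the class of a word, since T and U are moved to
  the reference tableaux inside the Young subgroup.\<close>

lemma induced_span:
 assumes std: "!!x. x : std_pairs n d i ==> wd (std_word n x) : K" and u: "u : carrier Ind.ind"
 shows "u : K"
proof (rule Ind.ind_closure[OF K _ u])
 fix g v assume g: "g : carrier (sym_group n)" and v: "v : carrier V"
 have "v : {v \<in> carrier V. Ind.ig g v : K}"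
 proof (rule vt_closure[OF Ind.V.vimage_submodule[OF Ind.ind_module Ind.ig_linear[OF g] K] _ v])
  fix T U assume T: "T : S1.X" and U: "U : S2.X"
  obtain \<sigma> where \<sigma>: "\<sigma> : Yg" "T = S1.act \<sigma> T0" "U = S2.act \<sigma> U0" by (rule young_transitive[OF T U])
  have p: "g \<circ> \<sigma> permutes {1..n}"
   by (rule permutes_compose[OF young(1)[OF \<sigma>(1)]]) (use g in "simp only: sym_group_carrier")
  have "Ind.ig g (vt T U) = Ind.ig (g \<otimes>\<^bsub>sym_group n\<^esub> \<sigma>) v0"
   unfolding Ind.ig_H[OF g \<sigma>(1) v0] V_act_vt[OF \<sigma>(1) T0_X U0_X] \<sigma>(2,3) ..
  also have "... = wd (map (g \<circ> \<sigma>) [1..<Suc n])"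
   unfolding wd_def sym_group_mult word_perm_map(1)[OF p, symmetric] ..
  also have "... : K" by (rule word_straighten[OF std word_perm_map(2)[OF p]])
  finally show "vt T U : {v \<in> carrier V. Ind.ig g v : K}" using vt_closed[OF T U] by blast
 qed simp
 thus "Ind.ig g v : K" by simp
qed

end

text \<open>The permutation of the word carries the column and the arm of \<open>T0\<close> to the
  two components of the pair, and the action on \<open>wel\<close> follows such a
  relabelling.\<close>

lemma wd_std_image:
 assumes f: "!!g T U. g permutes {1..n} ==> T : S1.X ==> U : S2.X ==> f (Ind.ig g (vt T U)) = gact (Wmod i) g (pw T)"
  and x: "x : std_pairs n d i"
 shows "f (wd (std_word n x)) = wel A n (fst x) (snd x)"
proof -
 note X = mset_std_word[OF x]
 let ?l = "std_word n x" and ?q = "sorted_list_of_set (snd x)"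
 have "finite (snd x)" using x finite_subset[of "snd x" "{1..n}"] by (auto simp: std_pairs_def)
 hence sq: "set ?q = snd x" by simp
 have nth1: "?l ! k = fst x ! k" if "k <= i" for k using that X(2) by (simp add: std_word_def nth_append)
 have nth2: "?l ! (Suc i + k) = ?q ! k" if "k < d - 1" for k
  using that X(2,3) by (simp add: std_word_def nth_append)
 have "f (wd ?l) = wel A n (map (word_perm n ?l) (col T0)) (word_perm n ?l ` arm T0)"
  unfolding wd_def f[OF word_perm_permutes[OF X(1)] T0_X U0_X]
  by (rule W_wel_act[OF word_perm_permutes[OF X(1)] col_arm(7)[OF T0_X]])
 also have "map (word_perm n ?l) (col T0) = fst x"
  by (rule nth_equalityI) (use le d_pos X(2) in "auto simp: col_def T0_cell word_perm_Suc nth1 less_Suc_eq_le simp del: upt_Suc")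
 also have "word_perm n ?l ` arm T0 = set ?q"
 proof -
  have "word_perm n ?l (T0 (0, c)) = ?q ! (c - 1)" if "c : {1..<d}" for c
  proof -
   have e: "Suc i + (c - 1) = i + c" "c - 1 < d - 1" "i + c < n" using that le by auto
   show ?thesis using that nth2[OF e(2)] unfolding e(1) by (simp add: T0_cell word_perm_Suc e(3))
  qed
  hence "word_perm n ?l ` arm T0 = (%c. ?q ! (c - 1)) ` {1..<d}" unfolding arm_def image_image by (rule image_cong[OF refl])
  also have "... = (%k. ?q ! k) ` (%c. c - 1) ` {1..<d}" by (simp only: image_image)
  also have "(%c. c - 1) ` {1..<d} = {..<d - 1}"
  proof (intro equalityI subsetI)
   fix k assume "k : {..<d - 1}"
   thus "k : (%c. c - 1) ` {1..<d}" by (intro image_eqI[of _ _ "Suc k"]) auto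
  qed auto
  also have "(%k. ?q ! k) ` {..<d - 1} = set ?q" using X(3) by (auto simp: set_conv_nth)
  finally show ?thesis .
 qed
 finally show ?thesis unfolding sq .
qed

text \<open>The inverse \<open>g\<close> reads off the standard coordinates of a cycle and returns
  the corresponding combination of standard words. One composite is the expansion of a cycle; the
  other need only be checked on standard words, because they span the induced module.\<close>

lemma U_iso: "group_ring_module_iso A (sym_group n) (U_module A d n i) (Wmod i)"
proof -
 interpret W: module A "Wmod i" by (rule W_module)
 interpret U: module A Ind.ind by (rule Ind.ind_module)
 obtain f where f: "f : linear_maps A Ind.ind (Wmod i)"
  "!!g T U. g permutes {1..n} ==> T : S1.X ==> U : S2.X ==> f (Ind.ig g (vt T U)) = gact (Wmod i) g (pw T)"
  "!!\<sigma> u. \<sigma> permutes {1..n} ==> u : carrier Ind.ind ==> f (gact Ind.ind \<sigma> u) = gact (Wmod i) \<sigma> (f u)"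
  using comparison_map by blast
 let ?S = "std_pairs n d i" and ?u = "%x. wd (std_word n x)"
 have u: "?u x : carrier Ind.ind" if "x : ?S" for x by (rule wd_closed[OF mset_std_word(1)[OF that]])
 have fu: "f (?u x) = wel A n (fst x) (snd x)" if "x : ?S" for x by (rule wd_std_image[OF f(2) that])
 have fZ: "f v : Z i" if "v : carrier Ind.ind" for v
  using slinearD(1)[OF f(1) that] by (simp only: W_simps(1))
 have pc: "pair_coord x w : carrier A" if "w : Z i" for x w unfolding pair_coord_def by (rule cycD(2)[OF that])
 define g where "g w = (\<Oplus>\<^bsub>Ind.ind\<^esub>x\<in>?S. pair_coord x w \<odot>\<^bsub>Ind.ind\<^esub> ?u x)" for w
 have gc: "(%x. pair_coord x w \<odot>\<^bsub>Ind.ind\<^esub> ?u x) : ?S \<rightarrow> carrier Ind.ind" if "w : Z i" for w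
  by (rule funcsetI) (rule U.smult_closed[OF pc[OF that] u])
 have glin: "g : linear_maps A (Wmod i) Ind.ind"
 proof (rule slinearI)
  fix w assume "w : carrier (Wmod i)"
  hence w: "w : Z i" by (simp only: W_simps(1))
  show "g w : carrier Ind.ind" unfolding g_def by (rule U.M.finsum_closed[OF gc[OF w]])
  show "g (a \<odot>\<^bsub>Wmod i\<^esub> w) = id a \<odot>\<^bsub>Ind.ind\<^esub> g w" if a: "a : carrier A" for a
  proof -
   have "id a \<odot>\<^bsub>Ind.ind\<^esub> g w = (\<Oplus>\<^bsub>Ind.ind\<^esub>x\<in>?S. a \<odot>\<^bsub>Ind.ind\<^esub> (pair_coord x w \<odot>\<^bsub>Ind.ind\<^esub> ?u x))"
    unfolding g_def id_apply by (rule U.finsum_smult_ldistr[OF finite_std_pairs a gc[OF w]])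
   also have "... = g (a \<odot>\<^bsub>Wmod i\<^esub> w)" unfolding g_def
   proof (rule U.M.finsum_cong')
    show "(%x. pair_coord x (a \<odot>\<^bsub>Wmod i\<^esub> w) \<odot>\<^bsub>Ind.ind\<^esub> ?u x) : ?S \<rightarrow> carrier Ind.ind"
     by (rule gc) (use W.smult_closed[OF a, of w] w in "simp only: W_simps(1)")
    show "a \<odot>\<^bsub>Ind.ind\<^esub> (pair_coord x w \<odot>\<^bsub>Ind.ind\<^esub> ?u x) = pair_coord x (a \<odot>\<^bsub>Wmod i\<^esub> w) \<odot>\<^bsub>Ind.ind\<^esub> ?u x"
     if "x : ?S" for x
     unfolding U.smult_assoc1[OF a pc[OF w] u[OF that], symmetric] by (simp only: W_simps(4) pair_coord_def)
   qed simp
   finally show ?thesis by simp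
  qed
  fix w' assume "w' : carrier (Wmod i)"
  hence w': "w' : Z i" by (simp only: W_simps(1))
  have "g w \<oplus>\<^bsub>Ind.ind\<^esub> g w'
    = (\<Oplus>\<^bsub>Ind.ind\<^esub>x\<in>?S. pair_coord x w \<odot>\<^bsub>Ind.ind\<^esub> ?u x \<oplus>\<^bsub>Ind.ind\<^esub> pair_coord x w' \<odot>\<^bsub>Ind.ind\<^esub> ?u x)"
   unfolding g_def by (rule U.M.finsum_addf[symmetric, OF gc[OF w] gc[OF w']])
  also have "... = g (w \<oplus>\<^bsub>Wmod i\<^esub> w')" unfolding g_def
  proof (rule U.M.finsum_cong')
   show "(%x. pair_coord x (w \<oplus>\<^bsub>Wmod i\<^esub> w') \<odot>\<^bsub>Ind.ind\<^esub> ?u x) : ?S \<rightarrow> carrier Ind.ind"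
    by (rule gc) (use W.M.a_closed[of w w'] w w' in "simp only: W_simps(1)")
   show "pair_coord x w \<odot>\<^bsub>Ind.ind\<^esub> ?u x \<oplus>\<^bsub>Ind.ind\<^esub> pair_coord x w' \<odot>\<^bsub>Ind.ind\<^esub> ?u x
     = pair_coord x (w \<oplus>\<^bsub>Wmod i\<^esub> w') \<odot>\<^bsub>Ind.ind\<^esub> ?u x" if "x : ?S" for x
    unfolding U.smult_l_distr[OF pc[OF w] pc[OF w'] u[OF that], symmetric] by (simp only: W_simps(3) pair_coord_def)
  qed simp
  finally show "g (w \<oplus>\<^bsub>Wmod i\<^esub> w') = g w \<oplus>\<^bsub>Ind.ind\<^esub> g w'" by simp
 qed
 have fg: "f (g w) = w" if w: "w : Z i" for w
 proof -
  have "f (g w) = (\<Oplus>\<^bsub>Wmod i\<^esub>x\<in>?S. f (pair_coord x w \<odot>\<^bsub>Ind.ind\<^esub> ?u x))"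
   unfolding g_def
   by (rule semilinear_finsum[OF Ind.ind_module W_module f(1) finite_std_pairs]) (rule U.smult_closed[OF pc[OF w] u])
  also have "... = (\<Oplus>\<^bsub>Wmod i\<^esub>x\<in>?S. pair_coord x w \<odot>\<^bsub>Wmod i\<^esub> wel A n (fst x) (snd x))"
  proof (rule W.M.finsum_cong')
   show "(%x. pair_coord x w \<odot>\<^bsub>Wmod i\<^esub> wel A n (fst x) (snd x)) : ?S \<rightarrow> carrier (Wmod i)"
    by (rule funcsetI) (rule W.smult_closed[OF pc[OF w]], unfold W_simps(1), rule std_wel_Z)
   show "f (pair_coord x w \<odot>\<^bsub>Ind.ind\<^esub> ?u x) = pair_coord x w \<odot>\<^bsub>Wmod i\<^esub> wel A n (fst x) (snd x)" if "x : ?S" for x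
    unfolding slinearD(3)[OF f(1) pc[OF w] u[OF that]] fu[OF that] id_apply ..
  qed simp
  also have "... = w" using Z_expand[OF w] by (simp only: comb_def)
  finally show ?thesis .
 qed
 have gf: "g (f v) = v" if v: "v : carrier Ind.ind" for v
 proof -
  have idl: "(%v. v) : linear_maps A Ind.ind Ind.ind" by (rule slinearI) simp_all
  have "v : {v \<in> carrier Ind.ind. g (f v) = v}"
  proof (rule induced_span[OF U.eq_submodule[OF Ind.ind_module linear_comp[OF f(1) glin] idl] _ v])
   fix x assume x: "x : ?S"
   have "g (f (?u x)) = (\<Oplus>\<^bsub>Ind.ind\<^esub>y\<in>?S. if x = y then ?u y else \<zero>\<^bsub>Ind.ind\<^esub>)"
    unfolding g_def fu[OF x]
   proof (rule U.M.finsum_cong'[OF _ funcsetI])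
    fix y assume y: "y : ?S"
    have e: "pair_coord y (wel A n (fst x) (snd x)) = (if y = x then \<one> else \<zero>)"
     using pair_coord_wel[of "fst y" "snd y" n d i "fst x" "snd x"] x y by simp
    show "pair_coord y (wel A n (fst x) (snd x)) \<odot>\<^bsub>Ind.ind\<^esub> ?u y = (if x = y then ?u y else \<zero>\<^bsub>Ind.ind\<^esub>)"
     unfolding e using U.smult_one[OF u[OF y]] U.smult_l_null[OF u[OF y]]
     by (cases "x = y") (simp_all only: refl if_True if_False not_sym not_False_eq_True)
    show "(if x = y then ?u y else \<zero>\<^bsub>Ind.ind\<^esub>) : carrier Ind.ind" if "y : ?S" for y
     using u[OF that] U.M.zero_closed by (rule if_split_mem)
   qed simp
   also have "... = ?u x" by (rule U.M.finsum_singleton[OF x finite_std_pairs]) (rule funcsetI, rule u)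
   finally show "?u x : {v \<in> carrier Ind.ind. g (f v) = v}" using u[OF x] by blast
  qed
  thus ?thesis by simp
 qed
 have gZ: "g w : carrier Ind.ind" if "w : Z i" for w
  using slinearD(1)[OF glin, of w] that by (simp only: W_simps(1))
 have bij: "bij_betw f (carrier Ind.ind) (carrier (Wmod i))"
  unfolding W_simps(1) by (rule bij_betw_byWitness[where f' = g]) (use fg gf fZ gZ in auto)
 have act: "gact Ind.ind \<sigma> v : carrier Ind.ind" if "\<sigma> : carrier (sym_group n)" "v : carrier Ind.ind" for \<sigma> v
  by (rule slinearD(1)[OF Ind.ind_act(1)[OF that(1)] that(2)])
 note F = slinearD[OF f(1)]
 show ?thesis unfolding U_eq
 proof (rule group_ring_module_isoI[OF sym_group_is_group W_group_ring_module bij])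
  show "gact Ind.ind \<sigma> v : carrier Ind.ind & f (gact Ind.ind \<sigma> v) = gact (Wmod i) \<sigma> (f v)"
   if "\<sigma> : carrier (sym_group n)" "v : carrier Ind.ind" for \<sigma> v
   using act[OF that] f(3)[OF that(1)[unfolded sym_group_carrier] that(2)] by blast
  show "f \<zero>\<^bsub>Ind.ind\<^esub> = \<zero>\<^bsub>Wmod i\<^esub>" by (rule semilinear_zero[OF Ind.ind_module W_module f(1)])
 qed (use F U.smult_closed U.M.a_closed in "simp_all only: id_apply simp_thms U.M.zero_closed")
qed

end

section \<open>Rank of free modules\<close>

text \<open>Gaussian elimination by induction on the equations: one equation is used to solve for
  one unknown, and the reduced system again has fewer equations than unknowns.\<close>

lemma (in field) underdetermined_system:
 assumes "finite J" "finite I" "card J < card I" "!!i j. i : I ==> j : J ==> P i j : carrier R"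
 shows "\<exists>a. (\<forall>i\<in>I. a i : carrier R) & (\<exists>i\<in>I. a i ~= \<zero>) & (\<forall>j\<in>J. (\<Oplus>i\<in>I. a i \<otimes> P i j) = \<zero>)"
 using assms
proof (induction J arbitrary: I P rule: finite_induct)
 case empty
 hence "I ~= {}" by auto
 thus ?case by (intro exI[of _ "%_. \<one>"]) auto
next
 case (insert j J)
 note cl = insert.prems(3)
 show ?case
 proof (cases "\<forall>i\<in>I. P i j = \<zero>")
  case True
  have "card J < card I" using insert.prems(2) insert.hyps by simp
  moreover have "P i l : carrier R" if "i : I" "l : J" for i l using cl that by blast
  ultimately obtain a where
   a: "\<forall>i\<in>I. a i : carrier R" "\<exists>i\<in>I. a i ~= \<zero>" "\<forall>l\<in>J. (\<Oplus>i\<in>I. a i \<otimes> P i l) = \<zero>"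
   using insert.IH[OF insert.prems(1), of P] by auto
  have "(\<Oplus>i\<in>I. a i \<otimes> P i j) = (\<Oplus>i\<in>I. \<zero>)" by (rule finsum_cong') (use a(1) True in auto)
  thus ?thesis using a by (intro exI[of _ a]) auto
 next
  case False
  then obtain p where p: "p : I" "P p j ~= \<zero>" by blast
  define b where "b = inv (P p j)"
  have b: "b : carrier R" "b \<otimes> P p j = \<one>" using field_Units p cl[OF p(1), of j] by (auto simp: b_def)
  define I' where "I' = I - {p}"
  have I': "finite I'" "p \<notin> I'" "I = insert p I'" using insert.prems(1) p(1) by (auto simp: I'_def)
  \<comment> \<open>The coefficients after elimination with pivot \<open>P p j\<close>; those of
    equation \<open>j\<close> become zero.\<close>
  define P' where "P' i l = P i l \<ominus> P i j \<otimes> b \<otimes> P p l" for i l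
  have c: "P i l : carrier R" if "i : I'" "l : insert j J" for i l using cl that I'(3) by blast
  have cp: "P p l : carrier R" if "l : insert j J" for l using cl that p(1) by blast
  have "card J < card I'" using insert.prems(2) insert.hyps I' by simp
  moreover have "P' i l : carrier R" if "i : I'" "l : J" for i l
   unfolding P'_def using c[OF that(1)] cp that(2) b(1) by simp
  ultimately obtain a where
   a: "\<forall>i\<in>I'. a i : carrier R" "\<exists>i\<in>I'. a i ~= \<zero>" "\<forall>l\<in>J. (\<Oplus>i\<in>I'. a i \<otimes> P' i l) = \<zero>"
   using insert.IH[OF I'(1), of P'] by auto
  define s where "s = (\<Oplus>i\<in>I'. a i \<otimes> (P i j \<otimes> b))"
  have ac: "a i : carrier R" if "i : I'" for i using a(1) that by blast
  have sc: "s : carrier R" unfolding s_def by (rule finsum_closed) (use ac c b(1) in auto)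
  have key: "(\<Oplus>i\<in>I'. a i \<otimes> P i l) = s \<otimes> P p l" if l: "l : insert j J" for l
  proof -
   have P'c: "P' i l : carrier R" if "i : I'" for i
    unfolding P'_def using c[OF that l] c[OF that, of j] cp[OF l] b(1) by simp
   have "(\<Oplus>i\<in>I'. a i \<otimes> P i l) = (\<Oplus>i\<in>I'. a i \<otimes> P' i l \<oplus> a i \<otimes> (P i j \<otimes> b) \<otimes> P p l)"
   proof (rule finsum_cong')
    show "(%i. a i \<otimes> P' i l \<oplus> a i \<otimes> (P i j \<otimes> b) \<otimes> P p l) : I' \<rightarrow> carrier R"
     using ac c cp[OF l] b(1) P'c by auto
    fix i assume i: "i : I'"
    have *: "P i j : carrier R" "P i l : carrier R" using c[OF i] l by auto
    have "a i \<otimes> P' i l \<oplus> a i \<otimes> (P i j \<otimes> b) \<otimes> P p l = a i \<otimes> (P' i l \<oplus> P i j \<otimes> b \<otimes> P p l)"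
     using ac[OF i] * b(1) cp[OF l] P'c[OF i] by (simp add: r_distr m_assoc)
    also have "P' i l \<oplus> P i j \<otimes> b \<otimes> P p l = P i l"
     unfolding P'_def using * b(1) cp[OF l] by (simp add: a_minus_def a_assoc l_neg)
    finally show "a i \<otimes> P i l = a i \<otimes> P' i l \<oplus> a i \<otimes> (P i j \<otimes> b) \<otimes> P p l" ..
   qed simp
   also have "... = (\<Oplus>i\<in>I'. a i \<otimes> P' i l) \<oplus> (\<Oplus>i\<in>I'. a i \<otimes> (P i j \<otimes> b) \<otimes> P p l)"
    by (rule finsum_addf) (use ac c cp[OF l] b(1) P'c in auto)
   also have "(\<Oplus>i\<in>I'. a i \<otimes> (P i j \<otimes> b) \<otimes> P p l) = s \<otimes> P p l"
    unfolding s_def by (rule finsum_ldistr[symmetric, OF I'(1) cp[OF l]]) (use ac c b(1) in auto)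
   also have "(\<Oplus>i\<in>I'. a i \<otimes> P' i l) = \<zero>"
   proof (cases "l = j")
    case True
    have "P' i j = \<zero>" if "i : I'" for i
     unfolding P'_def using c[OF that, of j] b cp[of j] by (simp add: m_assoc a_minus_def r_neg)
    hence "(\<Oplus>i\<in>I'. a i \<otimes> P' i l) = (\<Oplus>i\<in>I'. \<zero>)" by (intro finsum_cong') (use ac True in auto)
    thus ?thesis by simp
   next
    case False
    thus ?thesis using a(3) l by blast
   qed
   finally show ?thesis using sc cp[OF l] by simp
  qed
  \<comment> \<open>The eliminated unknown is recovered from equation \<open>j\<close>.\<close>
  let ?a = "a(p := \<ominus> s)"
  have "(\<Oplus>i\<in>I. ?a i \<otimes> P i l) = \<zero>" if l: "l : insert j J" for l
  proof -
   have "(\<Oplus>i\<in>I. ?a i \<otimes> P i l) = ?a p \<otimes> P p l \<oplus> (\<Oplus>i\<in>I'. ?a i \<otimes> P i l)"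
    unfolding I'(3) by (rule finsum_insert[OF I'(1,2)]) (use ac c l cp sc I'(2) in auto)
   also have "(\<Oplus>i\<in>I'. ?a i \<otimes> P i l) = (\<Oplus>i\<in>I'. a i \<otimes> P i l)"
    by (rule finsum_cong') (use ac c l I'(2) in auto)
   finally show ?thesis using sc cp[OF l] unfolding key[OF l] by (simp add: l_minus l_neg)
  qed
  moreover obtain i where "i : I'" "a i ~= \<zero>" using a(2) by blast
  hence "\<exists>i\<in>I. ?a i ~= \<zero>" using I'(2,3) by (intro bexI[of _ i]) auto
  moreover have "?a i : carrier R" if "i : I" for i using ac sc that I'(3) by auto
  ultimately show ?thesis by (intro exI[of _ ?a] conjI ballI)
 qed
qed

lemma (in abelian_monoid) finsum_swap:
 assumes "finite I" "finite J" "!!i j. i : I ==> j : J ==> g i j : carrier G"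
 shows "(\<Oplus>i\<in>I. \<Oplus>j\<in>J. g i j) = (\<Oplus>j\<in>J. \<Oplus>i\<in>I. g i j)"
 using assms(2,3)
proof (induction J rule: finite_induct)
 case empty
 show ?case by simp
next
 case (insert j J)
 have "(\<Oplus>i\<in>I. \<Oplus>j\<in>insert j J. g i j) = (\<Oplus>i\<in>I. g i j \<oplus> (\<Oplus>j\<in>J. g i j))"
  by (rule finsum_cong') (use insert in "auto intro!: finsum_insert finsum_closed")
 also have "... = (\<Oplus>i\<in>I. g i j) \<oplus> (\<Oplus>i\<in>I. \<Oplus>j\<in>J. g i j)"
  by (rule finsum_addf) (use insert.prems in "auto intro!: finsum_closed")
 also have "(\<Oplus>i\<in>I. \<Oplus>j\<in>J. g i j) = (\<Oplus>j\<in>J. \<Oplus>i\<in>I. g i j)" using insert by auto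
 also have "(\<Oplus>i\<in>I. g i j) \<oplus> (\<Oplus>j\<in>J. \<Oplus>i\<in>I. g i j) = (\<Oplus>j\<in>insert j J. \<Oplus>i\<in>I. g i j)"
  by (rule finsum_insert[symmetric]) (use insert in "auto intro!: finsum_closed")
 finally show ?case .
qed

lemma (in cring) maximal_ideal_exists:
 assumes "\<one> ~= \<zero>" shows "\<exists>I. maximalideal I R"
proof -
 let ?S = "{I. ideal I R & \<one> \<notin> I}"
 have "\<exists>M\<in>?S. \<forall>X\<in>?S. M <= X --> X = M"
 proof (rule subset_Zorn_nonempty)
  show "?S ~= {}" using zeroideal assms by auto
  fix C assume C: "C ~= {}" "subset.chain ?S C"
  hence "subset.chain {I. ideal I R} C" unfolding pred_on.chain_def by blast
  hence "ideal (\<Union>C) R" using chain_Union_is_ideal[of C] C(1) by simp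
  moreover have "\<one> \<notin> \<Union>C" using C(2) unfolding pred_on.chain_def by blast
  ultimately show "\<Union>C : ?S" by blast
 qed
 then obtain M where M: "ideal M R" "\<one> \<notin> M" "!!X. ideal X R ==> \<one> \<notin> X ==> M <= X ==> X = M" by blast
 have "maximalideal M R"
 proof (rule maximalidealI[OF M(1)])
  show "carrier R ~= M" using M(2) by blast
  fix X assume X: "ideal X R" "M <= X" "X <= carrier R"
  show "X = M | X = carrier R"
  proof (cases "\<one> : X")
   case True
   thus ?thesis using ideal.one_imp_carrier[OF X(1)] by blast
  qed (use M(3) X in blast)
 qed
 thus ?thesis by blast
qed

text \<open>Modulo a maximal ideal, with too few columns there is a nonzero row vector a with a P =
  0. Then a = a P Q = 0, a contradiction.\<close>

lemma (in cring) matrix_right_inverse_card: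
 assumes "\<one> ~= \<zero>" and fin: "finite I" "finite J"
  and P: "!!i j. i : I ==> j : J ==> P i j : carrier R" and Q: "!!j l. j : J ==> l : I ==> Q j l : carrier R"
  and PQ: "!!i l. i : I ==> l : I ==> (\<Oplus>j\<in>J. P i j \<otimes> Q j l) = (if i = l then \<one> else \<zero>)"
 shows "card I <= card J"
proof (rule ccontr)
 assume "~ card I <= card J"
 hence lt: "card J < card I" by simp
 obtain M where M: "maximalideal M R" using maximal_ideal_exists[OF assms(1)] by blast
 interpret M: maximalideal M R by (rule M)
 let ?F = "R Quot M" and ?h = "%x. M +> x"
 interpret F: field ?F by (rule M.quotient_is_field[OF is_cring])
 interpret h: ring_hom_cring R ?F ?h by (rule M.rcos_ring_hom_cring[OF is_cring])
 have hP: "?h (P i j) : carrier ?F" if "i : I" "j : J" for i j using P[OF that] by simp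
 have hQ: "?h (Q j l) : carrier ?F" if "j : J" "l : I" for j l using Q[OF that] by simp
 obtain a where a: "!!i. i : I ==> a i : carrier ?F" "\<exists>i\<in>I. a i ~= \<zero>\<^bsub>?F\<^esub>"
  "!!j. j : J ==> (\<Oplus>\<^bsub>?F\<^esub>i\<in>I. a i \<otimes>\<^bsub>?F\<^esub> ?h (P i j)) = \<zero>\<^bsub>?F\<^esub>"
  using F.underdetermined_system[OF fin(2,1) lt, of "%i j. ?h (P i j)"] hP by blast
 have "a l = \<zero>\<^bsub>?F\<^esub>" if l: "l : I" for l
 proof -
  have hPQ: "(\<Oplus>\<^bsub>?F\<^esub>j\<in>J. ?h (P i j) \<otimes>\<^bsub>?F\<^esub> ?h (Q j l)) = (if l = i then \<one>\<^bsub>?F\<^esub> else \<zero>\<^bsub>?F\<^esub>)" if i: "i : I" for i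
  proof -
   have "?h (\<Oplus>j\<in>J. P i j \<otimes> Q j l) = (\<Oplus>\<^bsub>?F\<^esub>j\<in>J. (?h \<circ> (%j. P i j \<otimes> Q j l)) j)"
    by (rule h.hom_finsum) (use P[OF i] Q[OF _ l] in auto)
   also have "... = (\<Oplus>\<^bsub>?F\<^esub>j\<in>J. ?h (P i j) \<otimes>\<^bsub>?F\<^esub> ?h (Q j l))"
    by (rule F.finsum_cong') (use P[OF i] Q[OF _ l] hP[OF i] hQ[OF _ l] in auto)
   finally show ?thesis unfolding PQ[OF i l] by (auto split: if_splits)
  qed
  have "a l = (\<Oplus>\<^bsub>?F\<^esub>i\<in>I. if l = i then a i else \<zero>\<^bsub>?F\<^esub>)"
   by (rule F.finsum_singleton[symmetric, OF l fin(1)]) (use a(1) in auto)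
  also have "... = (\<Oplus>\<^bsub>?F\<^esub>i\<in>I. \<Oplus>\<^bsub>?F\<^esub>j\<in>J. a i \<otimes>\<^bsub>?F\<^esub> ?h (P i j) \<otimes>\<^bsub>?F\<^esub> ?h (Q j l))"
  proof (rule F.finsum_cong')
   show "(%i. \<Oplus>\<^bsub>?F\<^esub>j\<in>J. a i \<otimes>\<^bsub>?F\<^esub> ?h (P i j) \<otimes>\<^bsub>?F\<^esub> ?h (Q j l)) : I \<rightarrow> carrier ?F"
    using a(1) hP hQ[OF _ l] by (auto intro!: F.finsum_closed)
   fix i assume i: "i : I"
   have "(\<Oplus>\<^bsub>?F\<^esub>j\<in>J. a i \<otimes>\<^bsub>?F\<^esub> ?h (P i j) \<otimes>\<^bsub>?F\<^esub> ?h (Q j l))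
     = (\<Oplus>\<^bsub>?F\<^esub>j\<in>J. a i \<otimes>\<^bsub>?F\<^esub> (?h (P i j) \<otimes>\<^bsub>?F\<^esub> ?h (Q j l)))"
    by (rule F.finsum_cong') (use a(1)[OF i] hP[OF i] hQ[OF _ l] in "auto simp: F.m_assoc")
   also have "... = a i \<otimes>\<^bsub>?F\<^esub> (\<Oplus>\<^bsub>?F\<^esub>j\<in>J. ?h (P i j) \<otimes>\<^bsub>?F\<^esub> ?h (Q j l))"
    by (rule F.finsum_rdistr[symmetric, OF fin(2) a(1)[OF i]]) (use hP[OF i] hQ[OF _ l] in auto)
   finally show "(if l = i then a i else \<zero>\<^bsub>?F\<^esub>) = (\<Oplus>\<^bsub>?F\<^esub>j\<in>J. a i \<otimes>\<^bsub>?F\<^esub> ?h (P i j) \<otimes>\<^bsub>?F\<^esub> ?h (Q j l))"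
    unfolding hPQ[OF i] using a(1)[OF i] by (cases "l = i") simp_all
  qed simp
  also have "... = (\<Oplus>\<^bsub>?F\<^esub>j\<in>J. \<Oplus>\<^bsub>?F\<^esub>i\<in>I. a i \<otimes>\<^bsub>?F\<^esub> ?h (P i j) \<otimes>\<^bsub>?F\<^esub> ?h (Q j l))"
   by (rule F.finsum_swap[OF fin]) (use a(1) hP hQ[OF _ l] in auto)
  also have "... = (\<Oplus>\<^bsub>?F\<^esub>j\<in>J. \<zero>\<^bsub>?F\<^esub>)"
  proof (rule F.finsum_cong')
   fix j assume j: "j : J"
   have "(\<Oplus>\<^bsub>?F\<^esub>i\<in>I. a i \<otimes>\<^bsub>?F\<^esub> ?h (P i j) \<otimes>\<^bsub>?F\<^esub> ?h (Q j l)) = (\<Oplus>\<^bsub>?F\<^esub>i\<in>I. a i \<otimes>\<^bsub>?F\<^esub> ?h (P i j)) \<otimes>\<^bsub>?F\<^esub> ?h (Q j l)"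
    by (rule F.finsum_ldistr[symmetric, OF fin(1) hQ[OF j l]]) (use a(1) hP[OF _ j] in auto)
   thus "(\<Oplus>\<^bsub>?F\<^esub>i\<in>I. a i \<otimes>\<^bsub>?F\<^esub> ?h (P i j) \<otimes>\<^bsub>?F\<^esub> ?h (Q j l)) = \<zero>\<^bsub>?F\<^esub>"
    unfolding a(3)[OF j] using hQ[OF j l] by simp
  qed auto
  finally show ?thesis by simp
 qed
 thus False using a(2) by blast
qed

text \<open>Expressing \<open>B\<close> through \<open>B'\<close> and back gives a matrix with a
  right inverse. By symmetry the rank is well defined over every nonzero commutative ring.\<close>

lemma basis_card_le:
 assumes M: "module R M" and one: "\<one>\<^bsub>R\<^esub> ~= \<zero>\<^bsub>R\<^esub>"
  and B: "finite B" "module_basis R M B" and B': "finite B'" "module_basis R M B'"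
 shows "card B <= card B'"
proof -
 interpret M: module R M by (rule M)
 let ?c = "%B. free_lift R M (%b. b)"
 have basis: "B <= carrier M" "bij_betw (free_lift R M (%b. b)) (carrier (free_module R B)) (carrier M)"
  if "module_basis R M B" for B
  using that unfolding module_basis_def free_lift_def by blast+
 define crd where "crd B = inv_into (carrier (free_module R B)) (free_lift R M (%b. b))" for B
 have crd: "crd B v : carrier (free_module R B)" "free_lift R M (%b. b) (crd B v) = v"
  if "module_basis R M B" "v : carrier M" for B v
  using basis(2)[OF that(1)] that(2) unfolding crd_def bij_betw_def by (metis inv_into_into, metis f_inv_into_f)
 have crd_eq: "crd B (free_lift R M (%b. b) f) = f" if "module_basis R M B" "f : carrier (free_module R B)" for B f
  using basis(2)[OF that(1)] that(2) unfolding crd_def bij_betw_def by (metis inv_into_f_f)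
 have id: "(%b. b) : B \<rightarrow> carrier M" if "module_basis R M B" for B using basis(1)[OF that] by auto
 have crd_lin: "crd B : linear_maps R M (free_module R B)" if b: "module_basis R M B" for B
 proof (rule slinearI)
  note lin = slinearD[OF M.free_lift_linear[OF id[OF b]]]
  interpret FB: module R "free_module R B" by (rule M.free_module_is_module)
  fix v assume v: "v : carrier M"
  note cv = crd[OF b v]
  show "crd B v : carrier (free_module R B)" by (rule cv(1))
  show "crd B (a \<odot>\<^bsub>M\<^esub> v) = id a \<odot>\<^bsub>free_module R B\<^esub> crd B v" if a: "a : carrier R" for a
   using crd_eq[OF b FB.smult_closed[OF a cv(1)]] unfolding lin(3)[OF a cv(1)] cv(2) id_apply .
  fix w assume w: "w : carrier M"
  note cw = crd[OF b w]
  show "crd B (v \<oplus>\<^bsub>M\<^esub> w) = crd B v \<oplus>\<^bsub>free_module R B\<^esub> crd B w"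
   using crd_eq[OF b FB.M.a_closed[OF cv(1) cw(1)]] unfolding lin(2)[OF cv(1) cw(1)] cv(2) cw(2) .
 qed
 have crd_gen: "crd B b = free_gen R b" if "module_basis R M B" "b : B" for B b
  using crd_eq[OF that(1) M.gen_cl[OF that(2)]] M.free_lift_gen[OF id[OF that(1)] that(2)] by simp
 have cc: "crd B v l : carrier R" if "module_basis R M B" "v : carrier M" for B v l
  using crd(1)[OF that] unfolding free_simps by blast
 show ?thesis
 proof (rule M.matrix_right_inverse_card[OF one B(1) B'(1), where P = "crd B'" and Q = "crd B"])
  show "crd B' b j : carrier R" if "b : B" for b j using cc[OF B'(2)] basis(1)[OF B(2)] that by blast
  show "crd B j l : carrier R" if "j : B'" for j l using cc[OF B(2)] basis(1)[OF B'(2)] that by blast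
  fix b l assume b: "b : B" and l: "l : B"
  have bM: "b : carrier M" using basis(1)[OF B(2)] b by blast
  have jM: "j : carrier M" if "j : B'" for j using basis(1)[OF B'(2)] that by blast
  note cb = crd[OF B'(2) bM]
  have f: "(%v. crd B v l) (\<Oplus>\<^bsub>M\<^esub>j\<in>B'. crd B' b j \<odot>\<^bsub>M\<^esub> j) = (\<Oplus>\<^bsub>R\<^esub>j\<in>B'. crd B (crd B' b j \<odot>\<^bsub>M\<^esub> j) l)"
   by (rule additive_finsum[where f = "%v. crd B v l", OF M.M.abelian_group_axioms M.R.abelian_group_axioms _ _ B'(1)])
    (use cc[OF B(2)] cc[OF B'(2) bM] jM slinearD(2)[OF crd_lin[OF B(2)]] in "auto simp: free_simps")
  have "b = free_lift R M (%b. b) (crd B' b)" using cb(2) by simp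
  also have "... = (\<Oplus>\<^bsub>M\<^esub>j\<in>B'. crd B' b j \<odot>\<^bsub>M\<^esub> j)"
   by (rule M.free_lift_eq[OF cb(1) id[OF B'(2)] B'(1)]) (use cb(1) in "auto simp: free_simps")
  finally have "crd B b l = (\<Oplus>\<^bsub>R\<^esub>j\<in>B'. crd B (crd B' b j \<odot>\<^bsub>M\<^esub> j) l)" using f by simp
  also have "... = (\<Oplus>\<^bsub>R\<^esub>j\<in>B'. crd B' b j \<otimes>\<^bsub>R\<^esub> crd B j l)"
  proof (rule M.R.finsum_cong')
   show "(%j. crd B' b j \<otimes>\<^bsub>R\<^esub> crd B j l) : B' \<rightarrow> carrier R" using cc[OF B'(2) bM] cc[OF B(2) jM] by auto
   show "crd B (crd B' b j \<odot>\<^bsub>M\<^esub> j) l = crd B' b j \<otimes>\<^bsub>R\<^esub> crd B j l" if "j : B'" for j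
    unfolding slinearD(3)[OF crd_lin[OF B(2)] cc[OF B'(2) bM] jM[OF that]] by (simp add: free_simps)
  qed simp
  finally show "(\<Oplus>\<^bsub>R\<^esub>j\<in>B'. crd B' b j \<otimes>\<^bsub>R\<^esub> crd B j l) = (if b = l then \<one>\<^bsub>R\<^esub> else \<zero>\<^bsub>R\<^esub>)"
   unfolding crd_gen[OF B(2) b] by (simp add: free_gen_def eq_commute)
 qed
qed

lemma module_rank_eq:
 assumes "module R M" "\<one>\<^bsub>R\<^esub> ~= \<zero>\<^bsub>R\<^esub>" "finite B" "module_basis R M B"
 shows "module_rank R M = card B"
 unfolding module_rank_def
proof (rule the_equality)
 fix k assume "\<exists>B'. finite B' & module_basis R M B' & card B' = k"
 thus "k = card B" using basis_card_le[OF assms(1,2)] assms(3,4) by (metis order.antisym)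
qed (use assms in blast)

text \<open>The functions \<open>crd\<close> are dual to the family \<open>u\<close>. Together with
  \<open>\<one> ~= \<zero>\<close> this makes \<open>u\<close> injective, so that the indexed family
  and its image set have the same size.\<close>

lemma (in module) finite_basisI:
 assumes one: "\<one> ~= \<zero>" and S: "finite S" and u: "!!x. x : S ==> u x : carrier M"
  and coord: "!!a x. (!!y. y : S ==> a y : carrier R) ==> x : S ==> crd x (\<Oplus>\<^bsub>M\<^esub>y\<in>S. a y \<odot>\<^bsub>M\<^esub> u y) = a x"
  and crd: "!!v x. v : carrier M ==> crd x v : carrier R"
  and expand: "!!v. v : carrier M ==> v = (\<Oplus>\<^bsub>M\<^esub>x\<in>S. crd x v \<odot>\<^bsub>M\<^esub> u x)"
 shows "module_basis R M (u ` S)" "card (u ` S) = card S"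
proof -
 have one_u: "crd y (u x) = (if x = y then \<one> else \<zero>)" if "x : S" "y : S" for x y
 proof -
  have "(\<Oplus>\<^bsub>M\<^esub>z\<in>S. (if x = z then \<one> else \<zero>) \<odot>\<^bsub>M\<^esub> u z) = (\<Oplus>\<^bsub>M\<^esub>z\<in>S. if x = z then u z else \<zero>\<^bsub>M\<^esub>)"
   by (rule M.finsum_cong') (use u in auto)
  also have "... = u x" by (rule M.finsum_singleton[OF that(1) S]) (use u in auto)
  finally show ?thesis using coord[of "%z. if x = z then \<one> else \<zero>", OF _ that(2)] by simp
 qed
 have inj: "inj_on u S"
  by (rule inj_onI) (use one_u one in metis)
 show "card (u ` S) = card S" by (rule card_image[OF inj])
 have uc: "u ` S <= carrier M" using u by auto
 have id: "(%b. b) : u ` S \<rightarrow> carrier M" using uc by auto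
 have fl: "free_lift R M (%b. b) f = (\<Oplus>\<^bsub>M\<^esub>x\<in>S. f (u x) \<odot>\<^bsub>M\<^esub> u x)" if f: "f : carrier (free_module R (u ` S))" for f
 proof -
  have fc: "f b : carrier R" for b using f unfolding free_simps by blast
  have "free_lift R M (%b. b) f = (\<Oplus>\<^bsub>M\<^esub>b\<in>u ` S. f b \<odot>\<^bsub>M\<^esub> b)"
   by (rule free_lift_eq[OF f id]) (use S f in "auto simp: free_simps")
  also have "... = (\<Oplus>\<^bsub>M\<^esub>x\<in>S. f (u x) \<odot>\<^bsub>M\<^esub> u x)"
   by (rule M.finsum_reindex[OF _ inj]) (use fc u in auto)
  finally show ?thesis .
 qed
 define g where "g v b = (if b : u ` S then crd (inv_into S u b) v else \<zero>)" for v b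
 have gu: "g v (u x) = crd x v" if "x : S" for v x using that inj by (simp add: g_def)
 have gc: "g v : carrier (free_module R (u ` S))" if "v : carrier M" for v
  unfolding free_simps using crd[OF that] S
  by (auto simp: g_def intro: finite_subset[of _ "u ` S"])
 have "bij_betw (free_lift R M (%b. b)) (carrier (free_module R (u ` S))) (carrier M)"
 proof (rule bij_betw_byWitness[where f' = g])
  show "\<forall>f\<in>carrier (free_module R (u ` S)). g (free_lift R M (%b. b) f) = f"
  proof (intro ballI ext)
   fix f b assume f: "f : carrier (free_module R (u ` S))"
   have fc: "f b : carrier R" for b using f unfolding free_simps by blast
   show "g (free_lift R M (%b. b) f) b = f b"
   proof (cases "b : u ` S")
    case True
    then obtain x where x: "x : S" "b = u x" by blast
    show ?thesis unfolding x(2) gu[OF x(1)] fl[OF f] by (rule coord[of "%x. f (u x)", OF fc x(1)])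
   next
    case False
    thus ?thesis using f unfolding free_simps by (auto simp: g_def)
   qed
  qed
  show "\<forall>v\<in>carrier M. free_lift R M (%b. b) (g v) = v"
  proof
   fix v assume v: "v : carrier M"
   have "free_lift R M (%b. b) (g v) = (\<Oplus>\<^bsub>M\<^esub>x\<in>S. crd x v \<odot>\<^bsub>M\<^esub> u x)"
    unfolding fl[OF gc[OF v]] by (rule M.finsum_cong') (use gu crd[OF v] u in auto)
   thus "free_lift R M (%b. b) (g v) = v" using expand[OF v] by simp
  qed
  show "free_lift R M (%b. b) ` carrier (free_module R (u ` S)) <= carrier M"
   using slinearD(1)[OF free_lift_linear[OF id]] by blast
  show "g ` carrier M <= carrier (free_module R (u ` S))" using gc by blast
 qed
 thus "module_basis R M (u ` S)" unfolding module_basis_def free_lift_def using uc by blast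
qed

section \<open>Counting standard tableaux of hook shape\<close>

text \<open>A standard hook is determined by its first column and the set of its arm entries, and
  row increase at the corner is the condition that \<open>hd c\<close> lies below the arm.\<close>

lemma card_SYT_hook:
 assumes d: "1 <= d" shows "card (SYT (hook d i) {1..n}) = card (std_pairs n d i)"
proof (rule bij_betw_same_card)
 let ?D = "diagram (hook d i)"
 let ?f = "%T :: nat \<times> nat => nat. (map (%r. T (r, 0)) [0..<Suc i], (%c. T (0, c)) ` {1..<d})"
 \<comment> \<open>The arm begins in column 1, so cell \<open>k\<close> holds the sorted entry with
   index \<open>k - 1\<close>.\<close>
 define g where "g = (%(c :: nat list, Q). \<lambda>(r, k)\<in>?D. if k = 0 then c ! r else sorted_list_of_set Q ! (k - 1))"
 have D: "(r, k) : ?D \<longleftrightarrow> r = 0 & k < d | r <= i & k = 0" for r k by (rule diagram_hook[OF d])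
 show "bij_betw ?f (SYT (hook d i) {1..n}) (std_pairs n d i)"
 proof (rule bij_betw_byWitness[where f' = g])
  have T: "?f T : std_pairs n d i & g (?f T) = T" if T: "T : SYT (hook d i) {1..n}" for T
  proof
   have tab: "!!x. x : ?D ==> T x : {1..n}" "!!x. x \<notin> ?D ==> T x = undefined" "inj_on T ?D"
    using T unfolding SYT_def tableaux_iff by blast+
   have row: "!!c c'. c < c' ==> c' < d ==> T (0, c) < T (0, c')"
    and col: "!!r r'. r < r' ==> r' <= i ==> T (r, 0) < T (r', 0)"
    using T unfolding SYT_def by (auto simp: D)
   have srt: "sorted_wrt (<) (map (%r. T (r, 0)) [0..<Suc i])"
    unfolding sorted_wrt_iff_nth_less by (auto intro: col simp del: upt_Suc)
   have disj: "T (r, 0) ~= T (0, c)" if "r <= i" "1 <= c" "c < d" for r c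
    using inj_onD[OF tab(3), of "(r, 0)" "(0, c)"] that by (auto simp: D)
   have "inj_on (%c. T (0, c)) {1..<d}" by (rule linorder_inj_onI) (use row in fastforce)+
   hence cQ: "card ((%c. T (0, c)) ` {1..<d}) = d - 1" by (simp add: card_image)
   show "?f T : std_pairs n d i"
    unfolding std_pairs_def mem_Collect_eq prod.case
   proof (intro conjI)
    show "set (map (%r. T (r, 0)) [0..<Suc i]) <= {1..n}" using tab(1) by (force simp: D less_Suc_eq_le simp del: upt_Suc)
    show "(%c. T (0, c)) ` {1..<d} <= {1..n}" using tab(1) by (force simp: D)
    show "set (map (%r. T (r, 0)) [0..<Suc i]) \<inter> (%c. T (0, c)) ` {1..<d} = {}"
     using disj by (force simp: less_Suc_eq_le simp del: upt_Suc)
    have "hd (map (%r. T (r, 0)) [0..<Suc i]) = T (0, 0)" by (simp add: upt_rec)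
    thus "\<forall>r\<in>(%c. T (0, c)) ` {1..<d}. hd (map (%r. T (r, 0)) [0..<Suc i]) < r"
     using row by auto
   qed (use srt cQ in simp_all)
   have "sorted_list_of_set ((%c. T (0, c)) ` {1..<d}) = map (%c. T (0, c)) [1..<d]"
    by (rule sorted_wrt_unique) (auto simp: sorted_wrt_iff_nth_less[of _ "map _ _"] row)
   thus "g (?f T) = T"
    using tab(2) by (auto simp: g_def fun_eq_iff D less_Suc_eq_le nth_append simp del: upt_Suc)
  qed
  thus "\<forall>T\<in>SYT (hook d i) {1..n}. g (?f T) = T" "?f ` SYT (hook d i) {1..n} <= std_pairs n d i" by blast+
  have x: "g x : SYT (hook d i) {1..n} & ?f (g x) = x" if x: "x : std_pairs n d i" for x
  proof -
   obtain c Q where cQ: "x = (c, Q)" by fastforce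
   define q where "q = sorted_list_of_set Q"
   have X: "length c = Suc i" "sorted_wrt (<) c" "set c <= {1..n}" "Q <= {1..n}" "card Q = d - 1" "set c \<inter> Q = {}"
    "!!r. r : Q ==> hd c < r"
    using x by (auto simp: std_pairs_def cQ)
   have "finite Q" using X(4) finite_subset by blast
   hence q: "set q = Q" "length q = d - 1" "sorted_wrt (<) q" "distinct q"
    using X(5) by (simp_all add: q_def strict_sorted_iff)
   have dc: "distinct c" using X(2) strict_sorted_iff by blast
   have gT: "g x (r, k) = (if k = 0 then c ! r else q ! (k - 1))" if "(r, k) : ?D" for r k
    using that by (simp add: g_def cQ q_def)
   have cm: "c ! r : set c" if "r <= i" for r using that X(1) by (intro nth_mem) simp
   have qm: "q ! (k - 1) : Q" if "k ~= 0" "k < d" for k unfolding q(1)[symmetric] using that q(2) by (intro nth_mem) simp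
   have cq: "c ! r ~= q ! (k - 1)" if "r <= i" "k ~= 0" "k < d" for r k
    using cm[OF that(1)] qm[OF that(2,3)] X(6) by auto
   have hdc: "hd c = c ! 0" using X(1) by (cases c) auto
   have "g x : SYT (hook d i) {1..n}"
    unfolding SYT_def mem_Collect_eq tableaux_iff
   proof (intro conjI ballI allI impI)
    show "g x y : {1..n}" if "y : ?D" for y
    proof -
     obtain r k where y: "y = (r, k)" by fastforce
     show ?thesis unfolding y gT[OF that[unfolded y]] using that X(3,4) cm[of r] qm[of k] by (auto simp: y D)
    qed
    show "g x y = undefined" if "y \<notin> ?D" for y using that by (simp add: g_def cQ)
    show "inj_on (g x) ?D"
    proof (rule inj_onI)
     fix y z assume yz: "y : ?D" "z : ?D" "g x y = g x z"
     obtain r k r' k' where y: "y = (r, k)" "z = (r', k')" by fastforce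
     have e: "(if k = 0 then c ! r else q ! (k - 1)) = (if k' = 0 then c ! r' else q ! (k' - 1))"
      using yz(3) unfolding y gT[OF yz(1)[unfolded y]] gT[OF yz(2)[unfolded y]] .
     show "y = z"
     proof (cases "k = 0"; cases "k' = 0")
      assume "k = 0" "k' = 0"
      thus ?thesis using e yz(1,2) dc X(1) by (auto simp: y D nth_eq_iff_index_eq)
     next
      assume "k = 0" "k' ~= 0"
      thus ?thesis using e yz(1,2) cq[of r k'] by (auto simp: y D)
     next
      assume "k ~= 0" "k' = 0"
      thus ?thesis using e yz(1,2) cq[of r' k] by (auto simp: y D)
     next
      assume "k ~= 0" "k' ~= 0"
      thus ?thesis using e yz(1,2) q(2,4) by (auto simp: y D nth_eq_iff_index_eq)
     qed
    qed
    fix r k k' assume a: "k < k' & (r, k) : ?D & (r, k') : ?D"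
    hence r0: "r = 0" "k' ~= 0" "k' < d" by (auto simp: D)
    show "g x (r, k) < g x (r, k')"
    proof (cases "k = 0")
     case True
     thus ?thesis using a r0 X(7)[OF qm[of k']] hdc by (simp add: gT)
    next
     case False
     have "q ! (k - 1) < q ! (k' - 1)" by (rule sorted_wrt_nth_less[OF q(3)]) (use a r0 q(2) False in auto)
     thus ?thesis using a r0 False by (simp add: gT)
    qed
   next
    fix r r' k assume a: "r < r' & (r, k) : ?D & (r', k) : ?D"
    hence k0: "k = 0" "r' <= i" by (auto simp: D)
    have "c ! r < c ! r'" by (rule sorted_wrt_nth_less[OF X(2)]) (use a k0 X(1) in auto)
    thus "g x (r, k) < g x (r', k)" using a k0 by (simp add: gT)
   qed
   moreover have "map (%r. g x (r, 0)) [0..<Suc i] = c"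
    by (rule nth_equalityI) (use X(1) in "simp_all add: gT D less_Suc_eq_le del: upt_Suc")
   moreover have "(%k. g x (0, k)) ` {1..<d} = Q"
   proof -
    have "(%k. g x (0, k)) ` {1..<d} = (%k. q ! (k - 1)) ` {1..<d}" by (rule image_cong) (simp_all add: gT D)
    also have "... = (%k. q ! k) ` {..<d - 1}"
    proof (intro equalityI subsetI)
     fix y assume "y : (%k. q ! k) ` {..<d - 1}"
     then obtain k where "k < d - 1" "y = q ! k" by auto
     thus "y : (%k. q ! (k - 1)) ` {1..<d}" by (intro image_eqI[of _ _ "Suc k"]) auto
    qed auto
    also have "... = Q" using q(1,2) by (auto simp: set_conv_nth)
    finally show ?thesis .
   qed
   ultimately show ?thesis by (simp add: cQ)
  qed
  show "\<forall>x\<in>std_pairs n d i. ?f (g x) = x" "g ` std_pairs n d i <= SYT (hook d i) {1..n}" using x by blast+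
 qed
qed

section \<open>From cycles to the isomorphisms and Betti numbers\<close>

lemma zero_gmodule_group_ring_module:
 assumes "cring A" shows "group_ring_module A G (zero_gmodule :: ('a, 'b, 'g) gmodule)"
proof -
 interpret cring A by fact
 have "module A (zero_gmodule :: ('a, 'b, 'g) gmodule)"
  by (intro moduleI abelian_groupI) (simp_all add: zero_gmodule_def is_cring)
 thus ?thesis by (simp add: group_ring_module_def semilinear_maps_def zero_gmodule_def)
qed

lemma group_ring_module_iso_common_target:
 assumes V: "group_ring_module_iso A G V W" and U: "group_ring_module_iso A G U W"
 shows "group_ring_module_iso A G V U"
proof -
 obtain f where f: "f : linear_maps A V W" "bij_betw f (carrier V) (carrier W)"
  "!!g v. g : carrier G ==> v : carrier V ==> f (gact V g v) = gact W g (f v)"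
  using V unfolding group_ring_module_iso_def by blast
 obtain h where h: "h : linear_maps A U W" "bij_betw h (carrier U) (carrier W)"
  "!!g v. g : carrier G ==> v : carrier U ==> h (gact U g v) = gact W g (h v)"
  using U unfolding group_ring_module_iso_def by blast
 have gr: "group_ring_module A G V" "group_ring_module A G U"
  using V U unfolding group_ring_module_iso_def by blast+
 interpret U: module A U using gr(2) unfolding group_ring_module_def by blast
 define k where "k v = inv_into (carrier U) h (f v)" for v
 have inj: "inj_on h (carrier U)" using h(2) by (simp add: bij_betw_def)
 have k: "k v : carrier U" "h (k v) = f v" if "v : carrier V" for v
 proof -
  have "f v : h ` carrier U" using f(2) h(2) that by (auto simp: bij_betw_def)
  thus "k v : carrier U" "h (k v) = f v" unfolding k_def by (rule inv_into_into, rule f_inv_into_f)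
 qed
 have Vc: "gact V g v : carrier V" if "g : carrier G" "v : carrier V" for g v
  using gr(1) that unfolding group_ring_module_def by (auto dest: slinearD(1))
 have Uc: "gact U g v : carrier U" if "g : carrier G" "v : carrier U" for g v
  using gr(2) that unfolding group_ring_module_def by (auto dest: slinearD(1))
 interpret V: module A V using gr(1) unfolding group_ring_module_def by blast
 note F = slinearD[OF f(1)] and H = slinearD[OF h(1)]
 have "k : linear_maps A V U"
 proof (rule slinearI)
  fix x assume x: "x : carrier V"
  show "k x : carrier U" by (rule k(1)[OF x])
  show "k (a \<odot>\<^bsub>V\<^esub> x) = id a \<odot>\<^bsub>U\<^esub> k x" if a: "a : carrier A" for a
   by (rule inj_onD[OF inj]) (simp_all add: k x a F H)
  show "k (x \<oplus>\<^bsub>V\<^esub> y) = k x \<oplus>\<^bsub>U\<^esub> k y" if y: "y : carrier V" for y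
   by (rule inj_onD[OF inj]) (simp_all add: k x y F H)
 qed
 moreover have "bij_betw k (carrier V) (carrier U)"
 proof -
  have "k = inv_into (carrier U) h \<circ> f" by (rule ext) (simp add: k_def)
  thus ?thesis using bij_betw_trans[OF f(2) bij_betw_inv_into[OF h(2)]] by simp
 qed
 moreover have "k (gact V g v) = gact U g (k v)" if "g : carrier G" "v : carrier V" for g v
  by (rule inj_onD[OF inj]) (simp_all add: k that Vc Uc f(3) h(3))
 ultimately show ?thesis unfolding group_ring_module_iso_def using gr by blast
qed

locale sqfree_tor = sqfree A n d for A :: "('a, 'p) ring_scheme" (structure) and n d +
 fixes P :: "(nat multiset => 'a, 'f, nat multiset => 'a) resolution"
  and \<psi> :: "nat => 'f => 'b \<times> nat multiset => 'a" and B dg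
 assumes tor: "coord_tor A n P \<psi> B dg Isq gI co (sqfree_mons d n) (%_. 0)"
begin

sublocale T: coord_tor A n P \<psi> B dg Isq gI co "sqfree_mons d n" "%_. 0" by (rule tor)

lemma W_eq: "T.W i j = cyc i j"
 by (simp only: T.W_def cyc_def)

lemma TD_trivial:
 assumes "j ~= int (d + i)" shows "carrier (T.TD i j) = {\<zero>\<^bsub>T.TD i j\<^esub>}"
 by (rule T.tor_trivial) (use cyc_acyclic assms in "simp only: W_eq")

lemma TD_trivial_ops:
 assumes "j ~= int (d + i)"
 shows "\<zero>\<^bsub>T.TD i j\<^esub> \<oplus>\<^bsub>T.TD i j\<^esub> \<zero>\<^bsub>T.TD i j\<^esub> = \<zero>\<^bsub>T.TD i j\<^esub>"
  "a : carrier A ==> a \<odot>\<^bsub>T.TD i j\<^esub> \<zero>\<^bsub>T.TD i j\<^esub> = \<zero>\<^bsub>T.TD i j\<^esub>"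
 unfolding T.td_zero
 by (simp_all add: T.td_add T.td_smult const_poly_closed)

abbreviation "tm i == T.tor_map i (int (d + i))"
abbreviation "TDi i == T.TD i (int (d + i))"

lemma tm_bij: "bij_betw (tm i) (carrier (TDi i)) (Z i)"
 using T.tor_map_bij[OF top_chains_zero] by (simp only: W_eq)

lemma tm_Z: "X : carrier (TDi i) ==> tm i X : Z i"
 using tm_bij unfolding bij_betw_def by blast

lemma tm_add:
 assumes "X : carrier (TDi i)" "Y : carrier (TDi i)"
 shows "X \<oplus>\<^bsub>TDi i\<^esub> Y : carrier (TDi i) & tm i (X \<oplus>\<^bsub>TDi i\<^esub> Y) = tm i X \<oplus>\<^bsub>Wmod i\<^esub> tm i Y"
proof
 show "X \<oplus>\<^bsub>TDi i\<^esub> Y : carrier (TDi i)" by (rule T.tor_map_add(1)[OF top_chains_zero[of _ i] assms])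
 show "tm i (X \<oplus>\<^bsub>TDi i\<^esub> Y) = tm i X \<oplus>\<^bsub>Wmod i\<^esub> tm i Y"
  unfolding W_simps(3) by (rule T.tor_map_add(2)[OF top_chains_zero[of _ i] assms, unfolded Im_add])
qed

lemma tm_smult:
 assumes a: "a : carrier A" and X: "X : carrier (TDi i)"
 shows "a \<odot>\<^bsub>TDi i\<^esub> X : carrier (TDi i) & tm i (a \<odot>\<^bsub>TDi i\<^esub> X) = a \<odot>\<^bsub>Wmod i\<^esub> tm i X"
proof -
 have w: "tm i X l : carrier Isq" for l
  using tm_Z[OF X] I.kchainsD(3) unfolding cyc_def by blast
 have "(const_poly A n a \<odot>\<^bsub>Isq\<^esub> tm i X l) m = a \<otimes> tm i X l m" for l m
  using I.coord_const[OF a w[of l], of "()" m] by simp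
 hence e: "(%l. const_poly A n a \<odot>\<^bsub>Isq\<^esub> tm i X l) = a \<odot>\<^bsub>Wmod i\<^esub> tm i X" unfolding W_simps(4) by (intro ext)
 show ?thesis
 proof
  show "a \<odot>\<^bsub>TDi i\<^esub> X : carrier (TDi i)" by (rule T.tor_map_smult(1)[OF top_chains_zero[of _ i] a X])
  show "tm i (a \<odot>\<^bsub>TDi i\<^esub> X) = a \<odot>\<^bsub>Wmod i\<^esub> tm i X"
   unfolding e[symmetric] by (rule T.tor_map_smult(2)[OF top_chains_zero[of _ i] a X])
 qed
qed

lemma tm_zero: "\<zero>\<^bsub>TDi i\<^esub> : carrier (TDi i)" "tm i \<zero>\<^bsub>TDi i\<^esub> = \<zero>\<^bsub>Wmod i\<^esub>"
proof -
 show "\<zero>\<^bsub>TDi i\<^esub> : carrier (TDi i)" by (rule T.tor_map_zero(1)[OF top_chains_zero[of _ i]])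
 show "tm i \<zero>\<^bsub>TDi i\<^esub> = \<zero>\<^bsub>Wmod i\<^esub>"
  unfolding W_simps(2) by (rule T.tor_map_zero(2)[OF top_chains_zero[of _ i], unfolded Im_zero])
qed

lemma TD_module: "module A (T.TD i j)"
proof (cases "j = int (d + i)")
 case True
 show ?thesis unfolding True
  by (rule module_transport[OF W_module, where f = "tm i"])
   (use tm_bij[of i] tm_add tm_smult tm_zero in "auto simp: bij_betw_def W_simps(1) simp del: of_nat_add")
next
 case False
 \<comment> \<open>In the other degrees the piece of Tor has one element and embeds in a zero
   module.\<close>
 have Z: "module A (zero_gmodule :: ('a, unit, nat => nat) gmodule)"
  using zero_gmodule_group_ring_module[OF is_cring] unfolding group_ring_module_def by blast
 show ?thesis
  by (rule module_transport[OF Z, where f = "%_. undefined"])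
   (simp_all add: TD_trivial[OF False] TD_trivial_ops[OF False] zero_gmodule_def)
qed

lemma perm_vars_graded:
 assumes \<sigma>: "\<sigma> permutes {1..n}"
 shows "graded_map A n Isq gI co (sqfree_mons d n) (%_. 0) Isq gI co (sqfree_mons d n) (%_. 0) (perm_vars \<sigma>) \<sigma>"
proof (intro graded_map.intro I.coord_module_axioms graded_map_axioms.intro)
 interpret E: ring_endo "mpoly_ring A n" "perm_vars \<sigma>" by (rule perm_vars_endo[OF R_cring \<sigma>])
 have car: "f : carrier (mpoly_ring A n)" if "f : carrier Isq" for f using that by (simp add: Im_carrier)
 have inj: "inj_on (inv' \<sigma>) S" for S by (rule permutes_inj_on[OF permutes_inv[OF \<sigma>]])
 show cl: "perm_vars \<sigma> f : carrier Isq" if f: "f : carrier Isq" for f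
  using f E.endo_closed[OF car[OF f]] unfolding Im_carrier perm_vars_def by (auto simp: card_image inj)
 show "perm_vars \<sigma> f : gI j" if "f : gI j" for f j
  using that cl[of f] unfolding gI_iff by (auto simp: perm_vars_def)
 show "perm_vars \<sigma> (f \<oplus>\<^bsub>Isq\<^esub> g) = perm_vars \<sigma> f \<oplus>\<^bsub>Isq\<^esub> perm_vars \<sigma> g" for f g
  by (simp add: Im_add perm_vars_def)
 fix k f assume k: "k : {1..n}" and f: "f : carrier Isq"
 have "var A k : carrier (mpoly_ring A n)" by (rule var_closed[OF k])
 thus "perm_vars \<sigma> (var A k \<odot>\<^bsub>Isq\<^esub> f) = var A (\<sigma> k) \<odot>\<^bsub>Isq\<^esub> perm_vars \<sigma> f"
  using E.endo_mult[OF _ car[OF f]] by (simp add: sqfree_module_simps perm_vars_var[OF \<sigma>])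
qed (rule \<sigma>)

context
 fixes \<phi>
 assumes \<phi>: "action_lift A n Isq P \<phi>"
begin

abbreviation "TG i j == tor_gmodule A n P \<phi> (residue_module A n) i j"

abbreviation "ta \<sigma> i == quot_map (T.T i) (T.bd i)
 (tensor_map T.R (T.F i) T.K (T.F i) T.K (perm_vars \<sigma>) (\<phi> \<sigma> i) (gact T.K \<sigma>))"

lemma lift:
 assumes "\<sigma> permutes {1..n}"
 shows "\<phi> \<sigma> i : semilinear_maps (mpoly_ring A n) (perm_vars \<sigma>) (res_term P i) (res_term P i)"
  "x : res_grade P i j ==> \<phi> \<sigma> i x : res_grade P i j"
  "y : carrier (res_term P (Suc i)) ==> res_diff P i (\<phi> \<sigma> (Suc i) y) = \<phi> \<sigma> i (res_diff P i y)"
  "z : carrier (res_term P 0) ==> res_aug P (\<phi> \<sigma> 0 z) = perm_vars \<sigma> (res_aug P z)"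
proof -
 have s: "\<sigma> : carrier (sym_group n)" unfolding sym_group_carrier by (rule assms)
 note L1 = \<phi>[unfolded action_lift_def Let_def, THEN bspec, OF s]
 note L2 = L1[THEN conjunct2] note L3 = L2[THEN conjunct2]
 show "\<phi> \<sigma> i : semilinear_maps (mpoly_ring A n) (perm_vars \<sigma>) (res_term P i) (res_term P i)"
  by (rule L1[THEN conjunct1, THEN spec])
 show "\<phi> \<sigma> i x : res_grade P i j" if "x : res_grade P i j"
  by (rule subsetD[OF L2[THEN conjunct1, THEN spec, THEN spec] imageI[OF that]])
 show "res_diff P i (\<phi> \<sigma> (Suc i) y) = \<phi> \<sigma> i (res_diff P i y)" if "y : carrier (res_term P (Suc i))"
  by (rule L3[THEN conjunct1, THEN spec, THEN bspec, OF that])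
 show "res_aug P (\<phi> \<sigma> 0 z) = perm_vars \<sigma> (res_aug P z)" if "z : carrier (res_term P 0)"
  using L3[THEN conjunct2, THEN bspec, OF that] unfolding sqfree_module_simps(5) .
qed

lemma TG_iso: "group_ring_module_iso A (sym_group n) (TG i (int (d + i))) (Wmod i)"
 unfolding tor_gmodule_def
proof (rule group_ring_module_isoI[OF sym_group_is_group W_group_ring_module, where f = "tm i"]; unfold action_simps)
 show "bij_betw (tm i) (carrier (TDi i)) (carrier (Wmod i))" unfolding W_simps(1) by (rule tm_bij)
 fix \<sigma> X assume "\<sigma> : carrier (sym_group n)" and X: "X : carrier (TDi i)"
 hence \<sigma>: "\<sigma> permutes {1..n}" by (simp only: sym_group_carrier)
 note act = T.tor_map_act[OF top_chains_zero[of _ i] \<sigma> lift(1)[OF \<sigma>] lift(2)[OF \<sigma>] lift(3)[OF \<sigma>] lift(4)[OF \<sigma>]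
   perm_vars_graded[OF \<sigma>] X]
 show "ta \<sigma> i X : carrier (TDi i) &
  tm i (ta \<sigma> i X) = gact (Wmod i) \<sigma> (tm i X)"
  unfolding W_simps(5) by (rule conjI, rule act(1), assumption+, rule act(2))
qed (use tm_add tm_smult tm_zero in blast)+

lemma TG_trivial:
 assumes j: "j ~= int (d + i)"
 shows "group_ring_module_iso A (sym_group n) (TG i j) (zero_gmodule :: ('a, unit, nat => nat) gmodule)"
 unfolding tor_gmodule_def
 \<comment> \<open>The conditional only fixes the type of the argument of the zero map.\<close>
proof (rule group_ring_module_isoI[OF sym_group_is_group zero_gmodule_group_ring_module[OF is_cring],
   where f = "%X. if X = \<zero>\<^bsub>T.TD i j\<^esub> then () else ()"]; unfold action_simps)
 fix \<sigma> X assume "\<sigma> : carrier (sym_group n)" and X: "X : carrier (T.TD i j)"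
 hence \<sigma>: "\<sigma> permutes {1..n}" by (simp only: sym_group_carrier)
 have X0: "X = T.cls i \<zero>\<^bsub>res_term P i\<^esub>" using X unfolding TD_trivial[OF j] T.td_zero by simp
 have "\<phi> \<sigma> i \<zero>\<^bsub>res_term P i\<^esub> = \<zero>\<^bsub>res_term P i\<^esub>"
  by (rule semilinear_zero[OF T.F.module_axioms T.F.module_axioms lift(1)[OF \<sigma>]])
 hence "ta \<sigma> i X = X"
  using T.td_act[where \<phi> = "\<phi> \<sigma>", OF \<sigma> lift(1)[OF \<sigma>] lift(3)[OF \<sigma>], of "\<zero>\<^bsub>res_term P i\<^esub>" i] unfolding X0 by simp
 thus "ta \<sigma> i X : carrier (T.TD i j) &
   (if ta \<sigma> i X = \<zero>\<^bsub>T.TD i j\<^esub> then () else ())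
    = gact (zero_gmodule :: ('a, unit, nat => nat) gmodule) \<sigma> (if X = \<zero>\<^bsub>T.TD i j\<^esub> then () else ())"
  using X by simp
qed (simp_all add: TD_trivial[OF j] TD_trivial_ops[OF j] zero_gmodule_def bij_betw_def)

end

text \<open>The basis consists of the preimages of the standard cycles, with the coordinates of
  cycles pulled back along the injection \<open>tm i\<close>.\<close>

lemma TD_basis:
 assumes one: "\<one> ~= \<zero>"
 shows "\<exists>B. finite B & module_basis A (TDi i) B & card B = card (std_pairs n d i)"
proof -
 interpret V: module A "TDi i" by (rule TD_module)
 interpret W: module A "Wmod i" by (rule W_module)
 have lin: "tm i : linear_maps A (TDi i) (Wmod i)"
  by (rule slinearI) (use tm_Z tm_add tm_smult in "simp_all add: W_simps(1) del: of_nat_add")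
 define u where "u x = inv_into (carrier (TDi i)) (tm i) (wel A n (fst x) (snd x))" for x
 have u: "u x : carrier (TDi i)" "tm i (u x) = wel A n (fst x) (snd x)" if "x : std_pairs n d i" for x
 proof -
  have "wel A n (fst x) (snd x) : tm i ` carrier (TDi i)"
   using std_wel_Z[OF that] tm_bij unfolding bij_betw_def by blast
  thus "u x : carrier (TDi i)" "tm i (u x) = wel A n (fst x) (snd x)"
   unfolding u_def by (rule inv_into_into, rule f_inv_into_f)
 qed
 have tm_comb: "tm i (\<Oplus>\<^bsub>TDi i\<^esub>x\<in>std_pairs n d i. a x \<odot>\<^bsub>TDi i\<^esub> u x) = comb i a"
  if a: "!!x. x : std_pairs n d i ==> a x : carrier A" for a
 proof -
  have "tm i (\<Oplus>\<^bsub>TDi i\<^esub>x\<in>std_pairs n d i. a x \<odot>\<^bsub>TDi i\<^esub> u x)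
    = (\<Oplus>\<^bsub>Wmod i\<^esub>x\<in>std_pairs n d i. tm i (a x \<odot>\<^bsub>TDi i\<^esub> u x))"
   by (rule semilinear_finsum[OF TD_module W_module lin finite_std_pairs]) (rule V.smult_closed[OF a u(1)])
  also have "... = comb i a" unfolding comb_def
  proof (rule W.M.finsum_cong'[OF _ funcsetI])
   fix x assume x: "x : std_pairs n d i"
   show "a x \<odot>\<^bsub>Wmod i\<^esub> wel A n (fst x) (snd x) : carrier (Wmod i)"
    by (rule W.smult_closed[OF a[OF x]]) (unfold W_simps(1), rule std_wel_Z[OF x])
   show "tm i (a x \<odot>\<^bsub>TDi i\<^esub> u x) = a x \<odot>\<^bsub>Wmod i\<^esub> wel A n (fst x) (snd x)"
    using tm_smult[OF a[OF x] u(1)[OF x]] unfolding u(2)[OF x] by blast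
  qed simp
  finally show ?thesis .
 qed
 have crd: "pair_coord x (tm i v) : carrier A" if "v : carrier (TDi i)" for x v
  unfolding pair_coord_def by (rule cycD(2)[OF tm_Z[OF that]])
 have expand: "v = (\<Oplus>\<^bsub>TDi i\<^esub>x\<in>std_pairs n d i. pair_coord x (tm i v) \<odot>\<^bsub>TDi i\<^esub> u x)" if v: "v : carrier (TDi i)" for v
 proof (rule inj_onD[OF bij_betw_imp_inj_on[OF tm_bij] _ v])
  show "tm i v = tm i (\<Oplus>\<^bsub>TDi i\<^esub>x\<in>std_pairs n d i. pair_coord x (tm i v) \<odot>\<^bsub>TDi i\<^esub> u x)"
   unfolding tm_comb[OF crd[OF v]] by (rule Z_expand[OF tm_Z[OF v]])
  show "(\<Oplus>\<^bsub>TDi i\<^esub>x\<in>std_pairs n d i. pair_coord x (tm i v) \<odot>\<^bsub>TDi i\<^esub> u x) : carrier (TDi i)"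
   by (rule V.M.finsum_closed) (rule funcsetI, rule V.smult_closed[OF crd[OF v] u(1)])
 qed
 have coord: "pair_coord x (tm i (\<Oplus>\<^bsub>TDi i\<^esub>y\<in>std_pairs n d i. a y \<odot>\<^bsub>TDi i\<^esub> u y)) = a x"
  if "!!y. y : std_pairs n d i ==> a y : carrier A" "x : std_pairs n d i" for a x
 proof -
  have "tm i (\<Oplus>\<^bsub>TDi i\<^esub>y\<in>std_pairs n d i. a y \<odot>\<^bsub>TDi i\<^esub> u y) = comb i a" by (rule tm_comb) (rule that(1))
  thus ?thesis by (simp only:) (rule pair_coord_comb, rule that(1), assumption, rule that(2))
 qed
 have "module_basis A (TDi i) (u ` std_pairs n d i)" "card (u ` std_pairs n d i) = card (std_pairs n d i)"
  using V.finite_basisI[where crd = "%x v. pair_coord x (tm i v)", OF one finite_std_pairs u(1) coord crd expand] by blast+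
 thus ?thesis using finite_std_pairs by blast
qed

lemma TD_trivial_basis:
 assumes one: "\<one> ~= \<zero>" and j: "j ~= int (d + i)"
 shows "module_basis A (T.TD i j) {}"
proof -
 interpret V: module A "T.TD i j" by (rule TD_module)
 show ?thesis
  using V.finite_basisI(1)[OF one finite.emptyI, of "%_. \<zero>\<^bsub>T.TD i j\<^esub>" "%_ _. \<zero>"] TD_trivial[OF j] by simp
qed

end

text \<open>For d + i > n both sides vanish: a standard pair uses \<open>d + i\<close> distinct
  indices, so none exists and the expansion of every cycle is empty.\<close>

lemma (in sqfree) U_module_iso: 
 assumes dn: "d <= n" shows "group_ring_module_iso A (sym_group n) (U_module A d n i) (Wmod i)"
proof (cases "d + i <= n")
 case True
 then interpret hook_module A n d i by unfold_locales
 show ?thesis by (rule U_iso)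
next
 case False
 have empty: "std_pairs n d i = {}"
 proof (rule ccontr)
  assume "std_pairs n d i ~= {}"
  then obtain c Q where x: "(c, Q) : std_pairs n d i" by fastforce
  hence "mset (std_word n (c, Q)) = mset [1..<Suc n]" "length c = Suc i" "length (sorted_list_of_set Q) = d - 1"
   using mset_std_word[OF x] by simp_all
  moreover from word_length[OF this(1)] have "length (std_word n (c, Q)) = n" .
  ultimately show False using False d_pos by (simp add: std_word_def)
 qed
 have Z: "Z i = {\<zero>\<^bsub>Wmod i\<^esub>}"
 proof -
  have "w = \<zero>\<^bsub>Wmod i\<^esub>" if "w : Z i" for w
  proof -
   interpret W: module A "Wmod i" by (rule W_module)
   show ?thesis using Z_expand[OF that] by (simp add: comb_def empty)
  qed
  moreover have "\<zero>\<^bsub>Wmod i\<^esub> : Z i" unfolding W_simps(2) by (rule Z_zero)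
  ultimately show ?thesis by blast
 qed
 have U: "U_module A d n i = zero_gmodule" 
 proof -
  have "~ i <= n - d" using False dn by linarith
  thus ?thesis unfolding U_module_def by (simp only: simp_thms if_False)
 qed
 interpret W: module A "Wmod i" by (rule W_module)
 have act: "gact (Wmod i) \<sigma> \<zero>\<^bsub>Wmod i\<^esub> = \<zero>\<^bsub>Wmod i\<^esub>" if "\<sigma> permutes {1..n}" for \<sigma>
  by (rule semilinear_zero[OF W_module W_module W_act_linear[OF that]])
 show ?thesis unfolding U
 proof (rule group_ring_module_isoI[OF sym_group_is_group W_group_ring_module, where f = "%_. \<zero>\<^bsub>Wmod i\<^esub>"])
  show "bij_betw (%_. \<zero>\<^bsub>Wmod i\<^esub>) (carrier zero_gmodule) (carrier (Wmod i))"
   unfolding W_simps(1) Z by (simp add: zero_gmodule_def bij_betw_def)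
 qed (simp_all add: zero_gmodule_def act sym_group_carrier del: atLeastAtMost_iff)
qed

theorem corollary4p12:
  fixes A :: "('a, 'p) ring_scheme"
    and n d :: nat
    and P :: "(nat multiset \<Rightarrow> 'a, 'f, nat multiset \<Rightarrow> 'a) resolution"
  assumes "cring A" and "1 \<le> d" and "d \<le> n"
    and "graded_free_resolution A n (sqfree_ideal_module A d n) P"
  shows "(\<forall>\<phi>. action_lift A n (sqfree_ideal_module A d n) P \<phi> \<longrightarrow>
            (\<forall>(i::nat) (j::int).
              (j = int (d + i) \<longrightarrow>
                 group_ring_module_iso A (sym_group n)
                   (tor_gmodule A n P \<phi> (residue_module A n) i j) (U_module A d n i)) \<and>
              (j \<noteq> int (d + i) \<longrightarrow>
                 group_ring_module_iso A (sym_group n)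
                   (tor_gmodule A n P \<phi> (residue_module A n) i j)
                   (zero_gmodule :: ('a, unit, nat \<Rightarrow> nat) gmodule))))
         \<and>
         (\<one>\<^bsub>A\<^esub> \<noteq> \<zero>\<^bsub>A\<^esub> \<longrightarrow>
            (\<forall>(i::nat) (j::int).
               (\<exists>B. finite B \<and> module_basis A (tor_degree A n P (residue_module A n) i j) B) \<and>
               betti A n P i j = (if j = int (d + i) then card (SYT (hook d i) {1..n}) else 0)))"
proof -
 note r1 = assms(4)[unfolded graded_free_resolution_def Let_def]
 note r2 = r1[THEN conjunct2] note r3 = r2[THEN conjunct2] note r4 = r3[THEN conjunct2] note r5 = r4[THEN conjunct2]
 note r6 = r5[THEN conjunct2] note r7 = r6[THEN conjunct2]
 note res = r2[THEN conjunct1] r3[THEN conjunct1] r4[THEN conjunct1] r5[THEN conjunct1] r6[THEN conjunct1]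
  r7[THEN conjunct1] r7[THEN conjunct2]
 have gf: "graded_free A n (res_term P i) (res_grade P i)" for i by (rule r1[THEN conjunct1, THEN spec])
 have "\<forall>i. \<exists>\<psi> (B :: 'f set) dg. coord_module A n (res_term P i) (res_grade P i) \<psi>
   {(b, m). b : B & set_mset m <= {1..n}} dg"
  using graded_free_coord[OF assms(1) gf] by blast
 then obtain \<psi> :: "nat => 'f => 'f \<times> nat multiset => 'a" and B dg where
  coord: "!!i. coord_module A n (res_term P i) (res_grade P i) (\<psi> i) {(b, m). b : B i & set_mset m <= {1..n}} (dg i)"
  by metis
 \<comment> \<open>Each term of the resolution is a module over the polynomial ring, which includes
   that this ring is commutative with unit.\<close>
 have R: "cring (mpoly_ring A n)"
  using gf[of 0] unfolding graded_free_def Let_def by (blast dest: module.axioms(1))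
 interpret sqfree A n d by (intro sqfree.intro sqfree_axioms.intro assms R)
 interpret sqfree_tor A n d P \<psi> B dg
 proof (intro sqfree_tor.intro sqfree_tor_axioms.intro sqfree_axioms coord_tor.intro coord_resolution.intro)
  show "coord_module A n (res_term P i) (res_grade P i) (\<psi> i) {(b, m). b : B i & set_mset m <= {1..n}} (dg i)" for i
   by (rule coord)
  show "coord_module A n Isq gI co (sqfree_mons d n) (%_. 0)" by (rule I.coord_module_axioms)
  show "res_diff P i x : res_grade P i j" if "x : res_grade P (Suc i) j" for i j x using res(2) that by blast
  show "res_aug P x : gI j" if "x : res_grade P 0 j" for j x using res(4) that by blast
 qed (fact res(3) res(5) | rule res(1)[THEN spec] res(6) res(7)[THEN spec])+
 have part1: "group_ring_module_iso A (sym_group n) (tor_gmodule A n P \<phi> (residue_module A n) i (int (d + i))) (U_module A d n i)"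
  if "action_lift A n Isq P \<phi>" for \<phi> i
  by (rule group_ring_module_iso_common_target[OF TG_iso[OF that] U_module_iso[OF assms(3)]])
 have part2: "(\<exists>B. finite B & module_basis A (tor_degree A n P (residue_module A n) i j) B) &
   betti A n P i j = (if j = int (d + i) then card (SYT (hook d i) {1..n}) else 0)" if one: "\<one>\<^bsub>A\<^esub> ~= \<zero>\<^bsub>A\<^esub>" for i j
 proof (cases "j = int (d + i)")
  case True
  obtain B where B: "finite B" "module_basis A (TDi i) B" "card B = card (std_pairs n d i)" using TD_basis[OF one] by blast
  have "betti A n P i j = card (SYT (hook d i) {1..n})"
   unfolding True betti_def module_rank_eq[OF TD_module one B(1,2)] B(3) by (rule card_SYT_hook[OF assms(2), symmetric])
  thus ?thesis using B(1,2) unfolding True by auto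
 next
  case False
  have "betti A n P i j = 0"
   unfolding betti_def module_rank_eq[OF TD_module one finite.emptyI TD_trivial_basis[OF one False]] by simp
  thus ?thesis using TD_trivial_basis[OF one False] False by auto
 qed
 show ?thesis using part1 TG_trivial part2 by blast
qed

end
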